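(* Let $m\ge 1$, and let $\mathbf F=(F_1,\dots,F_m)=(\delta(u_1),\dots,\delta(u_m))$ be a vector in $\mathbb R^m$ of centered random variables with $F_i\in\mathbb D^{1,2}(\Omega)$ and $u_i\in\mathrm{Dom}(\delta)$ for $i=1,\dots,m$. Let $N_\Sigma=(N_1,\dots,N_m)$ be a centered Gaussian vector with invertible $m\times m$ covariance matrix $\Sigma=\{\Sigma(i,j)\}$. Then $$d_c(\mathbf F,N_\Sigma)\le 402\,\Big(\|\Sigma^{-1}\|_{\mathrm{op}}^{3/2}+1\Big)\,m^{41/24}\,\sqrt{\mathbb E\big[\|M_F-\Sigma\|_{\mathrm{H.S.}}^2\big]},$$ where $M_F$ is the random $m\times m$ matrix with entries $M_F(i,j)=\langle DF_i,u_j\rangle_{\mathfrak H}$, $1\le i,j\le m$.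
   Context: Setting: $\mathfrak H$ is a real separable Hilbert space with inner product $\langle\cdot,\cdot\rangle_{\mathfrak H}$, and $X=\{X(h):h\in\mathfrak H\}$ is an isonormal Gaussian process over $\mathfrak H$ on a probability space $(\Omega,\mathscr F,\mathbb P)$, i.e. a centered Gaussian family with $\mathbb E[X(h)X(g)]=\langle h,g\rangle_{\mathfrak H}$ for all $h,g\in\mathfrak H$; $\mathscr F$ is the $\sigma$-field generated by $X$. Every $F\in L^2(\Omega)$ has a unique Wiener-Itô chaos expansion $F=\mathbb E F+\sum_{q\ge1}I_q(f_q)$ with $f_q\in\mathfrak H^{\odot q}$ (symmetric $q$th tensor product), where $I_q$ denotes the $q$-th multiple Wiener-Itô integral with respect to $X$. One writes $F\in\mathbb D^{1,2}(\Omega)$ if $\sum_{q\ge1}q\,q!\,\|f_q\|^2_{\mathfrak H^{\otimes q}}<\infty$. For $F\in\mathbb D^{1,2}(\Omega)$, $DF$ denotes the Malliavin derivative of $F$, a random element with values in $\mathfrak H$. The divergence operator $\delta$ is the adjoint of $D$, with domain $\mathrm{Dom}(\delta)\subset L^2(\Omega;\mathfrak H)$; it satisfies $\mathbb E[\delta(u)F]=\mathbb E[\langle u,DF\rangle_{\mathfrak H}]$ for all $F\in\mathbb D^{1,2}(\Omega)$ and $u\in\mathrm{Dom}(\delta)$. The convex distance between the laws of two $\mathbb R^m$-valued random vectors is $d_c(\mathbf F,\mathbf G)=\sup_{h\in\mathcal I_m}|\mathbb E h(\mathbf F)-\mathbb E h(\mathbf G)|$, where $\mathcal I_m$ is the class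 of indicator functions of measurable convex subsets of $\mathbb R^m$. $\|\cdot\|_{\mathrm{op}}$ is the operator norm on $m\times m$ matrices and $\|A\|_{\mathrm{H.S.}}^2=\sum_{i,j=1}^mA(i,j)^2$ is the squared Hilbert-Schmidt norm. *)

theory Defs
  imports "HOL-Probability.Probability" "HOL-Combinatorics.Permutations"
begin

section \<open>Gaussian families and isonormal processes\<close>

text \<open>Constant random variables count as Gaussian; this is needed for \<open>X 0\<close>.\<close>

definition gaussian_rv :: "'w measure \<Rightarrow> ('w \<Rightarrow> real) \<Rightarrow> bool" where
  "gaussian_rv M Y \<longleftrightarrow> Y \<in> borel_measurable M \<and>
     ((\<exists>c. AE w in M. Y w = c) \<or>
      (\<exists>\<mu> \<sigma>. 0 < \<sigma> \<and> distributed M lborel Y (normal_density \<mu> \<sigma>)))"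

definition centered_gaussian_family :: "'w measure \<Rightarrow> ('i \<Rightarrow> 'w \<Rightarrow> real) \<Rightarrow> bool" where
  "centered_gaussian_family M Y \<longleftrightarrow>
     (\<forall>J c. finite J \<longrightarrow> gaussian_rv M (\<lambda>w. \<Sum>i\<in>J. c i * Y i w)) \<and>
     (\<forall>i. (LINT w|M. Y i w) = 0)"

text \<open>The real separable Hilbert space is a type \<open>'h\<close>: for metric spaces, separability and
  second countability agree.\<close>

locale isonormal_process = prob_space M
  for M :: "'w measure"
    and X :: "'h::{real_inner, complete_space, second_countable_topology} \<Rightarrow> 'w \<Rightarrow> real" +
  assumes gaussian: "centered_gaussian_family M X"
    and covariance: "\<And>h g. (LINT w|M. X h w * X g w) = inner h g"
    and generated: "sets M = sigma_sets (space M) {X h -` B \<inter> space M | h B. B \<in> sets borel}"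

section \<open>Square integrable random elements\<close>

definition L2 :: "'w measure \<Rightarrow> ('w \<Rightarrow> 'b::real_normed_vector) set" where
  "L2 M = {F \<in> borel_measurable M. integrable M (\<lambda>w. (norm (F w))\<^sup>2)}"

definition L2_tendsto ::
    "'w measure \<Rightarrow> (nat \<Rightarrow> 'w \<Rightarrow> 'b::real_normed_vector) \<Rightarrow> ('w \<Rightarrow> 'b) \<Rightarrow> bool" where
  "L2_tendsto M Fs F \<longleftrightarrow> (\<forall>n. Fs n \<in> L2 M) \<and> F \<in> L2 M \<and>
     (\<lambda>n. LINT w|M. (norm (Fs n w - F w))\<^sup>2) \<longlonglongrightarrow> 0"

section \<open>Hilbert tensor powers\<close>

text \<open>The \<open>q\<close>-th Hilbert tensor power of \<open>'h\<close> is realised as the space of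
  Hilbert-Schmidt \<open>q\<close>-linear forms, \<open>h\<^sub>0 \<otimes> \<dots> \<otimes> h\<^sub>q\<^sub>-\<^sub>1\<close> being the form that maps \<open>x\<close> to the product
  of the \<open>\<langle>h\<^sub>i, x\<^sub>i\<rangle>\<close>. A \<open>q\<close>-tuple of vectors is a function on \<open>nat\<close> of which only the first
  \<open>q\<close> values matter. The squared Hilbert-Schmidt norm is the sum of \<open>(T x)\<^sup>2\<close> over all tuples
  \<open>x\<close> from an orthonormal basis, that is, the supremum over all finite orthonormal sets.\<close>

definition tensor_norm2 :: "nat \<Rightarrow> ((nat \<Rightarrow> 'h::real_inner) \<Rightarrow> real) \<Rightarrow> ennreal" where
  "tensor_norm2 q T =
     (SUP B\<in>{B. finite B \<and> pairwise orthogonal B \<and> (\<forall>b\<in>B. norm b = 1)}.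
        \<Sum>x\<in>PiE {..<q} (\<lambda>_. B). ennreal ((T x)\<^sup>2))"

definition tensor_power :: "nat \<Rightarrow> ((nat \<Rightarrow> 'h::real_inner) \<Rightarrow> real) set" where
  "tensor_power q =
     {T. (\<forall>x y. (\<forall>i<q. x i = y i) \<longrightarrow> T x = T y) \<and>
         (\<forall>x. \<forall>i<q. bounded_linear (\<lambda>h. T (x(i := h)))) \<and>
         tensor_norm2 q T < \<infinity>}"

definition sym_tensor_power :: "nat \<Rightarrow> ((nat \<Rightarrow> 'h::real_inner) \<Rightarrow> real) set" where
  "sym_tensor_power q =
     {T \<in> tensor_power q. \<forall>\<pi> x. \<pi> permutes {..<q} \<longrightarrow> T (\<lambda>i. x (\<pi> i)) = T x}"

section \<open>Multiple Wiener-Ito integrals and the Sobolev space\<close>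

text \<open>Probabilists' (monic) Hermite polynomials.\<close>

fun hermite :: "nat \<Rightarrow> real \<Rightarrow> real" where
  "hermite 0 x = 1"
| "hermite (Suc 0) x = x"
| "hermite (Suc (Suc n)) x = x * hermite (Suc n) x - real (Suc n) * hermite n x"

text \<open>\<open>T\<close> is a finite linear combination of tensors \<open>h \<otimes> \<dots> \<otimes> h\<close> with \<open>\<parallel>h\<parallel> = 1\<close>, and \<open>G\<close> is the
  same linear combination of the variables \<open>H\<^sub>q(X(h))\<close>.\<close>

definition elementary_integral ::
    "('h::real_inner \<Rightarrow> 'w \<Rightarrow> real) \<Rightarrow> nat \<Rightarrow> ((nat \<Rightarrow> 'h) \<Rightarrow> real) \<Rightarrow> ('w \<Rightarrow> real) \<Rightarrow> bool" where
  "elementary_integral X q T G \<longleftrightarrow>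
     (\<exists>(N::nat) c h. (\<forall>j<N. norm (h j) = 1) \<and>
        T = (\<lambda>x. \<Sum>j<N. c j * (\<Prod>i<q. inner (h j) (x i))) \<and>
        G = (\<lambda>w. \<Sum>j<N. c j * hermite q (X (h j) w)))"

text \<open>\<open>G\<close> is a version of \<open>I\<^sub>q(f)\<close>: the map \<open>h \<otimes> \<dots> \<otimes> h \<mapsto> H\<^sub>q(X(h))\<close> (for \<open>\<parallel>h\<parallel> = 1\<close>) extends
  uniquely to a linear map on the symmetric tensor power which is continuous into
  \<open>L\<^sup>2\<close>, with \<open>E[I\<^sub>q(f)\<^sup>2] = q! \<parallel>f\<parallel>\<^sup>2\<close>.\<close>

definition wiener_ito_integral ::
    "'w measure \<Rightarrow> ('h::real_inner \<Rightarrow> 'w \<Rightarrow> real) \<Rightarrow> nat \<Rightarrow> ((nat \<Rightarrow> 'h) \<Rightarrow> real) \<Rightarrow>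
     ('w \<Rightarrow> real) \<Rightarrow> bool" where
  "wiener_ito_integral M X q f G \<longleftrightarrow> f \<in> sym_tensor_power q \<and>
     (\<exists>T Gs. (\<forall>k. elementary_integral X q (T k) (Gs k)) \<and>
        (\<lambda>k. tensor_norm2 q (\<lambda>x. T k x - f x)) \<longlonglongrightarrow> 0 \<and>
        L2_tendsto M Gs G)"

definition chaos_expansion ::
    "'w measure \<Rightarrow> ('h::real_inner \<Rightarrow> 'w \<Rightarrow> real) \<Rightarrow> ('w \<Rightarrow> real) \<Rightarrow>
     (nat \<Rightarrow> (nat \<Rightarrow> 'h) \<Rightarrow> real) \<Rightarrow> bool" where
  "chaos_expansion M X F f \<longleftrightarrow>
     (\<exists>J. (\<forall>q\<ge>1. wiener_ito_integral M X q (f q) (J q)) \<and>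
          L2_tendsto M (\<lambda>Q w. (LINT v|M. F v) + (\<Sum>q=1..Q. J q w)) F)"

definition D12 :: "'w measure \<Rightarrow> ('h::real_inner \<Rightarrow> 'w \<Rightarrow> real) \<Rightarrow> ('w \<Rightarrow> real) set" where
  "D12 M X = {F \<in> L2 M. \<exists>f. chaos_expansion M X F f \<and>
     (\<Sum>q. ennreal (real q * fact q) * tensor_norm2 q (f q)) < \<infinity>}"

section \<open>Malliavin derivative and divergence\<close>

text \<open>Functions on \<open>\<real>\<^sup>n\<close> are functions on \<open>nat \<Rightarrow> real\<close> that depend on the first \<open>n\<close>
  coordinates only; for these, continuity in the product topology is continuity on \<open>\<real>\<^sup>n\<close>.\<close>

definition partial_deriv :: "nat \<Rightarrow> ((nat \<Rightarrow> real) \<Rightarrow> real) \<Rightarrow> (nat \<Rightarrow> real) \<Rightarrow> real" where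
  "partial_deriv i f x = deriv (\<lambda>t. f (x(i := t))) (x i)"

fun iter_partial_deriv :: "nat list \<Rightarrow> ((nat \<Rightarrow> real) \<Rightarrow> real) \<Rightarrow> (nat \<Rightarrow> real) \<Rightarrow> real" where
  "iter_partial_deriv [] f = f"
| "iter_partial_deriv (i # is) f = partial_deriv i (iter_partial_deriv is f)"

text \<open>Infinitely differentiable functions on \<open>\<real>\<^sup>n\<close> that have, together with all their partial
  derivatives, at most polynomial growth.\<close>

definition smooth_poly_growth :: "nat \<Rightarrow> ((nat \<Rightarrow> real) \<Rightarrow> real) \<Rightarrow> bool" where
  "smooth_poly_growth n f \<longleftrightarrow>
     (\<forall>x y. (\<forall>i<n. x i = y i) \<longrightarrow> f x = f y) \<and>
     (\<forall>is. set is \<subseteq> {..<n} \<longrightarrow>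
        continuous_on UNIV (iter_partial_deriv is f) \<and>
        (\<forall>i<n. \<forall>x. (\<lambda>t. iter_partial_deriv is f (x(i := t))) differentiable (at (x i))) \<and>
        (\<exists>C k. \<forall>x. \<bar>iter_partial_deriv is f x\<bar> \<le> C * (1 + (\<Sum>i<n. \<bar>x i\<bar>)) ^ k))"

text \<open>\<open>F = f(X(h\<^sub>0), \<dots>, X(h\<^sub>n\<^sub>-\<^sub>1))\<close> and \<open>U = \<Sum>\<^sub>i \<partial>\<^sub>i f(X(h\<^sub>0), \<dots>, X(h\<^sub>n\<^sub>-\<^sub>1)) h\<^sub>i\<close>.\<close>

definition cylindrical_derivative ::
    "('h::real_inner \<Rightarrow> 'w \<Rightarrow> real) \<Rightarrow> ('w \<Rightarrow> real) \<Rightarrow> ('w \<Rightarrow> 'h) \<Rightarrow> bool" where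
  "cylindrical_derivative X F U \<longleftrightarrow>
     (\<exists>n f h. smooth_poly_growth n f \<and>
        F = (\<lambda>w. f (\<lambda>i. X (h i) w)) \<and>
        U = (\<lambda>w. \<Sum>i<n. partial_deriv i f (\<lambda>i. X (h i) w) *\<^sub>R h i))"

text \<open>The Malliavin derivative is the closure of this operator from \<open>L\<^sup>2(\<Omega>)\<close> to
  \<open>L\<^sup>2(\<Omega>; 'h)\<close>. As \<open>DF\<close> is determined only almost surely, it is given by the relation
  ``\<open>U\<close> is a version of \<open>DF\<close>'' (and similarly for the divergence).\<close>

definition malliavin_derivative ::
    "'w measure \<Rightarrow> ('h::real_inner \<Rightarrow> 'w \<Rightarrow> real) \<Rightarrow> ('w \<Rightarrow> real) \<Rightarrow> ('w \<Rightarrow> 'h) \<Rightarrow> bool" where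
  "malliavin_derivative M X F U \<longleftrightarrow> F \<in> D12 M X \<and>
     (\<exists>Fs Us. (\<forall>k. cylindrical_derivative X (Fs k) (Us k)) \<and>
        L2_tendsto M Fs F \<and> L2_tendsto M Us U)"

text \<open>\<open>u \<in> Dom(\<delta>)\<close> and \<open>G\<close> is a version of \<open>\<delta>(u)\<close>, where \<open>\<delta>\<close> is the Hilbert space adjoint of
  the unbounded operator \<open>D\<close> with domain \<open>D12 M X\<close>.\<close>

definition divergence ::
    "'w measure \<Rightarrow> ('h::real_inner \<Rightarrow> 'w \<Rightarrow> real) \<Rightarrow> ('w \<Rightarrow> 'h) \<Rightarrow> ('w \<Rightarrow> real) \<Rightarrow> bool" where
  "divergence M X u G \<longleftrightarrow> u \<in> L2 M \<and> G \<in> L2 M \<and>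
     (\<forall>F U. malliavin_derivative M X F U \<longrightarrow>
        (LINT w|M. G w * F w) = (LINT w|M. inner (u w) (U w)))"

section \<open>Convex distance and matrix norms\<close>

definition convex_indicators :: "('a::euclidean_space \<Rightarrow> real) set" where
  "convex_indicators = {indicator C | C. convex C \<and> C \<in> sets borel}"

definition convex_distance ::
    "'w measure \<Rightarrow> ('w \<Rightarrow> 'a::euclidean_space) \<Rightarrow> 'v measure \<Rightarrow> ('v \<Rightarrow> 'a) \<Rightarrow> real" where
  "convex_distance M F M' G =
     (SUP h\<in>convex_indicators. \<bar>(LINT w|M. h (F w)) - (LINT v|M'. h (G v))\<bar>)"

definition op_norm :: "real ^ 'm ^ 'm \<Rightarrow> real" where
  "op_norm A = onorm ((*v) A)"

definition hs_norm :: "real ^ 'm ^ 'm \<Rightarrow> real" where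
  "hs_norm A = sqrt (\<Sum>i\<in>UNIV. \<Sum>j\<in>UNIV. (A $ i $ j)\<^sup>2)"

definition gaussian_vector :: "'v measure \<Rightarrow> ('v \<Rightarrow> real ^ 'm) \<Rightarrow> real ^ 'm ^ 'm \<Rightarrow> bool" where
  "gaussian_vector M N \<Sigma> \<longleftrightarrow>
     centered_gaussian_family M (\<lambda>i v. N v $ i) \<and>
     (\<forall>i j. (LINT v|M. N v $ i * N v $ j) = \<Sigma> $ i $ j)"

definition ennreal_sqrt :: "ennreal \<Rightarrow> ennreal" where
  "ennreal_sqrt x = (if x = \<infinity> then \<infinity> else ennreal (sqrt (enn2real x)))"

end

theory Submission
  imports Defs
begin

text \<open>
  The proof is Stein's method, run on rotations and on Fourier transforms instead of on
  differential equations.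

  \<^bold>\<open>The only input from Malliavin calculus.\<close> Since \<open>F\<^sub>j = \<delta>(u\<^sub>j)\<close>, the duality of \<open>\<delta>\<close> and \<open>D\<close>, applied to
  the random variable \<open>exp(i c \<langle>\<xi>, F\<rangle>)\<close>, gives
  \<open>E[\<langle>\<xi>, F\<rangle> exp(i c \<langle>\<xi>, F\<rangle>)] = i c E[\<langle>\<xi>, M\<^sub>F \<xi>\<rangle> exp(i c \<langle>\<xi>, F\<rangle>)]\<close> for all \<open>\<xi>\<close> and \<open>c\<close>
  (\<open>stein_identity_malliavin\<close>). The duality is available for elements of the Sobolev space only.
  It is first applied to Hermite polynomials of one Gaussian variable, whose chaos expansion has a
  single term; summing an exponential series gives \<open>exp(i X(h))\<close>
  (\<open>divergence_iexp\<close>). This is an identity between Fourier transforms of signed measures on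
  \<open>\<real>\<^sup>n\<close>, hence an integration by parts formula for bounded functions of finitely many
  \<open>X(h\<^sub>i)\<close> with derivatives of polynomial growth (\<open>fourier_integration_by_parts\<close>), and approximating the \<open>F\<^sub>j\<close> by
  cylindrical variables yields the claim. A Gaussian vector satisfies the same Stein identity with
  the constant matrix \<open>\<Sigma>\<close> in place of \<open>M\<^sub>F\<close>.

  \<^bold>\<open>Interpolation.\<close> Let \<open>Y\<close> satisfy the Stein identity with the random matrix \<open>V\<close>, let \<open>Z\<close> be
  an independent standard Gaussian vector, and rotate \<open>Y\<close> into \<open>Z\<close> along
  \<open>cos t Y + sin t Z\<close>. For bounded \<open>h\<close>, differentiating in the angle and integrating by parts in
  \<open>Z\<close> gives
  \<open>E h(cos a Y + sin a Z) - E h(Z) = \<Sum>\<^sub>i\<^sub>j E[(V\<^sub>i\<^sub>j - \<delta>\<^sub>i\<^sub>j) W\<^sub>i\<^sub>j(Y)]\<close>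
  where \<open>W\<^sub>i\<^sub>j\<close> is the integral over the angles from \<open>a\<close> to \<open>\<pi>/2\<close> of
  \<open>cot t E[(Z\<^sub>i Z\<^sub>j - \<delta>\<^sub>i\<^sub>j) h(cos t y + sin t Z)]\<close> (\<open>stein_interpolation\<close>). Both
  sides are integrals of \<open>h\<close> against signed measures, so it is enough to compare them for
  \<open>h(y) = exp(i \<langle>\<xi>, y\<rangle>)\<close>, where the formula is the fundamental theorem of calculus.

  \<^bold>\<open>Convexity.\<close> Let \<open>h\<close> be the indicator function of a convex set \<open>C\<close>, and let \<open>\<kappa>\<close> be the
  convex distance of the laws of \<open>Y\<close> and \<open>Z\<close>. Convexity enters three times.
  The Gaussian measure of a boundary layer of \<open>C\<close> is bounded by its thickness
  (\<open>gauss_boundary_layer\<close>); as \<open>Z\<^sub>i Z\<^sub>j - \<delta>\<^sub>i\<^sub>j\<close> has mean zero, this tames the singularity of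
  \<open>cot t\<close> at zero and gives \<open>E W\<^sub>i\<^sub>j(Z)\<^sup>2 \<le> 64 m\<close>, uniformly in \<open>a\<close>
  (\<open>stein_hessian_gauss_L2\<close>). Next, \<open>W\<^sub>i\<^sub>j(y)\<^sup>2\<close> is a mixture of indicator functions of intersections
  of two convex sets, so \<open>E W\<^sub>i\<^sub>j(Y)\<^sup>2\<close> exceeds \<open>E W\<^sub>i\<^sub>j(Z)\<^sup>2\<close> by at most \<open>\<kappa>\<close> times a squared logarithm
  of \<open>a\<close> (\<open>stein_hessian_compare\<close>). Last, undoing the smoothing by \<open>sin a Z\<close> costs
  a multiple of \<open>m\<^sup>3\<^sup>/\<^sup>2 a\<close> and a quarter of \<open>\<kappa>\<close> (\<open>convex_smoothing\<close>). With \<open>a = g\<close>, the root of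
  \<open>E \<parallel>V - I\<parallel>\<^sup>2\<close>, all terms that contain \<open>\<kappa>\<close> can be absorbed on the left, and
  \<open>\<kappa> \<le> 402 m\<^sup>3\<^sup>/\<^sup>2 g\<close> follows (\<open>convex_distance_std_gauss\<close>).

  \<^bold>\<open>General covariance.\<close> Choose \<open>A\<close> with \<open>A \<Sigma> A\<^sup>T = I\<close>. The image \<open>A F\<close> satisfies the Stein identity with
  \<open>A M\<^sub>F A\<^sup>T\<close>, convex sets go to convex sets, and \<open>A (M\<^sub>F - \<Sigma>) A\<^sup>T\<close> is at most
  \<open>\<parallel>\<Sigma>\<^sup>-\<^sup>1\<parallel>\<close> times as large as \<open>M\<^sub>F - \<Sigma>\<close>. This gives the claim, as \<open>m\<^sup>3\<^sup>/\<^sup>2 \<le> m\<^sup>4\<^sup>1\<^sup>/\<^sup>2\<^sup>4\<close> and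
  \<open>x \<le> x\<^sup>3\<^sup>/\<^sup>2 + 1\<close>.
\<close>

section \<open>The standard normal law\<close>

abbreviation std_gauss :: "real measure" where "std_gauss \<equiv> std_normal_distribution"

lemma prob_space_std_gauss: "prob_space std_gauss"
  by (simp add: prob_space_normal_density)

interpretation std_gauss: prob_space std_gauss
  by (rule prob_space_std_gauss)

lemma integrable_std_gauss_poly_growth:
  fixes g :: "real \<Rightarrow> 'a::{banach, second_countable_topology}"
  assumes "g \<in> borel_measurable borel" "\<And>x. norm (g x) \<le> C * (1 + \<bar>x\<bar>) ^ k"
  shows "integrable std_gauss g"
proof -
  have "integrable std_gauss (\<lambda>x. C * (\<Sum>j\<le>k. of_nat (k choose j) * \<bar>x\<bar> ^ j))"
    by (intro integrable_mult_right integrable_sum)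
       (simp add: integrable_density integrable_std_normal_moment_abs)
  then have "integrable std_gauss (\<lambda>x. C * (1 + \<bar>x\<bar>) ^ k)"
    using binomial_ring[of "\<bar>_\<bar>" "1::real" k] by (simp add: add.commute)
  then show ?thesis
    by (rule Bochner_Integration.integrable_bound)
       (use assms in \<open>auto intro!: AE_I2 intro: order_trans[OF _ abs_ge_self]\<close>)
qed

text \<open>From \<open>- u\<^sup>2 / 2 \<le> 2 - (1 + \<bar>u\<bar>)\<close> the density is at most \<open>exp 2 / exp (1 + \<bar>u\<bar>)\<close>, and an
  exponential beats every power. The filter is arbitrary so that both ends of the line are covered.\<close>

lemma normal_density_poly_tendsto_0:
  fixes F :: "'b filter" and u :: "'b \<Rightarrow> real"
  assumes "filterlim (\<lambda>x. \<bar>u x\<bar>) at_top F"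
  shows "((\<lambda>x. std_normal_density (u x) * (C * (1 + \<bar>u x\<bar>) ^ k)) \<longlongrightarrow> 0) F"
proof -
  have lim: "filterlim (\<lambda>x. 1 + \<bar>u x\<bar>) at_top F"
    by (rule filterlim_tendsto_add_at_top[OF tendsto_const assms])
  have "((\<lambda>x. (1 + \<bar>u x\<bar>) ^ k / exp (1 + \<bar>u x\<bar>)) \<longlongrightarrow> 0) F"
    by (rule filterlim_compose[OF tendsto_power_div_exp_0 lim])
  then have "((\<lambda>x. (\<bar>C\<bar> * exp 2) * ((1 + \<bar>u x\<bar>) ^ k / exp (1 + \<bar>u x\<bar>))) \<longlongrightarrow> (\<bar>C\<bar> * exp 2) * 0) F"
    by (intro tendsto_intros)
  then have *: "((\<lambda>x. (\<bar>C\<bar> * exp 2) * ((1 + \<bar>u x\<bar>) ^ k / exp (1 + \<bar>u x\<bar>))) \<longlongrightarrow> 0) F" by simp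
  show ?thesis
  proof (rule Lim_null_comparison[OF _ *], rule always_eventually, rule allI)
    fix x
    let ?y = "\<bar>u x\<bar>"
    have "0 \<le> (?y - 1)\<^sup>2" by simp
    then have "- (u x)\<^sup>2 / 2 \<le> 2 - (1 + ?y)" by (simp add: power2_eq_square algebra_simps)
    then have 1: "exp (- (u x)\<^sup>2 / 2) \<le> exp 2 / exp (1 + ?y)" by (metis exp_diff exp_le_cancel_iff)
    have "1 / sqrt (2 * pi) \<le> 1" using pi_ge_two by (simp add: real_le_rsqrt)
    then have "std_normal_density (u x) \<le> 1 * exp (- (u x)\<^sup>2 / 2)"
      unfolding std_normal_density_def by (intro mult_right_mono) auto
    with 1 have 2: "std_normal_density (u x) \<le> exp 2 / exp (1 + ?y)" by simp
    have "norm (std_normal_density (u x) * (C * (1 + ?y) ^ k)) = std_normal_density (u x) * (\<bar>C\<bar> * (1 + ?y) ^ k)"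
      by (simp add: abs_mult power_abs)
    also have "\<dots> \<le> exp 2 / exp (1 + ?y) * (\<bar>C\<bar> * (1 + ?y) ^ k)"
      by (intro mult_right_mono 2) auto
    finally show "norm (std_normal_density (u x) * (C * (1 + ?y) ^ k)) \<le> (\<bar>C\<bar> * exp 2) * ((1 + ?y) ^ k / exp (1 + ?y))"
      by (simp add: field_simps)
  qed
qed

lemma std_normal_density_has_derivative:
  "(std_normal_density has_real_derivative (- x * std_normal_density x)) (at x)"
  unfolding std_normal_density_def
  by (auto intro!: derivative_eq_intros simp: field_simps)

text \<open>The function \<open>\<phi> g\<close>, with \<open>\<phi>\<close> the standard normal density, vanishes at both ends of the
  line, and \<open>\<phi>' = - x \<phi>\<close>.\<close>

lemma std_gauss_integration_by_parts:
  fixes g g' :: "real \<Rightarrow> 'a::euclidean_space"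
  assumes der: "\<And>x. (g has_vector_derivative g' x) (at x)"
    and cont: "continuous_on UNIV g'"
    and g: "\<And>x. norm (g x) \<le> C * (1 + \<bar>x\<bar>) ^ k"
    and g': "\<And>x. norm (g' x) \<le> C * (1 + \<bar>x\<bar>) ^ k"
  shows "(LINT x|std_gauss. x *\<^sub>R g x) = (LINT x|std_gauss. g' x)"
proof -
  have cg: "continuous_on UNIV g"
    by (intro continuous_at_imp_continuous_on ballI has_vector_derivative_continuous[OF der])
  note [measurable] = borel_measurable_continuous_onI[OF cg] borel_measurable_continuous_onI[OF cont]
  have i1: "integrable std_gauss g'"
    by (rule integrable_std_gauss_poly_growth[OF _ g']) simp
  have i2: "integrable std_gauss (\<lambda>x. x *\<^sub>R g x)"
  proof (rule integrable_std_gauss_poly_growth)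
    show "norm (x *\<^sub>R g x) \<le> C * (1 + \<bar>x\<bar>) ^ Suc k" for x
    proof -
      have "norm (x *\<^sub>R g x) \<le> (1 + \<bar>x\<bar>) * (C * (1 + \<bar>x\<bar>) ^ k)"
        using g[of x] by (auto intro!: mult_mono)
      then show ?thesis by (simp add: mult_ac)
    qed
  qed simp
  let ?f = "\<lambda>x. std_normal_density x *\<^sub>R (g' x - x *\<^sub>R g x)"
  let ?F = "\<lambda>x. std_normal_density x *\<^sub>R g x"
  have if0: "integrable std_gauss (\<lambda>x. g' x - x *\<^sub>R g x)"
    using i1 i2 by (rule Bochner_Integration.integrable_diff)
  have if1: "integrable lborel ?f"
    using if0 by (subst (asm) integrable_density) auto
  have "filterlim (\<lambda>x::real. \<bar>x\<bar>) at_top at_top" "filterlim (\<lambda>x::real. \<bar>x\<bar>) at_top at_bot"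
    by (simp_all add: filterlim_abs_real filterlim_at_bot_mirror)
  note F0 = this[THEN normal_density_poly_tendsto_0, of C k]
  have lims: "(?F \<longlongrightarrow> 0) at_top" "(?F \<longlongrightarrow> 0) at_bot"
    by (rule Lim_null_comparison[OF _ F0(1)], simp add: mult_left_mono[OF g],
        rule Lim_null_comparison[OF _ F0(2)], simp add: mult_left_mono[OF g])
  have "(LBINT x=-\<infinity>..\<infinity>. ?f x) = 0 - 0"
  proof (rule interval_integral_FTC_integrable[where F="?F"])
    show "(?F has_vector_derivative ?f x) (at x)" for x
      by (rule has_vector_derivative_eq_rhs[OF has_vector_derivative_scaleR[OF std_normal_density_has_derivative der]])
         (simp add: algebra_simps)
    have "continuous_on UNIV ?f"
      by (intro continuous_intros cg cont continuous_at_imp_continuous_on ballI DERIV_isCont[OF std_normal_density_has_derivative])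
    then show "isCont ?f x" for x
      by (simp add: continuous_on_eq_continuous_at)
    show "set_integrable lborel (einterval (- \<infinity>) \<infinity>) ?f"
      using if1 by (simp add: set_integrable_def)
    show "((?F \<circ> real_of_ereal) \<longlongrightarrow> 0) (at_right (- \<infinity>))"
      "((?F \<circ> real_of_ereal) \<longlongrightarrow> 0) (at_left \<infinity>)"
      unfolding ereal_tendsto_simps using lims by auto
  qed simp
  then have "(LINT x|lborel. ?f x) = 0"
    by (simp add: interval_lebesgue_integral_def set_lebesgue_integral_def)
  then have "(LINT x|std_gauss. g' x - x *\<^sub>R g x) = 0"
    by (subst integral_density) auto
  then show ?thesis
    using i1 i2 by simp
qed

section \<open>Random variables with moments of all orders\<close>

text \<open>This class is closed under sums and products, hence under polynomials, and it contains the
  Gaussian variables; it is the bookkeeping device for integrability throughout.\<close>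

definition all_moments :: "'w measure \<Rightarrow> ('w \<Rightarrow> real) \<Rightarrow> bool" where
  "all_moments M f \<longleftrightarrow> f \<in> borel_measurable M \<and> (\<forall>p::nat. integrable M (\<lambda>w. \<bar>f w\<bar> ^ p))"

lemma all_moments_integrable: "all_moments M f \<Longrightarrow> integrable M f"
proof -
  assume a: "all_moments M f"
  then have [measurable]: "f \<in> borel_measurable M" by (simp add: all_moments_def)
  have "integrable M (\<lambda>w. \<bar>f w\<bar> ^ 1)" using a unfolding all_moments_def by blast
  then show ?thesis by (simp add: integrable_abs_iff)
qed

lemma all_moments_bound:
  assumes "all_moments M g" "f \<in> borel_measurable M" "\<And>w. \<bar>f w\<bar> \<le> \<bar>g w\<bar>"
  shows "all_moments M f"
  unfolding all_moments_def
proof (intro conjI allI)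
  fix p
  have "integrable M (\<lambda>w. \<bar>g w\<bar> ^ p)" using assms(1) by (simp add: all_moments_def)
  then show "integrable M (\<lambda>w. \<bar>f w\<bar> ^ p)"
    by (rule Bochner_Integration.integrable_bound)
       (use assms(2,3) in \<open>auto intro!: AE_I2 power_mono simp: power_abs\<close>)
qed fact

lemma all_moments_abs: "all_moments M f \<Longrightarrow> all_moments M (\<lambda>w. \<bar>f w\<bar>)"
  by (auto simp: all_moments_def)

lemma all_moments_power: assumes "all_moments M f" shows "all_moments M (\<lambda>w. f w ^ k)"
  using assms by (auto simp: all_moments_def power_abs power_mult[symmetric])

lemma all_moments_mult: assumes "all_moments M f" shows "all_moments M (\<lambda>w. c * f w)"
  using assms by (auto simp: all_moments_def abs_mult power_mult_distrib)

lemma all_moments_add: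
  assumes "all_moments M f" "all_moments M g"
  shows "all_moments M (\<lambda>w. f w + g w)"
  unfolding all_moments_def
proof (intro conjI allI)
  have [measurable]: "f \<in> borel_measurable M" "g \<in> borel_measurable M"
    using assms by (auto simp: all_moments_def)
  show "(\<lambda>w. f w + g w) \<in> borel_measurable M" by simp
  fix p
  have "integrable M (\<lambda>w. 2 ^ p * (\<bar>f w\<bar> ^ p + \<bar>g w\<bar> ^ p))"
    using assms by (auto simp: all_moments_def)
  then show "integrable M (\<lambda>w. \<bar>f w + g w\<bar> ^ p)"
  proof (rule Bochner_Integration.integrable_bound)
    show "AE w in M. norm (\<bar>f w + g w\<bar> ^ p) \<le> norm (2 ^ p * (\<bar>f w\<bar> ^ p + \<bar>g w\<bar> ^ p))"
    proof (rule AE_I2)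
      fix w
      have "\<bar>f w + g w\<bar> ^ p \<le> (2 * max \<bar>f w\<bar> \<bar>g w\<bar>) ^ p"
        by (intro power_mono) auto
      also have "\<dots> \<le> 2 ^ p * (\<bar>f w\<bar> ^ p + \<bar>g w\<bar> ^ p)"
        by (auto simp: power_mult_distrib max_def)
      finally show "norm (\<bar>f w + g w\<bar> ^ p) \<le> norm (2 ^ p * (\<bar>f w\<bar> ^ p + \<bar>g w\<bar> ^ p))"
        by simp
    qed
  qed simp
qed

lemma (in finite_measure) all_moments_const: "all_moments M (\<lambda>w. c)"
  by (simp add: all_moments_def)

lemma (in finite_measure) all_moments_sum:
  assumes "\<And>i. i \<in> I \<Longrightarrow> all_moments M (f i)"
  shows "all_moments M (\<lambda>w. \<Sum>i\<in>I. f i w)"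
  using assms by (induction I rule: infinite_finite_induct)
                 (auto intro: all_moments_add all_moments_const)

lemma all_moments_times:
  assumes "all_moments M f" "all_moments M g"
  shows "all_moments M (\<lambda>w. f w * g w)"
proof (rule all_moments_bound)
  show "all_moments M (\<lambda>w. (f w)\<^sup>2 + (g w)\<^sup>2)"
    by (intro all_moments_add all_moments_power assms)
  show "(\<lambda>w. f w * g w) \<in> borel_measurable M"
    using assms by (auto simp: all_moments_def)
  fix w
  have "0 \<le> (\<bar>f w\<bar> - \<bar>g w\<bar>)\<^sup>2 + (f w)\<^sup>2 + (g w)\<^sup>2" by simp
  then show "\<bar>f w * g w\<bar> \<le> \<bar>(f w)\<^sup>2 + (g w)\<^sup>2\<bar>"
    by (simp add: power2_diff abs_mult)
qed

lemma (in finite_measure) all_moments_poly: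
  assumes "all_moments M f"
  shows "all_moments M (\<lambda>w. poly p (f w))"
  by (induction p) (auto intro!: all_moments_add all_moments_times all_moments_const assms)

lemma all_moments_square_integrable: "all_moments M f \<Longrightarrow> integrable M (\<lambda>w. (f w)\<^sup>2)"
  unfolding all_moments_def by (metis (no_types, lifting) Bochner_Integration.integrable_cong power2_abs)

lemma all_moments_std_gauss: "all_moments std_gauss (\<lambda>x. x)"
  unfolding all_moments_def
proof (intro conjI allI)
  show "integrable std_gauss (\<lambda>x. \<bar>x\<bar> ^ p)" for p
    by (simp add: integrable_density integrable_std_normal_moment_abs)
qed simp

lemma all_moments_distr:
  assumes "f \<in> measurable M N" and [measurable]: "g \<in> borel_measurable N"
  shows "all_moments (distr M N f) g \<longleftrightarrow> all_moments M (\<lambda>w. g (f w))"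
  unfolding all_moments_def using assms by (auto simp: integrable_distr_eq)

text \<open>The quadratic form \<open>(s, t) \<mapsto> \<integral> (s f + t g)\<^sup>2\<close> is nonnegative, so its discriminant has a sign.\<close>

lemma Cauchy_Schwarz_integral:
  fixes f g :: "'a \<Rightarrow> real"
  assumes [measurable]: "f \<in> borel_measurable M" "g \<in> borel_measurable M"
    and f: "integrable M (\<lambda>x. (f x)\<^sup>2)" and g: "integrable M (\<lambda>x. (g x)\<^sup>2)"
  shows "integrable M (\<lambda>x. f x * g x)"
    and "(LINT x|M. f x * g x)\<^sup>2 \<le> (LINT x|M. (f x)\<^sup>2) * (LINT x|M. (g x)\<^sup>2)"
proof -
  show i: "integrable M (\<lambda>x. f x * g x)"
  proof (rule Bochner_Integration.integrable_bound)
    show "integrable M (\<lambda>x. (f x)\<^sup>2 + (g x)\<^sup>2)" using f g by simp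
    show "AE x in M. norm (f x * g x) \<le> norm ((f x)\<^sup>2 + (g x)\<^sup>2)"
    proof (rule AE_I2)
      fix x
      have "0 \<le> (\<bar>f x\<bar> - \<bar>g x\<bar>)\<^sup>2 + (f x)\<^sup>2 + (g x)\<^sup>2" by simp
      then show "norm (f x * g x) \<le> norm ((f x)\<^sup>2 + (g x)\<^sup>2)"
        by (simp add: power2_diff abs_mult)
    qed
  qed simp
  let ?a = "LINT x|M. (f x)\<^sup>2" and ?b = "LINT x|M. f x * g x" and ?c = "LINT x|M. (g x)\<^sup>2"
  have q: "0 \<le> s\<^sup>2 * ?a + 2 * s * t * ?b + t\<^sup>2 * ?c" for s t
  proof -
    have "0 \<le> (LINT x|M. (s * f x + t * g x)\<^sup>2)" by simp
    also have "\<dots> = (LINT x|M. s\<^sup>2 * (f x)\<^sup>2 + 2 * s * t * (f x * g x) + t\<^sup>2 * (g x)\<^sup>2)"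
      by (intro Bochner_Integration.integral_cong) (auto simp: power2_eq_square algebra_simps)
    also have "\<dots> = s\<^sup>2 * ?a + 2 * s * t * ?b + t\<^sup>2 * ?c"
      using f g i by simp
    finally show ?thesis .
  qed
  have c0: "0 \<le> ?c" "0 \<le> ?a" by simp_all
  show "?b\<^sup>2 \<le> ?a * ?c"
  proof (cases "?c = 0")
    case True
    have b0: "?b = 0"
    proof (rule ccontr)
      assume nz: "?b \<noteq> 0"
      have "0 \<le> ?a + 2 * (-(?a + 1) / (2 * ?b)) * ?b" using q[of 1 "-(?a + 1) / (2 * ?b)"] True by simp
      then show False using nz by (simp add: field_simps)
    qed
    then show ?thesis using c0 by (metis mult_nonneg_nonneg power_zero_numeral)
  next
    case False
    then have c: "?c > 0" using c0 by linarith
    have "0 \<le> ?c * (?c * ?a - ?b\<^sup>2)"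
      using q[of "?c" "- ?b"] by (simp add: power2_eq_square algebra_simps)
    then show ?thesis using c by (simp add: zero_le_mult_iff mult.commute)
  qed
qed

section \<open>Fourier uniqueness for weighted measures\<close>

text \<open>The positive and the negative part of the weight \<open>w\<close> have the same total mass \<open>c\<close>, by the hypothesis at
  \<open>t = 0\<close>. Unless \<open>c = 0\<close>, both define probability laws of \<open>R\<close>, which have the same characteristic function and
  therefore coincide by Levy's uniqueness theorem.\<close>

lemma fourier_uniqueness_real_weight:
  fixes w R :: "'a \<Rightarrow> real"
  assumes w: "integrable M w" and R[measurable]: "R \<in> borel_measurable M"
    and zero: "\<And>t. (CLINT x|M. complex_of_real (w x) * iexp (t * R x)) = 0"
    and A[measurable]: "A \<in> sets borel"
  shows "(LINT x|M. w x * indicator A (R x)) = 0"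
proof -
  have [measurable]: "w \<in> borel_measurable M" using w by simp
  define v where "v s x = max 0 (s * w x)" for s :: real and x
  have v0: "0 \<le> v s x" for s x by (simp add: v_def)
  have [measurable]: "v s \<in> borel_measurable M" for s unfolding v_def by measurable
  have vi: "integrable M (v s)" for s
    unfolding v_def by (intro Bochner_Integration.integrable_max) (use w in auto)
  have diff: "w x = v 1 x - v (-1) x" for x by (simp add: v_def)
  have wi0: "(LINT x|M. w x) = 0"
    using zero[of 0] by (simp del: of_real_mult add: of_real_mult[symmetric])
  define c where "c = (LINT x|M. v 1 x)"
  have c: "(LINT x|M. v s x) = c" if "s \<in> {1,-1}" for s
  proof -
    have "(LINT x|M. w x) = c - (LINT x|M. v (-1) x)"
      unfolding diff c_def using vi by simp
    with wi0 that show ?thesis by (auto simp: c_def)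
  qed
  show ?thesis
  proof (cases "c = 0")
    case True
    have "AE x in M. v s x = 0" if "s \<in> {1,-1}" for s
      using integral_nonneg_eq_0_iff_AE[OF vi, of s] c[OF that] True v0 by simp
    from this[of 1] this[of "-1"] have "AE x in M. w x = 0"
      by (auto simp: diff)
    then have "(LINT x|M. w x * indicator A (R x)) = (LINT x|M. 0)"
      by (intro integral_cong_AE) auto
    then show ?thesis by simp
  next
    case False
    have "c \<ge> 0" unfolding c_def by (simp add: v0)
    with False have cpos: "c > 0" by simp
    define D where "D s = distr (density M (\<lambda>x. ennreal (v s x / c))) borel R" for s
    have vc0: "0 \<le> v s x / c" for s x using v0 cpos by simp
    have int: "(\<integral>x. f x \<partial>D s) = (\<integral>x. (v s x / c) *\<^sub>R f (R x) \<partial>M)"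
      if "f \<in> borel_measurable borel" for s and f :: "real \<Rightarrow> 'b::{banach, second_countable_topology}"
      unfolding D_def using that vc0 by (subst integral_distr) (auto intro!: integral_density)
    have rd: "real_distribution (D s)" if "s \<in> {1,-1}" for s
    proof -
      have "emeasure (density M (\<lambda>x. ennreal (v s x / c))) (space M) = (\<integral>\<^sup>+x. ennreal (v s x / c) \<partial>M)"
        by (subst emeasure_density) (auto intro!: nn_integral_cong)
      also have "\<dots> = ennreal (LINT x|M. v s x / c)"
        using vi vc0 by (intro nn_integral_eq_integral) auto
      also have "(LINT x|M. v s x / c) = 1" using c[OF that] cpos by simp
      finally have "prob_space (density M (\<lambda>x. ennreal (v s x / c)))"
        by (intro prob_spaceI) simp
      then have "prob_space (D s)" unfolding D_def
        by (rule prob_space.prob_space_distr) simp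
      then show ?thesis
        by (simp add: real_distribution_def real_distribution_axioms_def D_def)
    qed
    have ichar: "integrable M (\<lambda>x. complex_of_real (v s x) * iexp (t * R x))" for s t
      by (rule Bochner_Integration.integrable_bound[OF vi[of s]]) (auto simp: norm_mult)
    have "char (D 1) = char (D (-1))"
    proof
      fix t
      have "(CLINT x|M. complex_of_real (v 1 x) * iexp (t * R x)) - (CLINT x|M. complex_of_real (v (-1) x) * iexp (t * R x))
          = (CLINT x|M. complex_of_real (w x) * iexp (t * R x))"
        unfolding Bochner_Integration.integral_diff[OF ichar ichar, symmetric]
        by (intro Bochner_Integration.integral_cong) (auto simp: diff left_diff_distrib)
      then have "(CLINT x|M. complex_of_real (v 1 x) * iexp (t * R x)) = (CLINT x|M. complex_of_real (v (-1) x) * iexp (t * R x))"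
        using zero[of t] by simp
      then have "(CLINT x|M. (complex_of_real (v 1 x) * iexp (t * R x)) / c) = (CLINT x|M. (complex_of_real (v (-1) x) * iexp (t * R x)) / c)"
        by simp
      then show "char (D 1) t = char (D (-1)) t"
        unfolding char_def by (subst (1 2) int) (simp_all add: scaleR_conv_of_real field_simps)
    qed
    then have "D 1 = D (-1)" using rd by (intro Levy_uniqueness) auto
    then have eq: "(LINT x|M. v 1 x * indicator A (R x)) = (LINT x|M. v (-1) x * indicator A (R x))"
      using cpos int[of "indicat_real A" 1] int[of "indicat_real A" "-1"] by simp
    have ii: "integrable M (\<lambda>x. v s x * indicat_real A (R x))" for s
      by (rule Bochner_Integration.integrable_bound[OF vi[of s]]) (auto simp: v0 split: split_indicator)
    have "(LINT x|M. w x * indicator A (R x)) = (LINT x|M. v 1 x * indicat_real A (R x) - v (-1) x * indicat_real A (R x))"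
      by (intro Bochner_Integration.integral_cong) (auto simp: diff left_diff_distrib)
    also have "\<dots> = 0" using ii eq by simp
    finally show ?thesis .
  qed
qed

lemma fourier_uniqueness_complex_weight:
  fixes w :: "'a \<Rightarrow> complex" and R :: "'a \<Rightarrow> real"
  assumes w: "integrable M w" and R[measurable]: "R \<in> borel_measurable M"
    and zero: "\<And>t. (CLINT x|M. w x * iexp (t * R x)) = 0"
    and A[measurable]: "A \<in> sets borel"
  shows "(CLINT x|M. w x * indicator A (R x)) = 0"
proof -
  have [measurable]: "w \<in> borel_measurable M" using w by simp
  have [measurable]: "(\<lambda>x. cnj (w x)) \<in> borel_measurable M"
    by (rule measurable_compose[of w M borel]) (auto intro!: borel_measurable_continuous_onI continuous_intros)
  have i1: "integrable M (\<lambda>x. w x * iexp (t * R x))" for t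
    by (rule Bochner_Integration.integrable_bound[OF w]) (auto simp: norm_mult)
  have i2: "integrable M (\<lambda>x. cnj (w x) * iexp (t * R x))" for t
    by (rule Bochner_Integration.integrable_bound[OF w]) (auto simp: norm_mult)
  have zero': "(CLINT x|M. cnj (w x) * iexp (t * R x)) = 0" for t
  proof -
    have "(CLINT x|M. cnj (w x) * iexp (t * R x)) = (CLINT x|M. cnj (w x * iexp (- t * R x)))"
      by (intro Bochner_Integration.integral_cong) (simp_all add: exp_cnj)
    also have "\<dots> = 0" using zero[of "-t"] by (simp del: complex_cnj_mult)
    finally show ?thesis .
  qed
  have re: "(LINT x|M. Re (w x) * indicator A (R x)) = 0"
  proof (rule fourier_uniqueness_real_weight[OF _ R _ A])
    fix t
    have "(CLINT x|M. complex_of_real (Re (w x)) * iexp (t * R x)) =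
       (CLINT x|M. (w x * iexp (t * R x) + cnj (w x) * iexp (t * R x)) / 2)"
      by (intro Bochner_Integration.integral_cong) (simp_all add: ring_distribs[symmetric] complex_add_cnj)
    also have "\<dots> = 0" using i1 i2 zero zero' by simp
    finally show "(CLINT x|M. complex_of_real (Re (w x)) * iexp (t * R x)) = 0" .
  qed (use w in simp)
  have im: "(LINT x|M. Im (w x) * indicator A (R x)) = 0"
  proof (rule fourier_uniqueness_real_weight[OF _ R _ A])
    fix t
    have "(CLINT x|M. complex_of_real (Im (w x)) * iexp (t * R x)) =
       (CLINT x|M. (w x * iexp (t * R x) - cnj (w x) * iexp (t * R x)) / (2 * \<i>))"
    proof (intro Bochner_Integration.integral_cong refl)
      fix x
      have "complex_of_real (Im (w x)) = (w x - cnj (w x)) / (2 * \<i>)"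
        by (simp add: complex_diff_cnj mult.commute[of "complex_of_real _" "\<i>"])
      then show "complex_of_real (Im (w x)) * iexp (t * R x) = (w x * iexp (t * R x) - cnj (w x) * iexp (t * R x)) / (2 * \<i>)"
        by (simp only: left_diff_distrib times_divide_eq_left diff_divide_distrib)
    qed
    also have "\<dots> = 0" using i1 i2 zero zero' by simp
    finally show "(CLINT x|M. complex_of_real (Im (w x)) * iexp (t * R x)) = 0" .
  qed (use w in simp)
  have iA: "integrable M (\<lambda>x. w x * indicator A (R x))"
    by (rule Bochner_Integration.integrable_bound[OF w]) (auto simp: norm_mult split: split_indicator)
  show ?thesis
  proof (rule complex_eqI)
    have "Re (CLINT x|M. w x * indicator A (R x)) = (LINT x|M. Re (w x * indicator A (R x)))"
      by (rule integral_Re[symmetric, OF iA])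
    also have "\<dots> = (LINT x|M. Re (w x) * indicator A (R x))"
      by (intro Bochner_Integration.integral_cong) (auto split: split_indicator)
    finally show "Re (CLINT x|M. w x * indicator A (R x)) = Re 0" using re by simp
    have "Im (CLINT x|M. w x * indicator A (R x)) = (LINT x|M. Im (w x * indicator A (R x)))"
      by (rule integral_Im[symmetric, OF iA])
    also have "\<dots> = (LINT x|M. Im (w x) * indicator A (R x))"
      by (intro Bochner_Integration.integral_cong) (auto split: split_indicator)
    finally show "Im (CLINT x|M. w x * indicator A (R x)) = Im 0" using im by simp
  qed
qed

text \<open>One coordinate at a time: once the indicator function of \<open>A j\<close> has replaced the exponential in the coordinate \<open>j\<close>,
  it becomes part of the weight. This is why the weight has to be complex.\<close>

lemma fourier_uniqueness_boxes:
  fixes w :: "'a \<Rightarrow> complex" and R :: "'i \<Rightarrow> 'a \<Rightarrow> real"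
  assumes "finite I" and "integrable M w" and "\<And>i. i \<in> I \<Longrightarrow> R i \<in> borel_measurable M"
    and "\<And>\<xi>. (CLINT x|M. w x * iexp (\<Sum>i\<in>I. \<xi> i * R i x)) = 0"
    and "\<And>i. i \<in> I \<Longrightarrow> A i \<in> sets borel"
  shows "(CLINT x|M. w x * (\<Prod>i\<in>I. indicator (A i) (R i x))) = 0"
  using assms
proof (induction I arbitrary: w rule: finite_induct)
  case empty
  then show ?case by simp
next
  case (insert j I)
  have [measurable]: "R i \<in> borel_measurable M" if "i \<in> I" for i using insert that by auto
  have Rj[measurable]: "R j \<in> borel_measurable M" using insert by auto
  have Aj[measurable]: "A j \<in> sets borel" using insert by auto
  have [measurable]: "w \<in> borel_measurable M" using insert.prems(1) by simp
  have "(CLINT x|M. (w x * indicator (A j) (R j x)) * (\<Prod>i\<in>I. indicator (A i) (R i x))) = 0"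
  proof (rule insert.IH)
    show "integrable M (\<lambda>x. w x * indicator (A j) (R j x))"
      by (rule Bochner_Integration.integrable_bound[OF insert.prems(1)]) (auto simp: norm_mult split: split_indicator)
    fix \<xi> :: "'i \<Rightarrow> real"
    have "(CLINT x|M. (w x * iexp (\<Sum>i\<in>I. \<xi> i * R i x)) * indicator (A j) (R j x)) = 0"
    proof (rule fourier_uniqueness_complex_weight[OF _ Rj _ Aj])
      show "integrable M (\<lambda>x. w x * iexp (\<Sum>i\<in>I. \<xi> i * R i x))"
        by (rule Bochner_Integration.integrable_bound[OF insert.prems(1)]) (auto simp: norm_mult)
      fix t
      have "(CLINT x|M. (w x * iexp (\<Sum>i\<in>I. \<xi> i * R i x)) * iexp (t * R j x)) =
            (CLINT x|M. w x * iexp (\<Sum>i\<in>insert j I. (\<xi>(j := t)) i * R i x))"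
      proof (intro Bochner_Integration.integral_cong refl)
        fix x
        have "(\<Sum>i\<in>I. (\<xi>(j := t)) i * R i x) = (\<Sum>i\<in>I. \<xi> i * R i x)"
          using insert.hyps by (intro sum.cong) auto
        then show "(w x * iexp (\<Sum>i\<in>I. \<xi> i * R i x)) * iexp (t * R j x) = w x * iexp (\<Sum>i\<in>insert j I. (\<xi>(j := t)) i * R i x)"
          using insert.hyps by (simp add: exp_add[symmetric] distrib_left add.commute del: fun_upd_apply) (simp add: mult.assoc exp_add[symmetric] distrib_left add.commute)
      qed
      also have "\<dots> = 0" by (rule insert.prems)
      finally show "(CLINT x|M. (w x * iexp (\<Sum>i\<in>I. \<xi> i * R i x)) * iexp (t * R j x)) = 0" .
    qed
    then show "(CLINT x|M. (w x * indicator (A j) (R j x)) * iexp (\<Sum>i\<in>I. \<xi> i * R i x)) = 0"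
      by (simp add: mult_ac)
  qed (use insert.prems in auto)
  then show ?case using insert.hyps by (simp add: mult_ac)
qed

text \<open>The two finite measures given by the positive and the negative part of \<open>w\<close> agree on boxes, which generate the
  product sigma-algebra.\<close>

lemma fourier_uniqueness_single:
  fixes w :: "'a \<Rightarrow> real" and R :: "'i \<Rightarrow> 'a \<Rightarrow> real"
  assumes fin: "finite I" and w: "integrable M w" and R: "\<And>i. i \<in> I \<Longrightarrow> R i \<in> borel_measurable M"
    and zero: "\<And>\<xi>. (CLINT x|M. complex_of_real (w x) * iexp (\<Sum>i\<in>I. \<xi> i * R i x)) = 0"
    and g[measurable]: "g \<in> borel_measurable (\<Pi>\<^sub>M i\<in>I. borel)" and bdd: "\<And>y. norm (g y) \<le> B"
  shows "(LINT x|M. w x *\<^sub>R (g (\<lambda>i\<in>I. R i x) :: 'b::{banach, second_countable_topology})) = 0"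
proof -
  note [measurable] = R
  have [measurable]: "w \<in> borel_measurable M" using w by simp
  have RI[measurable]: "(\<lambda>x. \<lambda>i\<in>I. R i x) \<in> measurable M (\<Pi>\<^sub>M i\<in>I. borel)"
    by (rule measurable_restrict) fact
  define v where "v s x = max 0 (s * w x)" for s :: real and x
  have v0: "0 \<le> v s x" for s x by (simp add: v_def)
  have [measurable]: "v s \<in> borel_measurable M" for s unfolding v_def by measurable
  have vi: "integrable M (v s)" for s
    unfolding v_def by (intro Bochner_Integration.integrable_max) (use w in auto)
  have diff: "w x = v 1 x - v (-1) x" for x by (simp add: v_def)
  define D where "D s = distr (density M (\<lambda>x. ennreal (v s x))) (\<Pi>\<^sub>M i\<in>I. borel) (\<lambda>x. \<lambda>i\<in>I. R i x)" for s
  have fD: "finite_measure (D s)" for s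
    unfolding D_def
  proof (intro finite_measure.finite_measure_distr finite_measureI)
    have "emeasure (density M (\<lambda>x. ennreal (v s x))) (space M) = (\<integral>\<^sup>+x. ennreal (v s x) \<partial>M)"
      by (subst emeasure_density) (auto intro!: nn_integral_cong)
    also have "\<dots> = ennreal (LINT x|M. v s x)"
      using vi v0 by (intro nn_integral_eq_integral) auto
    finally show "emeasure (density M (\<lambda>x. ennreal (v s x))) (space (density M (\<lambda>x. ennreal (v s x)))) \<noteq> \<infinity>"
      by simp
  qed simp
  have int: "(\<integral>x. f x \<partial>D s) = (\<integral>x. v s x *\<^sub>R f (\<lambda>i\<in>I. R i x) \<partial>M)"
    if "f \<in> borel_measurable (\<Pi>\<^sub>M i\<in>I. borel)" for s and f :: "_ \<Rightarrow> 'c::{banach, second_countable_topology}"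
    unfolding D_def using that v0 by (subst integral_distr) (auto intro!: integral_density)
  have "D 1 = D (-1)"
  proof (rule measure_eqI_PiM_finite[OF fin])
    fix A assume A: "\<And>i. i \<in> I \<Longrightarrow> A i \<in> sets (borel :: real measure)"
    note [measurable] = A
    have "(CLINT x|M. complex_of_real (w x) * (\<Prod>i\<in>I. indicator (A i) (R i x))) = 0"
      by (rule fourier_uniqueness_boxes[OF fin _ R zero A]) (use w in auto)
    moreover have "complex_of_real (w x) * (\<Prod>i\<in>I. indicator (A i) (R i x)) =
       complex_of_real (w x * indicator (Pi\<^sub>E I A) (\<lambda>i\<in>I. R i x))" for x
      by (auto simp: fin prod_eq_1_iff prod_zero_iff PiE_iff indicator_def)
    ultimately have 1: "(LINT x|M. w x * indicator (Pi\<^sub>E I A) (\<lambda>i\<in>I. R i x)) = 0"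
      by (simp del: of_real_mult)
    have Am: "Pi\<^sub>E I A \<in> sets (\<Pi>\<^sub>M i\<in>I. borel :: real measure)"
      using fin A by (intro sets_PiM_I_finite) auto
    note [measurable] = Am
    have ii: "integrable M (\<lambda>x. v s x * indicat_real (Pi\<^sub>E I A) (\<lambda>i\<in>I. R i x))" for s
      by (rule Bochner_Integration.integrable_bound[OF vi[of s]]) (auto simp: v0 split: split_indicator)
    have "measure (D s) (Pi\<^sub>E I A) = (LINT x|M. v s x * indicat_real (Pi\<^sub>E I A) (\<lambda>i\<in>I. R i x))" for s
    proof -
      have "measure (D s) (Pi\<^sub>E I A) = (\<integral>x. indicat_real (Pi\<^sub>E I A) x \<partial>D s)"
        using Am by (simp add: D_def)
      then show ?thesis by (subst (asm) int) auto
    qed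
    then have "measure (D 1) (Pi\<^sub>E I A) - measure (D (-1)) (Pi\<^sub>E I A) = (LINT x|M. w x * indicator (Pi\<^sub>E I A) (\<lambda>i\<in>I. R i x))"
      using ii by (simp add: diff left_diff_distrib)
    with 1 have "measure (D 1) (Pi\<^sub>E I A) = measure (D (-1)) (Pi\<^sub>E I A)" by simp
    then show "emeasure (D 1) (Pi\<^sub>E I A) = emeasure (D (-1)) (Pi\<^sub>E I A)"
      using fD by (simp add: finite_measure.emeasure_eq_measure)
  next
    show "range (\<lambda>n::nat. space (\<Pi>\<^sub>M i\<in>I. borel :: real measure)) \<subseteq> prod_algebra I (\<lambda>_. borel)"
      using fin by (auto simp: space_PiM intro!: prod_algebraI_finite)
    show "emeasure (D 1) (space (\<Pi>\<^sub>M i\<in>I. borel :: real measure)) \<noteq> \<infinity>"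
      using fD[of 1] by (simp add: finite_measure.emeasure_eq_measure)
  qed (auto simp: D_def)
  then have eq: "(\<integral>x. g x \<partial>D 1) = (\<integral>x. g x \<partial>D (-1))" by simp
  have ii: "integrable M (\<lambda>x. v s x *\<^sub>R g (\<lambda>i\<in>I. R i x))" for s
    by (rule Bochner_Integration.integrable_bound[of M "\<lambda>x. B * v s x"])
       (use vi v0 order_trans[OF bdd abs_ge_self] in \<open>auto simp: mult.commute[of B] abs_mult intro!: mult_left_mono\<close>)
  have "(LINT x|M. w x *\<^sub>R g (\<lambda>i\<in>I. R i x)) = (LINT x|M. v 1 x *\<^sub>R g (\<lambda>i\<in>I. R i x) - v (-1) x *\<^sub>R g (\<lambda>i\<in>I. R i x))"
    by (intro Bochner_Integration.integral_cong) (auto simp: diff scaleR_left_diff_distrib)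
  also have "\<dots> = 0" using ii eq by (simp add: int)
  finally show ?thesis .
qed

text \<open>A finite sum of integrals over \<open>M\<close> is one integral over a product with a counting measure.\<close>

lemma integral_count_space_pair:
  fixes f :: "'k \<Rightarrow> 'a \<Rightarrow> 'b::{banach, second_countable_topology}"
  assumes K: "finite K" and M: "sigma_finite_measure M"
    and f: "\<And>k. k \<in> K \<Longrightarrow> integrable M (f k)"
  shows "integrable (count_space K \<Otimes>\<^sub>M M) (\<lambda>(k, x). f k x)"
    and "(LINT p|(count_space K \<Otimes>\<^sub>M M). (case p of (k, x) \<Rightarrow> f k x)) = (\<Sum>k\<in>K. LINT x|M. f k x)"
proof -
  interpret pair_sigma_finite "count_space K" M
    using K M by (intro pair_sigma_finite.intro sigma_finite_measure_count_space_finite)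
  have [measurable]: "f k \<in> borel_measurable M" if "k \<in> K" for k using f[OF that] by simp
  have m: "(\<lambda>(k, x). f k x) \<in> borel_measurable (count_space K \<Otimes>\<^sub>M M)"
    by (rule measurable_pair_measure_countable1) (use K in \<open>auto simp: countable_finite\<close>)
  show i: "integrable (count_space K \<Otimes>\<^sub>M M) (\<lambda>(k, x). f k x)"
    by (rule Fubini_integrable[OF m]) (use K f in \<open>auto simp: AE_count_space integrable_count_space\<close>)
  show "(LINT p|(count_space K \<Otimes>\<^sub>M M). (case p of (k, x) \<Rightarrow> f k x)) = (\<Sum>k\<in>K. LINT x|M. f k x)"
    using integral_fst'[OF i] K by (simp add: lebesgue_integral_count_space_finite)
qed

text \<open>Finitely many weighted laws can be compared in one step, because \<open>fourier_uniqueness_single\<close> applies on the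
  product of \<open>M\<close> with the index set.\<close>

lemma fourier_uniqueness:
  fixes w :: "'k \<Rightarrow> 'a \<Rightarrow> real" and R :: "'k \<Rightarrow> 'i \<Rightarrow> 'a \<Rightarrow> real"
  assumes K: "finite K" and I: "finite I" and M: "sigma_finite_measure M"
    and w: "\<And>k. k \<in> K \<Longrightarrow> integrable M (w k)"
    and R: "\<And>k i. k \<in> K \<Longrightarrow> i \<in> I \<Longrightarrow> R k i \<in> borel_measurable M"
    and zero: "\<And>\<xi>. (\<Sum>k\<in>K. CLINT x|M. complex_of_real (w k x) * iexp (\<Sum>i\<in>I. \<xi> i * R k i x)) = 0"
    and g[measurable]: "g \<in> borel_measurable (\<Pi>\<^sub>M i\<in>I. borel)" and bdd: "\<And>y. \<bar>g y\<bar> \<le> B"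
  shows "(\<Sum>k\<in>K. LINT x|M. w k x * g (\<lambda>i\<in>I. R k i x)) = 0"
proof -
  note [measurable] = R
  have [measurable]: "w k \<in> borel_measurable M" if "k \<in> K" for k using w[OF that] by simp
  let ?P = "count_space K \<Otimes>\<^sub>M M"
  have "(LINT p|?P. (case p of (k, x) \<Rightarrow> w k x) *\<^sub>R g (\<lambda>i\<in>I. (case p of (k, x) \<Rightarrow> R k i x))) = 0"
  proof (rule fourier_uniqueness_single[OF I])
    show "integrable ?P (\<lambda>(k, x). w k x)"
      by (rule integral_count_space_pair(1)[OF K M w])
    show "(\<lambda>p. case p of (k, x) \<Rightarrow> R k i x) \<in> borel_measurable ?P" if "i \<in> I" for i
      by (rule measurable_pair_measure_countable1) (use K that in \<open>auto simp: countable_finite\<close>)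
    fix \<xi> :: "'i \<Rightarrow> real"
    have "(CLINT p|?P. complex_of_real (case p of (k, x) \<Rightarrow> w k x) * iexp (\<Sum>i\<in>I. \<xi> i * (case p of (k, x) \<Rightarrow> R k i x)))
      = (CLINT p|?P. (case p of (k, x) \<Rightarrow> complex_of_real (w k x) * iexp (\<Sum>i\<in>I. \<xi> i * R k i x)))"
      by (intro Bochner_Integration.integral_cong) auto
    also have "\<dots> = (\<Sum>k\<in>K. CLINT x|M. complex_of_real (w k x) * iexp (\<Sum>i\<in>I. \<xi> i * R k i x))"
    proof (rule integral_count_space_pair(2)[OF K M])
      fix k assume k: "k \<in> K"
      note [measurable] = R[OF k]
      show "integrable M (\<lambda>x. complex_of_real (w k x) * iexp (\<Sum>i\<in>I. \<xi> i * R k i x))"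
        by (rule Bochner_Integration.integrable_bound[OF w[OF k]]) (use k in \<open>auto simp: norm_mult\<close>)
    qed
    finally show "(CLINT p|?P. complex_of_real (case p of (k, x) \<Rightarrow> w k x) * iexp (\<Sum>i\<in>I. \<xi> i * (case p of (k, x) \<Rightarrow> R k i x))) = 0"
      using zero by simp
  qed (use g bdd in auto)
  moreover have "(LINT p|?P. (case p of (k, x) \<Rightarrow> w k x) *\<^sub>R g (\<lambda>i\<in>I. (case p of (k, x) \<Rightarrow> R k i x)))
     = (LINT p|?P. (case p of (k, x) \<Rightarrow> w k x * g (\<lambda>i\<in>I. R k i x)))"
    by (intro Bochner_Integration.integral_cong) auto
  moreover have "\<dots> = (\<Sum>k\<in>K. LINT x|M. w k x * g (\<lambda>i\<in>I. R k i x))"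
  proof (rule integral_count_space_pair(2)[OF K M])
    fix k assume k: "k \<in> K"
    have [measurable]: "(\<lambda>x. \<lambda>i\<in>I. R k i x) \<in> measurable M (\<Pi>\<^sub>M i\<in>I. borel)"
      by (rule measurable_restrict) (rule R[OF k])
    show "integrable M (\<lambda>x. w k x * g (\<lambda>i\<in>I. R k i x))"
      by (rule Bochner_Integration.integrable_bound[of M "\<lambda>x. B * w k x"])
         (use w k order_trans[OF bdd abs_ge_self] in \<open>auto simp: mult.commute[of B] abs_mult intro!: mult_left_mono\<close>)
  qed
  ultimately show ?thesis by simp
qed

section \<open>Centered Gaussian variables\<close>

lemma iexp_has_vector_derivative:
  "((\<lambda>x. iexp (t * x)) has_vector_derivative (\<i> * t * iexp (t * x))) (at x)"
proof -
  have "((\<lambda>z. exp (\<i> * (t * z))) has_field_derivative (\<i> * t * iexp (t * x))) (at (complex_of_real x))"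
    by (auto intro!: derivative_eq_intros)
  from has_vector_derivative_real_field[OF this] show ?thesis by simp
qed

lemma std_gauss_stein_iexp:
  "(CLINT x|std_gauss. x * iexp (t * x)) = \<i> * t * (CLINT x|std_gauss. iexp (t * x))"
proof -
  have "(CLINT x|std_gauss. x *\<^sub>R iexp (t * x)) = (CLINT x|std_gauss. \<i> * t * iexp (t * x))"
  proof (rule std_gauss_integration_by_parts[where C="1 + \<bar>t\<bar>" and k=0])
    show "((\<lambda>x. iexp (t * x)) has_vector_derivative (\<i> * t * iexp (t * x))) (at x)" for x
      by (rule iexp_has_vector_derivative)
  qed (auto simp: norm_mult intro!: continuous_intros)
  then show ?thesis by (simp add: scaleR_conv_of_real)
qed

text \<open>This treats the constant variables (with \<open>\<sigma> = 0\<close>) and the variables with a normal density alike.\<close>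

lemma (in prob_space) centered_gaussian_distr:
  assumes g: "gaussian_rv M S" and mean: "(LINT w|M. S w) = 0"
  obtains \<sigma> where "0 \<le> \<sigma>" "distr M borel S = distr std_gauss borel (\<lambda>x. \<sigma> * x)"
proof -
  have [measurable]: "S \<in> borel_measurable M" using g by (simp add: gaussian_rv_def)
  consider c where "AE w in M. S w = c" | \<mu> \<sigma> where "0 < \<sigma>" "distributed M lborel S (normal_density \<mu> \<sigma>)"
    using g unfolding gaussian_rv_def by blast
  then show ?thesis
  proof cases
    case 1
    have "(LINT w|M. S w) = (LINT w|M. c)" by (rule integral_cong_AE) (use 1 in auto)
    then have "c = 0" using mean by (simp add: prob_space)
    have "distr M borel S = distr M borel (\<lambda>_. 0)"
      by (rule distr_cong_AE) (use 1 \<open>c = 0\<close> in auto)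
    also have "\<dots> = distr std_gauss borel (\<lambda>x. 0 * x)"
      by (simp add: distr_const prob_space.distr_const[OF prob_space_std_gauss])
    finally show ?thesis using that[of 0] by simp
  next
    case 2
    have "\<mu> = 0" using normal_distributed_expectation[OF 2] mean by simp
    then have "distributed M lborel (\<lambda>x. S x / \<sigma>) std_normal_density"
      using normal_standard_normal_convert[OF 2(1), of S \<mu>] 2(2) by simp
    then have d: "distr M lborel (\<lambda>x. S x / \<sigma>) = std_gauss"
      by (simp add: distributed_def)
    have "distr std_gauss borel (\<lambda>x. \<sigma> * x) = distr M borel (\<lambda>x. \<sigma> * (S x / \<sigma>))"
      unfolding d[symmetric] by (subst distr_distr) (auto simp: comp_def)
    also have "\<dots> = distr M borel S" using 2(1) by simp
    finally show ?thesis using that[of \<sigma>] 2(1) by simp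
  qed
qed

context
  fixes M :: "'w measure" and S :: "'w \<Rightarrow> real" and \<sigma> :: real
  assumes S[measurable]: "S \<in> borel_measurable M"
    and law: "distr M borel S = distr std_gauss borel (\<lambda>x. \<sigma> * x)"
begin

lemma scaled_gauss_integral:
  fixes f :: "real \<Rightarrow> 'b::{banach, second_countable_topology}"
  assumes [measurable]: "f \<in> borel_measurable borel"
  shows "(LINT w|M. f (S w)) = (LINT x|std_gauss. f (\<sigma> * x))"
    and "integrable M (\<lambda>w. f (S w)) \<longleftrightarrow> integrable std_gauss (\<lambda>x. f (\<sigma> * x))"
proof -
  have "(LINT w|M. f (S w)) = (LINT y|distr M borel S. f y)" by (simp add: integral_distr)
  then show "(LINT w|M. f (S w)) = (LINT x|std_gauss. f (\<sigma> * x))"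
    unfolding law by (simp add: integral_distr)
  have "integrable M (\<lambda>w. f (S w)) \<longleftrightarrow> integrable (distr M borel S) f" by (simp add: integrable_distr_eq)
  then show "integrable M (\<lambda>w. f (S w)) \<longleftrightarrow> integrable std_gauss (\<lambda>x. f (\<sigma> * x))"
    unfolding law by (simp add: integrable_distr_eq)
qed

lemma scaled_gauss_all_moments: "all_moments M S"
  unfolding all_moments_def
proof (intro conjI allI S)
  show "integrable M (\<lambda>w. \<bar>S w\<bar> ^ p)" for p
    using all_moments_mult[OF all_moments_std_gauss, of \<sigma>]
    by (subst scaled_gauss_integral(2)) (auto simp: all_moments_def)
qed

lemma scaled_gauss_second_moment: "(LINT w|M. (S w)\<^sup>2) = \<sigma>\<^sup>2"
proof -
  have "(LINT w|M. (S w)\<^sup>2) = (LINT x|std_gauss. (\<sigma> * x)\<^sup>2)"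
    by (rule scaled_gauss_integral) simp
  then show ?thesis
    using std_normal_distribution_even_moments(1)[of 1] by (simp add: power_mult_distrib fact_numeral)
qed

lemma scaled_gauss_stein:
  "(CLINT w|M. S w * iexp (c * S w)) = \<i> * (c * \<sigma>\<^sup>2) * (CLINT w|M. iexp (c * S w))"
proof -
  have "(CLINT w|M. S w * iexp (c * S w)) = (CLINT x|std_gauss. (\<sigma> * x) * iexp (c * (\<sigma> * x)))"
    by (subst scaled_gauss_integral(1)[of "\<lambda>y. complex_of_real y * iexp (c * y)"]) auto
  also have "\<dots> = (CLINT x|std_gauss. \<sigma> * (x * iexp ((c * \<sigma>) * x)))"
    by (intro Bochner_Integration.integral_cong) (auto simp: mult_ac)
  also have "\<dots> = \<sigma> * (\<i> * (c * \<sigma>) * (CLINT x|std_gauss. iexp ((c * \<sigma>) * x)))"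
    using std_gauss_stein_iexp[of "c * \<sigma>"] by simp
  also have "(CLINT x|std_gauss. iexp ((c * \<sigma>) * x)) = (CLINT w|M. iexp (c * S w))"
    by (subst scaled_gauss_integral(1)[of "\<lambda>y. iexp (c * y)"]) (auto simp: mult_ac)
  finally show ?thesis by (simp add: power2_eq_square mult_ac)
qed

lemma scaled_gauss_exp_integrable: "integrable M (\<lambda>w. exp (a * \<bar>S w\<bar>))"
proof -
  have e: "integrable std_gauss (\<lambda>x. exp (b * x))" for b
  proof -
    have "std_normal_density x * exp (b * x) = exp (b\<^sup>2 / 2) * normal_density b 1 x" for x
      unfolding normal_density_def
      by (simp add: exp_add[symmetric] field_simps power2_eq_square)
    then have "integrable lborel (\<lambda>x. std_normal_density x * exp (b * x))" by simp
    then show ?thesis by (simp add: integrable_density)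
  qed
  have "integrable std_gauss (\<lambda>x. exp (\<bar>a * \<sigma>\<bar> * x) + exp (-\<bar>a * \<sigma>\<bar> * x))"
    using e[of "\<bar>a * \<sigma>\<bar>"] e[of "-\<bar>a * \<sigma>\<bar>"] by simp
  then have "integrable std_gauss (\<lambda>x. exp (a * \<bar>\<sigma> * x\<bar>))"
  proof (rule Bochner_Integration.integrable_bound)
    show "AE x in std_gauss. norm (exp (a * \<bar>\<sigma> * x\<bar>)) \<le> norm (exp (\<bar>a * \<sigma>\<bar> * x) + exp (-\<bar>a * \<sigma>\<bar> * x))"
    proof (rule AE_I2)
      fix x :: real
      have "a * \<bar>\<sigma> * x\<bar> \<le> \<bar>a * \<sigma>\<bar> * \<bar>x\<bar>" by (simp add: abs_mult mult.assoc mult_right_mono)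
      then have "exp (a * \<bar>\<sigma> * x\<bar>) \<le> exp (\<bar>a * \<sigma>\<bar> * \<bar>x\<bar>)" by simp
      also have "\<dots> \<le> exp (\<bar>a * \<sigma>\<bar> * x) + exp (-\<bar>a * \<sigma>\<bar> * x)"
        by (cases "x \<ge> 0") (auto simp: abs_of_nonneg abs_of_neg add_increasing add_increasing2)
      finally show "norm (exp (a * \<bar>\<sigma> * x\<bar>)) \<le> norm (exp (\<bar>a * \<sigma>\<bar> * x) + exp (-\<bar>a * \<sigma>\<bar> * x))"
        by (simp add: add_nonneg_nonneg)
    qed
  qed simp
  then show ?thesis
    by (subst scaled_gauss_integral(2)[of "\<lambda>y. exp (a * \<bar>y\<bar>)"]) auto
qed

end

section \<open>Hermite polynomials\<close>

text \<open>The polynomials whose values are given by the function \<open>hermite\<close>; as objects of type \<open>poly\<close> they can be differentiated and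
  compared by coefficients.\<close>

fun hermite_poly :: "nat \<Rightarrow> real poly" where
  "hermite_poly 0 = 1"
| "hermite_poly (Suc 0) = [:0, 1:]"
| "hermite_poly (Suc (Suc n)) = pCons 0 (hermite_poly (Suc n)) - smult (real (Suc n)) (hermite_poly n)"

lemma poly_hermite_poly: "poly (hermite_poly n) x = hermite n x"
  by (induction n rule: hermite_poly.induct) auto

lemma hermite_poly_rec:
  "hermite_poly (Suc n) = pCons 0 (hermite_poly n) - smult (real n) (hermite_poly (n - 1))"
  by (cases n) (auto simp: one_pCons)

lemma pderiv_hermite_poly: "pderiv (hermite_poly n) = smult (real n) (hermite_poly (n - 1))"
proof (induction n rule: hermite_poly.induct)
  case (3 n)
  have "pderiv (hermite_poly (Suc (Suc n))) =
     hermite_poly (Suc n) + smult (real (Suc n)) (pCons 0 (hermite_poly n)) - smult (real (Suc n)) (smult (real n) (hermite_poly (n - 1)))"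
    using 3 by (simp add: pderiv_diff pderiv_smult pderiv_pCons del: of_nat_Suc)
  also have "\<dots> = hermite_poly (Suc n) + smult (real (Suc n)) (hermite_poly (Suc n))"
    by (simp add: hermite_poly_rec[of n] smult_diff_right del: of_nat_Suc)
  also have "\<dots> = smult (real (Suc (Suc n))) (hermite_poly (Suc n))"
    by (metis (no_types, opaque_lifting) add.commute of_nat_Suc smult_1_left smult_add_left)
  finally show ?case by simp
qed (auto simp: pderiv_pCons one_pCons)

text \<open>The leading coefficient is one, so the Hermite polynomials span all polynomials.\<close>

lemma coeff_hermite_poly: "coeff (hermite_poly n) n = 1" "n < k \<Longrightarrow> coeff (hermite_poly n) k = 0"
proof (induction n arbitrary: k rule: hermite_poly.induct)
  case 1 { case 1 then show ?case by simp next case 2 then show ?case by (simp add: one_pCons coeff_pCons split: nat.split) }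
next
  case 2 { case 1 then show ?case by simp next case 2 then show ?case by (simp add: coeff_pCons split: nat.split) }
next
  case (3 n)
  { case 1 show ?case using 3(1) 3(4)[of "Suc (Suc n)"] by (simp add: coeff_pCons) 
  next case 2 then show ?case using 3(2)[of "k - 1"] 3(4)[of k] by (cases k) (auto simp: coeff_pCons) }
qed

lemma poly_poly_growth: "\<exists>C k. \<forall>x::real. \<bar>poly p x\<bar> \<le> C * (1 + \<bar>x\<bar>) ^ k"
proof (induction p)
  case 0
  show ?case by (intro exI[of _ 0]) simp
next
  case (pCons a p)
  then obtain C k where Ck: "\<And>x. \<bar>poly p x\<bar> \<le> C * (1 + \<bar>x\<bar>) ^ k" by blast
  show ?case
  proof (intro exI allI)
    fix x
    have "\<bar>poly (pCons a p) x\<bar> \<le> \<bar>a\<bar> + \<bar>x\<bar> * \<bar>poly p x\<bar>" by (simp add: abs_mult[symmetric] abs_triangle_ineq)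
    also have "\<dots> \<le> \<bar>a\<bar> * (1 + \<bar>x\<bar>) ^ Suc k + (1 + \<bar>x\<bar>) * (C * (1 + \<bar>x\<bar>) ^ k)"
      using Ck[of x] by (intro add_mono mult_mono) (auto intro: mult_le_cancel_left1[THEN iffD2] simp del: power_Suc)
    also have "\<dots> = (\<bar>a\<bar> + C) * (1 + \<bar>x\<bar>) ^ Suc k" by (simp add: algebra_simps)
    finally show "\<bar>poly (pCons a p) x\<bar> \<le> (\<bar>a\<bar> + C) * (1 + \<bar>x\<bar>) ^ Suc k" .
  qed
qed

text \<open>The recursion reads \<open>H\<^sub>n\<^sub>+\<^sub>1 = x H\<^sub>n - H\<^sub>n'\<close>, whose mean vanishes by Gaussian integration by parts.\<close>

lemma std_gauss_hermite_mean: "(LINT x|std_gauss. hermite n x) = (if n = 0 then 1 else 0)"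
proof (cases n)
  case 0
  then show ?thesis using std_gauss.prob_space by simp
next
  case (Suc m)
  let ?p = "hermite_poly m"
  obtain C1 k1 where 1: "\<And>x. \<bar>poly ?p x\<bar> \<le> C1 * (1 + \<bar>x\<bar>) ^ k1" using poly_poly_growth by blast
  obtain C2 k2 where 2: "\<And>x. \<bar>poly (pderiv ?p) x\<bar> \<le> C2 * (1 + \<bar>x\<bar>) ^ k2" using poly_poly_growth by blast
  have mono: "C * (1 + \<bar>x\<bar>) ^ k \<le> (\<bar>C1\<bar> + \<bar>C2\<bar>) * (1 + \<bar>x\<bar>) ^ (k1 + k2)" if "C \<in> {C1, C2}" "k \<in> {k1, k2}" for C k and x :: real
    using that by (intro mult_mono power_increasing) auto
  have ibp: "(LINT x|std_gauss. x *\<^sub>R poly ?p x) = (LINT x|std_gauss. poly (pderiv ?p) x)"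
  proof (rule std_gauss_integration_by_parts)
    show "(poly ?p has_vector_derivative poly (pderiv ?p) x) (at x)" for x
      using poly_DERIV[of ?p x] by (simp only: has_real_derivative_iff_has_vector_derivative)
    show "norm (poly ?p x) \<le> (\<bar>C1\<bar> + \<bar>C2\<bar>) * (1 + \<bar>x\<bar>) ^ (k1 + k2)" for x
      using order_trans[OF 1[of x] mono] by simp
    show "norm (poly (pderiv ?p) x) \<le> (\<bar>C1\<bar> + \<bar>C2\<bar>) * (1 + \<bar>x\<bar>) ^ (k1 + k2)" for x
      using order_trans[OF 2[of x] mono] by simp
  qed (intro continuous_intros)
  have i: "integrable std_gauss (\<lambda>x. x * poly q x)" "integrable std_gauss (\<lambda>x. poly q x)" for q
    by (intro all_moments_integrable all_moments_times std_gauss.all_moments_poly all_moments_std_gauss)+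
  have "(LINT x|std_gauss. hermite n x) = (LINT x|std_gauss. x * poly ?p x - poly (pderiv ?p) x)"
    unfolding Suc poly_hermite_poly[symmetric] hermite_poly_rec[of m] pderiv_hermite_poly
    by simp
  also have "\<dots> = 0" using ibp i by simp
  finally show ?thesis using Suc by simp
qed

section \<open>Malliavin derivatives of Hermite polynomials\<close>

text \<open>The projection of \<open>h\<close> onto the span of \<open>B\<close> is not longer than \<open>h\<close>.\<close>

lemma Bessel_inequality_finite:
  fixes B :: "'h::real_inner set"
  assumes B: "finite B" and orth: "pairwise orthogonal B" and unit: "\<forall>b\<in>B. norm b = 1"
  shows "(\<Sum>b\<in>B. (inner h b)\<^sup>2) \<le> (norm h)\<^sup>2"
proof -
  define p where "p = (\<Sum>b\<in>B. inner h b *\<^sub>R b)"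
  have hp: "inner h p = (\<Sum>b\<in>B. (inner h b)\<^sup>2)"
    by (simp add: p_def inner_sum_right power2_eq_square)
  have "inner p b = inner h b" if "b \<in> B" for b
  proof -
    have "inner p b = (\<Sum>b'\<in>B. inner h b' * inner b' b)" by (simp add: p_def inner_sum_left)
    also have "\<dots> = (\<Sum>b'\<in>B. if b' = b then inner h b else 0)"
    proof (rule sum.cong)
      fix b' assume "b' \<in> B"
      show "inner h b' * inner b' b = (if b' = b then inner h b else 0)"
      proof (cases "b' = b")
        case True
        then show ?thesis using unit that by (simp add: dot_square_norm)
      next
        case False
        then show ?thesis using pairwiseD[OF orth \<open>b' \<in> B\<close> that] by (simp add: orthogonal_def)
      qed
    qed simp
    finally show ?thesis using B that by simp
  qed
  then have pp: "inner p p = (\<Sum>b\<in>B. (inner h b)\<^sup>2)"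
    by (subst (2) p_def) (simp add: inner_sum_right power2_eq_square)
  have "0 \<le> inner (h - p) (h - p)" by simp
  also have "\<dots> = (norm h)\<^sup>2 - (\<Sum>b\<in>B. (inner h b)\<^sup>2)"
    using hp pp by (simp add: inner_diff inner_commute[of p h] power2_norm_eq_inner)
  finally show ?thesis by simp
qed

lemma tensor_norm2_zero: "tensor_norm2 q (\<lambda>x. 0) = 0"
  unfolding tensor_norm2_def by (auto intro!: antisym SUP_least)

text \<open>The sum over all tuples factorizes into a power of \<open>\<Sum>\<^sub>b \<langle>h, b\<rangle>\<^sup>2\<close>, to which Bessel's inequality applies.\<close>

lemma tensor_norm2_pure_tensor:
  fixes h :: "'h::real_inner"
  assumes h: "norm h = 1"
  shows "tensor_norm2 q (\<lambda>x. \<Prod>i<q. inner h (x i)) \<le> 1"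
  unfolding tensor_norm2_def
proof (rule SUP_least, clarify)
  fix B :: "'h set" assume B: "finite B" "pairwise orthogonal B" "\<forall>b\<in>B. norm b = 1"
  have "(\<Sum>x\<in>PiE {..<q} (\<lambda>_. B). ennreal ((\<Prod>i<q. inner h (x i))\<^sup>2)) =
     ennreal (\<Sum>x\<in>PiE {..<q} (\<lambda>_. B). \<Prod>i<q. (inner h (x i))\<^sup>2)"
    by (subst sum_ennreal) (simp_all add: prod_power_distrib prod_nonneg)
  also have "(\<Sum>x\<in>PiE {..<q} (\<lambda>_. B). \<Prod>i<q. (inner h (x i))\<^sup>2) = (\<Prod>i<q. \<Sum>b\<in>B. (inner h b)\<^sup>2)"
    using B(1) by (subst prod_sum_PiE) auto
  also have "ennreal \<dots> \<le> ennreal 1"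
    using Bessel_inequality_finite[OF B, of h] h
    by (intro ennreal_leI) (simp add: power_le_one sum_nonneg)
  finally show "(\<Sum>x\<in>PiE {..<q} (\<lambda>_. B). ennreal ((\<Prod>i<q. inner h (x i))\<^sup>2)) \<le> 1" by simp
qed

lemma zero_sym_tensor_power: "(\<lambda>x. 0) \<in> sym_tensor_power q"
  by (simp add: sym_tensor_power_def tensor_power_def tensor_norm2_zero)

lemma pure_tensor_sym_tensor_power:
  fixes h :: "'h::real_inner"
  assumes h: "norm h = 1"
  shows "(\<lambda>x. \<Prod>i<q. inner h (x i)) \<in> sym_tensor_power q"
  unfolding sym_tensor_power_def tensor_power_def
proof (safe)
  fix x y :: "nat \<Rightarrow> 'h" assume "\<forall>i<q. x i = y i"
  then show "(\<Prod>i<q. inner h (x i)) = (\<Prod>i<q. inner h (y i))" by simp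
next
  fix x :: "nat \<Rightarrow> 'h" and i assume i: "i < q"
  have "(\<Prod>j<q. inner h ((x(i := g)) j)) = inner h g * (\<Prod>j\<in>{..<q} - {i}. inner h (x j))" for g
    using i by (subst prod.remove[of _ i]) auto
  then show "bounded_linear (\<lambda>g. \<Prod>j<q. inner h ((x(i := g)) j))"
    by (simp add: bounded_linear_mult_const bounded_linear_inner_right del: fun_upd_apply)
next
  show "tensor_norm2 q (\<lambda>x. \<Prod>i<q. inner h (x i)) < \<infinity>"
    using le_less_trans[OF tensor_norm2_pure_tensor[OF h]] by simp
next
  fix \<pi> and x :: "nat \<Rightarrow> 'h" assume "\<pi> permutes {..<q}"
  then show "(\<Prod>i<q. inner h (x (\<pi> i))) = (\<Prod>i<q. inner h (x i))"
    using prod.permute[of \<pi> "{..<q}" "\<lambda>i. inner h (x i)"] by (simp add: comp_def)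
qed

lemma iter_partial_deriv_poly:
  assumes "set is \<subseteq> {..<Suc 0}"
  shows "iter_partial_deriv is (\<lambda>x. poly p (x 0)) = (\<lambda>x. poly ((pderiv ^^ length is) p) (x 0))"
  using assms
proof (induction "is")
  case (Cons i "is")
  then have "i = 0" by auto
  with Cons show ?case by (simp add: partial_deriv_def fun_eq_iff DERIV_imp_deriv[OF poly_DERIV])
qed simp

lemma smooth_poly_growth_poly: "smooth_poly_growth (Suc 0) (\<lambda>x. poly p (x 0))"
  unfolding smooth_poly_growth_def
proof (intro conjI allI impI)
  fix "is" assume "is": "set is \<subseteq> {..<Suc 0}"
  let ?r = "(pderiv ^^ length is) p"
  show "continuous_on UNIV (iter_partial_deriv is (\<lambda>x. poly p (x 0)))"
    unfolding iter_partial_deriv_poly[OF "is"]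
    by (intro continuous_intros continuous_on_product_coordinates)
  show "(\<lambda>t. iter_partial_deriv is (\<lambda>x. poly p (x 0)) (x(i := t))) differentiable (at (x i))" if "i < Suc 0" for i x
    unfolding iter_partial_deriv_poly[OF "is"] using that by (simp add: poly_differentiable)
  obtain C k where "\<And>x. \<bar>poly ?r x\<bar> \<le> C * (1 + \<bar>x\<bar>) ^ k" using poly_poly_growth by blast
  then show "\<exists>C k. \<forall>x. \<bar>iter_partial_deriv is (\<lambda>x. poly p (x 0)) x\<bar> \<le> C * (1 + (\<Sum>i<Suc 0. \<bar>x i\<bar>)) ^ k"
    unfolding iter_partial_deriv_poly[OF "is"] by auto
qed auto

context isonormal_process
begin

lemma X_gaussian: "gaussian_rv M (X h)"
  using gaussian[unfolded centered_gaussian_family_def, THEN conjunct1, rule_format, of "{h}" "\<lambda>_. 1"]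
  by simp

lemma X_mean: "(LINT w|M. X h w) = 0"
  by (rule gaussian[unfolded centered_gaussian_family_def, THEN conjunct2, rule_format])

lemma X_measurable[measurable]: "X h \<in> borel_measurable M"
  using X_gaussian by (simp add: gaussian_rv_def)

lemma X_law: "distr M borel (X h) = distr std_gauss borel (\<lambda>x. norm h * x)"
proof -
  obtain \<sigma> where s: "0 \<le> \<sigma>" "distr M borel (X h) = distr std_gauss borel (\<lambda>x. \<sigma> * x)"
    using centered_gaussian_distr[OF X_gaussian X_mean] by blast
  have "\<sigma>\<^sup>2 = (norm h)\<^sup>2"
    using scaled_gauss_second_moment[OF X_measurable s(2)] covariance[of h h]
    by (simp add: power2_eq_square[of "X _ _"] power2_norm_eq_inner)
  then have "\<sigma> = norm h" using s(1) by (simp add: power2_eq_iff_nonneg)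
  with s show ?thesis by simp
qed

lemma X_all_moments: "all_moments M (X h)"
  by (rule scaled_gauss_all_moments[OF X_measurable X_law])

lemma L2_all_moments: "all_moments M f \<Longrightarrow> f \<in> L2 M"
  by (auto simp: L2_def all_moments_square_integrable) (simp add: all_moments_def)

text \<open>The variable \<open>H\<^sub>q(X(h))\<close> is its own chaos expansion, concentrated in order \<open>q\<close>, and it is cylindrical, so
  all approximating sequences can be taken constant. These variables and the constant \<open>1\<close> are the only elements of the Sobolev
  space that have to be exhibited; everything else is reached through Fourier transforms.\<close>

lemma malliavin_derivative_hermite:
  assumes h: "norm h = 1"
  shows "malliavin_derivative M X (\<lambda>w. hermite q (X h w)) (\<lambda>w. (real q * hermite (q - 1) (X h w)) *\<^sub>R h)"
proof -
  let ?F = "\<lambda>w. hermite q (X h w)" and ?U = "\<lambda>w. (real q * hermite (q - 1) (X h w)) *\<^sub>R h"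
  have mom: "all_moments M (\<lambda>w. hermite k (X h w))" for k
    unfolding poly_hermite_poly[symmetric] by (rule all_moments_poly[OF X_all_moments])
  then have FL: "?F \<in> L2 M" by (rule L2_all_moments)
  have [measurable]: "(\<lambda>w. hermite k (X h w)) \<in> borel_measurable M" for k
    using mom by (simp add: all_moments_def)
  have [measurable]: "hermite k \<in> borel_measurable borel" for k
    unfolding poly_hermite_poly[abs_def, symmetric] by (intro borel_measurable_continuous_onI continuous_intros)
  have UL: "?U \<in> L2 M"
    unfolding L2_def
  proof (intro CollectI conjI)
    show "?U \<in> borel_measurable M" by measurable
    show "integrable M (\<lambda>w. (norm (?U w))\<^sup>2)"
      using all_moments_square_integrable[OF all_moments_mult[OF mom, of "real q" "q - 1"]] by (simp add: h)
  qed
  have mean: "(LINT v|M. ?F v) = (if q = 0 then 1 else 0)"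
    by (subst scaled_gauss_integral(1)[OF X_measurable X_law]) (simp_all add: h std_gauss_hermite_mean)
  define f where "f q' = (if q' = q \<and> 1 \<le> q then (\<lambda>x. \<Prod>i<q. inner h (x i)) else (\<lambda>x. 0))" for q' :: nat
  define J where "J q' = (if q' = q \<and> 1 \<le> q then ?F else (\<lambda>w. 0))" for q' :: nat
  have zL: "(\<lambda>w. 0::real) \<in> L2 M" by (simp add: L2_def)
  have JL: "J q' \<in> L2 M" for q' using FL zL by (simp add: J_def)
  have wi: "wiener_ito_integral M X q' (f q') (J q')" for q'
    unfolding wiener_ito_integral_def
  proof (intro conjI exI[of _ "\<lambda>_. f q'"] exI[of _ "\<lambda>_. J q'"] allI)
    show "f q' \<in> sym_tensor_power q'"
      by (auto simp: f_def zero_sym_tensor_power pure_tensor_sym_tensor_power[OF h])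
    show "elementary_integral X q' (f q') (J q')"
    proof (cases "q' = q \<and> 1 \<le> q")
      case True
      then show ?thesis unfolding elementary_integral_def f_def J_def
        by (intro exI[of _ "1::nat"] exI[of _ "\<lambda>_. 1"] exI[of _ "\<lambda>_. h"]) (auto simp: h)
    next
      case False
      then have "f q' = (\<lambda>x. 0)" "J q' = (\<lambda>w. 0)" unfolding f_def J_def by auto
      then show ?thesis unfolding elementary_integral_def
        by (intro exI[of _ "0::nat"]) auto
    qed
    show "L2_tendsto M (\<lambda>_. J q') (J q')" using JL by (simp add: L2_tendsto_def)
  qed (simp add: tensor_norm2_zero)
  have partial: "(LINT v|M. ?F v) + (\<Sum>q'=1..Q. J q' w) = (if q \<le> Q then ?F w else 0)" for Q w
  proof (cases "q = 0")
    case True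
    then show ?thesis using mean by (simp add: J_def)
  next
    case False
    then have "(\<Sum>q'=1..Q. J q' w) = (\<Sum>q'\<in>{1..Q}. if q' = q then ?F w else 0)"
      by (intro sum.cong) (auto simp: J_def)
    then show ?thesis using mean False by (simp add: Suc_le_eq)
  qed
  have "L2_tendsto M (\<lambda>Q w. (LINT v|M. ?F v) + (\<Sum>q'=1..Q. J q' w)) ?F"
    unfolding L2_tendsto_def partial
  proof (intro conjI allI FL)
    show "(\<lambda>w. if q \<le> Q then ?F w else 0) \<in> L2 M" for Q using FL zL by (cases "q \<le> Q") simp_all
    show "(\<lambda>Q. LINT w|M. (norm ((if q \<le> Q then ?F w else 0) - ?F w))\<^sup>2) \<longlonglongrightarrow> 0"
      by (rule tendsto_eventually) (auto simp: eventually_sequentially intro!: exI[of _ q])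
  qed
  then have ce: "chaos_expansion M X ?F f"
    unfolding chaos_expansion_def using wi by blast
  have "(\<Sum>q'. ennreal (real q' * fact q') * tensor_norm2 q' (f q')) = (\<Sum>q'\<in>{q}. ennreal (real q' * fact q') * tensor_norm2 q' (f q'))"
    by (rule suminf_finite) (auto simp: f_def tensor_norm2_zero)
  also have "\<dots> < \<infinity>"
    using le_less_trans[OF tensor_norm2_pure_tensor[OF h, of q], of \<infinity>]
    by (auto simp: f_def tensor_norm2_zero ennreal_mult_less_top)
  finally have D: "?F \<in> D12 M X"
    unfolding D12_def using FL ce by blast
  have cyl: "cylindrical_derivative X ?F ?U"
    unfolding cylindrical_derivative_def
  proof (intro exI conjI)
    show "smooth_poly_growth (Suc 0) (\<lambda>x. poly (hermite_poly q) (x 0))"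
      by (rule smooth_poly_growth_poly)
    show "?F = (\<lambda>w. poly (hermite_poly q) (X h w))"
      by (simp only: poly_hermite_poly)
    have "partial_deriv 0 (\<lambda>x. poly (hermite_poly q) (x 0)) x = real q * hermite (q - 1) (x 0)" for x :: "nat \<Rightarrow> real"
    proof -
      have "deriv (\<lambda>t. poly (hermite_poly q) t) (x 0) = poly (pderiv (hermite_poly q)) (x 0)"
        by (rule DERIV_imp_deriv[OF poly_DERIV])
      then show ?thesis
        by (simp only: partial_deriv_def fun_upd_same pderiv_hermite_poly poly_smult poly_hermite_poly)
    qed
    then show "?U = (\<lambda>w. \<Sum>i<Suc 0. partial_deriv i (\<lambda>x. poly (hermite_poly q) (x 0)) (\<lambda>i. X h w) *\<^sub>R h)"
      by simp
  qed
  show ?thesis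
    unfolding malliavin_derivative_def
    using D cyl FL UL
    by (intro conjI exI[of _ "\<lambda>_. ?F"] exI[of _ "\<lambda>_. ?U"]) (auto simp: L2_tendsto_def)
qed

lemma malliavin_derivative_one: "malliavin_derivative M X (\<lambda>w. 1) (\<lambda>w. 0)"
proof -
  let ?F = "\<lambda>w. 1::real"
  have FL: "?F \<in> L2 M" and zL: "(\<lambda>w. 0::real) \<in> L2 M" and UL: "(\<lambda>w. 0::'h) \<in> L2 M"
    by (simp_all add: L2_def)
  have el: "elementary_integral X q (\<lambda>x. 0) (\<lambda>w. 0)" for q
    unfolding elementary_integral_def by (intro exI[of _ "0::nat"]) simp
  have wi: "wiener_ito_integral M X q (\<lambda>x. 0) (\<lambda>w. 0)" for q
    unfolding wiener_ito_integral_def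
  proof (intro conjI zero_sym_tensor_power exI[of _ "\<lambda>_ _. 0"] allI el)
    show "(\<lambda>k. tensor_norm2 q (\<lambda>x. 0 - 0)) \<longlonglongrightarrow> 0" by (simp add: tensor_norm2_zero)
    show "L2_tendsto M (\<lambda>_ _. 0::real) (\<lambda>w. 0)" using zL by (simp add: L2_tendsto_def)
  qed
  then have "chaos_expansion M X ?F (\<lambda>_ _. 0)"
    unfolding chaos_expansion_def using FL
    by (intro exI[of _ "\<lambda>_ _. 0"]) (simp add: L2_tendsto_def prob_space)
  then have D: "?F \<in> D12 M X"
    unfolding D12_def using FL by (auto simp: tensor_norm2_zero intro!: exI[of _ "\<lambda>_ _. 0"])
  have "smooth_poly_growth 0 (\<lambda>x. 1)"
    unfolding smooth_poly_growth_def
  proof (intro conjI allI impI)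
    fix "is" :: "nat list" assume "set is \<subseteq> {..<0}"
    then have e: "is = []" by simp
    show "continuous_on UNIV (iter_partial_deriv is (\<lambda>x. 1))" by (simp add: e)
    show "\<exists>C k. \<forall>x. \<bar>iter_partial_deriv is (\<lambda>x. 1) x\<bar> \<le> C * (1 + (\<Sum>i<0. \<bar>x i\<bar>)) ^ k"
      by (intro exI[of _ "1::real"] exI[of _ "0::nat"]) (simp add: e)
  qed auto
  then have "cylindrical_derivative X ?F (\<lambda>w. 0)"
    unfolding cylindrical_derivative_def
    by (intro exI[of _ "0::nat"] exI[of _ "\<lambda>x. 1"]) simp
  then show ?thesis
    unfolding malliavin_derivative_def
    using D FL UL
    by (intro conjI exI[of _ "\<lambda>_. ?F"] exI[of _ "\<lambda>_ _. 0"]) (auto simp: L2_tendsto_def)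
qed

end

section \<open>Integrals over product spaces\<close>

context
  fixes M :: "'a measure" and N :: "'b measure"
  assumes M: "prob_space M" and N: "prob_space N"
begin

lemma pair_prob_fst:
  fixes f :: "'a \<Rightarrow> 'c::{banach, second_countable_topology}"
  assumes f: "integrable M f"
  shows "integrable (M \<Otimes>\<^sub>M N) (\<lambda>p. f (fst p))" "(LINT p|(M \<Otimes>\<^sub>M N). f (fst p)) = (LINT w|M. f w)"
proof -
  have d: "distr (M \<Otimes>\<^sub>M N) M fst = M" by (rule prob_space.distr_pair_fst[OF N])
  have [measurable]: "f \<in> borel_measurable M" using f by simp
  have "integrable (distr (M \<Otimes>\<^sub>M N) M fst) f" using f d by simp
  then show "integrable (M \<Otimes>\<^sub>M N) (\<lambda>p. f (fst p))" by (subst (asm) integrable_distr_eq) auto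
  have "(LINT w|M. f w) = (LINT w|distr (M \<Otimes>\<^sub>M N) M fst. f w)" by (simp add: d)
  then show "(LINT p|(M \<Otimes>\<^sub>M N). f (fst p)) = (LINT w|M. f w)" by (subst (asm) integral_distr) auto
qed

lemma pair_prob_snd:
  fixes f :: "'b \<Rightarrow> 'c::{banach, second_countable_topology}"
  assumes f: "integrable N f"
  shows "integrable (M \<Otimes>\<^sub>M N) (\<lambda>p. f (snd p))" "(LINT p|(M \<Otimes>\<^sub>M N). f (snd p)) = (LINT w|N. f w)"
proof -
  interpret M: prob_space M by (rule M)
  interpret N: prob_space N by (rule N)
  interpret pair_sigma_finite M N ..
  have [measurable]: "f \<in> borel_measurable N" using f by simp
  show i: "integrable (M \<Otimes>\<^sub>M N) (\<lambda>p. f (snd p))"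
    by (rule Fubini_integrable) (use f in auto)
  show "(LINT p|(M \<Otimes>\<^sub>M N). f (snd p)) = (LINT w|N. f w)"
    using integral_fst'[OF i] by (simp add: M.prob_space)
qed

lemma all_moments_fst: assumes "all_moments M f" shows "all_moments (M \<Otimes>\<^sub>M N) (\<lambda>p. f (fst p))"
proof -
  have [measurable]: "f \<in> borel_measurable M" using assms by (simp add: all_moments_def)
  show ?thesis using assms pair_prob_fst(1) unfolding all_moments_def by auto
qed

lemma all_moments_snd: assumes "all_moments N f" shows "all_moments (M \<Otimes>\<^sub>M N) (\<lambda>p. f (snd p))"
proof -
  have [measurable]: "f \<in> borel_measurable N" using assms by (simp add: all_moments_def)
  show ?thesis using assms pair_prob_snd(1) unfolding all_moments_def by auto
qed

end

lemma integrable_product_pair: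
  fixes f :: "'a \<Rightarrow> 'c::{real_normed_field, banach, second_countable_topology}" and g :: "'b \<Rightarrow> 'c"
  assumes M: "prob_space M" and N: "prob_space N" and f: "integrable M f" and g: "integrable N g"
  shows "integrable (M \<Otimes>\<^sub>M N) (\<lambda>p. f (fst p) * g (snd p))"
    and "(LINT p|(M \<Otimes>\<^sub>M N). f (fst p) * g (snd p)) = (LINT w|M. f w) * (LINT z|N. g z)"
proof -
  interpret M: prob_space M by (rule M)
  interpret N: prob_space N by (rule N)
  interpret pair_sigma_finite M N ..
  have [measurable]: "f \<in> borel_measurable M" "g \<in> borel_measurable N" using f g by auto
  show i: "integrable (M \<Otimes>\<^sub>M N) (\<lambda>p. f (fst p) * g (snd p))"
    by (rule Fubini_integrable) (use f g in \<open>auto simp: norm_mult\<close>)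
  show "(LINT p|(M \<Otimes>\<^sub>M N). f (fst p) * g (snd p)) = (LINT w|M. f w) * (LINT z|N. g z)"
    using integral_fst'[OF i] by simp
qed

section \<open>Integration by parts from a Fourier identity\<close>

abbreviation gauss_pi :: "'i set \<Rightarrow> ('i \<Rightarrow> real) measure" where
  "gauss_pi I \<equiv> \<Pi>\<^sub>M i\<in>I. std_gauss"

interpretation gauss_pi: product_prob_space "\<lambda>_. std_gauss" UNIV
  by unfold_locales

lemma prob_space_gauss_pi: "prob_space (gauss_pi I)"
  by (rule prob_space_PiM) (rule prob_space_std_gauss)

lemma sets_gauss_pi: "sets (gauss_pi I) = sets (\<Pi>\<^sub>M i\<in>I. borel)"
  by (rule sets_PiM_cong) simp_all

lemma gauss_pi_component:
  assumes "finite I" "i \<in> I"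
  shows "distr (gauss_pi I) borel (\<lambda>z. z i) = std_gauss"
proof -
  have "distr (gauss_pi I) std_gauss (\<lambda>z. z i) = std_gauss"
    by (rule distr_PiM_component) (use assms prob_space_std_gauss in auto)
  moreover have "distr (gauss_pi I) std_gauss (\<lambda>z. z i) = distr (gauss_pi I) borel (\<lambda>z. z i)"
    by (rule distr_cong) auto
  ultimately show ?thesis by simp
qed

lemma gauss_pi_all_moments:
  assumes "finite I" "i \<in> I"
  shows "all_moments (gauss_pi I) (\<lambda>z. z i)"
proof -
  have "(\<lambda>z. z i) \<in> borel_measurable (gauss_pi I)" using assms by measurable
  then show ?thesis
    using all_moments_std_gauss gauss_pi_component[OF assms]
      all_moments_distr[of "\<lambda>z. z i" "gauss_pi I" borel "\<lambda>x. x"] by simp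
qed

text \<open>Both sides are products over the coordinates, by independence; the coordinate \<open>i\<close> contributes the one-dimensional
  identity.\<close>

lemma gauss_pi_stein:
  fixes a :: "'i \<Rightarrow> real"
  assumes I: "finite I" "i \<in> I"
  shows "(CLINT z|gauss_pi I. z i * iexp (\<Sum>j\<in>I. a j * z j)) = \<i> * a i * (CLINT z|gauss_pi I. iexp (\<Sum>j\<in>I. a j * z j))"
proof -
  let ?e = "\<lambda>j x. iexp (a j * x)"
  have ie: "integrable std_gauss (?e j)" for j
    by (rule integrable_std_gauss_poly_growth[where C=1 and k=0]) auto
  have ixe: "integrable std_gauss (\<lambda>x. complex_of_real x * ?e j x)" for j
    by (rule integrable_std_gauss_poly_growth[where C=1 and k=1]) (auto simp: norm_mult)
  have prod_e: "iexp (\<Sum>j\<in>J. a j * z j) = (\<Prod>j\<in>J. ?e j (z j))" if "finite J" for J and z :: "'i \<Rightarrow> real"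
    by (simp add: sum_distrib_left exp_sum[OF that])
  let ?f = "\<lambda>j x. (if j = i then complex_of_real x else 1) * ?e j x"
  have ife: "integrable std_gauss (?f j)" for j
    by (cases "j = i") (use ie[of j] ixe[of j] in auto)
  have split: "(\<Prod>j\<in>I. ?f j (z j)) = z i * (\<Prod>j\<in>I. ?e j (z j))" for z
  proof -
    have "(\<Prod>j\<in>I. (if j = i then complex_of_real (z j) else 1)) = z i"
      using I by (simp add: prod.delta)
    then show ?thesis by (simp add: prod.distrib)
  qed
  have "(CLINT z|gauss_pi I. z i * iexp (\<Sum>j\<in>I. a j * z j)) = (CLINT z|gauss_pi I. (\<Prod>j\<in>I. ?f j (z j)))"
    by (simp only: split prod_e[OF I(1)])
  also have "\<dots> = (\<Prod>j\<in>I. CLINT x|std_gauss. ?f j x)"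
    by (rule gauss_pi.product_integral_prod[OF I(1) ife])
  also have "\<dots> = (\<Prod>j\<in>I. (if j = i then \<i> * a i else 1) * (CLINT x|std_gauss. ?e j x))"
    by (intro prod.cong refl) (auto simp: std_gauss_stein_iexp[simplified])
  also have "\<dots> = \<i> * a i * (\<Prod>j\<in>I. CLINT x|std_gauss. ?e j x)"
    using I by (simp add: prod.distrib prod.delta)
  also have "(\<Prod>j\<in>I. CLINT x|std_gauss. ?e j x) = (CLINT z|gauss_pi I. (\<Prod>j\<in>I. ?e j (z j)))"
    by (rule gauss_pi.product_integral_prod[symmetric, OF I(1)]) (rule ie)
  finally show ?thesis by (simp only: prod_e[OF I(1)])
qed

text \<open>Gaussian integration by parts in the coordinate \<open>i\<close>, the other coordinates being frozen. The growth bound may depend on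
  the frozen coordinates.\<close>

lemma gauss_pi_integration_by_parts:
  fixes q Dq :: "('i \<Rightarrow> real) \<Rightarrow> complex"
  assumes I: "finite I" "i \<in> I"
    and mq[measurable]: "q \<in> borel_measurable (gauss_pi I)" and mD[measurable]: "Dq \<in> borel_measurable (gauss_pi I)"
    and iq: "integrable (gauss_pi I) (\<lambda>z. z i *\<^sub>R q z)" and iD: "integrable (gauss_pi I) Dq"
    and der: "\<And>z t. ((\<lambda>s. q (z(i := s))) has_vector_derivative Dq (z(i := t))) (at t)"
    and cont: "\<And>z. continuous_on UNIV (\<lambda>t. Dq (z(i := t)))"
    and growth: "\<And>z. \<exists>C k. \<forall>t. norm (q (z(i := t))) \<le> C * (1 + \<bar>t\<bar>) ^ k \<and> norm (Dq (z(i := t))) \<le> C * (1 + \<bar>t\<bar>) ^ k"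
  shows "(CLINT z|gauss_pi I. z i *\<^sub>R q z) = (CLINT z|gauss_pi I. Dq z)"
proof -
  define J where "J = I - {i}"
  have IJ: "I = insert i J" "finite J" "i \<notin> J" using I by (auto simp: J_def)
  have "(CLINT z|gauss_pi I. z i *\<^sub>R q z) = (CLINT z|gauss_pi J. CLINT t|std_gauss. t *\<^sub>R q (z(i := t)))"
    unfolding IJ(1) using gauss_pi.product_integral_insert[OF IJ(2,3) iq[unfolded IJ(1)]] by simp
  also have "\<dots> = (CLINT z|gauss_pi J. CLINT t|std_gauss. Dq (z(i := t)))"
  proof (rule Bochner_Integration.integral_cong[OF refl])
    fix z
    obtain C k where "\<forall>t. norm (q (z(i := t))) \<le> C * (1 + \<bar>t\<bar>) ^ k \<and> norm (Dq (z(i := t))) \<le> C * (1 + \<bar>t\<bar>) ^ k"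
      using growth by blast
    then show "(CLINT t|std_gauss. t *\<^sub>R q (z(i := t))) = (CLINT t|std_gauss. Dq (z(i := t)))"
      by (intro std_gauss_integration_by_parts[where C=C and k=k] der cont) auto
  qed
  also have "\<dots> = (CLINT z|gauss_pi I. Dq z)"
    unfolding IJ(1) using gauss_pi.product_integral_insert[OF IJ(2,3) iD[unfolded IJ(1)]] by simp
  finally show ?thesis .
qed

text \<open>Integration by parts extends from exponentials to general \<open>g\<close>. The law of \<open>Y\<close> need not have a
  density, so an independent Gaussian vector \<open>\<sigma> Z\<close> is added to \<open>Y\<close>. By the hypothesis \<open>fourier\<close> and by
  the Stein identity of \<open>Z\<close>, the weight \<open>G - \<Sum>\<^sub>i V\<^sub>i Z\<^sub>i / \<sigma>\<close> integrates every exponential of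
  \<open>Y + \<sigma> Z\<close> to zero, hence every bounded function. Integrating by parts in
  \<open>Z\<close> removes the factor \<open>1 / \<sigma>\<close>, and \<open>\<sigma> \<rightarrow> 0\<close> gives the claim. The conditions \<open>dep\<close> say that only the coordinates in
  \<open>I\<close> matter.\<close>

lemma fourier_integration_by_parts:
  fixes Y :: "'i::countable \<Rightarrow> 'w \<Rightarrow> real" and G :: "'w \<Rightarrow> real" and V :: "'i \<Rightarrow> 'w \<Rightarrow> real"
    and g :: "('i \<Rightarrow> real) \<Rightarrow> complex" and D :: "'i \<Rightarrow> ('i \<Rightarrow> real) \<Rightarrow> complex"
  assumes M: "prob_space M" and I: "finite I"
    and Y: "\<And>i. i \<in> I \<Longrightarrow> all_moments M (Y i)"
    and G: "integrable M G"
    and V: "\<And>i. i \<in> I \<Longrightarrow> V i \<in> borel_measurable M" "\<And>i. i \<in> I \<Longrightarrow> integrable M (\<lambda>w. (V i w)\<^sup>2)"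
    and fourier: "\<And>\<xi>. (CLINT w|M. G w * iexp (\<Sum>i\<in>I. \<xi> i * Y i w)) =
        \<i> * (\<Sum>i\<in>I. \<xi> i * (CLINT w|M. V i w * iexp (\<Sum>i\<in>I. \<xi> i * Y i w)))"
    and g: "continuous_on UNIV g" "\<And>x. norm (g x) \<le> B"
    and D: "\<And>i. i \<in> I \<Longrightarrow> continuous_on UNIV (D i)"
       "\<And>i x. i \<in> I \<Longrightarrow> norm (D i x) \<le> C * (1 + (\<Sum>j\<in>I. \<bar>x j\<bar>)) ^ k"
    and der: "\<And>i x. i \<in> I \<Longrightarrow> ((\<lambda>t. g (x(i := t))) has_vector_derivative D i x) (at (x i))"
    and dep: "\<And>x y. (\<And>i. i \<in> I \<Longrightarrow> x i = y i) \<Longrightarrow> g x = g y"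
       "\<And>i x y. i \<in> I \<Longrightarrow> (\<And>j. j \<in> I \<Longrightarrow> x j = y j) \<Longrightarrow> D i x = D i y"
  shows "(CLINT w|M. G w * g (\<lambda>i. Y i w)) = (\<Sum>i\<in>I. CLINT w|M. V i w * D i (\<lambda>i. Y i w))"
proof -
  interpret M: prob_space M by (rule M)
  let ?N = "gauss_pi I"
  interpret N: prob_space ?N by (rule prob_space_gauss_pi)
  let ?P = "M \<Otimes>\<^sub>M ?N"
  interpret P: pair_prob_space M ?N ..
  have Ym[measurable]: "Y i \<in> borel_measurable M" if "i \<in> I" for i using Y[OF that] by (simp add: all_moments_def)
  have Gm[measurable]: "G \<in> borel_measurable M" using G by simp
  note Vm[measurable] = V(1)
  have zm[measurable]: "(\<lambda>z. z i) \<in> borel_measurable ?N" if "i \<in> I" for i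
    using gauss_pi_all_moments[OF I that] by (simp add: all_moments_def)
  have gm[measurable]: "g \<in> borel_measurable borel" using g(1) by (rule borel_measurable_continuous_onI)
  have Dm[measurable]: "D i \<in> borel_measurable borel" if "i \<in> I" for i
    using D(1)[OF that] by (rule borel_measurable_continuous_onI)
  \<comment> \<open>Coordinates outside \<open>I\<close> are set to zero, as the product measure leaves them undefined.\<close>
  define ext :: "('i \<Rightarrow> real) \<Rightarrow> 'i \<Rightarrow> real" where "ext x = (\<lambda>i. if i \<in> I then x i else 0)" for x
  have ext_m[measurable]: "ext \<in> measurable (\<Pi>\<^sub>M i\<in>I. borel) borel"
    unfolding ext_def
  proof (rule measurable_coordinatewise_then_product)
    fix i show "(\<lambda>x. if i \<in> I then x i else 0) \<in> borel_measurable (\<Pi>\<^sub>M i\<in>I. borel :: real measure)"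
      by (cases "i \<in> I") auto
  qed
  define T where "T \<sigma> p = (\<lambda>i. if i \<in> I then Y i (fst p) + \<sigma> * snd p i else 0)" for \<sigma> :: real and p
  have T_m[measurable]: "T \<sigma> \<in> borel_measurable ?P" for \<sigma>
    unfolding T_def
  proof (rule measurable_coordinatewise_then_product)
    fix i show "(\<lambda>p. if i \<in> I then Y i (fst p) + \<sigma> * snd p i else 0) \<in> borel_measurable ?P"
      by (cases "i \<in> I") auto
  qed
  \<comment> \<open>An integrable majorant of all \<open>D i (T \<sigma> p)\<close> with \<open>\<bar>\<sigma>\<bar> \<le> 1\<close>, for the passage to the limit.\<close>
  define E where "E p = \<bar>C\<bar> * (1 + (\<Sum>j\<in>I. \<bar>Y j (fst p)\<bar> + \<bar>snd p j\<bar>)) ^ k" for p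
  have sum_mom: "all_moments ?P (\<lambda>p. 1 + (\<Sum>j\<in>I. \<bar>Y j (fst p)\<bar> + \<bar>snd p j\<bar>))"
    by (intro all_moments_add P.P.all_moments_const P.P.all_moments_sum all_moments_abs
        all_moments_fst[OF M N.prob_space_axioms] all_moments_snd[OF M N.prob_space_axioms] Y gauss_pi_all_moments I)
  then have E_mom: "all_moments ?P E"
    unfolding E_def by (intro all_moments_mult all_moments_power)
  have DE: "norm (D i (T \<sigma> p)) \<le> E p" if "i \<in> I" "\<bar>\<sigma>\<bar> \<le> 1" for i \<sigma> p
  proof -
    have "norm (D i (T \<sigma> p)) \<le> C * (1 + (\<Sum>j\<in>I. \<bar>T \<sigma> p j\<bar>)) ^ k" by (rule D(2)[OF that(1)])
    also have "\<dots> \<le> E p" unfolding E_def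
    proof (intro mult_mono power_mono add_left_mono sum_mono)
      fix j assume "j \<in> I"
      have "\<bar>\<sigma>\<bar> * \<bar>snd p j\<bar> \<le> 1 * \<bar>snd p j\<bar>" using that(2) by (intro mult_right_mono) auto
      then show "\<bar>T \<sigma> p j\<bar> \<le> \<bar>Y j (fst p)\<bar> + \<bar>snd p j\<bar>"
        using \<open>j \<in> I\<close> abs_triangle_ineq[of "Y j (fst p)" "\<sigma> * snd p j"] by (simp add: T_def abs_mult)
    qed (auto intro!: add_nonneg_nonneg sum_nonneg)
    finally show ?thesis .
  qed
  have Vfst2: "integrable ?P (\<lambda>p. (V i (fst p))\<^sup>2)" if "i \<in> I" for i
    by (rule pair_prob_fst(1)[OF M N.prob_space_axioms V(2)[OF that]])
  have VE: "integrable ?P (\<lambda>p. V i (fst p) * E p)" if "i \<in> I" for i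
    by (rule Cauchy_Schwarz_integral(1)[OF _ _ Vfst2[OF that] all_moments_square_integrable[OF E_mom]])
       (use that E_mom in \<open>auto simp: all_moments_def\<close>)
  have VD: "integrable ?P (\<lambda>p. V i (fst p) * D i (T \<sigma> p))" if "i \<in> I" "\<bar>\<sigma>\<bar> \<le> 1" for i \<sigma>
    by (rule Bochner_Integration.integrable_bound[OF VE[OF that(1)]])
       (use that order_trans[OF DE[OF that] abs_ge_self] in \<open>auto simp: norm_mult abs_mult intro!: mult_left_mono\<close>)
  have Vz: "integrable ?P (\<lambda>p. V i (fst p) * snd p i)" if "i \<in> I" for i
    by (rule Cauchy_Schwarz_integral(1)[OF _ _ Vfst2[OF that]
          all_moments_square_integrable[OF all_moments_snd[OF M N.prob_space_axioms gauss_pi_all_moments[OF I that]]]])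
       (use that in auto)
  have Gf: "integrable ?P (\<lambda>p. G (fst p))" by (rule pair_prob_fst(1)[OF M N.prob_space_axioms G])
  have gE: "norm (g x) \<le> \<bar>B\<bar>" for x using order_trans[OF g(2) abs_ge_self] .
  have Vzg: "integrable ?P (\<lambda>p. V i (fst p) * snd p i * g (T \<sigma> p))" if "i \<in> I" for i \<sigma>
    by (rule Bochner_Integration.integrable_bound[of _ "\<lambda>p. \<bar>B\<bar> * (V i (fst p) * snd p i)"])
       (use that gE Vz[OF that] in \<open>auto simp: norm_mult abs_mult mult.commute[of "\<bar>B\<bar>"] intro!: mult_left_mono\<close>)
  have Gg: "integrable ?P (\<lambda>p. G (fst p) * g (T \<sigma> p))" for \<sigma>
    by (rule Bochner_Integration.integrable_bound[of _ "\<lambda>p. \<bar>B\<bar> * G (fst p)"])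
       (use gE Gf in \<open>auto simp: norm_mult abs_mult mult.commute[of "\<bar>B\<bar>"] intro!: mult_left_mono\<close>)
  have step: "(CLINT p|?P. G (fst p) * g (T \<sigma> p)) = (\<Sum>i\<in>I. CLINT p|?P. V i (fst p) * D i (T \<sigma> p))"
    if s: "0 < \<sigma>" "\<sigma> \<le> 1" for \<sigma>
  proof -
    \<comment> \<open>The Stein identity of \<open>snd p\<close> turns \<open>snd p i / \<sigma>\<close> into the factor \<open>\<i> * \<xi> i\<close> of the hypothesis.\<close>
    define W where "W p = G (fst p) - (\<Sum>i\<in>I. V i (fst p) * snd p i / \<sigma>)" for p
    have "(LINT p|?P. W p *\<^sub>R (g \<circ> ext) (\<lambda>i\<in>I. Y i (fst p) + \<sigma> * snd p i)) = 0"
    proof (rule fourier_uniqueness_single[OF I])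
      show Wi: "integrable ?P W" unfolding W_def using Gf Vz by auto
      show "(\<lambda>p. Y i (fst p) + \<sigma> * snd p i) \<in> borel_measurable ?P" if "i \<in> I" for i using that by measurable
      show "g \<circ> ext \<in> borel_measurable (\<Pi>\<^sub>M i\<in>I. borel)" by measurable
      show "norm ((g \<circ> ext) y) \<le> B" for y using g(2) by simp
      fix \<xi> :: "'i \<Rightarrow> real"
      let ?eY = "\<lambda>w. iexp (\<Sum>i\<in>I. \<xi> i * Y i w)" and ?ez = "\<lambda>z. iexp (\<Sum>i\<in>I. (\<sigma> * \<xi> i) * z i)"
      let ?c = "CLINT z|?N. ?ez z"
      have e: "iexp (\<Sum>i\<in>I. \<xi> i * (Y i (fst p) + \<sigma> * snd p i)) = ?eY (fst p) * ?ez (snd p)" for p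
        by (simp add: exp_add[symmetric] sum.distrib[symmetric] distrib_left[symmetric] algebra_simps)
      have ez_i: "integrable ?N ?ez"
        by (rule N.integrable_const_bound[where B=1]) (auto simp: norm_exp_i_times[of "\<Sum>i\<in>I. _ i", simplified])
      have eYi: "integrable M (\<lambda>w. complex_of_real (f w) * ?eY w)" if "integrable M f" for f
        by (rule Bochner_Integration.integrable_bound[OF that]) (use that in \<open>auto simp: norm_mult\<close>)
      have zez: "integrable ?N (\<lambda>z. complex_of_real (z i) * ?ez z)" if "i \<in> I" for i
        by (rule Bochner_Integration.integrable_bound[OF all_moments_integrable[OF gauss_pi_all_moments[OF I that]]])
           (use that in \<open>auto simp: norm_mult\<close>)
      have Vi: "integrable M (V i)" if "i \<in> I" for i
        by (rule M.square_integrable_imp_integrable[OF V(1)[OF that] V(2)[OF that]])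
      have t1: "integrable ?P (\<lambda>p. (complex_of_real (G (fst p)) * ?eY (fst p)) * ?ez (snd p))"
        "(CLINT p|?P. (complex_of_real (G (fst p)) * ?eY (fst p)) * ?ez (snd p)) = (CLINT w|M. G w * ?eY w) * ?c"
        by (rule integrable_product_pair[OF M N.prob_space_axioms eYi[OF G] ez_i])+
      have t2: "integrable ?P (\<lambda>p. (complex_of_real (V i (fst p)) * ?eY (fst p)) * (complex_of_real (snd p i) * ?ez (snd p)))"
        "(CLINT p|?P. (complex_of_real (V i (fst p)) * ?eY (fst p)) * (complex_of_real (snd p i) * ?ez (snd p))) =
           (CLINT w|M. V i w * ?eY w) * (\<i> * (\<sigma> * \<xi> i) * ?c)" if "i \<in> I" for i
        using integrable_product_pair[OF M N.prob_space_axioms eYi[OF Vi[OF that]] zez[OF that]]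
          gauss_pi_stein[OF I that, of "\<lambda>i. \<sigma> * \<xi> i"] by simp_all
      have "(CLINT p|?P. complex_of_real (W p) * iexp (\<Sum>i\<in>I. \<xi> i * (Y i (fst p) + \<sigma> * snd p i))) =
        (CLINT p|?P. (complex_of_real (G (fst p)) * ?eY (fst p)) * ?ez (snd p) -
          (\<Sum>i\<in>I. (complex_of_real (V i (fst p)) * ?eY (fst p)) * (complex_of_real (snd p i) * ?ez (snd p)) / \<sigma>))"
        unfolding e W_def
        by (intro Bochner_Integration.integral_cong refl)
           (simp add: left_diff_distrib right_diff_distrib sum_distrib_left sum_distrib_right mult_ac)
      also have "\<dots> = (CLINT w|M. G w * ?eY w) * ?c - (\<Sum>i\<in>I. (CLINT w|M. V i w * ?eY w) * (\<i> * (\<sigma> * \<xi> i) * ?c) / \<sigma>)"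
        using t1 t2 by (subst Bochner_Integration.integral_diff) auto
      also have "\<dots> = 0"
        unfolding fourier using s(1)
        by (simp add: sum_distrib_left sum_distrib_right mult_ac)
      finally show "(CLINT p|?P. complex_of_real (W p) * iexp (\<Sum>i\<in>I. \<xi> i * (Y i (fst p) + \<sigma> * snd p i))) = 0" .
    qed
    moreover have "(g \<circ> ext) (\<lambda>i\<in>I. Y i (fst p) + \<sigma> * snd p i) = g (T \<sigma> p)" for p
      by (auto simp: ext_def T_def restrict_def fun_eq_iff intro!: arg_cong[of _ _ g])
    ultimately have "(CLINT p|?P. W p *\<^sub>R g (T \<sigma> p)) = 0" by simp
    moreover have "W p *\<^sub>R g (T \<sigma> p) = G (fst p) * g (T \<sigma> p) - (\<Sum>i\<in>I. V i (fst p) * snd p i * g (T \<sigma> p) / \<sigma>)" for p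
      by (simp add: W_def scaleR_conv_of_real left_diff_distrib sum_distrib_right)
    ultimately have 1: "(CLINT p|?P. G (fst p) * g (T \<sigma> p)) = (\<Sum>i\<in>I. (CLINT p|?P. V i (fst p) * snd p i * g (T \<sigma> p)) / \<sigma>)"
      using Gg[of \<sigma>] Vzg[of _ \<sigma>] by simp
    have "(CLINT p|?P. V i (fst p) * snd p i * g (T \<sigma> p)) = \<sigma> * (CLINT p|?P. V i (fst p) * D i (T \<sigma> p))"
      if i: "i \<in> I" for i
    proof -
      have "(CLINT p|?P. V i (fst p) * snd p i * g (T \<sigma> p)) = (CLINT w|M. CLINT z|?N. V i w * z i * g (T \<sigma> (w, z)))"
        using P.integral_fst'[OF Vzg[OF i, of \<sigma>]] by simp
      also have "\<dots> = (CLINT w|M. CLINT z|?N. V i w * (\<sigma> * D i (T \<sigma> (w, z))))"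
      proof (rule Bochner_Integration.integral_cong[OF refl])
        fix w assume w: "w \<in> space M"
        let ?q = "\<lambda>z. g (T \<sigma> (w, z))" and ?Dq = "\<lambda>z. \<sigma> * D i (T \<sigma> (w, z))"
        have Tw[measurable]: "(\<lambda>z. T \<sigma> (w, z)) \<in> borel_measurable ?N"
          using measurable_Pair2[OF T_m w] by simp
        have upd: "T \<sigma> (w, z(i := t)) = (T \<sigma> (w, z))(i := Y i w + \<sigma> * t)" for z t
          using i by (auto simp: T_def fun_eq_iff)
        have "(CLINT z|?N. z i *\<^sub>R ?q z) = (CLINT z|?N. ?Dq z)"
        proof (rule gauss_pi_integration_by_parts[OF I i])
          show "?q \<in> borel_measurable ?N" "?Dq \<in> borel_measurable ?N" using i by measurable
          show "integrable ?N (\<lambda>z. z i *\<^sub>R ?q z)"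
            by (rule Bochner_Integration.integrable_bound[of _ "\<lambda>z. \<bar>B\<bar> * z i"])
               (use i gE all_moments_integrable[OF gauss_pi_all_moments[OF I i]] in
                 \<open>auto simp: mult.commute[of "\<bar>B\<bar>"] abs_mult intro!: mult_left_mono\<close>)
          have "all_moments ?N (\<lambda>z. 1 + (\<Sum>j\<in>I. \<bar>Y j w\<bar> + \<bar>z j\<bar>))"
            by (intro all_moments_add N.all_moments_const N.all_moments_sum all_moments_abs gauss_pi_all_moments I)
          then have "all_moments ?N (\<lambda>z. E (w, z))"
            unfolding E_def by (auto intro!: all_moments_mult all_moments_power)
          from all_moments_integrable[OF this] show "integrable ?N ?Dq"
          proof (rule Bochner_Integration.integrable_bound)
            have "norm (?Dq z) \<le> norm (E (w, z))" for z
            proof -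
              have "norm (?Dq z) \<le> 1 * norm (D i (T \<sigma> (w, z)))"
                unfolding norm_mult using s by (intro mult_right_mono) auto
              then show ?thesis using DE[OF i, of \<sigma> "(w, z)"] s by simp
            qed
            then show "AE z in ?N. norm (?Dq z) \<le> norm (E (w, z))" by simp
          qed (use i in measurable)
          show "((\<lambda>t. ?q (z(i := t))) has_vector_derivative ?Dq (z(i := t))) (at t)" for z t
          proof -
            have "((\<lambda>s. g ((T \<sigma> (w, z))(i := s))) has_vector_derivative D i ((T \<sigma> (w, z))(i := Y i w + \<sigma> * t))) (at (Y i w + \<sigma> * t))"
              using der[OF i, of "(T \<sigma> (w, z))(i := Y i w + \<sigma> * t)"] by simp
            then have "(((\<lambda>s. g ((T \<sigma> (w, z))(i := s))) \<circ> (\<lambda>t. Y i w + \<sigma> * t)) has_vector_derivative \<sigma> *\<^sub>R D i ((T \<sigma> (w, z))(i := Y i w + \<sigma> * t))) (at t)"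
              by (intro vector_diff_chain_at) (auto intro!: derivative_eq_intros)
            then show ?thesis unfolding upd comp_def by (simp add: scaleR_conv_of_real)
          qed
          show "continuous_on UNIV (\<lambda>t. ?Dq (z(i := t)))" for z
          proof -
            have "continuous_on UNIV (\<lambda>t. (T \<sigma> (w, z))(i := Y i w + \<sigma> * t))"
            proof (rule continuous_on_coordinatewise_then_product)
              fix j show "continuous_on UNIV (\<lambda>t. ((T \<sigma> (w, z))(i := Y i w + \<sigma> * t)) j)"
                by (cases "j = i") (auto intro!: continuous_intros)
            qed
            then show ?thesis unfolding upd
              by (rule continuous_on_mult[OF continuous_on_const continuous_on_compose2[OF D(1)[OF i]]]) auto
          qed
          show "\<exists>C k. \<forall>t. norm (?q (z(i := t))) \<le> C * (1 + \<bar>t\<bar>) ^ k \<and> norm (?Dq (z(i := t))) \<le> C * (1 + \<bar>t\<bar>) ^ k" for z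
          proof (intro exI allI conjI)
            fix t :: real
            define A where "A = (\<Sum>j\<in>I. \<bar>Y j w\<bar> + \<bar>z j\<bar>)"
            have A0: "0 \<le> A" unfolding A_def by (intro sum_nonneg) auto
            let ?C = "\<bar>B\<bar> + \<bar>C\<bar> * (2 + A) ^ k"
            have one: "1 \<le> (1 + \<bar>t\<bar>) ^ k" by (rule one_le_power) simp
            have "norm (?q (z(i := t))) \<le> \<bar>B\<bar> * 1" using gE by simp
            also have "\<dots> \<le> ?C * (1 + \<bar>t\<bar>) ^ k"
              using one A0 by (intro mult_mono) auto
            finally show "norm (?q (z(i := t))) \<le> ?C * (1 + \<bar>t\<bar>) ^ k" .
            have "norm (?Dq (z(i := t))) \<le> 1 * norm (D i (T \<sigma> (w, z(i := t))))"
              unfolding norm_mult using s by (intro mult_right_mono) auto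
            also have "\<dots> \<le> E (w, z(i := t))" using DE[OF i, of \<sigma>] s by simp
            also have "\<dots> \<le> \<bar>C\<bar> * ((2 + A) * (1 + \<bar>t\<bar>)) ^ k"
            proof -
              have "(\<Sum>j\<in>I. \<bar>Y j w\<bar> + \<bar>(z(i := t)) j\<bar>) \<le> (\<Sum>j\<in>I. (\<bar>Y j w\<bar> + \<bar>z j\<bar>) + (if j = i then \<bar>t\<bar> else 0))"
                by (intro sum_mono) auto
              also have "\<dots> = A + \<bar>t\<bar>" using i I by (simp add: A_def sum.distrib)
              finally have "1 + (\<Sum>j\<in>I. \<bar>Y j w\<bar> + \<bar>(z(i := t)) j\<bar>) \<le> 1 + (A + \<bar>t\<bar>)" by simp
              also have "\<dots> \<le> (2 + A) * (1 + \<bar>t\<bar>)" using A0 by (simp add: algebra_simps)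
              finally show ?thesis unfolding E_def
                by (intro mult_left_mono power_mono) (auto intro!: add_nonneg_nonneg sum_nonneg)
            qed
            also have "\<dots> \<le> ?C * (1 + \<bar>t\<bar>) ^ k"
              unfolding power_mult_distrib by (simp add: distrib_right mult.assoc)
            finally show "norm (?Dq (z(i := t))) \<le> ?C * (1 + \<bar>t\<bar>) ^ k" .
          qed
        qed
        then show "(CLINT z|?N. V i w * z i * g (T \<sigma> (w, z))) = (CLINT z|?N. V i w * (\<sigma> * D i (T \<sigma> (w, z))))"
          by (simp add: scaleR_conv_of_real mult.assoc)
      qed
      also have "\<dots> = (CLINT w|M. CLINT z|?N. \<sigma> * (V i w * D i (T \<sigma> (w, z))))"
        by (simp add: mult_ac)
      also have "\<dots> = (CLINT p|?P. \<sigma> * (V i (fst p) * D i (T \<sigma> p)))"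
        using P.integral_fst'[OF integrable_mult_right[OF VD[OF i, of \<sigma>], of "complex_of_real \<sigma>"]] s by simp
      finally show ?thesis by simp
    qed
    with 1 s show ?thesis by simp
  qed
  define \<sigma> where "\<sigma> n = 1 / real (Suc n)" for n
  have s: "0 < \<sigma> n" "\<sigma> n \<le> 1" "\<bar>\<sigma> n\<bar> \<le> 1" for n by (auto simp: \<sigma>_def)
  have s0: "\<sigma> \<longlonglongrightarrow> 0" unfolding \<sigma>_def by (rule LIMSEQ_Suc[OF lim_1_over_n])
  have Tlim: "(\<lambda>n. h (T (\<sigma> n) p)) \<longlonglongrightarrow> h (T 0 p)" if "continuous_on UNIV h" for p and h :: "_ \<Rightarrow> complex"
  proof -
    have "continuous_on UNIV (\<lambda>s. T s p)"
    proof (rule continuous_on_coordinatewise_then_product)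
      fix j show "continuous_on UNIV (\<lambda>s. T s p j)"
        unfolding T_def by (cases "j \<in> I") (auto intro!: continuous_intros)
    qed
    then have "continuous_on UNIV (\<lambda>s. h (T s p))"
      by (intro continuous_on_compose2[OF that]) auto
    then have "isCont (\<lambda>s. h (T s p)) 0" by (simp add: continuous_on_eq_continuous_at)
    then show ?thesis using s0 by (rule isCont_tendsto_compose)
  qed
  have L: "(\<lambda>n. CLINT p|?P. G (fst p) * g (T (\<sigma> n) p)) \<longlonglongrightarrow> (CLINT p|?P. G (fst p) * g (T 0 p))"
  proof (rule integral_dominated_convergence[where w="\<lambda>p. \<bar>B\<bar> * \<bar>G (fst p)\<bar>"])
    show "AE p in ?P. (\<lambda>n. G (fst p) * g (T (\<sigma> n) p)) \<longlonglongrightarrow> G (fst p) * g (T 0 p)"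
      by (intro AE_I2 tendsto_mult tendsto_const Tlim g(1))
    show "AE p in ?P. norm (G (fst p) * g (T (\<sigma> n) p)) \<le> \<bar>B\<bar> * \<bar>G (fst p)\<bar>" for n
      using gE by (auto simp: norm_mult mult.commute[of "\<bar>B\<bar>"] intro!: mult_left_mono)
  qed (use Gf in auto)
  have R: "(\<lambda>n. \<Sum>i\<in>I. CLINT p|?P. V i (fst p) * D i (T (\<sigma> n) p)) \<longlonglongrightarrow> (\<Sum>i\<in>I. CLINT p|?P. V i (fst p) * D i (T 0 p))"
  proof (rule tendsto_sum)
    fix i assume i: "i \<in> I"
    show "(\<lambda>n. CLINT p|?P. V i (fst p) * D i (T (\<sigma> n) p)) \<longlonglongrightarrow> (CLINT p|?P. V i (fst p) * D i (T 0 p))"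
    proof (rule integral_dominated_convergence[where w="\<lambda>p. \<bar>V i (fst p) * E p\<bar>"])
      show "AE p in ?P. (\<lambda>n. V i (fst p) * D i (T (\<sigma> n) p)) \<longlonglongrightarrow> V i (fst p) * D i (T 0 p)"
        by (intro AE_I2 tendsto_mult tendsto_const Tlim D(1) i)
      show "AE p in ?P. norm (V i (fst p) * D i (T (\<sigma> n) p)) \<le> \<bar>V i (fst p) * E p\<bar>" for n
        using order_trans[OF DE[OF i s(3)] abs_ge_self] by (auto simp: norm_mult abs_mult intro!: mult_left_mono)
    qed (use i VE[OF i] in auto)
  qed
  have "(CLINT p|?P. G (fst p) * g (T 0 p)) = (\<Sum>i\<in>I. CLINT p|?P. V i (fst p) * D i (T 0 p))"
    using L R by (intro LIMSEQ_unique[OF L]) (simp add: step s)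
  moreover have g0: "g (T 0 p) = g (\<lambda>i. Y i (fst p))" for p by (rule dep(1)) (simp add: T_def)
  moreover have D0: "D i (T 0 p) = D i (\<lambda>i. Y i (fst p))" if "i \<in> I" for i p
    by (rule dep(2)[OF that]) (simp add: T_def)
  ultimately have fin: "(CLINT p|?P. G (fst p) * g (\<lambda>i. Y i (fst p))) = (\<Sum>i\<in>I. CLINT p|?P. V i (fst p) * D i (\<lambda>i. Y i (fst p)))"
    by simp
  have down: "(CLINT p|?P. f (fst p)) = (CLINT w|M. f w)" if "integrable ?P (\<lambda>p. f (fst p))" for f :: "'w \<Rightarrow> complex"
    using P.integral_fst'[OF that] by (simp add: N.prob_space)
  have "(CLINT p|?P. G (fst p) * g (\<lambda>i. Y i (fst p))) = (CLINT w|M. G w * g (\<lambda>i. Y i w))"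
    by (rule down) (use Gg[of 0] in \<open>simp add: g0\<close>)
  moreover have "(CLINT p|?P. V i (fst p) * D i (\<lambda>i. Y i (fst p))) = (CLINT w|M. V i w * D i (\<lambda>i. Y i w))" if "i \<in> I" for i
    by (rule down) (use VD[OF that, of 0] that in \<open>simp add: D0\<close>)
  ultimately show ?thesis using fin by simp
qed

section \<open>Pairing the divergence with complex exponentials\<close>

lemma (in prob_space) L2_inner_integrable:
  fixes u U :: "'a \<Rightarrow> 'h::{real_inner, second_countable_topology}"
  assumes u: "u \<in> L2 M" and U: "U \<in> L2 M"
  shows "integrable M (\<lambda>w. inner (u w) (U w))"
    and "(LINT w|M. \<bar>inner (u w) (U w)\<bar>) \<le> sqrt (LINT w|M. (norm (u w))\<^sup>2) * sqrt (LINT w|M. (norm (U w))\<^sup>2)"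
proof -
  have [measurable]: "u \<in> borel_measurable M" "U \<in> borel_measurable M"
    using assms by (auto simp: L2_def)
  have i: "integrable M (\<lambda>w. norm (u w) * norm (U w))"
    by (rule Cauchy_Schwarz_integral(1)) (use assms in \<open>auto simp: L2_def\<close>)
  show j: "integrable M (\<lambda>w. inner (u w) (U w))"
    by (rule Bochner_Integration.integrable_bound[OF i]) (auto simp: Cauchy_Schwarz_ineq2)
  have "(LINT w|M. \<bar>inner (u w) (U w)\<bar>) \<le> (LINT w|M. norm (u w) * norm (U w))"
    by (rule integral_mono[OF _ i]) (use j in \<open>auto simp: Cauchy_Schwarz_ineq2\<close>)
  also have "\<dots> \<le> sqrt ((LINT w|M. (norm (u w))\<^sup>2) * (LINT w|M. (norm (U w))\<^sup>2))"
    by (rule real_le_rsqrt, rule Cauchy_Schwarz_integral(2)) (use assms in \<open>auto simp: L2_def\<close>)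
  finally show "(LINT w|M. \<bar>inner (u w) (U w)\<bar>) \<le> sqrt (LINT w|M. (norm (u w))\<^sup>2) * sqrt (LINT w|M. (norm (U w))\<^sup>2)"
    by (simp add: real_sqrt_mult)
qed

lemma (in prob_space) L2_integrable:
  fixes f :: "'a \<Rightarrow> real"
  shows "f \<in> L2 M \<Longrightarrow> integrable M f"
  by (rule square_integrable_imp_integrable) (auto simp: L2_def)

context isonormal_process
begin

text \<open>Linearity is not part of the definition of an isonormal process; it holds almost surely because the variance of the
  difference, computed from the covariances, is zero.\<close>

lemma X_linear:
  assumes I: "finite I"
  shows "AE w in M. X (\<Sum>i\<in>I. \<xi> i *\<^sub>R h i) w = (\<Sum>i\<in>I. \<xi> i * X (h i) w)"
proof -
  define g where "g = (\<Sum>i\<in>I. \<xi> i *\<^sub>R h i)"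
  define Y where "Y w = (\<Sum>i\<in>I. \<xi> i * X (h i) w)" for w
  have ii: "integrable M (\<lambda>w. X a w * X b w)" for a b
    by (rule all_moments_integrable[OF all_moments_times[OF X_all_moments X_all_moments]])
  have iY: "integrable M (\<lambda>w. X a w * Y w)" for a
    unfolding Y_def sum_distrib_left using ii by (auto simp: mult.left_commute)
  have XY: "(LINT w|M. X a w * Y w) = inner a g" for a
    unfolding Y_def sum_distrib_left g_def
    using ii by (simp add: mult.left_commute inner_sum_right covariance)
  have YY: "integrable M (\<lambda>w. Y w * Y w)" "(LINT w|M. Y w * Y w) = inner g g"
  proof -
    have e: "Y w * Y w = (\<Sum>i\<in>I. \<xi> i * (X (h i) w * Y w))" for w
      by (subst (1) Y_def) (simp add: sum_distrib_right mult.assoc)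
    show "integrable M (\<lambda>w. Y w * Y w)" unfolding e using iY by auto
    show "(LINT w|M. Y w * Y w) = inner g g" unfolding e using iY
      by (simp add: XY) (simp add: g_def inner_sum_left)
  qed
  have e: "(X g w - Y w)\<^sup>2 = X g w * X g w - 2 * (X g w * Y w) + Y w * Y w" for w
    by (simp add: power2_eq_square algebra_simps)
  have i2: "integrable M (\<lambda>w. (X g w - Y w)\<^sup>2)" unfolding e using ii iY YY by auto
  have "(LINT w|M. (X g w - Y w)\<^sup>2) = 0"
    unfolding e using ii iY YY by (simp add: XY covariance)
  then have "AE w in M. (X g w - Y w)\<^sup>2 = 0"
    using integral_nonneg_eq_0_iff_AE[OF i2] by simp
  then show ?thesis by (auto simp: g_def Y_def)
qed

context
  fixes u :: "'w \<Rightarrow> 'h" and G :: "'w \<Rightarrow> real"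
  assumes dv: "divergence M X u G"
begin

lemma u_L2: "u \<in> L2 M" and G_L2: "G \<in> L2 M"
  using dv by (auto simp: divergence_def)

lemma uG_measurable[measurable]: "u \<in> borel_measurable M" "G \<in> borel_measurable M"
  using u_L2 G_L2 by (auto simp: L2_def)

lemma divergence_apply: "malliavin_derivative M X F U \<Longrightarrow> (LINT w|M. G w * F w) = (LINT w|M. inner (u w) (U w))"
  using dv unfolding divergence_def by blast

lemma inner_u_square_integrable: "integrable M (\<lambda>w. (inner (u w) h)\<^sup>2)"
proof (rule Bochner_Integration.integrable_bound)
  show "integrable M (\<lambda>w. (norm h)\<^sup>2 * (norm (u w))\<^sup>2)" using u_L2 by (simp add: L2_def)
  have "(inner (u w) h)\<^sup>2 \<le> (norm h)\<^sup>2 * (norm (u w))\<^sup>2" for w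
    using Cauchy_Schwarz_ineq[of "u w" h] by (simp add: power2_norm_eq_inner mult.commute)
  then show "AE w in M. norm ((inner (u w) h)\<^sup>2) \<le> norm ((norm h)\<^sup>2 * (norm (u w))\<^sup>2)" by simp
qed simp

lemma G_square_integrable: "integrable M (\<lambda>w. (G w)\<^sup>2)"
  using G_L2 by (simp add: L2_def)

lemma mult_moments_integrable:
  assumes "all_moments M f"
  shows "integrable M (\<lambda>w. G w * f w)" "integrable M (\<lambda>w. inner (u w) h * f w)"
  using assms all_moments_square_integrable[OF assms] inner_u_square_integrable[of h] G_square_integrable
  by (auto intro!: Cauchy_Schwarz_integral(1) simp: all_moments_def)

text \<open>The polynomials with this property form a linear space that contains the Hermite polynomials, by the definition of the
  divergence. Since these are monic, subtracting multiples of them lowers the degree until nothing is left.\<close>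

lemma divergence_poly:
  assumes h: "norm h = 1"
  shows "(LINT w|M. G w * poly p (X h w)) = (LINT w|M. inner (u w) h * poly (pderiv p) (X h w))"
proof -
  define S where "S = {p. (LINT w|M. G w * poly p (X h w)) = (LINT w|M. inner (u w) h * poly (pderiv p) (X h w))}"
  note i = mult_moments_integrable[OF all_moments_poly[OF X_all_moments]]
  have herm: "hermite_poly q \<in> S" for q
  proof -
    have "(LINT w|M. G w * hermite q (X h w)) = (LINT w|M. inner (u w) ((real q * hermite (q - 1) (X h w)) *\<^sub>R h))"
      by (rule divergence_apply[OF malliavin_derivative_hermite[OF h]])
    then show ?thesis
      by (simp add: S_def poly_hermite_poly pderiv_hermite_poly mult_ac)
  qed
  have lin: "smult a p + r \<in> S" if "p \<in> S" "r \<in> S" for a p r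
  proof -
    have "(LINT w|M. G w * poly (smult a p + r) (X h w)) = (LINT w|M. a * (G w * poly p (X h w)) + G w * poly r (X h w))"
      by (intro Bochner_Integration.integral_cong) (auto simp: algebra_simps)
    also have "\<dots> = a * (LINT w|M. G w * poly p (X h w)) + (LINT w|M. G w * poly r (X h w))" using i by simp
    also have "\<dots> = a * (LINT w|M. inner (u w) h * poly (pderiv p) (X h w)) + (LINT w|M. inner (u w) h * poly (pderiv r) (X h w))"
      using that by (simp add: S_def)
    also have "\<dots> = (LINT w|M. a * (inner (u w) h * poly (pderiv p) (X h w)) + inner (u w) h * poly (pderiv r) (X h w))"
      using i by simp
    also have "\<dots> = (LINT w|M. inner (u w) h * poly (pderiv (smult a p + r)) (X h w))"
      by (intro Bochner_Integration.integral_cong) (auto simp: algebra_simps pderiv_add pderiv_smult)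
    finally show ?thesis by (simp add: S_def)
  qed
  \<comment> \<open>Induction on a strict upper bound of the degree.\<close>
  have "p \<in> S" if "\<And>k. n \<le> k \<Longrightarrow> coeff p k = 0" for n p
    using that
  proof (induction n arbitrary: p)
    case 0
    then have "p = 0" by (simp add: poly_eq_iff)
    then show ?case by (simp add: S_def)
  next
    case (Suc n)
    have "p - smult (coeff p n) (hermite_poly n) \<in> S"
    proof (rule Suc.IH)
      fix k assume "n \<le> k"
      then show "coeff (p - smult (coeff p n) (hermite_poly n)) k = 0"
        using Suc.prems[of k] by (cases "k = n") (auto simp: coeff_hermite_poly)
    qed
    from lin[OF herm this, of "coeff p n" n] show ?case by simp
  qed
  from this[of "Suc (degree p)" p] show ?thesis
    by (simp add: S_def coeff_eq_0)
qed

text \<open>The partial sums of the exponential series are polynomials, and they are dominated by \<open>exp (\<bar>l\<bar> \<bar>X(h)\<bar>)\<close>, which is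
  square integrable.\<close>

lemma divergence_iexp_unit:
  assumes h: "norm h = 1"
  shows "(CLINT w|M. G w * iexp (l * X h w)) = \<i> * l * (CLINT w|M. inner (u w) h * iexp (l * X h w))"
proof -
  define s where "s N x = (\<Sum>n<N. (\<i> * complex_of_real (l * x)) ^ n / fact n)" for N x
  have s_lim: "(\<lambda>N. s N x) \<longlonglongrightarrow> iexp (l * x)" for x
  proof -
    have "(\<lambda>n. (\<i> * complex_of_real (l * x)) ^ n /\<^sub>R fact n) sums exp (\<i> * complex_of_real (l * x))"
      by (rule exp_converges)
    then show ?thesis by (simp add: sums_def s_def scaleR_conv_of_real divide_inverse mult.commute)
  qed
  have s_bound: "norm (s N x) \<le> exp (\<bar>l\<bar> * \<bar>x\<bar>)" for N x
  proof -
    have "norm (s N x) \<le> (\<Sum>n<N. (\<bar>l\<bar> * \<bar>x\<bar>) ^ n / fact n)"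
      unfolding s_def by (rule order_trans[OF norm_sum]) (simp add: norm_divide norm_power norm_mult abs_mult)
    also have "\<dots> \<le> (\<Sum>n. (\<bar>l\<bar> * \<bar>x\<bar>) ^ n / fact n)"
      using summable_exp[of "\<bar>l\<bar> * \<bar>x\<bar>"] by (intro sum_le_suminf) (auto simp: divide_inverse mult.commute)
    also have "\<dots> = exp (\<bar>l\<bar> * \<bar>x\<bar>)" by (simp add: exp_def divide_inverse scaleR_conv_of_real mult.commute)
    finally show ?thesis .
  qed
  have expi: "integrable M (\<lambda>w. (exp (\<bar>l\<bar> * \<bar>X h w\<bar>))\<^sup>2)"
    using scaled_gauss_exp_integrable[OF X_measurable X_law, of "2 * \<bar>l\<bar>" h]
    by (simp add: power2_eq_square exp_add[symmetric] mult.assoc)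
  have lim: "(\<lambda>N. CLINT w|M. f w * s N (X h w)) \<longlonglongrightarrow> (CLINT w|M. f w * iexp (l * X h w))"
    if f[measurable]: "f \<in> borel_measurable M" and f2: "integrable M (\<lambda>w. (f w)\<^sup>2)" for f :: "'w \<Rightarrow> real"
  proof (rule integral_dominated_convergence[where w="\<lambda>w. \<bar>f w * exp (\<bar>l\<bar> * \<bar>X h w\<bar>)\<bar>"])
    have [measurable]: "s N \<in> borel_measurable borel" for N unfolding s_def by measurable
    show "(\<lambda>w. complex_of_real (f w) * s N (X h w)) \<in> borel_measurable M" for N by measurable
    show "integrable M (\<lambda>w. \<bar>f w * exp (\<bar>l\<bar> * \<bar>X h w\<bar>)\<bar>)"
      by (intro integrable_abs Cauchy_Schwarz_integral(1) f2 expi) auto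
    show "AE w in M. (\<lambda>N. f w * s N (X h w)) \<longlonglongrightarrow> f w * iexp (l * X h w)"
      by (intro AE_I2 tendsto_mult tendsto_const s_lim)
    show "AE w in M. norm (f w * s N (X h w)) \<le> \<bar>f w * exp (\<bar>l\<bar> * \<bar>X h w\<bar>)\<bar>" for N
      using s_bound by (auto simp: norm_mult abs_mult intro!: mult_left_mono)
  qed simp
  have mono: "(CLINT w|M. f w * s N (X h w)) = (\<Sum>n<N. (\<i> * l) ^ n / fact n * (LINT w|M. f w * X h w ^ n))"
    if "\<And>n. integrable M (\<lambda>w. f w * X h w ^ n)" for f :: "'w \<Rightarrow> real" and N
  proof -
    have "(CLINT w|M. f w * s N (X h w)) = (CLINT w|M. (\<Sum>n<N. (\<i> * l) ^ n / fact n * complex_of_real (f w * X h w ^ n)))"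
      unfolding s_def by (intro Bochner_Integration.integral_cong) (auto simp: sum_distrib_left power_mult_distrib mult_ac)
    also have "\<dots> = (\<Sum>n<N. (CLINT w|M. (\<i> * l) ^ n / fact n * complex_of_real (f w * X h w ^ n)))"
      by (rule Bochner_Integration.integral_sum)
         (intro integrable_mult_right integrable_of_real that)
    also have "\<dots> = (\<Sum>n<N. (\<i> * l) ^ n / fact n * (LINT w|M. f w * X h w ^ n))"
      by (intro sum.cong refl) (simp only: integral_mult_right_zero integral_complex_of_real)
    finally show ?thesis .
  qed
  note ig = mult_moments_integrable[OF all_moments_power[OF X_all_moments]]
  have rec: "(CLINT w|M. G w * s (Suc N) (X h w)) = \<i> * l * (CLINT w|M. inner (u w) h * s N (X h w))" for N
  proof -
    have pm: "(LINT w|M. G w * X h w ^ n) = real n * (LINT w|M. inner (u w) h * X h w ^ (n - 1))" for n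
    proof -
      have "(LINT w|M. G w * X h w ^ n) = (LINT w|M. real n * (inner (u w) h * X h w ^ (n - 1)))"
        using divergence_poly[OF h, of "monom 1 n"] by (simp add: poly_monom pderiv_monom mult_ac)
      then show ?thesis by simp
    qed
    have "(CLINT w|M. G w * s (Suc N) (X h w)) = (\<Sum>n<Suc N. (\<i> * l) ^ n / fact n * (LINT w|M. G w * X h w ^ n))"
      by (rule mono[OF ig(1)])
    also have "\<dots> = (\<Sum>n<N. (\<i> * l) ^ Suc n / fact (Suc n) * (real (Suc n) * (LINT w|M. inner (u w) h * X h w ^ n)))"
      unfolding sum.lessThan_Suc_shift by (simp add: pm pm[of 0, simplified] del: fact_Suc of_nat_Suc power_Suc)
    also have "\<dots> = (\<Sum>n<N. \<i> * l * ((\<i> * l) ^ n / fact n * (LINT w|M. inner (u w) h * X h w ^ n)))"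
      by (intro sum.cong refl) (simp add: field_simps del: of_nat_Suc)
    also have "\<dots> = \<i> * l * (CLINT w|M. inner (u w) h * s N (X h w))"
      by (subst mono[OF ig(2)]) (simp only: sum_distrib_left)
    finally show ?thesis .
  qed
  have "(\<lambda>N. CLINT w|M. G w * s (Suc N) (X h w)) \<longlonglongrightarrow> (CLINT w|M. G w * iexp (l * X h w))"
    by (rule LIMSEQ_Suc[OF lim]) (auto intro: G_square_integrable)
  moreover have "(\<lambda>N. CLINT w|M. G w * s (Suc N) (X h w)) \<longlonglongrightarrow> \<i> * l * (CLINT w|M. inner (u w) h * iexp (l * X h w))"
    unfolding rec by (intro tendsto_mult tendsto_const lim) (auto intro: inner_u_square_integrable)
  ultimately show ?thesis by (rule LIMSEQ_unique)
qed

text \<open>By homogeneity it is enough to treat unit vectors; for \<open>h = 0\<close> the identity says that the divergence has mean zero, which is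
  the duality with the constant \<open>1\<close>.\<close>

lemma divergence_iexp:
  "(CLINT w|M. G w * iexp (X h w)) = \<i> * (CLINT w|M. inner (u w) h * iexp (X h w))"
proof (cases "h = 0")
  case True
  have X0: "AE w in M. X h w = 0"
    using X_linear[of "{}" "\<lambda>_. 0" "\<lambda>_. h"] True by simp
  have "(CLINT w|M. G w * iexp (X h w)) = (CLINT w|M. complex_of_real (G w))"
    by (rule integral_cong_AE) (use X0 in auto)
  also have "\<dots> = of_real (LINT w|M. G w * 1)" by simp
  also have "\<dots> = 0" by (subst divergence_apply[OF malliavin_derivative_one]) simp
  finally show ?thesis using True by simp
next
  case False
  define e where "e = h /\<^sub>R norm h"
  have e: "norm e = 1" "norm h *\<^sub>R e = h" using False by (auto simp: e_def)
  have Xe: "AE w in M. X h w = norm h * X e w"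
    using X_linear[of "{()}" "\<lambda>_. norm h" "\<lambda>_. e"] e by simp
  have "(CLINT w|M. G w * iexp (X h w)) = (CLINT w|M. G w * iexp (norm h * X e w))"
    by (rule integral_cong_AE) (use Xe in auto)
  also have "\<dots> = \<i> * norm h * (CLINT w|M. inner (u w) e * iexp (norm h * X e w))"
    by (rule divergence_iexp_unit[OF e(1)])
  also have "(CLINT w|M. inner (u w) e * iexp (norm h * X e w)) = (CLINT w|M. inner (u w) e * iexp (X h w))"
    by (rule integral_cong_AE) (use Xe in auto)
  also have "\<i> * norm h * (CLINT w|M. inner (u w) e * iexp (X h w)) = \<i> * (CLINT w|M. norm h * (inner (u w) e * iexp (X h w)))"
    by (subst integral_mult_right_zero) simp
  also have "(CLINT w|M. norm h * (inner (u w) e * iexp (X h w))) = (CLINT w|M. inner (u w) h * iexp (X h w))"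
    by (subst (2) e(2)[symmetric]) (simp add: mult_ac)
  finally show ?thesis .
qed

text \<open>Linear combinations of the \<open>X(h\<^sub>i)\<close> are again of the form \<open>X(h)\<close>.\<close>

lemma divergence_iexp_sum:
  assumes I: "finite I"
  shows "(CLINT w|M. G w * iexp (\<Sum>i\<in>I. \<xi> i * X (h i) w)) =
    \<i> * (\<Sum>i\<in>I. \<xi> i * (CLINT w|M. inner (u w) (h i) * iexp (\<Sum>i\<in>I. \<xi> i * X (h i) w)))"
proof -
  let ?g = "\<Sum>i\<in>I. \<xi> i *\<^sub>R h i" and ?e = "\<lambda>w. iexp (\<Sum>i\<in>I. \<xi> i * X (h i) w)"
  note lin = X_linear[OF I, of \<xi> h]
  have ii: "integrable M (\<lambda>w. complex_of_real (inner (u w) k) * ?e w)" for k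
    by (rule Bochner_Integration.integrable_bound[OF mult_moments_integrable(2)[OF all_moments_const, of k 1]])
       (auto simp: norm_mult)
  have "(CLINT w|M. G w * ?e w) = (CLINT w|M. G w * iexp (X ?g w))"
    by (rule integral_cong_AE) (use lin in auto)
  also have "\<dots> = \<i> * (CLINT w|M. inner (u w) ?g * iexp (X ?g w))" by (rule divergence_iexp)
  also have "(CLINT w|M. inner (u w) ?g * iexp (X ?g w)) = (CLINT w|M. inner (u w) ?g * ?e w)"
    by (rule integral_cong_AE) (use lin in auto)
  also have "\<dots> = (CLINT w|M. (\<Sum>i\<in>I. \<xi> i * (inner (u w) (h i) * ?e w)))"
    by (intro Bochner_Integration.integral_cong refl) (simp add: inner_sum_right sum_distrib_right mult.assoc)
  also have "\<dots> = (\<Sum>i\<in>I. \<xi> i * (CLINT w|M. inner (u w) (h i) * ?e w))"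
    using ii by simp
  finally show ?thesis .
qed

text \<open>The exponentials of cylindrical variables are smooth bounded functions of finitely many \<open>X(h)\<close>; their derivatives are
  given by the chain rule. The functions \<open>f j\<close> depend on different lists of vectors, which are put side by side
  in the index set \<open>I\<close> of pairs \<open>(j, i)\<close>.\<close>

lemma divergence_chain_iexp:
  fixes F :: "'m::finite \<Rightarrow> 'w \<Rightarrow> real" and U :: "'m \<Rightarrow> 'w \<Rightarrow> 'h"
  assumes cyl: "\<And>j. cylindrical_derivative X (F j) (U j)"
  shows "(CLINT w|M. G w * iexp (\<Sum>j\<in>UNIV. \<xi> j * F j w)) =
     \<i> * (CLINT w|M. inner (u w) (\<Sum>j\<in>UNIV. \<xi> j *\<^sub>R U j w) * iexp (\<Sum>j\<in>UNIV. \<xi> j * F j w))"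
proof -
  let ?cyl = "\<lambda>j (n, f, h). smooth_poly_growth n f \<and> F j = (\<lambda>w. f (\<lambda>i. X (h i) w)) \<and>
    U j = (\<lambda>w. \<Sum>i<n. partial_deriv i f (\<lambda>i. X (h i) w) *\<^sub>R h i)"
  have "\<forall>j. \<exists>t. ?cyl j t"
    using cyl unfolding cylindrical_derivative_def by simp
  then have "\<exists>t. \<forall>j. ?cyl j (t j)" by (rule choice)
  then obtain t where t: "\<forall>j. ?cyl j (t j)" ..
  define n f h where "n j = fst (t j)" and "f j = fst (snd (t j))" and "h j = snd (snd (t j))" for j
  have smooth: "smooth_poly_growth (n j) (f j)"
    and Feq: "F j = (\<lambda>w. f j (\<lambda>i. X (h j i) w))"
    and Ueq: "U j = (\<lambda>w. \<Sum>i<n j. partial_deriv i (f j) (\<lambda>i. X (h j i) w) *\<^sub>R h j i)" for j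
    using spec[OF t, of j] by (simp_all add: n_def f_def h_def case_prod_unfold)
  have f_dep: "f j x = f j y" if "\<And>i. i < n j \<Longrightarrow> x i = y i" for j x y
    using smooth[of j] that unfolding smooth_poly_growth_def by blast
  have f_iter: "continuous_on UNIV (iter_partial_deriv is (f j))"
    "\<And>i x. i < n j \<Longrightarrow> (\<lambda>t. iter_partial_deriv is (f j) (x(i := t))) differentiable (at (x i))"
    "\<exists>C k. \<forall>x. \<bar>iter_partial_deriv is (f j) x\<bar> \<le> C * (1 + (\<Sum>i<n j. \<bar>x i\<bar>)) ^ k"
    if "set is \<subseteq> {..<n j}" for "is" j
    using smooth[of j] that unfolding smooth_poly_growth_def by blast+
  have f_cont: "continuous_on UNIV (f j)" for j using f_iter(1)[of "[]" j] by simp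
  have f_der: "((\<lambda>t. f j (x(i := t))) has_real_derivative partial_deriv i (f j) x) (at (x i))" if "i < n j" for i j x
    using f_iter(2)[of "[]" j i x] that
    by (simp add: partial_deriv_def DERIV_deriv_iff_real_differentiable)
  have d_cont: "continuous_on UNIV (partial_deriv i (f j))" if "i < n j" for i j
    using f_iter(1)[of "[i]" j] that by simp
  have d_dep: "partial_deriv i (f j) x = partial_deriv i (f j) y" if "\<And>i. i < n j \<Longrightarrow> x i = y i" "i < n j" for i j x y
  proof -
    have "(\<lambda>t. f j (x(i := t))) = (\<lambda>t. f j (y(i := t)))"
      by (rule ext, rule f_dep) (use that in auto)
    then show ?thesis using that by (simp add: partial_deriv_def)
  qed
  have "\<exists>C k. \<forall>x. \<bar>partial_deriv i (f j) x\<bar> \<le> C * (1 + (\<Sum>i<n j. \<bar>x i\<bar>)) ^ k" if "i < n j" for i j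
    using f_iter(3)[of "[i]" j] that by simp
  then obtain Cf kf where growth: "\<And>i j x. i < n j \<Longrightarrow> \<bar>partial_deriv i (f j) x\<bar> \<le> Cf i j * (1 + (\<Sum>i<n j. \<bar>x i\<bar>)) ^ kf i j"
    by metis
  define I where "I = (SIGMA j:(UNIV :: 'm set). {..<n j})"
  have I: "finite I" unfolding I_def by (intro finite_SigmaI) auto
  have inI: "(j, i) \<in> I \<longleftrightarrow> i < n j" for i j by (auto simp: I_def)
  define slice where "slice x j = (\<lambda>i. x (j, i))" for x :: "'m \<times> nat \<Rightarrow> real" and j
  have slice_cont: "continuous_on UNIV (\<lambda>x. slice x j)" for j
    unfolding slice_def by (intro continuous_intros continuous_on_product_coordinates)
  define g where "g x = iexp (\<Sum>j\<in>UNIV. \<xi> j * f j (slice x j))" for x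
  define D where "D p x = \<i> * (\<xi> (fst p) * partial_deriv (snd p) (f (fst p)) (slice x (fst p))) * g x" for p x
  have g_norm: "norm (g x) = 1" for x unfolding g_def by simp
  have g_cont: "continuous_on UNIV g"
    unfolding g_def
    by (intro continuous_intros continuous_on_compose2[OF f_cont slice_cont]) auto
  define CC where "CC = (\<Sum>p\<in>I. \<bar>\<xi> (fst p)\<bar> * \<bar>Cf (snd p) (fst p)\<bar>)"
  define K where "K = (\<Sum>p\<in>I. kf (snd p) (fst p))"
  have main: "(CLINT w|M. G w * g (\<lambda>p. X (h (fst p) (snd p)) w)) =
    (\<Sum>p\<in>I. CLINT w|M. inner (u w) (h (fst p) (snd p)) * D p (\<lambda>p. X (h (fst p) (snd p)) w))"
  proof (rule fourier_integration_by_parts[OF prob_space_axioms I, where C=CC and k=K])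
    show "all_moments M (X (h (fst p) (snd p)))" for p by (rule X_all_moments)
    show "integrable M G" by (rule L2_integrable[OF G_L2])
    show "(\<lambda>w. inner (u w) (h (fst p) (snd p))) \<in> borel_measurable M" for p by measurable
    show "integrable M (\<lambda>w. (inner (u w) (h (fst p) (snd p)))\<^sup>2)" for p by (rule inner_u_square_integrable)
    show "(CLINT w|M. G w * iexp (\<Sum>p\<in>I. \<xi> p * X (h (fst p) (snd p)) w)) =
      \<i> * (\<Sum>p\<in>I. \<xi> p * (CLINT w|M. inner (u w) (h (fst p) (snd p)) * iexp (\<Sum>p\<in>I. \<xi> p * X (h (fst p) (snd p)) w)))" for \<xi>
      by (rule divergence_iexp_sum[OF I])
    show "continuous_on UNIV g" by (rule g_cont)
    show "norm (g x) \<le> 1" for x by (simp add: g_norm)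
    show "continuous_on UNIV (D p)" if "p \<in> I" for p
      unfolding D_def using that inI[of "fst p" "snd p"]
      by (intro continuous_intros g_cont continuous_on_compose2[OF d_cont slice_cont]) auto
    show "norm (D p x) \<le> CC * (1 + (\<Sum>p\<in>I. \<bar>x p\<bar>)) ^ K" if p: "p \<in> I" for p x
    proof -
      obtain j i where ji: "p = (j, i)" "i < n j" using p inI by (cases p) auto
      have le: "1 + (\<Sum>i<n j. \<bar>slice x j i\<bar>) \<le> 1 + (\<Sum>p\<in>I. \<bar>x p\<bar>)"
      proof -
        have "(\<Sum>i<n j. \<bar>slice x j i\<bar>) = (\<Sum>p\<in>Pair j ` {..<n j}. \<bar>x p\<bar>)"
          by (subst sum.reindex) (auto simp: inj_on_def slice_def)
        also have "\<dots> \<le> (\<Sum>p\<in>I. \<bar>x p\<bar>)"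
          by (rule sum_mono2[OF I]) (auto simp: inI)
        finally show ?thesis by simp
      qed
      have "norm (D p x) = \<bar>\<xi> j\<bar> * \<bar>partial_deriv i (f j) (slice x j)\<bar>"
        by (simp add: D_def ji norm_mult g_norm)
      also have "\<dots> \<le> \<bar>\<xi> j\<bar> * (Cf i j * (1 + (\<Sum>i<n j. \<bar>slice x j i\<bar>)) ^ kf i j)"
        by (intro mult_left_mono growth ji) auto
      also have "\<dots> \<le> \<bar>\<xi> j\<bar> * (\<bar>Cf i j\<bar> * (1 + (\<Sum>p\<in>I. \<bar>x p\<bar>)) ^ kf i j)"
        using le by (intro mult_left_mono mult_mono power_mono) (auto intro!: add_nonneg_nonneg sum_nonneg)
      also have "\<dots> = (\<bar>\<xi> j\<bar> * \<bar>Cf i j\<bar>) * (1 + (\<Sum>p\<in>I. \<bar>x p\<bar>)) ^ kf i j" by simp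
      also have "\<dots> \<le> CC * (1 + (\<Sum>p\<in>I. \<bar>x p\<bar>)) ^ K"
      proof (rule mult_mono)
        show "\<bar>\<xi> j\<bar> * \<bar>Cf i j\<bar> \<le> CC"
          unfolding CC_def using member_le_sum[of p I "\<lambda>p. \<bar>\<xi> (fst p)\<bar> * \<bar>Cf (snd p) (fst p)\<bar>"] p I ji by simp
        have "kf i j \<le> K" unfolding K_def using member_le_sum[of p I "\<lambda>p. kf (snd p) (fst p)"] p I ji by simp
        then show "(1 + (\<Sum>p\<in>I. \<bar>x p\<bar>)) ^ kf i j \<le> (1 + (\<Sum>p\<in>I. \<bar>x p\<bar>)) ^ K"
          by (rule power_increasing) (simp add: sum_nonneg)
        show "0 \<le> CC" unfolding CC_def by (intro sum_nonneg) auto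
      qed (auto intro!: zero_le_power add_nonneg_nonneg sum_nonneg)
      finally show ?thesis .
    qed
    show "((\<lambda>t. g (x(p := t))) has_vector_derivative D p x) (at (x p))" if p: "p \<in> I" for p x
    proof -
      obtain j i where ji: "p = (j, i)" "i < n j" using p inI by (cases p) auto
      have sl: "slice (x(p := t)) j' = (if j' = j then (slice x j)(i := t) else slice x j')" for t j'
        by (auto simp: slice_def ji fun_eq_iff)
      define R where "R = (\<Sum>j'\<in>UNIV - {j}. \<xi> j' * f j' (slice x j'))"
      have gt: "g (x(p := t)) = iexp (\<xi> j * f j ((slice x j)(i := t)) + R)" for t
        unfolding g_def sl R_def by (subst sum.remove[of _ j]) (auto intro!: arg_cong[of _ _ exp] sum.cong)
      have "((\<lambda>t. \<xi> j * f j ((slice x j)(i := t)) + R) has_real_derivative \<xi> j * partial_deriv i (f j) (slice x j)) (at (x p))"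
        using f_der[OF ji(2), of "slice x j"]
        by (auto intro!: derivative_eq_intros simp: ji slice_def)
      then have "((\<lambda>t. \<xi> j * f j ((slice x j)(i := t)) + R) has_vector_derivative \<xi> j * partial_deriv i (f j) (slice x j)) (at (x p))"
        by (simp add: has_real_derivative_iff_has_vector_derivative)
      from vector_diff_chain_at[OF this iexp_has_vector_derivative[of 1 "\<xi> j * f j ((slice x j)(i := x p)) + R", simplified]]
      have "((\<lambda>t. iexp (\<xi> j * f j ((slice x j)(i := t)) + R)) has_vector_derivative
         (\<xi> j * partial_deriv i (f j) (slice x j)) *\<^sub>R (\<i> * iexp (\<xi> j * f j ((slice x j)(i := x p)) + R))) (at (x p))"
        by (simp add: comp_def fun_upd_def)
      moreover have "iexp (\<xi> j * f j ((slice x j)(i := x p)) + R) = g x"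
        using gt[of "x p"] by simp
      ultimately show ?thesis
        unfolding gt by (simp add: D_def ji scaleR_conv_of_real mult_ac)
    qed
    show gdep: "g x = g y" if "\<And>p. p \<in> I \<Longrightarrow> x p = y p" for x y
      unfolding g_def by (intro arg_cong[of _ _ "\<lambda>r. iexp r"] sum.cong refl arg_cong2[where f="(*)"] f_dep)
        (use that in \<open>auto simp: slice_def inI\<close>)
    show "D p x = D p y" if "p \<in> I" "\<And>p. p \<in> I \<Longrightarrow> x p = y p" for p x y
    proof -
      have "partial_deriv (snd p) (f (fst p)) (slice x (fst p)) = partial_deriv (snd p) (f (fst p)) (slice y (fst p))"
        by (rule d_dep) (use that inI[of "fst p" "snd p"] in \<open>auto simp: slice_def inI\<close>)
      moreover have "g x = g y" by (rule gdep) (rule that(2))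
      ultimately show ?thesis by (simp add: D_def)
    qed
  qed
  have g_eq: "g (\<lambda>p. X (h (fst p) (snd p)) w) = iexp (\<Sum>j\<in>UNIV. \<xi> j * F j w)" for w
    by (simp add: g_def slice_def Feq)
  let ?e = "\<lambda>w. iexp (\<Sum>j\<in>UNIV. \<xi> j * F j w)"
  let ?pd = "\<lambda>p w. partial_deriv (snd p) (f (fst p)) (\<lambda>i. X (h (fst p) i) w)"
  have D_eq: "D p (\<lambda>p. X (h (fst p) (snd p)) w) = \<i> * (\<xi> (fst p) * ?pd p w) * ?e w" for p w
    unfolding D_def g_eq by (simp add: slice_def)
  have Xh_m: "(\<lambda>w. \<lambda>i. X (h j i) w) \<in> borel_measurable M" for j
    by (rule measurable_coordinatewise_then_product) measurable
  have F_m[measurable]: "F j \<in> borel_measurable M" for j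
    unfolding Feq by (rule measurable_compose[OF Xh_m borel_measurable_continuous_onI[OF f_cont]])
  have pd_mom: "all_moments M (?pd p)" if "p \<in> I" for p
  proof (rule all_moments_bound)
    have lt: "snd p < n (fst p)" using that inI[of "fst p" "snd p"] by simp
    show "all_moments M (\<lambda>w. Cf (snd p) (fst p) * (1 + (\<Sum>i<n (fst p). \<bar>X (h (fst p) i) w\<bar>)) ^ kf (snd p) (fst p))"
      by (intro all_moments_mult all_moments_power all_moments_add all_moments_const all_moments_sum all_moments_abs X_all_moments)
    show "?pd p \<in> borel_measurable M"
      by (rule measurable_compose[OF Xh_m borel_measurable_continuous_onI[OF d_cont[OF lt]]])
    show "\<bar>?pd p w\<bar> \<le> \<bar>Cf (snd p) (fst p) * (1 + (\<Sum>i<n (fst p). \<bar>X (h (fst p) i) w\<bar>)) ^ kf (snd p) (fst p)\<bar>" for w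
      using order_trans[OF growth[OF lt] abs_ge_self] .
  qed
  have int: "integrable M (\<lambda>w. inner (u w) (h (fst p) (snd p)) * D p (\<lambda>p. X (h (fst p) (snd p)) w))" if "p \<in> I" for p
  proof (rule Bochner_Integration.integrable_bound)
    show "integrable M (\<lambda>w. \<xi> (fst p) * (inner (u w) (h (fst p) (snd p)) * ?pd p w))"
      by (intro integrable_mult_right mult_moments_integrable(2) pd_mom that)
    have [measurable]: "?pd p \<in> borel_measurable M" using pd_mom[OF that] by (simp add: all_moments_def)
    show "(\<lambda>w. inner (u w) (h (fst p) (snd p)) * D p (\<lambda>p. X (h (fst p) (snd p)) w)) \<in> borel_measurable M"
      unfolding D_eq by measurable
  qed (auto simp: D_eq norm_mult abs_mult)
  have sumD: "(\<Sum>p\<in>I. inner (u w) (h (fst p) (snd p)) * D p (\<lambda>p. X (h (fst p) (snd p)) w)) =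
     \<i> * (inner (u w) (\<Sum>j\<in>UNIV. \<xi> j *\<^sub>R U j w) * ?e w)" for w
  proof -
    have "(\<Sum>p\<in>I. inner (u w) (h (fst p) (snd p)) * D p (\<lambda>p. X (h (fst p) (snd p)) w)) =
      (\<Sum>p\<in>I. \<i> * complex_of_real (\<xi> (fst p) * (?pd p w * inner (u w) (h (fst p) (snd p)))) * ?e w)"
      by (simp add: D_eq mult_ac)
    also have "\<dots> = \<i> * complex_of_real (\<Sum>p\<in>I. \<xi> (fst p) * (?pd p w * inner (u w) (h (fst p) (snd p)))) * ?e w"
      unfolding of_real_sum sum_distrib_left sum_distrib_right ..
    also have "(\<Sum>p\<in>I. \<xi> (fst p) * (?pd p w * inner (u w) (h (fst p) (snd p)))) =
       (\<Sum>j\<in>UNIV. \<Sum>i<n j. \<xi> j * (?pd (j, i) w * inner (u w) (h j i)))"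
      unfolding I_def by (subst sum.Sigma) (auto simp: case_prod_unfold)
    also have "\<dots> = inner (u w) (\<Sum>j\<in>UNIV. \<xi> j *\<^sub>R U j w)"
      by (simp add: Ueq inner_sum_right sum_distrib_left)
    finally show ?thesis by simp
  qed
  have "(CLINT w|M. G w * ?e w) = (CLINT w|M. (\<Sum>p\<in>I. inner (u w) (h (fst p) (snd p)) * D p (\<lambda>p. X (h (fst p) (snd p)) w)))"
    using main int by (simp add: g_eq)
  also have "\<dots> = \<i> * (CLINT w|M. inner (u w) (\<Sum>j\<in>UNIV. \<xi> j *\<^sub>R U j w) * ?e w)"
    unfolding sumD by simp
  finally show ?thesis .
qed

text \<open>Approximate the \<open>F j\<close> by cylindrical variables. On a subsequence these converge almost surely, so the exponentials
  converge boundedly, while the derivatives converge in mean square.\<close>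

lemma divergence_malliavin_iexp:
  fixes F :: "'m::finite \<Rightarrow> 'w \<Rightarrow> real" and DF :: "'m \<Rightarrow> 'w \<Rightarrow> 'h"
  assumes mal: "\<And>j. malliavin_derivative M X (F j) (DF j)"
  shows "(CLINT w|M. G w * iexp (\<Sum>j\<in>UNIV. \<xi> j * F j w)) =
     \<i> * (CLINT w|M. inner (u w) (\<Sum>j\<in>UNIV. \<xi> j *\<^sub>R DF j w) * iexp (\<Sum>j\<in>UNIV. \<xi> j * F j w))"
proof -
  have "\<forall>j. \<exists>Fs Us. (\<forall>k. cylindrical_derivative X (Fs k) (Us k)) \<and> L2_tendsto M Fs (F j) \<and> L2_tendsto M Us (DF j)"
    using mal unfolding malliavin_derivative_def by blast
  then obtain Fs Us where cyl: "\<And>j k. cylindrical_derivative X (Fs j k) (Us j k)"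
    and Fl: "\<And>j. L2_tendsto M (Fs j) (F j)" and Ul: "\<And>j. L2_tendsto M (Us j) (DF j)"
    by metis
  have L: "Fs j k \<in> L2 M" "F j \<in> L2 M" "Us j k \<in> L2 M" "DF j \<in> L2 M" for j k
    using Fl[of j] Ul[of j] by (auto simp: L2_tendsto_def)
  then have [measurable]: "Fs j k \<in> borel_measurable M" "F j \<in> borel_measurable M"
    "Us j k \<in> borel_measurable M" "DF j \<in> borel_measurable M" for j k
    by (auto simp: L2_def)
  have diffL: "integrable M (\<lambda>w. (Fs j k w - F j w)\<^sup>2)" for j k
  proof -
    have "integrable M (\<lambda>w. 2 * (Fs j k w)\<^sup>2 + 2 * (F j w)\<^sup>2)" using L(1)[of j k] L(2)[of j] by (simp add: L2_def)
    then show ?thesis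
    proof (rule Bochner_Integration.integrable_bound)
      have "(a - b)\<^sup>2 \<le> 2 * a\<^sup>2 + 2 * b\<^sup>2" for a b :: real
        using zero_le_power2[of "a + b"] by (simp add: power2_eq_square algebra_simps)
      then show "AE w in M. norm ((Fs j k w - F j w)\<^sup>2) \<le> norm (2 * (Fs j k w)\<^sup>2 + 2 * (F j w)\<^sup>2)" by simp
    qed simp
  qed
  have diffUL: "(\<lambda>w. Us j k w - DF j w) \<in> L2 M" for j k
    unfolding L2_def
  proof (intro CollectI conjI)
    have "integrable M (\<lambda>w. 2 * (norm (Us j k w))\<^sup>2 + 2 * (norm (DF j w))\<^sup>2)" using L(3)[of j k] L(4)[of j] by (simp add: L2_def)
    then show "integrable M (\<lambda>w. (norm (Us j k w - DF j w))\<^sup>2)"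
    proof (rule Bochner_Integration.integrable_bound)
      have "(norm (a - b))\<^sup>2 \<le> 2 * (norm a)\<^sup>2 + 2 * (norm b)\<^sup>2" for a b :: 'h
        using zero_le_power2[of "norm (a + b)"]
        by (simp add: power2_norm_eq_inner inner_add inner_diff inner_commute)
      then show "AE w in M. norm ((norm (Us j k w - DF j w))\<^sup>2) \<le> norm (2 * (norm (Us j k w))\<^sup>2 + 2 * (norm (DF j w))\<^sup>2)" by simp
    qed measurable
  qed measurable
  have "(\<lambda>k. \<Sum>j\<in>UNIV. LINT w|M. (Fs j k w - F j w)\<^sup>2) \<longlonglongrightarrow> (\<Sum>j\<in>(UNIV :: 'm set). 0)"
    by (rule tendsto_sum) (use Fl in \<open>simp add: L2_tendsto_def\<close>)
  then have sumlim: "(\<lambda>k. LINT w|M. norm (\<Sum>j\<in>UNIV. (Fs j k w - F j w)\<^sup>2)) \<longlonglongrightarrow> 0"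
    using diffL by (simp add: sum_nonneg)
  obtain r where r: "strict_mono r" and AEr: "AE w in M. (\<lambda>k. \<Sum>j\<in>UNIV. (Fs j (r k) w - F j w)\<^sup>2) \<longlonglongrightarrow> 0"
    using tendsto_L1_AE_subseq[OF _ sumlim] diffL by auto
  have AEF: "AE w in M. \<forall>j. (\<lambda>k. Fs j (r k) w) \<longlonglongrightarrow> F j w"
    using AEr
  proof eventually_elim
    case (elim w)
    show ?case
    proof
      fix j
      have "(\<lambda>k. (Fs j (r k) w - F j w)\<^sup>2) \<longlonglongrightarrow> 0"
      proof (rule tendsto_sandwich[OF _ _ tendsto_const elim])
        show "\<forall>\<^sub>F k in sequentially. (Fs j (r k) w - F j w)\<^sup>2 \<le> (\<Sum>j\<in>UNIV. (Fs j (r k) w - F j w)\<^sup>2)"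
          by (intro always_eventually allI member_le_sum) auto
      qed simp
      then have "(\<lambda>k. sqrt ((Fs j (r k) w - F j w)\<^sup>2)) \<longlonglongrightarrow> sqrt 0" by (rule tendsto_real_sqrt)
      then have "(\<lambda>k. Fs j (r k) w - F j w) \<longlonglongrightarrow> 0" by (simp add: tendsto_rabs_zero_iff)
      then show "(\<lambda>k. Fs j (r k) w) \<longlonglongrightarrow> F j w" by (simp add: LIM_zero_iff)
    qed
  qed
  let ?e = "\<lambda>w. iexp (\<Sum>j\<in>UNIV. \<xi> j * F j w)" and ?ek = "\<lambda>k w. iexp (\<Sum>j\<in>UNIV. \<xi> j * Fs j (r k) w)"
  have AEe: "AE w in M. (\<lambda>k. ?ek k w) \<longlonglongrightarrow> ?e w"
    using AEF by eventually_elim (auto intro!: tendsto_intros)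
  have dct: "(\<lambda>k. CLINT w|M. f w * ?ek k w) \<longlonglongrightarrow> (CLINT w|M. f w * ?e w)" if f: "integrable M f" for f :: "'w \<Rightarrow> real"
  proof (rule integral_dominated_convergence[where w="\<lambda>w. \<bar>f w\<bar>"])
    show "AE w in M. (\<lambda>k. f w * ?ek k w) \<longlonglongrightarrow> f w * ?e w"
      using AEe by eventually_elim (rule tendsto_mult[OF tendsto_const])
  qed (use f in \<open>auto simp: norm_mult\<close>)
  have iu: "integrable M (\<lambda>w. inner (u w) (DF j w))" "integrable M (\<lambda>w. inner (u w) (Us j k w))" for j k
    by (intro L2_inner_integrable(1) u_L2 L)+
  have ecomp: "integrable M (\<lambda>w. complex_of_real (f w) * iexp (v w))" if "integrable M f" "v \<in> borel_measurable M" for f v :: "'w \<Rightarrow> real"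
    by (rule Bochner_Integration.integrable_bound[OF that(1)]) (use that in \<open>auto simp: norm_mult\<close>)
  have Ulim: "(\<lambda>k. CLINT w|M. inner (u w) (Us j (r k) w) * ?ek k w) \<longlonglongrightarrow> (CLINT w|M. inner (u w) (DF j w) * ?e w)" for j
  proof -
    have small: "(\<lambda>k. CLINT w|M. inner (u w) (Us j (r k) w - DF j w) * ?ek k w) \<longlonglongrightarrow> 0"
    proof (rule Lim_null_comparison)
      show "\<forall>\<^sub>F k in sequentially. norm (CLINT w|M. inner (u w) (Us j (r k) w - DF j w) * ?ek k w) \<le>
         sqrt (LINT w|M. (norm (u w))\<^sup>2) * sqrt (LINT w|M. (norm (Us j (r k) w - DF j w))\<^sup>2)"
      proof (rule always_eventually, rule allI)
        fix k
        have "norm (CLINT w|M. inner (u w) (Us j (r k) w - DF j w) * ?ek k w) \<le> (LINT w|M. norm (complex_of_real (inner (u w) (Us j (r k) w - DF j w)) * ?ek k w))"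
          by (rule integral_norm_bound)
        also have "\<dots> = (LINT w|M. \<bar>inner (u w) (Us j (r k) w - DF j w)\<bar>)" by (simp add: norm_mult)
        also have "\<dots> \<le> sqrt (LINT w|M. (norm (u w))\<^sup>2) * sqrt (LINT w|M. (norm (Us j (r k) w - DF j w))\<^sup>2)"
          by (rule L2_inner_integrable(2)[OF u_L2 diffUL])
        finally show "norm (CLINT w|M. inner (u w) (Us j (r k) w - DF j w) * ?ek k w) \<le>
         sqrt (LINT w|M. (norm (u w))\<^sup>2) * sqrt (LINT w|M. (norm (Us j (r k) w - DF j w))\<^sup>2)" .
      qed
      have "(\<lambda>k. LINT w|M. (norm (Us j (r k) w - DF j w))\<^sup>2) \<longlonglongrightarrow> 0"
        using LIMSEQ_subseq_LIMSEQ[of "\<lambda>k. LINT w|M. (norm (Us j k w - DF j w))\<^sup>2", OF _ r] Ul[of j]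
        by (simp add: L2_tendsto_def comp_def)
      from tendsto_mult[OF tendsto_const[of "sqrt (LINT w|M. (norm (u w))\<^sup>2)"] tendsto_real_sqrt[OF this]]
      show "(\<lambda>k. sqrt (LINT w|M. (norm (u w))\<^sup>2) * sqrt (LINT w|M. (norm (Us j (r k) w - DF j w))\<^sup>2)) \<longlonglongrightarrow> 0" by simp
    qed
    have "(CLINT w|M. inner (u w) (Us j (r k) w) * ?ek k w) = (CLINT w|M. inner (u w) (Us j (r k) w - DF j w) * ?ek k w) + (CLINT w|M. inner (u w) (DF j w) * ?ek k w)" for k
    proof -
      have "integrable M (\<lambda>w. inner (u w) (Us j (r k) w - DF j w))" by (rule L2_inner_integrable(1)[OF u_L2 diffUL])
      then have "(CLINT w|M. inner (u w) (Us j (r k) w - DF j w) * ?ek k w) + (CLINT w|M. inner (u w) (DF j w) * ?ek k w) =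
         (CLINT w|M. inner (u w) (Us j (r k) w - DF j w) * ?ek k w + inner (u w) (DF j w) * ?ek k w)"
        by (intro Bochner_Integration.integral_add[symmetric] ecomp iu) auto
      then show ?thesis by (simp add: inner_diff_right left_diff_distrib)
    qed
    then show ?thesis using tendsto_add[OF small dct[OF iu(1)[of j]]] by simp
  qed
  have dist: "(CLINT w|M. inner (u w) (\<Sum>j\<in>UNIV. \<xi> j *\<^sub>R V j w) * iexp (v w)) = (\<Sum>j\<in>UNIV. \<xi> j * (CLINT w|M. inner (u w) (V j w) * iexp (v w)))"
    if "\<And>j. integrable M (\<lambda>w. inner (u w) (V j w))" and v: "v \<in> borel_measurable M" for V :: "'m \<Rightarrow> 'w \<Rightarrow> 'h" and v :: "'w \<Rightarrow> real"
    using ecomp[OF that(1) v] by (simp add: inner_sum_right sum_distrib_right mult.assoc)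
  have lim: "(\<lambda>k. \<i> * (\<Sum>j\<in>UNIV. \<xi> j * (CLINT w|M. inner (u w) (Us j (r k) w) * ?ek k w))) \<longlonglongrightarrow>
     \<i> * (\<Sum>j\<in>UNIV. \<xi> j * (CLINT w|M. inner (u w) (DF j w) * ?e w))"
    by (intro tendsto_intros Ulim)
  have eq: "\<i> * (\<Sum>j\<in>UNIV. \<xi> j * (CLINT w|M. inner (u w) (Us j (r k) w) * ?ek k w)) = (CLINT w|M. G w * ?ek k w)" for k
    using divergence_chain_iexp[of "\<lambda>j. Fs j (r k)" "\<lambda>j. Us j (r k)" \<xi>, OF cyl] by (subst dist[symmetric]) (auto simp: iu)
  have "(\<lambda>k. CLINT w|M. G w * ?ek k w) \<longlonglongrightarrow> \<i> * (\<Sum>j\<in>UNIV. \<xi> j * (CLINT w|M. inner (u w) (DF j w) * ?e w))"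
    using lim unfolding eq .
  with dct[OF L2_integrable[OF G_L2]] have "(CLINT w|M. G w * ?e w) = \<i> * (\<Sum>j\<in>UNIV. \<xi> j * (CLINT w|M. inner (u w) (DF j w) * ?e w))"
    by (rule LIMSEQ_unique)
  then show ?thesis by (subst dist) (auto simp: iu)
qed

end

end

section \<open>The standard Gaussian measure\<close>

definition gauss :: "(real ^ 'm::finite) measure" where
  "gauss = distr (gauss_pi UNIV) borel vec_lambda"

lemma vec_lambda_measurable[measurable]: "vec_lambda \<in> measurable (gauss_pi UNIV) (borel :: (real ^ 'm::finite) measure)"
proof (rule borel_measurable_euclidean_space[THEN iffD2], rule ballI)
  fix b :: "real ^ 'm" assume "b \<in> Basis"
  then obtain i where b: "b = axis i 1" by (auto simp: Basis_vec_def)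
  have "(\<lambda>z. z i) \<in> borel_measurable (gauss_pi (UNIV :: 'm set))" by measurable
  then show "(\<lambda>z. vec_lambda z \<bullet> b) \<in> borel_measurable (gauss_pi UNIV)"
    by (simp add: b inner_axis)
qed

lemma sets_gauss[simp, measurable_cong]: "sets gauss = sets borel"
  and space_gauss[simp]: "space gauss = UNIV"
  by (simp_all add: gauss_def)

lemma prob_space_gauss: "prob_space (gauss :: (real ^ 'm::finite) measure)"
  unfolding gauss_def by (rule prob_space.prob_space_distr[OF prob_space_gauss_pi]) measurable

interpretation gauss: prob_space "gauss :: (real ^ 'm::finite) measure"
  by (rule prob_space_gauss)

lemma borel_measurable_vec_nth[measurable]: "(\<lambda>x::real ^ 'm::finite. x $ i) \<in> borel_measurable borel"
  by (intro borel_measurable_continuous_onI continuous_intros)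

lemma gauss_integral:
  fixes f :: "real ^ 'm::finite \<Rightarrow> 'b::{banach, second_countable_topology}"
  assumes [measurable]: "f \<in> borel_measurable borel"
  shows "(LINT z|gauss. f z) = (LINT z|gauss_pi UNIV. f (vec_lambda z))"
    and "integrable gauss f \<longleftrightarrow> integrable (gauss_pi UNIV) (\<lambda>z. f (vec_lambda z))"
  by (simp_all add: gauss_def integral_distr integrable_distr_eq)

lemma gauss_component: "distr gauss borel (\<lambda>z::real ^ 'm::finite. z $ i) = std_gauss"
proof -
  have "distr gauss borel (\<lambda>z::real ^ 'm. z $ i) = distr (gauss_pi UNIV) borel (\<lambda>z. vec_lambda z $ i)"
    unfolding gauss_def by (subst distr_distr) (auto simp: comp_def)
  then show ?thesis using gauss_pi_component[of UNIV i] by simp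
qed

lemma gauss_all_moments: "all_moments gauss (\<lambda>z::real ^ 'm::finite. z $ i)"
proof -
  have "all_moments (distr gauss borel (\<lambda>z::real ^ 'm. z $ i)) (\<lambda>x. x)"
    unfolding gauss_component by (rule all_moments_std_gauss)
  then show ?thesis by (subst (asm) all_moments_distr) auto
qed

text \<open>The coordinates are independent.\<close>

lemma gauss_integral_prod:
  fixes f :: "'m::finite \<Rightarrow> real \<Rightarrow> 'b::{real_normed_field, banach, second_countable_topology}"
  assumes "\<And>k. integrable std_gauss (f k)"
  shows "(LINT z|gauss. (\<Prod>k\<in>UNIV. f k (z $ k))) = (\<Prod>k\<in>UNIV. LINT x|std_gauss. f k x)"
proof -
  have [measurable]: "f k \<in> borel_measurable borel" for k using assms[of k] by simp
  show ?thesis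
    by (subst gauss_integral(1)) (use gauss_pi.product_integral_prod[of UNIV f] assms in auto)
qed

lemma std_gauss_iexp: "(CLINT x|std_gauss. iexp (t * x)) = exp (- (t\<^sup>2) / 2)"
  using char_std_normal_distribution by (simp add: char_def fun_eq_iff)

lemma iexp_poly_integrable:
  assumes "all_moments N f" "v \<in> borel_measurable N"
  shows "integrable N (\<lambda>x. complex_of_real (f x) * iexp (v x))"
  by (rule Bochner_Integration.integrable_bound[OF all_moments_integrable[OF assms(1)]])
     (use assms in \<open>auto simp: norm_mult all_moments_def\<close>)

lemma std_gauss_iexp_integrable: "integrable std_gauss (\<lambda>x. iexp (t * x))"
  using iexp_poly_integrable[OF std_gauss.all_moments_const, of "\<lambda>x. t * x" 1] by simp

lemma std_gauss_square_iexp: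
  "(CLINT x|std_gauss. (complex_of_real x)\<^sup>2 * iexp (t * x)) = (1 - t\<^sup>2) * (CLINT x|std_gauss. iexp (t * x))"
proof -
  have "(CLINT x|std_gauss. x *\<^sub>R (complex_of_real x * iexp (t * x))) = (CLINT x|std_gauss. iexp (t * x) + complex_of_real x * (\<i> * t * iexp (t * x)))"
  proof (rule std_gauss_integration_by_parts[where C="1 + \<bar>t\<bar>" and k=1])
    show "((\<lambda>x. complex_of_real x * iexp (t * x)) has_vector_derivative (iexp (t * x) + complex_of_real x * (\<i> * t * iexp (t * x)))) (at x)" for x
      by (rule has_vector_derivative_eq_rhs[OF has_vector_derivative_mult[OF has_vector_derivative_of_real[OF DERIV_ident] iexp_has_vector_derivative]])
         simp
    show "norm (complex_of_real x * iexp (t * x)) \<le> (1 + \<bar>t\<bar>) * (1 + \<bar>x\<bar>) ^ 1" for x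
      by (simp add: norm_mult algebra_simps)
    show "norm (iexp (t * x) + complex_of_real x * (\<i> * t * iexp (t * x))) \<le> (1 + \<bar>t\<bar>) * (1 + \<bar>x\<bar>) ^ 1" for x
      by (rule order_trans[OF norm_triangle_ineq]) (simp add: norm_mult algebra_simps)
  qed (intro continuous_intros)
  also have "\<dots> = (CLINT x|std_gauss. iexp (t * x)) + \<i> * t * (CLINT x|std_gauss. x * iexp (t * x))"
  proof -
    have "integrable std_gauss (\<lambda>x. iexp (t * x))" using iexp_poly_integrable[OF std_gauss.all_moments_const, of "\<lambda>x. t * x" 1] by simp
    moreover have "integrable std_gauss (\<lambda>x. \<i> * t * (complex_of_real x * iexp (t * x)))"
      by (intro integrable_mult_right iexp_poly_integrable all_moments_std_gauss) simp
    moreover have "complex_of_real x * (\<i> * t * iexp (t * x)) = \<i> * t * (complex_of_real x * iexp (t * x))" for x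
      by simp
    ultimately show ?thesis
      by (simp only: Bochner_Integration.integral_add integral_mult_right_zero)
  qed
  finally show ?thesis
    unfolding std_gauss_stein_iexp by (simp add: scaleR_conv_of_real power2_eq_square algebra_simps)
qed

text \<open>The Hermite polynomials of order two in several variables: the Hessian of the Gaussian density is the density times
  \<open>H2\<close>.\<close>

definition H2 :: "'m \<Rightarrow> 'm \<Rightarrow> real ^ 'm \<Rightarrow> real" where
  "H2 i j z = z $ i * z $ j - (if i = j then 1 else 0)"

lemma H2_measurable[measurable]: "H2 i j \<in> borel_measurable borel"
  unfolding H2_def[abs_def] by measurable

lemma H2_moments: "all_moments gauss (H2 i j :: real ^ 'm::finite \<Rightarrow> real)"
proof -
  have "all_moments gauss (\<lambda>z::real ^ 'm. z $ i * z $ j + (if i = j then - 1 else 0))"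
    by (intro all_moments_add all_moments_times gauss_all_moments gauss.all_moments_const)
  then show ?thesis by (rule all_moments_bound) (auto simp: H2_def)
qed

lemma gauss_iexp: "(CLINT z|gauss. iexp (\<xi> \<bullet> (z :: real ^ 'm::finite))) = exp (- (norm \<xi>)\<^sup>2 / 2)"
proof -
  have e: "iexp (\<xi> \<bullet> z) = (\<Prod>k\<in>UNIV. iexp (\<xi> $ k * z $ k))" for z :: "real ^ 'm"
    by (simp add: inner_vec_def sum_distrib_left exp_sum)
  have "(CLINT z|gauss. iexp (\<xi> \<bullet> (z :: real ^ 'm))) = (\<Prod>k\<in>UNIV. CLINT x|std_gauss. iexp (\<xi> $ k * x))"
    unfolding e
    by (rule gauss_integral_prod[of "\<lambda>k x. iexp (\<xi> $ k * x)"])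
       (rule std_gauss_iexp_integrable)
  also have "\<dots> = of_real (exp (- (\<Sum>k\<in>UNIV. (\<xi> $ k)\<^sup>2) / 2))"
    unfolding std_gauss_iexp of_real_prod[symmetric] exp_sum[symmetric, OF finite]
    by (simp add: sum_divide_distrib sum_negf exp_sum[symmetric])
  also have "(\<Sum>k\<in>UNIV. (\<xi> $ k)\<^sup>2) = (norm \<xi>)\<^sup>2"
    by (simp add: norm_vec_def L2_set_def sum_nonneg)
  finally show ?thesis .
qed

text \<open>The integrand is a product over the coordinates, so this is a computation with one-dimensional Fourier integrals. The
  factor of \<open>H2\<close> acts as the second derivative \<open>\<partial>\<^sub>i \<partial>\<^sub>j\<close> of the exponential.\<close>

lemma gauss_H2_iexp:
  "(CLINT z|gauss. H2 i j z * iexp (\<xi> \<bullet> (z :: real ^ 'm::finite))) = - (\<xi> $ i * \<xi> $ j) * exp (- (norm \<xi>)\<^sup>2 / 2)"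
proof -
  let ?e = "\<lambda>k x. iexp (\<xi> $ k * x)"
  have e: "iexp (\<xi> \<bullet> z) = (\<Prod>k\<in>UNIV. ?e k (z $ k))" for z :: "real ^ 'm"
    by (simp add: inner_vec_def sum_distrib_left exp_sum)
  let ?f = "\<lambda>k x. (if k = i then complex_of_real x else 1) * (if k = j then complex_of_real x else 1) * ?e k x"
  have fi: "integrable std_gauss (?f k)" for k
  proof -
    have "all_moments std_gauss (\<lambda>x. (if k = i then x else 1) * (if k = j then x else 1))"
      by (cases "k = i"; cases "k = j"; simp add: all_moments_times all_moments_std_gauss std_gauss.all_moments_const)
    from iexp_poly_integrable[OF this, of "\<lambda>x. \<xi> $ k * x"] show ?thesis
      by (cases "k = i"; cases "k = j"; simp)
  qed
  have pz: "(\<Prod>k\<in>UNIV. ?f k (z $ k)) = z $ i * z $ j * iexp (\<xi> \<bullet> z)" for z :: "real ^ 'm"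
    unfolding e by (simp add: prod.distrib prod.delta)
  let ?c = "\<lambda>k. CLINT x|std_gauss. ?e k x"
  have "(CLINT z|gauss. z $ i * z $ j * iexp (\<xi> \<bullet> z)) = (\<Prod>k\<in>UNIV. CLINT x|std_gauss. ?f k x)"
    unfolding pz[symmetric] by (rule gauss_integral_prod[of ?f]) (rule fi)
  also have "\<dots> = (\<Prod>k\<in>UNIV. (if k = i \<and> k = j then 1 else 0) * ?c k +
       (if k = i then \<i> * \<xi> $ k else 1) * (if k = j then \<i> * \<xi> $ k else 1) * ?c k)"
  proof (rule prod.cong[OF refl])
    fix k
    have p2: "(CLINT x|std_gauss. complex_of_real x * (complex_of_real x * ?e k x)) = (1 - (\<xi> $ k)\<^sup>2) * ?c k"
      using std_gauss_square_iexp[of "\<xi> $ k"] by (simp add: power2_eq_square mult.assoc)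
    show "(CLINT x|std_gauss. ?f k x) = (if k = i \<and> k = j then 1 else 0) * ?c k +
       (if k = i then \<i> * \<xi> $ k else 1) * (if k = j then \<i> * \<xi> $ k else 1) * ?c k"
      using p2 std_gauss_stein_iexp[of "\<xi> $ k"]
      by (auto simp: power2_eq_square algebra_simps)
  qed
  also have "\<dots> = ((if i = j then 1 else 0) - \<xi> $ i * \<xi> $ j) * (\<Prod>k\<in>UNIV. ?c k)"
  proof (cases "i = j")
    case True
    have "(\<Prod>k\<in>UNIV. (if k = i \<and> k = j then 1 else 0) * ?c k +
       (if k = i then \<i> * \<xi> $ k else 1) * (if k = j then \<i> * \<xi> $ k else 1) * ?c k) =
      (\<Prod>k\<in>UNIV. (if k = i then complex_of_real (1 - \<xi> $ i * \<xi> $ i) else 1) * ?c k)"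
      using True by (intro prod.cong) (auto simp: algebra_simps)
    then show ?thesis using True by (simp add: prod.distrib prod.delta)
  next
    case False
    have "(\<Prod>k\<in>UNIV. (if k = i \<and> k = j then 1 else 0) * ?c k +
       (if k = i then \<i> * \<xi> $ k else 1) * (if k = j then \<i> * \<xi> $ k else 1) * ?c k) =
      (\<Prod>k\<in>UNIV. (if k = i then \<i> * \<xi> $ k else 1) * (if k = j then \<i> * \<xi> $ k else 1) * ?c k)"
      using False by (intro prod.cong) auto
    also have "\<dots> = (\<i> * \<xi> $ i) * (\<i> * \<xi> $ j) * (\<Prod>k\<in>UNIV. ?c k)"
      by (simp add: prod.distrib prod.delta)
    finally show ?thesis using False by (simp add: algebra_simps)
  qed
  also have c: "(\<Prod>k\<in>UNIV. ?c k) = (CLINT z|gauss. iexp (\<xi> \<bullet> (z :: real ^ 'm)))"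
    unfolding e
    by (rule gauss_integral_prod[symmetric, of "\<lambda>k x. iexp (\<xi> $ k * x)"])
       (rule std_gauss_iexp_integrable)
  finally have main: "(CLINT z|gauss. z $ i * z $ j * iexp (\<xi> \<bullet> (z :: real ^ 'm))) = ((if i = j then 1 else 0) - \<xi> $ i * \<xi> $ j) * (CLINT z|gauss. iexp (\<xi> \<bullet> (z :: real ^ 'm)))" .
  have 1: "integrable gauss (\<lambda>z::real ^ 'm. complex_of_real (z $ i * z $ j) * iexp (\<xi> \<bullet> z))"
    by (intro iexp_poly_integrable all_moments_times gauss_all_moments) measurable
  have 2: "integrable gauss (\<lambda>z::real ^ 'm. (if i = j then 1 else 0) * iexp (\<xi> \<bullet> z))"
    using iexp_poly_integrable[OF gauss.all_moments_const, of "\<lambda>z. \<xi> \<bullet> z" 1] by simp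
  have "(CLINT z|gauss. H2 i j z * iexp (\<xi> \<bullet> (z :: real ^ 'm))) =
     (CLINT z|gauss. complex_of_real (z $ i * z $ j) * iexp (\<xi> \<bullet> z) - (if i = j then 1 else 0) * iexp (\<xi> \<bullet> z))"
    by (intro Bochner_Integration.integral_cong refl) (simp add: H2_def left_diff_distrib)
  also have "\<dots> = (CLINT z|gauss. complex_of_real (z $ i * z $ j) * iexp (\<xi> \<bullet> z)) - (CLINT z|gauss. (if i = j then 1 else 0) * iexp (\<xi> \<bullet> z))"
    by (rule Bochner_Integration.integral_diff[OF 1 2])
  also have "\<dots> = - (\<xi> $ i * \<xi> $ j) * (CLINT z|gauss. iexp (\<xi> \<bullet> (z :: real ^ 'm)))"
    using main by (simp add: algebra_simps)
  finally show ?thesis by (simp only: gauss_iexp of_real_mult)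
qed

lemma gauss_H2_mean: "(LINT z|gauss. H2 i j (z :: real ^ 'm::finite)) = 0"
proof -
  have "complex_of_real (LINT z|gauss. H2 i j (z :: real ^ 'm)) = (CLINT z|gauss. H2 i j (z :: real ^ 'm) * iexp (0 \<bullet> z))"
    by simp
  also have "\<dots> = 0" unfolding gauss_H2_iexp by simp
  finally show ?thesis by simp
qed

lemma gauss_H2_second_moment: "(LINT z|gauss. (H2 i j (z :: real ^ 'm::finite))\<^sup>2) \<le> 2"
proof (cases "i = j")
  case True
  have "(LINT z|gauss. (H2 i j (z :: real ^ 'm))\<^sup>2) = (LINT x|distr gauss borel (\<lambda>z::real ^ 'm. z $ i). (x * x - 1)\<^sup>2)"
    using True by (subst integral_distr) (auto simp: H2_def)
  also have "\<dots> = (LINT x|std_gauss. x ^ (2 * 2) - 2 * x ^ (2 * 1) + 1)"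
    unfolding gauss_component by (intro Bochner_Integration.integral_cong) (auto simp: power2_eq_square power4_eq_xxxx algebra_simps)
  also have "\<dots> = 2"
    using std_normal_distribution_even_moments[of 2] std_normal_distribution_even_moments[of 1] std_gauss.prob_space
    by (simp add: fact_numeral)
  finally show ?thesis by simp
next
  case False
  let ?f = "\<lambda>k x::real. (if k = i then x\<^sup>2 else 1) * (if k = j then x\<^sup>2 else 1)"
  have i2: "integrable std_gauss (\<lambda>x. x\<^sup>2)" by (rule all_moments_square_integrable[OF all_moments_std_gauss])
  have e2: "(LINT x|std_gauss. x\<^sup>2) = 1" using std_normal_distribution_even_moments(1)[of 1] by simp
  have H2sq: "(H2 i j z)\<^sup>2 = (\<Prod>k\<in>UNIV. ?f k (z $ k))" for z :: "real ^ 'm"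
    using False by (simp add: H2_def prod.distrib prod.delta power_mult_distrib)
  have "(LINT z|gauss. (H2 i j (z :: real ^ 'm))\<^sup>2) = (\<Prod>k\<in>UNIV. LINT x|std_gauss. ?f k x)"
  proof -
    have "integrable std_gauss (?f k)" for k
      using False i2 by (cases "k = i"; cases "k = j"; simp)
    from gauss_integral_prod[of ?f, OF this] show ?thesis by (simp only: H2sq)
  qed
  also have "\<dots> = (\<Prod>k\<in>(UNIV :: 'm set). 1)"
  proof (rule prod.cong[OF refl])
    show "(LINT x|std_gauss. ?f k x) = 1" for k
      using False e2 std_gauss.prob_space by (cases "k = i"; cases "k = j"; simp)
  qed
  finally show ?thesis by simp
qed

lemma gauss_square_mean: "(LINT z|gauss. ((z :: real ^ 'm::finite) $ i)\<^sup>2) = 1"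
proof -
  have "(LINT z|gauss. ((z :: real ^ 'm) $ i)\<^sup>2) = (LINT x|distr gauss borel (\<lambda>z::real ^ 'm. z $ i). x\<^sup>2)"
    by (subst integral_distr) auto
  then show ?thesis unfolding gauss_component using std_normal_distribution_even_moments(1)[of 1] by simp
qed

lemma gauss_abs_mean: "(LINT z|gauss. \<bar>(z :: real ^ 'm::finite) $ i\<bar>) \<le> 1"
proof -
  have "(LINT z|gauss. \<bar>(z :: real ^ 'm) $ i\<bar>) \<le> (LINT z|gauss. (1 + (z $ i)\<^sup>2) / 2)"
  proof (rule integral_mono)
    show "integrable gauss (\<lambda>z::real ^ 'm. (1 + (z $ i)\<^sup>2) / 2)"
      using all_moments_square_integrable[OF gauss_all_moments[of i]] by simp
    show "\<bar>z $ i\<bar> \<le> (1 + (z $ i)\<^sup>2) / 2" for z :: "real ^ 'm"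
      using zero_le_power2[of "\<bar>z $ i\<bar> - 1"] by (simp add: power2_diff)
  qed (use all_moments_integrable[OF all_moments_abs[OF gauss_all_moments[of i]]] in simp)
  also have "\<dots> = 1"
    using all_moments_square_integrable[OF gauss_all_moments[of i]] gauss_square_mean[of i] gauss.prob_space by simp
  finally show ?thesis .
qed

section \<open>The Stein identity and its interpolation formula\<close>

text \<open>The matrix \<open>V\<close> is a Stein kernel of \<open>Y\<close>: formally \<open>E \<langle>Y, \<nabla>f(Y)\<rangle> = E \<langle>V, Hess f(Y)\<rangle>\<close> for all \<open>f\<close>. Only
  exponentials are tested, as these determine everything else, and \<open>V = I\<close> characterizes the standard Gaussian law.\<close>

definition stein_identity :: "'w measure \<Rightarrow> ('w \<Rightarrow> real ^ 'm) \<Rightarrow> ('w \<Rightarrow> real ^ 'm ^ 'm) \<Rightarrow> bool" where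
  "stein_identity M Y V \<longleftrightarrow> (\<forall>\<xi> c.
     (CLINT w|M. (\<xi> \<bullet> Y w) * iexp (c * (\<xi> \<bullet> Y w))) =
     \<i> * c * (CLINT w|M. (\<xi> \<bullet> (V w *v \<xi>)) * iexp (c * (\<xi> \<bullet> Y w))))"

text \<open>The uniform law on the angles from \<open>a\<close> to \<open>\<pi>/2\<close>. The normalization makes all product measures below
  probability measures; it is undone by the factor \<open>\<pi>/2 - a\<close> in \<open>stein_kernel\<close>.\<close>

definition angles :: "real \<Rightarrow> real measure" where
  "angles a = density lborel (\<lambda>t. ennreal (indicator {a..pi/2} t / (pi/2 - a)))"

lemma sets_angles[simp, measurable_cong]: "sets (angles a) = sets borel"
  and space_angles[simp]: "space (angles a) = UNIV"
  by (simp_all add: angles_def)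

lemma prob_space_angles:
  assumes "a < pi/2"
  shows "prob_space (angles a)"
proof (rule prob_spaceI)
  have "emeasure (angles a) (space (angles a)) = (\<integral>\<^sup>+t. ennreal (1 / (pi/2 - a)) * indicator {a..pi/2} t \<partial>lborel)"
    unfolding angles_def
    by (subst emeasure_density) (auto intro!: nn_integral_cong split: split_indicator)
  also have "\<dots> = ennreal (1 / (pi/2 - a)) * ennreal (pi/2 - a)"
    using assms by (subst nn_integral_cmult_indicator) auto
  also have "\<dots> = 1" using assms by (subst ennreal_mult[symmetric]) auto
  finally show "emeasure (angles a) (space (angles a)) = 1" .
qed

lemma AE_angles: "AE t in angles a. a \<le> t \<and> t \<le> pi/2"
  unfolding angles_def by (subst AE_density) (auto split: split_indicator)

lemma angles_integral:
  fixes f :: "real \<Rightarrow> 'b::{banach, second_countable_topology}"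
  assumes "a < pi/2" and [measurable]: "f \<in> borel_measurable borel"
  shows "(LINT t|angles a. (pi/2 - a) *\<^sub>R f t) = (LINT t|lborel. indicator {a..pi/2} t *\<^sub>R f t)"
  unfolding angles_def using assms by (subst integral_density) (auto intro!: Bochner_Integration.integral_cong)

lemma angles_integrable_bounded:
  fixes f :: "real \<Rightarrow> 'b::{banach, second_countable_topology}"
  assumes "a < pi/2" and [measurable]: "f \<in> borel_measurable borel"
    and "\<And>t. a \<le> t \<Longrightarrow> t \<le> pi/2 \<Longrightarrow> norm (f t) \<le> B"
  shows "integrable (angles a) f"
proof -
  interpret prob_space "angles a" by (rule prob_space_angles[OF assms(1)])
  show ?thesis
    by (rule integrable_const_bound[where B=B]) (use AE_angles[of a] assms(3) in auto)
qed

text \<open>An angle and an independent standard Gaussian vector.\<close>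

definition mixer :: "real \<Rightarrow> (real \<times> (real ^ 'm::finite)) measure" where
  "mixer a = angles a \<Otimes>\<^sub>M gauss"

definition rot :: "real \<Rightarrow> real ^ 'm \<Rightarrow> real ^ 'm \<Rightarrow> real ^ 'm" where
  "rot t y z = cos t *\<^sub>R y + sin t *\<^sub>R z"

lemma rot_measurable[measurable]:
  assumes [measurable]: "f \<in> borel_measurable M" "g \<in> borel_measurable M" "h \<in> borel_measurable M"
  shows "(\<lambda>x. rot (f x) (g x) (h x :: real ^ 'm::finite)) \<in> borel_measurable M"
  unfolding rot_def by measurable

definition stein_kernel :: "real \<Rightarrow> 'm \<Rightarrow> 'm \<Rightarrow> real \<times> (real ^ 'm::finite) \<Rightarrow> real" where
  "stein_kernel a i j q = (pi/2 - a) * (cos (fst q) / sin (fst q)) * H2 i j (snd q)"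

text \<open>Up to the sign and the truncation at the angle \<open>a\<close>, this is the second derivative \<open>\<partial>\<^sub>i \<partial>\<^sub>j\<close> of the solution of the Stein equation for
  \<open>h\<close>, the two derivatives having been moved from \<open>h\<close> to the Gaussian density.\<close>

definition stein_hessian :: "real \<Rightarrow> (real ^ 'm::finite \<Rightarrow> real) \<Rightarrow> 'm \<Rightarrow> 'm \<Rightarrow> real ^ 'm \<Rightarrow> real" where
  "stein_hessian a h i j y = (LINT q|mixer a. stein_kernel a i j q * h (rot (fst q) y (snd q)))"

lemma sets_mixer[measurable_cong, simp]: "sets (mixer a) = sets (borel \<Otimes>\<^sub>M borel)"
  unfolding mixer_def by (rule sets_pair_measure_cong) auto

lemma space_mixer[simp]: "space (mixer a) = UNIV"
  by (simp add: mixer_def space_pair_measure)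

lemma prob_space_mixer:
  assumes "a < pi/2" shows "prob_space (mixer a :: (real \<times> (real ^ 'm::finite)) measure)"
proof -
  interpret prob_space "angles a" by (rule prob_space_angles[OF assms])
  interpret pair_prob_space "angles a" "gauss :: (real ^ 'm) measure" ..
  show ?thesis unfolding mixer_def by (rule prob_space_axioms)
qed

lemma stein_kernel_measurable[measurable]: "stein_kernel a i j \<in> borel_measurable (borel \<Otimes>\<^sub>M borel)"
  unfolding stein_kernel_def[abs_def] by measurable

lemma cot_angles_bound:
  assumes "0 < a" "a \<le> t" "t \<le> pi/2"
  shows "0 \<le> cos t / sin t" "cos t / sin t \<le> 1 / sin a" "0 < sin t" "0 < sin a"
proof -
  show s: "0 < sin t" "0 < sin a" using assms pi_gt_zero by (auto intro!: sin_gt_zero)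
  show "0 \<le> cos t / sin t" using assms s by (intro divide_nonneg_pos cos_ge_zero) auto
  have "sin a \<le> sin t" using assms by (intro sin_monotone_2pi_le) auto
  then show "cos t / sin t \<le> 1 / sin a" using s by (intro frac_le) auto
qed

lemma integrable_cot_angles:
  assumes "0 < a" "a < pi/2"
  shows "integrable (angles a) (\<lambda>t. cos t / sin t)"
proof (rule angles_integrable_bounded[OF assms(2), where B="1 / sin a"])
  show "norm (cos t / sin t) \<le> 1 / sin a" if "a \<le> t" "t \<le> pi/2" for t
    using cot_angles_bound[OF assms(1) that] by (simp only: real_norm_def abs_of_nonneg)
qed measurable

lemma integrable_stein_kernel:
  assumes "0 < a" "a < pi/2"
  shows "integrable (mixer a) (stein_kernel a i j :: real \<times> (real ^ 'm::finite) \<Rightarrow> real)"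
  unfolding stein_kernel_def mixer_def
  by (rule integrable_product_pair(1)[OF prob_space_angles[OF assms(2)] prob_space_gauss
        integrable_mult_right[OF integrable_cot_angles[OF assms]] all_moments_integrable[OF H2_moments]])

context
  fixes M :: "'w measure" and Y :: "'w \<Rightarrow> real ^ 'm::finite" and V :: "'w \<Rightarrow> real ^ 'm ^ 'm" and a :: real
  assumes M: "prob_space M" and Ym[measurable]: "Y \<in> borel_measurable M"
    and Yi: "\<And>i. integrable M (\<lambda>w. Y w $ i)"
    and Vi: "\<And>i j. integrable M (\<lambda>w. V w $ i $ j)"
    and stein: "stein_identity M Y V"
    and a: "0 < a" "a < pi/2"
begin

interpretation M: prob_space M by (rule M)
interpretation A: prob_space "angles a" by (rule prob_space_angles[OF a(2)])
interpretation Q: prob_space "mixer a :: (real \<times> (real ^ 'm)) measure" by (rule prob_space_mixer[OF a(2)])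
interpretation MA: pair_prob_space M "angles a" ..
interpretation AG: pair_prob_space "angles a" "gauss :: (real ^ 'm) measure" ..
interpretation P: pair_prob_space M "mixer a :: (real \<times> (real ^ 'm)) measure" ..

abbreviation (input) "\<B> w i j \<equiv> V w $ i $ j - (if i = j then 1 else 0)"

lemma V_minus_identity_integrable: "integrable M (\<lambda>w. \<B> w i j)"
  using Vi by simp

lemma quadratic_integrable: "integrable M (\<lambda>w. \<xi> \<bullet> (V w *v \<xi>))"
  unfolding inner_vec_def matrix_vector_mult_def using Vi by (simp add: sum_distrib_left)

lemma linear_integrable: "integrable M (\<lambda>w. \<xi> \<bullet> Y w)"
  unfolding inner_vec_def using Yi by simp

lemma stein_iexp_integrable:
  assumes "integrable M f"
  shows "integrable M (\<lambda>w. complex_of_real (f w) * iexp (c * (\<xi> \<bullet> Y w)))"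
  by (rule Bochner_Integration.integrable_bound[OF assms]) (use assms in \<open>auto simp: norm_mult\<close>)

text \<open>By the Stein identity, the part with \<open>\<langle>\<xi>, V \<xi>\<rangle>\<close> can be replaced by one with \<open>\<langle>\<xi>, Y\<rangle>\<close>. Then the integrand is the
  derivative in \<open>t\<close> of the Fourier transform \<open>e t * iexp (cos t * \<langle>\<xi>, Y\<rangle>)\<close> of \<open>cos t Y + sin t Z\<close>, given \<open>Y\<close>.\<close>

lemma stein_interpolation_fourier:
  fixes \<xi> :: "real ^ 'm"
  defines "e \<equiv> \<lambda>t::real. exp (- ((sin t)\<^sup>2 * (norm \<xi>)\<^sup>2) / 2)"
  shows "(CLINT w|M. CLINT t|angles a. complex_of_real ((pi/2 - a) * (sin t * cos t * e t) * (\<xi> \<bullet> (V w *v \<xi>) - (norm \<xi>)\<^sup>2)) * iexp (cos t * (\<xi> \<bullet> Y w)))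
    = e (pi/2) - e a * (CLINT w|M. iexp (cos a * (\<xi> \<bullet> Y w)))"
proof -
  let ?S = "\<lambda>w. \<xi> \<bullet> Y w" and ?q = "\<lambda>w. \<xi> \<bullet> (V w *v \<xi>)" and ?n = "(norm \<xi>)\<^sup>2"
  define l where "l = pi/2 - a"
  define c1 c2 where "c1 t = sin t * cos t * e t" and "c2 t = sin t * e t" for t
  have e_m[measurable]: "e \<in> borel_measurable borel" unfolding e_def by measurable
  have e1: "0 \<le> e t" "e t \<le> 1" for t by (auto simp: e_def)
  have c_m[measurable]: "c1 \<in> borel_measurable borel" "c2 \<in> borel_measurable borel"
    unfolding c1_def[abs_def] c2_def[abs_def] by measurable
  have cb: "\<bar>c1 t\<bar> \<le> 1" "\<bar>c2 t\<bar> \<le> 1" for t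
    unfolding c1_def c2_def abs_mult using e1[of t] by (auto intro!: mult_le_one)
  have [measurable]: "?q \<in> borel_measurable M" "?S \<in> borel_measurable M" using quadratic_integrable linear_integrable by auto
  define F1 where "F1 w t = complex_of_real (l * c1 t * (?q w - ?n)) * iexp (cos t * ?S w)" for w t
  define F2 where "F2 s t = l *\<^sub>R ((complex_of_real (- c1 t * ?n) - \<i> * complex_of_real (c2 t * s)) * iexp (cos t * s))" for s t
  have dom: "integrable (M \<Otimes>\<^sub>M angles a) (\<lambda>p. \<bar>l\<bar> * f (fst p))" if "integrable M f" for f :: "'w \<Rightarrow> real"
    by (intro integrable_mult_right pair_prob_fst(1)[OF M A.prob_space_axioms that])
  have I1: "integrable (M \<Otimes>\<^sub>M angles a) (\<lambda>(w, t). F1 w t)"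
  proof (rule Bochner_Integration.integrable_bound[OF dom[of "\<lambda>w. \<bar>?q w - ?n\<bar>"]])
    have "norm (F1 w t) \<le> \<bar>l\<bar> * \<bar>?q w - ?n\<bar>" for w t
    proof -
      have "norm (F1 w t) = \<bar>l\<bar> * (\<bar>c1 t\<bar> * \<bar>?q w - ?n\<bar>)"
        unfolding F1_def norm_mult norm_of_real abs_mult by simp
      also have "\<dots> \<le> \<bar>l\<bar> * (1 * \<bar>?q w - ?n\<bar>)" by (intro mult_left_mono mult_right_mono cb) auto
      finally show ?thesis by simp
    qed
    then show "AE x in M \<Otimes>\<^sub>M angles a. norm (case x of (w, t) \<Rightarrow> F1 w t) \<le> norm (\<bar>l\<bar> * \<bar>?q (fst x) - ?n\<bar>)"
      by (auto simp: case_prod_unfold)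
  qed (use quadratic_integrable in \<open>auto simp: F1_def\<close>)
  have I2: "integrable (M \<Otimes>\<^sub>M angles a) (\<lambda>(w, t). F2 (?S w) t)"
  proof (rule Bochner_Integration.integrable_bound[OF dom[of "\<lambda>w. ?n + \<bar>?S w\<bar>"]])
    have "norm (F2 (?S w) t) \<le> \<bar>l\<bar> * (?n + \<bar>?S w\<bar>)" for w t
    proof -
      have "norm (complex_of_real (- c1 t * ?n) - \<i> * complex_of_real (c2 t * ?S w)) \<le> \<bar>c1 t\<bar> * ?n + \<bar>c2 t\<bar> * \<bar>?S w\<bar>"
        by (rule order_trans[OF norm_triangle_ineq4]) (simp add: norm_mult abs_mult del: of_real_mult of_real_minus)
      also have "\<dots> \<le> 1 * ?n + 1 * \<bar>?S w\<bar>" by (intro add_mono mult_right_mono cb) auto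
      finally show ?thesis unfolding F2_def by (simp add: norm_mult mult_left_mono del: of_real_mult of_real_minus)
    qed
    then show "AE x in M \<Otimes>\<^sub>M angles a. norm (case x of (w, t) \<Rightarrow> F2 (?S w) t) \<le> norm (\<bar>l\<bar> * (?n + \<bar>?S (fst x)\<bar>))"
      by (auto simp: case_prod_unfold)
  qed (use linear_integrable in \<open>auto simp: F2_def\<close>)
  have inner_eq: "(CLINT w|M. F1 w t) = (CLINT w|M. F2 (?S w) t)" for t
  proof -
    have i1: "integrable M (\<lambda>w. complex_of_real (?q w) * iexp (cos t * ?S w))"
      "integrable M (\<lambda>w. complex_of_real (?S w) * iexp (cos t * ?S w))"
      "integrable M (\<lambda>w. iexp (cos t * ?S w))"
      using stein_iexp_integrable[OF quadratic_integrable] stein_iexp_integrable[OF linear_integrable]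
        stein_iexp_integrable[of "\<lambda>_. 1"] by (simp_all only: M.integrable_const of_real_1 mult_1_left)
    define E1 where "E1 = (CLINT w|M. iexp (cos t * ?S w))"
    define Eq where "Eq = (CLINT w|M. ?q w * iexp (cos t * ?S w))"
    define Es where "Es = (CLINT w|M. ?S w * iexp (cos t * ?S w))"
    have st: "Es = \<i> * cos t * Eq"
      using stein unfolding stein_identity_def Es_def Eq_def by blast
    have "(CLINT w|M. F1 w t) =
      (CLINT w|M. complex_of_real (l * c1 t) * (?q w * iexp (cos t * ?S w)) - complex_of_real (l * c1 t * ?n) * iexp (cos t * ?S w))"
      unfolding F1_def by (intro Bochner_Integration.integral_cong refl) (simp add: algebra_simps)
    also have "\<dots> = complex_of_real (l * c1 t) * Eq - complex_of_real (l * c1 t * ?n) * E1"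
      unfolding E1_def Eq_def using i1 by (simp only: Bochner_Integration.integral_diff integrable_mult_right integral_mult_right_zero)
    also have "complex_of_real (l * c1 t) * Eq = complex_of_real (l * c2 t) * (- \<i> * Es)"
    proof -
      have "- \<i> * Es = cos t * Eq" unfolding st by (simp add: mult.assoc)
      then show ?thesis unfolding c1_def c2_def by (simp add: mult_ac)
    qed
    also have "complex_of_real (l * c2 t) * (- \<i> * Es) - complex_of_real (l * c1 t * ?n) * E1 =
       (- \<i> * complex_of_real (l * c2 t)) * Es - complex_of_real (l * c1 t * ?n) * E1"
      by (simp add: mult_ac)
    also have "\<dots> = (CLINT w|M. (- \<i> * complex_of_real (l * c2 t)) * (?S w * iexp (cos t * ?S w)) - complex_of_real (l * c1 t * ?n) * iexp (cos t * ?S w))"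
      unfolding E1_def Es_def using i1 by (simp only: Bochner_Integration.integral_diff integrable_mult_right integral_mult_right_zero)
    also have "\<dots> = (CLINT w|M. F2 (?S w) t)"
      unfolding F2_def
      by (intro Bochner_Integration.integral_cong refl) (simp add: scaleR_conv_of_real algebra_simps)
    finally show ?thesis .
  qed
  have ftc: "(CLINT t|angles a. F2 s t) = e (pi/2) - e a * iexp (cos a * s)" for s :: real
  proof -
    let ?f = "\<lambda>t. (complex_of_real (- c1 t * ?n) - \<i> * complex_of_real (c2 t * s)) * iexp (cos t * s)"
    have "(CLINT t|angles a. F2 s t) = (LINT t|lborel. indicator {a..pi/2} t *\<^sub>R ?f t)"
      unfolding F2_def l_def by (rule angles_integral[OF a(2)]) measurable
    also have "\<dots> = complex_of_real (e (pi/2)) * iexp (cos (pi/2) * s) - complex_of_real (e a) * iexp (cos a * s)"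
    proof (rule integral_FTC_atLeastAtMost)
      show "a \<le> pi/2" using a by simp
      show "continuous_on {a..pi/2} ?f" unfolding c1_def c2_def e_def by (intro continuous_intros) auto
      fix t
      have e': "(e has_real_derivative (- c1 t * ?n)) (at t within {a..pi/2})"
        unfolding e_def c1_def by (auto intro!: derivative_eq_intros)
      have cs: "((\<lambda>t. cos t * s) has_vector_derivative (- sin t * s)) (at t within {a..pi/2})"
        unfolding has_real_derivative_iff_has_vector_derivative[symmetric] by (auto intro!: derivative_eq_intros)
      have ie: "((\<lambda>t. iexp (cos t * s)) has_vector_derivative (- sin t * s) *\<^sub>R (\<i> * iexp (cos t * s))) (at t within {a..pi/2})"
        using vector_diff_chain_within[OF cs has_vector_derivative_at_within[OF iexp_has_vector_derivative[of 1 "cos t * s", simplified]]]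
        by (simp add: comp_def)
      show "((\<lambda>t. complex_of_real (e t) * iexp (cos t * s)) has_vector_derivative ?f t) (at t within {a..pi/2})"
        by (rule has_vector_derivative_eq_rhs[OF has_vector_derivative_mult[OF has_vector_derivative_of_real[OF e'] ie]])
           (simp add: c1_def c2_def scaleR_conv_of_real algebra_simps)
    qed
    finally show ?thesis by simp
  qed
  have "(CLINT w|M. CLINT t|angles a. F1 w t) = (CLINT t|angles a. CLINT w|M. F1 w t)"
    by (rule MA.Fubini_integral[OF I1, symmetric])
  also have "\<dots> = (CLINT t|angles a. CLINT w|M. F2 (?S w) t)"
    unfolding inner_eq ..
  also have "\<dots> = (CLINT w|M. CLINT t|angles a. F2 (?S w) t)"
    by (rule MA.Fubini_integral[OF I2])
  also have "\<dots> = (CLINT w|M. e (pi/2) - e a * iexp (cos a * ?S w))"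
    unfolding ftc ..
  also have "\<dots> = e (pi/2) - e a * (CLINT w|M. iexp (cos a * ?S w))"
    using stein_iexp_integrable[of "\<lambda>_. 1" "cos a" \<xi>] by (subst Bochner_Integration.integral_diff) (auto simp: M.prob_space)
  finally show ?thesis unfolding F1_def c1_def l_def .
qed

text \<open>All terms are integrals of \<open>h\<close> against weighted laws on the product of \<open>M\<close> and \<open>mixer a\<close>: the weights \<open>1\<close>, \<open>-1\<close> and
  \<open>- \<Sum>\<^sub>i\<^sub>j (V\<^sub>i\<^sub>j - \<delta>\<^sub>i\<^sub>j) K\<^sub>i\<^sub>j\<close>, with \<open>K\<close> the kernel \<open>stein_kernel\<close>, belong to the points \<open>rot a Y Z\<close>, \<open>Z\<close> and \<open>rot t Y Z\<close>. By \<open>fourier_uniqueness\<close> it is enough to check that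
  their Fourier transforms add up to zero, so \<open>h\<close> need not be smooth.\<close>

lemma stein_interpolation:
  fixes h :: "real ^ 'm \<Rightarrow> real"
  assumes h[measurable]: "h \<in> borel_measurable borel" and h1: "\<And>y. \<bar>h y\<bar> \<le> 1"
  shows "(LINT w|M. LINT z|gauss. h (rot a (Y w) z)) - (LINT z|gauss. h z) =
    (\<Sum>i\<in>UNIV. \<Sum>j\<in>UNIV. LINT w|M. \<B> w i j * stein_hessian a h i j (Y w))"
proof -
  let ?Q = "mixer a :: (real \<times> (real ^ 'm)) measure"
  let ?P = "M \<Otimes>\<^sub>M ?Q"
  define W where "W k p = (if k = 0 then 1 else if k = 1 then - 1 else - (\<Sum>i\<in>UNIV. \<Sum>j\<in>UNIV. \<B> (fst p) i j * stein_kernel a i j (snd p)))"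
    for k :: nat and p :: "'w \<times> real \<times> (real ^ 'm)"
  define R where "R k p = (if k = 0 then rot a (Y (fst p)) (snd (snd p)) else if k = 1 then snd (snd p) else rot (fst (snd p)) (Y (fst p)) (snd (snd p)))"
    for k :: nat and p :: "'w \<times> real \<times> (real ^ 'm)"
  have R_m[measurable]: "R k \<in> borel_measurable ?P" for k
    unfolding R_def[abs_def] by (cases "k = 0"; cases "k = 1"; simp)
  have BK: "integrable ?P (\<lambda>p. \<B> (fst p) i j * stein_kernel a i j (snd p))" for i j
    by (rule integrable_product_pair(1)[OF M Q.prob_space_axioms V_minus_identity_integrable integrable_stein_kernel[OF a]])
  have W_i: "integrable ?P (W k)" for k
    unfolding W_def[abs_def] using BK by (cases "k = 0"; cases "k = 1"; simp)
  have vl: "(\<lambda>x. h (vec_lambda x)) \<in> borel_measurable (\<Pi>\<^sub>M i\<in>UNIV. borel)"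
  proof -
    have "(\<lambda>x. h (vec_lambda x)) \<in> borel_measurable (gauss_pi UNIV)" by measurable
    then show ?thesis by (subst (asm) measurable_cong_sets[OF sets_gauss_pi refl])
  qed
  have "(\<Sum>k\<in>{0,1,2::nat}. LINT p|?P. W k p * h (vec_lambda (\<lambda>i\<in>UNIV. R k p $ i))) = 0"
  proof (rule fourier_uniqueness[where B=1])
    show "(\<lambda>p. R k p $ i) \<in> borel_measurable ?P" for k i by measurable
    fix \<xi>' :: "'m \<Rightarrow> real"
    define \<xi> :: "real ^ 'm" where "\<xi> = vec_lambda \<xi>'"
    have ip: "(\<Sum>i\<in>UNIV. \<xi>' i * x $ i) = \<xi> \<bullet> x" for x :: "real ^ 'm"
      by (simp add: \<xi>_def inner_vec_def)
    define e where "e t = exp (- ((sin t)\<^sup>2 * (norm \<xi>)\<^sup>2) / 2)" for t :: real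
    define l where "l = pi/2 - a"
    have ge: "(CLINT z|gauss. iexp (sin t * (\<xi> \<bullet> z))) = e t" for t
      using gauss_iexp[of "sin t *\<^sub>R \<xi>"] by (simp add: e_def power_mult_distrib)
    have split: "iexp (\<xi> \<bullet> rot t y z) = iexp (cos t * (\<xi> \<bullet> y)) * iexp (sin t * (\<xi> \<bullet> z))" for t y z
      by (simp add: rot_def inner_add_right exp_add[symmetric] distrib_left)
    have gi: "integrable gauss (\<lambda>z. iexp (s * (\<xi> \<bullet> z)))" for s
      using iexp_poly_integrable[OF gauss.all_moments_const, of "\<lambda>z. s * (\<xi> \<bullet> z)" 1] by simp
    note qi = pair_prob_snd[OF A.prob_space_axioms prob_space_gauss gi, folded mixer_def]
    have T0: "(CLINT p|?P. complex_of_real (W 0 p) * iexp (\<xi> \<bullet> R 0 p)) = e a * (CLINT w|M. iexp (cos a * (\<xi> \<bullet> Y w)))"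
    proof -
      have mi: "integrable M (\<lambda>w. iexp (cos a * (\<xi> \<bullet> Y w)))"
        using stein_iexp_integrable[of "\<lambda>_. 1" "cos a" \<xi>] by simp
      have "(CLINT p|?P. complex_of_real (W 0 p) * iexp (\<xi> \<bullet> R 0 p)) =
        (CLINT p|?P. iexp (cos a * (\<xi> \<bullet> Y (fst p))) * iexp (sin a * (\<xi> \<bullet> snd (snd p))))"
        by (simp only: W_def R_def split if_True refl of_real_1 mult_1_left)
      also have "\<dots> = (CLINT w|M. iexp (cos a * (\<xi> \<bullet> Y w))) * (CLINT q|?Q. iexp (sin a * (\<xi> \<bullet> snd q)))"
        by (rule integrable_product_pair(2)[OF M Q.prob_space_axioms mi qi(1)])
      finally show ?thesis unfolding qi(2) ge by (simp only: mult.commute)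
    qed
    have T1: "(CLINT p|?P. complex_of_real (W 1 p) * iexp (\<xi> \<bullet> R 1 p)) = - complex_of_real (e (pi/2))"
    proof -
      have "(CLINT p|?P. complex_of_real (W 1 p) * iexp (\<xi> \<bullet> R 1 p)) = (CLINT p|?P. - iexp (1 * (\<xi> \<bullet> snd (snd p))))"
        by (simp add: W_def R_def)
      also have "\<dots> = - (CLINT p|?P. iexp (1 * (\<xi> \<bullet> snd (snd p))))" by (rule integral_minus)
      also have "(CLINT p|?P. iexp (1 * (\<xi> \<bullet> snd (snd p)))) = (CLINT q|?Q. iexp (1 * (\<xi> \<bullet> snd q)))"
        by (rule pair_prob_snd(2)[OF M Q.prob_space_axioms qi(1)])
      finally show ?thesis unfolding qi(2) using ge[of "pi/2"] by simp
    qed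
    have T2: "(CLINT p|?P. complex_of_real (W 2 p) * iexp (\<xi> \<bullet> R 2 p)) = e (pi/2) - e a * (CLINT w|M. iexp (cos a * (\<xi> \<bullet> Y w)))"
    proof -
      have Pi: "integrable ?P (\<lambda>p. complex_of_real (W 2 p) * iexp (\<xi> \<bullet> R 2 p))"
        by (rule Bochner_Integration.integrable_bound[OF W_i[of 2]]) (use W_i[of 2] in \<open>auto simp: norm_mult\<close>)
      have "(CLINT p|?P. complex_of_real (W 2 p) * iexp (\<xi> \<bullet> R 2 p)) = (CLINT w|M. CLINT q|?Q. complex_of_real (W 2 (w, q)) * iexp (\<xi> \<bullet> R 2 (w, q)))"
        by (rule P.integral_fst'[OF Pi, symmetric])
      also have "\<dots> = (CLINT w|M. CLINT t|angles a. complex_of_real (l * (sin t * cos t * e t) * (\<xi> \<bullet> (V w *v \<xi>) - (norm \<xi>)\<^sup>2)) * iexp (cos t * (\<xi> \<bullet> Y w)))"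
      proof (rule Bochner_Integration.integral_cong[OF refl])
        fix w assume w: "w \<in> space M"
        have Wq: "integrable ?Q (\<lambda>q. W 2 (w, q))"
          unfolding W_def using integrable_stein_kernel[OF a]
          by (auto intro!: Bochner_Integration.integrable_sum integrable_mult_right)
        have Rq[measurable]: "(\<lambda>q. R 2 (w, q)) \<in> borel_measurable ?Q" by (rule measurable_Pair2[OF R_m w])
        have Qi: "integrable (angles a \<Otimes>\<^sub>M gauss) (\<lambda>q. complex_of_real (W 2 (w, q)) * iexp (\<xi> \<bullet> R 2 (w, q)))"
          unfolding mixer_def[symmetric]
          by (rule Bochner_Integration.integrable_bound[OF Wq]) (use Wq in \<open>auto simp: norm_mult\<close>)
        have "(CLINT q|?Q. complex_of_real (W 2 (w, q)) * iexp (\<xi> \<bullet> R 2 (w, q))) =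
          (CLINT t|angles a. CLINT z|gauss. complex_of_real (W 2 (w, (t, z))) * iexp (\<xi> \<bullet> R 2 (w, (t, z))))"
          unfolding mixer_def by (rule AG.integral_fst'[OF Qi, symmetric])
        also have "\<dots> = (CLINT t|angles a. complex_of_real (l * (sin t * cos t * e t) * (\<xi> \<bullet> (V w *v \<xi>) - (norm \<xi>)\<^sup>2)) * iexp (cos t * (\<xi> \<bullet> Y w)))"
        proof (rule Bochner_Integration.integral_cong[OF refl])
          fix t
          let ?E = "iexp (cos t * (\<xi> \<bullet> Y w))" and ?k = "l * (cos t / sin t)"
          have Hi: "integrable gauss (\<lambda>z. complex_of_real (H2 i j z) * iexp (sin t * (\<xi> \<bullet> z)))" for i j
            by (intro iexp_poly_integrable H2_moments) measurable
          have He: "(CLINT z|gauss. H2 i j z * iexp (sin t * (\<xi> \<bullet> z))) = complex_of_real (- ((sin t)\<^sup>2 * (\<xi> $ i * \<xi> $ j)) * e t)" for i j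
            using gauss_H2_iexp[of i j "sin t *\<^sub>R \<xi>"] by (simp add: e_def power_mult_distrib power2_eq_square mult_ac)
          have quad: "(\<Sum>i\<in>UNIV. \<Sum>j\<in>UNIV. \<B> w i j * (\<xi> $ i * \<xi> $ j)) = \<xi> \<bullet> (V w *v \<xi>) - (norm \<xi>)\<^sup>2"
          proof -
            have 1: "(\<Sum>i\<in>UNIV. \<Sum>j\<in>UNIV. V w $ i $ j * (\<xi> $ i * \<xi> $ j)) = \<xi> \<bullet> (V w *v \<xi>)"
              by (simp add: inner_vec_def matrix_vector_mult_def sum_distrib_left mult_ac)
            have "(\<Sum>j\<in>UNIV. (if i = j then 1 else 0) * (\<xi> $ i * \<xi> $ j)) = \<xi> $ i * \<xi> $ i" for i
            proof -
              have "(\<Sum>j\<in>UNIV. (if i = j then 1 else 0) * (\<xi> $ i * \<xi> $ j)) = (\<Sum>j\<in>UNIV. if i = j then \<xi> $ i * \<xi> $ j else 0)"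
                by (rule sum.cong) auto
              then show ?thesis by (simp add: sum.delta)
            qed
            then have 2: "(\<Sum>i\<in>UNIV. \<Sum>j\<in>UNIV. (if i = j then 1 else 0) * (\<xi> $ i * \<xi> $ j)) = (norm \<xi>)\<^sup>2"
              by (simp add: power2_norm_eq_inner inner_vec_def)
            show ?thesis unfolding left_diff_distrib sum_subtractf 1 2 ..
          qed
          have "(CLINT z|gauss. complex_of_real (W 2 (w, (t, z))) * iexp (\<xi> \<bullet> R 2 (w, (t, z)))) =
            (CLINT z|gauss. \<Sum>i\<in>UNIV. \<Sum>j\<in>UNIV. (?E * complex_of_real (- ?k * \<B> w i j)) * (complex_of_real (H2 i j z) * iexp (sin t * (\<xi> \<bullet> z))))"
          proof (rule Bochner_Integration.integral_cong[OF refl])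
            fix z :: "real ^ 'm"
            let ?F = "iexp (sin t * (\<xi> \<bullet> z))"
            have Rz: "iexp (\<xi> \<bullet> R 2 (w, (t, z))) = ?E * ?F" by (simp add: R_def split)
            have Wz: "W 2 (w, (t, z)) = (\<Sum>i\<in>UNIV. \<Sum>j\<in>UNIV. - ?k * \<B> w i j * H2 i j z)"
              by (simp add: W_def stein_kernel_def l_def sum_negf[symmetric] mult_ac)
            show "complex_of_real (W 2 (w, (t, z))) * iexp (\<xi> \<bullet> R 2 (w, (t, z))) =
              (\<Sum>i\<in>UNIV. \<Sum>j\<in>UNIV. (?E * complex_of_real (- ?k * \<B> w i j)) * (complex_of_real (H2 i j z) * ?F))"
              unfolding Rz Wz of_real_sum sum_distrib_right by (simp only: of_real_mult mult_ac)
          qed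
          also have "\<dots> = (\<Sum>i\<in>UNIV. \<Sum>j\<in>UNIV. (?E * complex_of_real (- ?k * \<B> w i j)) * (CLINT z|gauss. complex_of_real (H2 i j z) * iexp (sin t * (\<xi> \<bullet> z))))"
            using Hi by (simp only: Bochner_Integration.integral_sum integrable_mult_right Bochner_Integration.integrable_sum integral_mult_right_zero)
          also have "\<dots> = (\<Sum>i\<in>UNIV. \<Sum>j\<in>UNIV. ?E * complex_of_real ((?k * (sin t)\<^sup>2 * e t) * (\<B> w i j * (\<xi> $ i * \<xi> $ j))))"
          proof (intro sum.cong refl)
            fix i j
            have "(- ?k * \<B> w i j) * (- ((sin t)\<^sup>2 * (\<xi> $ i * \<xi> $ j)) * e t) = (?k * (sin t)\<^sup>2 * e t) * (\<B> w i j * (\<xi> $ i * \<xi> $ j))"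
              by (simp only: mult_ac mult_minus_left mult_minus_right minus_minus)
            then show "(?E * complex_of_real (- ?k * \<B> w i j)) * (CLINT z|gauss. complex_of_real (H2 i j z) * iexp (sin t * (\<xi> \<bullet> z))) =
              ?E * complex_of_real ((?k * (sin t)\<^sup>2 * e t) * (\<B> w i j * (\<xi> $ i * \<xi> $ j)))"
              unfolding He mult.assoc[of ?E] of_real_mult[symmetric] by (rule arg_cong)
          qed
          also have "\<dots> = ?E * complex_of_real (\<Sum>i\<in>UNIV. \<Sum>j\<in>UNIV. (?k * (sin t)\<^sup>2 * e t) * (\<B> w i j * (\<xi> $ i * \<xi> $ j)))"
            unfolding of_real_sum sum_distrib_left ..
          also have "(\<Sum>i\<in>UNIV. \<Sum>j\<in>UNIV. (?k * (sin t)\<^sup>2 * e t) * (\<B> w i j * (\<xi> $ i * \<xi> $ j))) = (?k * (sin t)\<^sup>2 * e t) * (\<xi> \<bullet> (V w *v \<xi>) - (norm \<xi>)\<^sup>2)"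
            unfolding quad[symmetric] sum_distrib_left ..
          also have "?k * (sin t)\<^sup>2 * e t = l * (sin t * cos t * e t)"
            by (simp add: power2_eq_square)
          finally show "(CLINT z|gauss. complex_of_real (W 2 (w, (t, z))) * iexp (\<xi> \<bullet> R 2 (w, (t, z)))) =
             complex_of_real (l * (sin t * cos t * e t) * (\<xi> \<bullet> (V w *v \<xi>) - (norm \<xi>)\<^sup>2)) * ?E"
            by (simp only: mult.commute)
        qed
        finally show "(CLINT q|?Q. complex_of_real (W 2 (w, q)) * iexp (\<xi> \<bullet> R 2 (w, q))) = (CLINT t|angles a. complex_of_real (l * (sin t * cos t * e t) * (\<xi> \<bullet> (V w *v \<xi>) - (norm \<xi>)\<^sup>2)) * iexp (cos t * (\<xi> \<bullet> Y w)))" .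
      qed
      also have "\<dots> = e (pi/2) - e a * (CLINT w|M. iexp (cos a * (\<xi> \<bullet> Y w)))"
        using stein_interpolation_fourier[of \<xi>] unfolding e_def l_def .
      finally show ?thesis .
    qed
    show "(\<Sum>k\<in>{0,1,2::nat}. CLINT p|?P. complex_of_real (W k p) * iexp (\<Sum>i\<in>UNIV. \<xi>' i * R k p $ i)) = 0"
      unfolding ip using T0 T1 T2 by simp
  qed (use W_i vl h1 P.sigma_finite_measure_axioms in auto)
  then have sum0: "(LINT p|?P. W 0 p * h (R 0 p)) + (LINT p|?P. W 1 p * h (R 1 p)) + (LINT p|?P. W 2 p * h (R 2 p)) = 0"
    by (simp add: restrict_UNIV)
  have hi: "integrable N (\<lambda>x. h (f x))" if "prob_space N" "f \<in> borel_measurable N" for N and f :: "'x \<Rightarrow> real ^ 'm"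
  proof -
    interpret N: prob_space N by (rule that(1))
    show ?thesis by (rule N.integrable_const_bound[where B=1]) (use h1 that in auto)
  qed
  have P0: "(LINT p|?P. W 0 p * h (R 0 p)) = (LINT w|M. LINT z|gauss. h (rot a (Y w) z))"
  proof -
    have "(LINT p|?P. W 0 p * h (R 0 p)) = (LINT p|?P. h (rot a (Y (fst p)) (snd (snd p))))" by (simp add: W_def R_def)
    also have "\<dots> = (LINT w|M. LINT q|?Q. h (rot a (Y w) (snd q)))"
      using P.integral_fst'[OF hi[OF P.prob_space_axioms, of "\<lambda>p. rot a (Y (fst p)) (snd (snd p))"]] by simp
    also have "\<dots> = (LINT w|M. LINT z|gauss. h (rot a (Y w) z))"
      unfolding mixer_def
      by (intro Bochner_Integration.integral_cong refl pair_prob_snd(2)[OF A.prob_space_axioms prob_space_gauss] hi[OF prob_space_gauss]) measurable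
    finally show ?thesis .
  qed
  have P1: "(LINT p|?P. W 1 p * h (R 1 p)) = - (LINT z|gauss. h z)"
  proof -
    have hg: "integrable gauss h" using hi[OF prob_space_gauss, of "\<lambda>x. x"] by simp
    note hq = pair_prob_snd[OF A.prob_space_axioms prob_space_gauss hg, folded mixer_def]
    show ?thesis
      using pair_prob_snd(2)[OF M Q.prob_space_axioms hq(1)] hq(2) by (simp add: W_def R_def)
  qed
  have P2: "(LINT p|?P. W 2 p * h (R 2 p)) = - (\<Sum>i\<in>UNIV. \<Sum>j\<in>UNIV. LINT w|M. \<B> w i j * stein_hessian a h i j (Y w))"
  proof -
    have BKh: "integrable ?P (\<lambda>p. \<B> (fst p) i j * stein_kernel a i j (snd p) * h (R 2 p))" for i j
    proof (rule Bochner_Integration.integrable_bound[OF BK[of i j]])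
      show "AE p in ?P. norm (\<B> (fst p) i j * stein_kernel a i j (snd p) * h (R 2 p)) \<le> norm (\<B> (fst p) i j * stein_kernel a i j (snd p))"
      proof (rule AE_I2)
        fix p
        show "norm (\<B> (fst p) i j * stein_kernel a i j (snd p) * h (R 2 p)) \<le> norm (\<B> (fst p) i j * stein_kernel a i j (snd p))"
          unfolding norm_mult[of _ "h (R 2 p)"] using mult_left_mono[OF h1[of "R 2 p"] norm_ge_zero[of "\<B> (fst p) i j * stein_kernel a i j (snd p)"]]
          by simp
      qed
    qed (use BK[of i j] in measurable)
    have one: "(LINT p|?P. \<B> (fst p) i j * stein_kernel a i j (snd p) * h (R 2 p)) = (LINT w|M. \<B> w i j * stein_hessian a h i j (Y w))" for i j
      unfolding P.integral_fst'[OF BKh[of i j], symmetric] stein_hessian_def by (simp add: R_def mult.assoc)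
    have "(LINT p|?P. W 2 p * h (R 2 p)) = (LINT p|?P. - (\<Sum>i\<in>UNIV. \<Sum>j\<in>UNIV. \<B> (fst p) i j * stein_kernel a i j (snd p) * h (R 2 p)))"
      by (intro Bochner_Integration.integral_cong refl) (simp add: W_def sum_distrib_right)
    also have "\<dots> = - (\<Sum>i\<in>UNIV. \<Sum>j\<in>UNIV. LINT p|?P. \<B> (fst p) i j * stein_kernel a i j (snd p) * h (R 2 p))"
      using BKh by (simp only: integral_minus Bochner_Integration.integral_sum Bochner_Integration.integrable_sum)
    finally show ?thesis unfolding one .
  qed
  show ?thesis using sum0 unfolding P0 P1 P2 by simp
qed

end

section \<open>Gaussian boundary layers of convex sets\<close>

text \<open>The standard normal density is at most \<open>1/2\<close>.\<close>

lemma std_gauss_interval: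
  assumes "0 \<le> \<epsilon>"
  shows "emeasure std_gauss {p - \<epsilon>..p + \<epsilon>} \<le> ennreal \<epsilon>"
proof -
  have half: "std_normal_density x \<le> 1/2" for x
  proof -
    have "2 \<le> sqrt (2 * pi)" using pi_ge_two by (intro real_le_rsqrt) auto
    then have "1 / sqrt (2 * pi) \<le> 1 / 2" by (intro frac_le) auto
    then have "1 / sqrt (2 * pi) * exp (- x\<^sup>2 / 2) \<le> 1 / 2 * 1" by (intro mult_mono) auto
    then show ?thesis by (simp add: std_normal_density_def)
  qed
  have "emeasure std_gauss {p - \<epsilon>..p + \<epsilon>} = (\<integral>\<^sup>+x. ennreal (std_normal_density x) * indicator {p - \<epsilon>..p + \<epsilon>} x \<partial>lborel)"
    by (subst emeasure_density) auto
  also have "\<dots> \<le> (\<integral>\<^sup>+x. ennreal (1/2) * indicator {p - \<epsilon>..p + \<epsilon>} x \<partial>lborel)"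
    by (intro nn_integral_mono mult_right_mono ennreal_leI half) simp
  also have "\<dots> = ennreal (1/2) * ennreal (2 * \<epsilon>)"
    using assms by (subst nn_integral_cmult_indicator) auto
  also have "\<dots> = ennreal \<epsilon>" using assms by (subst ennreal_mult[symmetric]) auto
  finally show ?thesis .
qed

text \<open>Fubini, the coordinate \<open>i\<close> being integrated first.\<close>

lemma gauss_slice_bound:
  fixes A :: "(real ^ 'm::finite) set"
  assumes A[measurable]: "A \<in> sets borel"
    and c: "\<And>z. emeasure std_gauss {t. vec_lambda (z(i := t)) \<in> A} \<le> c"
  shows "emeasure gauss A \<le> c"
proof -
  let ?J = "UNIV - {i}"
  have U: "UNIV = insert i ?J" by auto
  have "emeasure gauss A = (\<integral>\<^sup>+x. indicator A x \<partial>gauss)"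
    using A by simp
  also have "\<dots> = (\<integral>\<^sup>+z. indicator A (vec_lambda z) \<partial>gauss_pi UNIV)"
    unfolding gauss_def by (subst nn_integral_distr) auto
  also have "\<dots> = (\<integral>\<^sup>+z. (\<integral>\<^sup>+t. indicator A (vec_lambda (z(i := t))) \<partial>std_gauss) \<partial>gauss_pi ?J)"
    using gauss_pi.product_nn_integral_insert[of ?J i "\<lambda>z. indicator A (vec_lambda z)"] U by simp
  also have "\<dots> \<le> (\<integral>\<^sup>+z. c \<partial>gauss_pi ?J)"
  proof (rule nn_integral_mono)
    fix z assume "z \<in> space (gauss_pi ?J)"
    have m: "(\<lambda>t. vec_lambda (z(i := t))) \<in> borel_measurable borel"
    proof (rule borel_measurable_continuous_onI)
      have "continuous_on UNIV (\<lambda>t. (z(i := t)) j)" for j by (cases "j = i") auto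
      then show "continuous_on UNIV (\<lambda>t. vec_lambda (z(i := t)))"
        using continuous_on_vec_lambda[of UNIV "\<lambda>j t. (z(i := t)) j"] by (simp add: fun_upd_def)
    qed
    have "(\<integral>\<^sup>+t. indicator A (vec_lambda (z(i := t))) \<partial>std_gauss) = (\<integral>\<^sup>+t. indicator {t. vec_lambda (z(i := t)) \<in> A} t \<partial>std_gauss)"
      by (intro nn_integral_cong) (auto split: split_indicator)
    also have "\<dots> = emeasure std_gauss {t. vec_lambda (z(i := t)) \<in> A}"
    proof (rule nn_integral_indicator)
      show "{t. vec_lambda (z(i := t)) \<in> A} \<in> sets std_gauss"
        using measurable_sets[OF m A] by (simp add: vimage_def)
    qed
    finally show "(\<integral>\<^sup>+t. indicator A (vec_lambda (z(i := t))) \<partial>std_gauss) \<le> c" using c by simp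
  qed
  also have "\<dots> = c" using prob_space.emeasure_space_1[OF prob_space_gauss_pi[of ?J]] by simp
  finally show ?thesis .
qed

text \<open>Dilation and erosion act along one coordinate axis only: then a line parallel to this axis meets a convex set and its
  dilation in intervals, and the estimates stay one-dimensional.\<close>

definition dilate :: "'m \<Rightarrow> real \<Rightarrow> (real ^ 'm) set \<Rightarrow> (real ^ 'm) set" where
  "dilate i \<epsilon> C = {x. \<exists>s. \<bar>s\<bar> \<le> \<epsilon> \<and> x + s *\<^sub>R axis i 1 \<in> C}"

definition erode :: "'m \<Rightarrow> real \<Rightarrow> (real ^ 'm) set \<Rightarrow> (real ^ 'm) set" where
  "erode i \<epsilon> C = {x. \<forall>s. \<bar>s\<bar> \<le> \<epsilon> \<longrightarrow> x + s *\<^sub>R axis i 1 \<in> C}"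

lemma dilate_compact_convex:
  fixes C :: "(real ^ 'm::finite) set"
  assumes C: "compact C" "convex C"
  shows "compact (dilate i \<epsilon> C)" "convex (dilate i \<epsilon> C)"
proof -
  let ?S = "(\<lambda>s. s *\<^sub>R axis i 1 :: real ^ 'm) ` {-\<epsilon>..\<epsilon>}"
  have "dilate i \<epsilon> C = {x + y | x y. x \<in> C \<and> y \<in> ?S}"
  proof (intro set_eqI iffI)
    fix x assume "x \<in> dilate i \<epsilon> C"
    then obtain s where s: "\<bar>s\<bar> \<le> \<epsilon>" "x + s *\<^sub>R axis i 1 \<in> C" by (auto simp: dilate_def)
    then have "x = (x + s *\<^sub>R axis i 1) + (- s) *\<^sub>R axis i 1" "- s \<in> {-\<epsilon>..\<epsilon>}" by auto
    with s show "x \<in> {x + y | x y. x \<in> C \<and> y \<in> ?S}" by blast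
  next
    fix x assume "x \<in> {x + y | x y. x \<in> C \<and> y \<in> ?S}"
    then obtain y s where ys: "y \<in> C" "- \<epsilon> \<le> s" "s \<le> \<epsilon>" "x = y + s *\<^sub>R axis i 1" by auto
    then have "x + (- s) *\<^sub>R axis i 1 \<in> C" "\<bar>- s\<bar> \<le> \<epsilon>" by auto
    then show "x \<in> dilate i \<epsilon> C" unfolding dilate_def by blast
  qed
  moreover have "compact ?S" by (intro compact_continuous_image continuous_intros) auto
  ultimately show "compact (dilate i \<epsilon> C)" using compact_sums[OF C(1)] by simp
  show "convex (dilate i \<epsilon> C)"
  proof (rule convexI)
    fix x y and u v :: real assume xy: "x \<in> dilate i \<epsilon> C" "y \<in> dilate i \<epsilon> C" and uv: "0 \<le> u" "0 \<le> v" "u + v = 1"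
    then obtain s t where st: "\<bar>s\<bar> \<le> \<epsilon>" "x + s *\<^sub>R axis i 1 \<in> C" "\<bar>t\<bar> \<le> \<epsilon>" "y + t *\<^sub>R axis i 1 \<in> C" by (auto simp: dilate_def)
    have "u *\<^sub>R (x + s *\<^sub>R axis i 1) + v *\<^sub>R (y + t *\<^sub>R axis i 1) \<in> C" using convexD[OF C(2)] st uv by blast
    then have "(u *\<^sub>R x + v *\<^sub>R y) + (u * s + v * t) *\<^sub>R axis i 1 \<in> C" by (simp add: algebra_simps)
    moreover have "\<bar>u * s + v * t\<bar> \<le> u * \<epsilon> + v * \<epsilon>"
      using st uv by (intro order_trans[OF abs_triangle_ineq]) (auto simp: abs_mult intro!: add_mono mult_left_mono)
    moreover have "u * \<epsilon> + v * \<epsilon> = \<epsilon>" using uv by (metis distrib_right mult_1_left)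
    ultimately show "u *\<^sub>R x + v *\<^sub>R y \<in> dilate i \<epsilon> C" unfolding dilate_def by auto
  qed
qed

lemma erode_compact_convex:
  fixes C :: "(real ^ 'm::finite) set"
  assumes C: "compact C" "convex C" and \<epsilon>: "0 \<le> \<epsilon>"
  shows "compact (erode i \<epsilon> C)" "convex (erode i \<epsilon> C)"
proof -
  have e: "erode i \<epsilon> C = (\<Inter>s\<in>{-\<epsilon>..\<epsilon>}. (\<lambda>x. x - s *\<^sub>R axis i 1) ` C)"
  proof (intro set_eqI iffI)
    fix x assume "x \<in> erode i \<epsilon> C"
    then have "x = (x + s *\<^sub>R axis i 1) - s *\<^sub>R axis i 1 \<and> x + s *\<^sub>R axis i 1 \<in> C" if "s \<in> {-\<epsilon>..\<epsilon>}" for s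
      using that by (auto simp: erode_def)
    then show "x \<in> (\<Inter>s\<in>{-\<epsilon>..\<epsilon>}. (\<lambda>x. x - s *\<^sub>R axis i 1) ` C)" by blast
  next
    fix x assume x: "x \<in> (\<Inter>s\<in>{-\<epsilon>..\<epsilon>}. (\<lambda>x. x - s *\<^sub>R axis i 1) ` C)"
    have "x + s *\<^sub>R axis i 1 \<in> C" if "\<bar>s\<bar> \<le> \<epsilon>" for s
    proof -
      have "s \<in> {-\<epsilon>..\<epsilon>}" using that by auto
      then have "x \<in> (\<lambda>x. x - s *\<^sub>R axis i 1) ` C" using x by blast
      then show ?thesis by auto
    qed
    then show "x \<in> erode i \<epsilon> C" by (simp add: erode_def)
  qed
  show "compact (erode i \<epsilon> C)" unfolding e
    using \<epsilon> by (intro compact_Inter) (auto intro!: compact_continuous_image continuous_intros C)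
  show "convex (erode i \<epsilon> C)" unfolding e
    using C(2) by (intro convex_INT) (simp add: convex_translation_subtract)
qed

lemma erode_subset: "0 \<le> \<epsilon> \<Longrightarrow> erode i \<epsilon> C \<subseteq> C"
  unfolding erode_def by (auto dest: spec[of _ 0])

lemma subset_dilate: "0 \<le> \<epsilon> \<Longrightarrow> C \<subseteq> dilate i \<epsilon> C"
  unfolding dilate_def by (auto intro!: exI[of _ 0])

text \<open>On each line in direction \<open>i\<close> the layer is contained in two intervals of length \<open>2 \<epsilon>\<close> around the end points of the
  intersection of the line with \<open>C\<close>.\<close>

lemma gauss_boundary_layer:
  fixes C :: "(real ^ 'm::finite) set"
  assumes C: "compact C" "convex C" and \<epsilon>: "0 \<le> \<epsilon>"
  shows "measure gauss (dilate i \<epsilon> C - erode i \<epsilon> C) \<le> 2 * \<epsilon>"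
proof -
  have sets: "dilate i \<epsilon> C - erode i \<epsilon> C \<in> sets borel"
    by (intro sets.Diff borel_compact dilate_compact_convex(1)[OF C] erode_compact_convex(1)[OF C \<epsilon>])
  have "emeasure gauss (dilate i \<epsilon> C - erode i \<epsilon> C) \<le> ennreal (2 * \<epsilon>)"
  proof (rule gauss_slice_bound[OF sets])
    fix z :: "'m \<Rightarrow> real"
    let ?x = "\<lambda>t. vec_lambda (z(i := t)) :: real ^ 'm"
    have shift: "?x t + s *\<^sub>R axis i 1 = ?x (t + s)" for t s
      by (auto simp: vec_eq_iff axis_def)
    have xe: "?x t = ?x 0 + t *\<^sub>R axis i 1" for t using shift[of 0 t] by simp
    define T where "T = {t. ?x t \<in> C}"
    have Tv: "T = (\<lambda>t. ?x 0 + t *\<^sub>R axis i 1) -` C" unfolding T_def by (subst xe) auto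
    have "closed T" unfolding Tv
      by (rule continuous_closed_vimage) (auto intro!: continuous_intros compact_imp_closed C)
    moreover have "bounded T"
    proof -
      obtain B where B: "\<And>x. x \<in> C \<Longrightarrow> norm x \<le> B" using compact_imp_bounded[OF C(1)] by (auto simp: bounded_iff)
      have "norm t \<le> B" if "t \<in> T" for t
      proof -
        have "\<bar>?x t $ i\<bar> \<le> norm (?x t)" by (rule component_le_norm_cart)
        also have "\<dots> \<le> B" using that by (intro B) (simp add: T_def)
        finally show ?thesis by simp
      qed
      then show ?thesis by (auto simp: bounded_iff)
    qed
    ultimately have "compact T" by (simp add: compact_eq_bounded_closed)
    moreover have "convex T" unfolding convex_alt
    proof (intro ballI allI impI)
      fix s t u :: real assume st: "s \<in> T" "t \<in> T" and u: "0 \<le> u \<and> u \<le> 1"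
      have "(1 - u) *\<^sub>R ?x s + u *\<^sub>R ?x t \<in> C" using C(2) st u unfolding convex_alt T_def by blast
      moreover have "(1 - u) *\<^sub>R ?x s + u *\<^sub>R ?x t = ?x ((1 - u) *\<^sub>R s + u *\<^sub>R t)"
        by (auto simp: vec_eq_iff algebra_simps)
      ultimately show "(1 - u) *\<^sub>R s + u *\<^sub>R t \<in> T" by (simp add: T_def)
    qed
    ultimately obtain a b where T: "T = {a..b}"
      using connected_compact_interval_1[of T] convex_connected by blast
    have sub: "{t. ?x t \<in> dilate i \<epsilon> C - erode i \<epsilon> C} \<subseteq> {a - \<epsilon>..a + \<epsilon>} \<union> {b - \<epsilon>..b + \<epsilon>}"
    proof
      fix t assume "t \<in> {t. ?x t \<in> dilate i \<epsilon> C - erode i \<epsilon> C}"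
      then obtain s r where "\<bar>s\<bar> \<le> \<epsilon>" "\<bar>r\<bar> \<le> \<epsilon>" "?x (t + s) \<in> C" "?x (t + r) \<notin> C"
        by (auto simp: dilate_def erode_def shift)
      then have "t + s \<in> {a..b}" "t + r \<notin> {a..b}" unfolding T[symmetric] T_def by auto
      with \<open>\<bar>s\<bar> \<le> \<epsilon>\<close> \<open>\<bar>r\<bar> \<le> \<epsilon>\<close> show "t \<in> {a - \<epsilon>..a + \<epsilon>} \<union> {b - \<epsilon>..b + \<epsilon>}" by auto
    qed
    have "emeasure std_gauss {t. ?x t \<in> dilate i \<epsilon> C - erode i \<epsilon> C} \<le> emeasure std_gauss ({a - \<epsilon>..a + \<epsilon>} \<union> {b - \<epsilon>..b + \<epsilon>})"
      by (rule emeasure_mono[OF sub]) simp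
    also have "\<dots> \<le> emeasure std_gauss {a - \<epsilon>..a + \<epsilon>} + emeasure std_gauss {b - \<epsilon>..b + \<epsilon>}"
      by (rule emeasure_subadditive) auto
    also have "\<dots> \<le> ennreal \<epsilon> + ennreal \<epsilon>" by (intro add_mono std_gauss_interval \<epsilon>)
    also have "\<dots> = ennreal (2 * \<epsilon>)" using \<epsilon> by (simp add: ennreal_plus[symmetric] del: ennreal_plus)
    finally show "emeasure std_gauss {t. ?x t \<in> dilate i \<epsilon> C - erode i \<epsilon> C} \<le> ennreal (2 * \<epsilon>)" .
  qed
  then show ?thesis using \<epsilon> by (simp add: gauss.emeasure_eq_measure)
qed

lemma compact_borel[simp]: "compact (C :: (real ^ 'm::finite) set) \<Longrightarrow> C \<in> sets borel"
  by (rule borel_compact)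

lemma gauss_dilate_erode_le: 
  fixes C :: "(real ^ 'm::finite) set"
  assumes C: "compact C" "convex C" and \<epsilon>: "0 \<le> \<epsilon>"
  shows "measure gauss (dilate i \<epsilon> C) \<le> measure gauss C + 2 * \<epsilon>"
    and "measure gauss C \<le> measure gauss (erode i \<epsilon> C) + 2 * \<epsilon>"
proof -
  note cs = dilate_compact_convex(1)[OF C, of i \<epsilon>] erode_compact_convex(1)[OF C \<epsilon>, of i]
  have *: "measure gauss (dilate i \<epsilon> C) \<le> measure gauss (erode i \<epsilon> C) + 2 * \<epsilon>"
    using gauss_boundary_layer[OF C \<epsilon>, of i] order_trans[OF erode_subset[OF \<epsilon>] subset_dilate[OF \<epsilon>], of i C i] cs
    by (subst (asm) gauss.finite_measure_Diff) auto
  have "measure gauss (erode i \<epsilon> C) \<le> measure gauss C"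
    by (rule gauss.finite_measure_mono[OF erode_subset[OF \<epsilon>]]) (use C in simp)
  with * show "measure gauss (dilate i \<epsilon> C) \<le> measure gauss C + 2 * \<epsilon>" by simp
  have "measure gauss C \<le> measure gauss (dilate i \<epsilon> C)"
    by (rule gauss.finite_measure_mono[OF subset_dilate[OF \<epsilon>]]) (use cs in simp)
  with * show "measure gauss C \<le> measure gauss (erode i \<epsilon> C) + 2 * \<epsilon>" by simp
qed

definition cube :: "real \<Rightarrow> 'm set \<Rightarrow> (real ^ 'm) set" where
  "cube \<epsilon> I = {v. \<forall>i. \<bar>v $ i\<bar> \<le> \<epsilon> \<and> (i \<notin> I \<longrightarrow> v $ i = 0)}"

lemma cube_insertI:
  assumes "k \<notin> I" "0 \<le> \<epsilon>" "\<bar>s\<bar> \<le> \<epsilon>" "u \<in> cube \<epsilon> I"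
  shows "s *\<^sub>R axis k 1 + u \<in> cube \<epsilon> (insert k I)"
  using assms by (auto simp: cube_def axis_def)

lemma cube_insertE:
  fixes v :: "real ^ 'm::finite"
  assumes "k \<notin> I" "0 \<le> \<epsilon>" "v \<in> cube \<epsilon> (insert k I)"
  obtains s u where "\<bar>s\<bar> \<le> \<epsilon>" "u \<in> cube \<epsilon> I" "v = s *\<^sub>R axis k 1 + u"
proof (rule that[of "v $ k" "v - (v $ k) *\<^sub>R axis k 1"])
  show "v - (v $ k) *\<^sub>R axis k 1 \<in> cube \<epsilon> I"
    using assms by (auto simp: cube_def axis_def)
qed (use assms in \<open>auto simp: cube_def\<close>)

text \<open>The dilation by a cube is the composition of the dilations along the axes. The set is named by \<open>D\<close> so that compactness,
  convexity and the measure bound can be carried through the induction together.\<close>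

lemma cube_dilation:
  fixes C :: "(real ^ 'm::finite) set"
  assumes C: "compact C" "convex C" and \<epsilon>: "0 \<le> \<epsilon>" and "finite I"
  shows "\<exists>D. compact D \<and> convex D \<and> D = {x. \<exists>v\<in>cube \<epsilon> I. x + v \<in> C} \<and> measure gauss D \<le> measure gauss C + 2 * \<epsilon> * card I"
  using \<open>finite I\<close>
proof (induction I rule: finite_induct)
  case empty
  have "cube \<epsilon> {} = {0 :: real ^ 'm}" using \<epsilon> by (auto simp: cube_def vec_eq_iff)
  then show ?case using C by auto
next
  case (insert k I)
  then obtain D where D: "compact D" "convex D" "D = {x. \<exists>v\<in>cube \<epsilon> I. x + v \<in> C}" "measure gauss D \<le> measure gauss C + 2 * \<epsilon> * card I"
    by blast
  have "dilate k \<epsilon> D = {x. \<exists>v\<in>cube \<epsilon> (insert k I). x + v \<in> C}"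
  proof (intro set_eqI iffI; clarsimp)
    fix x assume "x \<in> dilate k \<epsilon> D"
    then obtain s v where s: "\<bar>s\<bar> \<le> \<epsilon>" and v: "v \<in> cube \<epsilon> I" and m: "x + s *\<^sub>R axis k 1 + v \<in> C"
      unfolding dilate_def D(3) by auto
    have "s *\<^sub>R axis k 1 + v \<in> cube \<epsilon> (insert k I)"
      using s v by (rule cube_insertI[OF insert(2) \<epsilon>])
    then show "\<exists>v\<in>cube \<epsilon> (insert k I). x + v \<in> C" using m by (intro bexI[of _ "s *\<^sub>R axis k 1 + v"]) (simp_all add: add.assoc)
  next
    fix x v assume v: "v \<in> cube \<epsilon> (insert k I)" and m: "x + v \<in> C"
    obtain s u where s: "\<bar>s\<bar> \<le> \<epsilon>" and u: "u \<in> cube \<epsilon> I" and vu: "v = s *\<^sub>R axis k 1 + u"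
      using cube_insertE[OF insert(2) \<epsilon> v] .
    have "x + s *\<^sub>R axis k 1 + u \<in> C" using m vu by (simp add: add.assoc)
    then have "x + s *\<^sub>R axis k 1 \<in> D" using u unfolding D(3) by blast
    then show "x \<in> dilate k \<epsilon> D" using s unfolding dilate_def by blast
  qed
  moreover have "measure gauss (dilate k \<epsilon> D) \<le> measure gauss C + 2 * \<epsilon> * card (insert k I)"
    using gauss_dilate_erode_le(1)[OF D(1,2) \<epsilon>, of k] D(4) insert by (simp add: algebra_simps)
  ultimately show ?case using dilate_compact_convex[OF D(1,2), of k \<epsilon>]
    by - (intro exI[of _ "dilate k \<epsilon> D"] conjI; assumption)
qed

lemma cube_erosion:
  fixes C :: "(real ^ 'm::finite) set"
  assumes C: "compact C" "convex C" and \<epsilon>: "0 \<le> \<epsilon>" and "finite I"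
  shows "\<exists>D. compact D \<and> convex D \<and> D = {x. \<forall>v\<in>cube \<epsilon> I. x + v \<in> C} \<and> measure gauss C \<le> measure gauss D + 2 * \<epsilon> * card I"
  using \<open>finite I\<close>
proof (induction I rule: finite_induct)
  case empty
  have "cube \<epsilon> {} = {0 :: real ^ 'm}" using \<epsilon> by (auto simp: cube_def vec_eq_iff)
  then show ?case using C by auto
next
  case (insert k I)
  then obtain D where D: "compact D" "convex D" "D = {x. \<forall>v\<in>cube \<epsilon> I. x + v \<in> C}" "measure gauss C \<le> measure gauss D + 2 * \<epsilon> * card I"
    by blast
  have "erode k \<epsilon> D = {x. \<forall>v\<in>cube \<epsilon> (insert k I). x + v \<in> C}"
  proof (intro set_eqI iffI; clarsimp)
    fix x v assume x: "x \<in> erode k \<epsilon> D" and v: "v \<in> cube \<epsilon> (insert k I)"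
    obtain s u where s: "\<bar>s\<bar> \<le> \<epsilon>" and u: "u \<in> cube \<epsilon> I" and vu: "v = s *\<^sub>R axis k 1 + u"
      using cube_insertE[OF insert(2) \<epsilon> v] .
    have "x + s *\<^sub>R axis k 1 \<in> D" using x s unfolding erode_def by blast
    then have "x + s *\<^sub>R axis k 1 + u \<in> C" using u unfolding D(3) by blast
    then show "x + v \<in> C" using vu by (simp add: add.assoc)
  next
    fix x assume x: "\<forall>v\<in>cube \<epsilon> (insert k I). x + v \<in> C"
    have "x + s *\<^sub>R axis k 1 \<in> D" if s: "\<bar>s\<bar> \<le> \<epsilon>" for s
      unfolding D(3)
    proof (rule CollectI, rule ballI)
      fix v assume "v \<in> cube \<epsilon> I"
      with s have "s *\<^sub>R axis k 1 + v \<in> cube \<epsilon> (insert k I)"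
        by (rule cube_insertI[OF insert(2) \<epsilon>])
      then have "x + (s *\<^sub>R axis k 1 + v) \<in> C" using x by blast
      then show "x + s *\<^sub>R axis k 1 + v \<in> C" by (simp add: add.assoc)
    qed
    then show "x \<in> erode k \<epsilon> D" unfolding erode_def by blast
  qed
  moreover have "measure gauss C \<le> measure gauss (erode k \<epsilon> D) + 2 * \<epsilon> * card (insert k I)"
    using gauss_dilate_erode_le(2)[OF D(1,2) \<epsilon>, of k] D(4) insert by (simp add: algebra_simps)
  ultimately show ?case using erode_compact_convex[OF D(1,2) \<epsilon>, of k]
    by - (intro exI[of _ "erode k \<epsilon> D"] conjI; assumption)
qed

lemma cube_uminus: "v \<in> cube \<epsilon> I \<Longrightarrow> - v \<in> cube \<epsilon> I"
  by (auto simp: cube_def)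

text \<open>Dilate twice: \<open>D\<close> contains every small translate of \<open>C\<close>, and every point that some small translation moves into \<open>D\<close> lies
  in \<open>U\<close>.\<close>

lemma convex_sandwich_outer:
  fixes C :: "(real ^ 'm::finite) set"
  assumes C: "compact C" "convex C" and \<epsilon>: "0 \<le> \<epsilon>"
  obtains D U where "compact D" "convex D" "compact U" "convex U"
    "\<And>x v. v \<in> cube \<epsilon> UNIV \<Longrightarrow> x \<in> C \<Longrightarrow> x + v \<in> D"
    "\<And>x v. v \<in> cube \<epsilon> UNIV \<Longrightarrow> x + v \<in> D \<Longrightarrow> x \<in> U"
    "measure gauss U \<le> measure gauss C + 4 * \<epsilon> * CARD('m)"
proof -
  obtain D where D: "compact D" "convex D" "D = {x. \<exists>v\<in>cube \<epsilon> UNIV. x + v \<in> C}" "measure gauss D \<le> measure gauss C + 2 * \<epsilon> * CARD('m)"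
    using cube_dilation[OF C \<epsilon>, of UNIV] by auto
  obtain U where U: "compact U" "convex U" "U = {x. \<exists>v\<in>cube \<epsilon> UNIV. x + v \<in> D}" "measure gauss U \<le> measure gauss D + 2 * \<epsilon> * CARD('m)"
    using cube_dilation[OF D(1,2) \<epsilon>, of UNIV] by auto
  show thesis
  proof (rule that[OF D(1,2) U(1,2)])
    show "x + v \<in> D" if "v \<in> cube \<epsilon> UNIV" "x \<in> C" for x v
      unfolding D(3) using that cube_uminus[OF that(1)] by (auto intro!: bexI[of _ "- v"])
    show "x \<in> U" if "v \<in> cube \<epsilon> UNIV" "x + v \<in> D" for x v
      unfolding U(3) using that by auto
    show "measure gauss U \<le> measure gauss C + 4 * \<epsilon> * CARD('m)" using D(4) U(4) by simp
  qed
qed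

text \<open>The same with erosions, from inside.\<close>

lemma convex_sandwich_inner:
  fixes C :: "(real ^ 'm::finite) set"
  assumes C: "compact C" "convex C" and \<epsilon>: "0 \<le> \<epsilon>"
  obtains D U where "compact D" "convex D" "compact U" "convex U"
    "\<And>x v. v \<in> cube \<epsilon> UNIV \<Longrightarrow> x \<in> U \<Longrightarrow> x + v \<in> D"
    "\<And>x v. v \<in> cube \<epsilon> UNIV \<Longrightarrow> x + v \<in> D \<Longrightarrow> x \<in> C"
    "measure gauss C \<le> measure gauss U + 4 * \<epsilon> * CARD('m)"
proof -
  obtain D where D: "compact D" "convex D" "D = {x. \<forall>v\<in>cube \<epsilon> UNIV. x + v \<in> C}" "measure gauss C \<le> measure gauss D + 2 * \<epsilon> * CARD('m)"
    using cube_erosion[OF C \<epsilon>, of UNIV] by auto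
  obtain U where U: "compact U" "convex U" "U = {x. \<forall>v\<in>cube \<epsilon> UNIV. x + v \<in> D}" "measure gauss D \<le> measure gauss U + 2 * \<epsilon> * CARD('m)"
    using cube_erosion[OF D(1,2) \<epsilon>, of UNIV] by auto
  show thesis
  proof (rule that[OF D(1,2) U(1,2)])
    show "x + v \<in> D" if "v \<in> cube \<epsilon> UNIV" "x \<in> U" for x v
      using that unfolding U(3) by auto
    show "x \<in> C" if "v \<in> cube \<epsilon> UNIV" "x + v \<in> D" for x v
    proof -
      have "(x + v) + (- v) \<in> C" using that cube_uminus[OF that(1)] unfolding D(3) by blast
      then show ?thesis by simp
    qed
    show "measure gauss C \<le> measure gauss U + 4 * \<epsilon> * CARD('m)" using D(4) U(4) by simp
  qed
qed

text \<open>Translate along one axis after the other; a point whose membership changes in one such step lies in a boundary layer of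
  the translated set.\<close>

lemma gauss_translation_symmetric_difference:
  fixes A :: "(real ^ 'm::finite) set"
  assumes A: "compact A" "convex A"
  shows "measure gauss {x. (x + v \<in> A) \<noteq> (x \<in> A)} \<le> 2 * (\<Sum>i\<in>UNIV. \<bar>v $ i\<bar>)"
proof -
  have tr: "compact {x. x + u \<in> A}" "convex {x. x + u \<in> A}" for u
  proof -
    have e: "{x. x + u \<in> A} = (\<lambda>x. x - u) ` A" by (auto simp: image_iff intro!: bexI[of _ "_ + u"])
    show "compact {x. x + u \<in> A}" unfolding e using A by (intro compact_continuous_image continuous_intros)
    show "convex {x. x + u \<in> A}" unfolding e using A(2) by (simp add: convex_translation_subtract)
  qed
  have [measurable]: "A \<in> sets borel" using A by simp
  define p where "p I = (\<Sum>i\<in>I. (v $ i) *\<^sub>R axis i 1 :: real ^ 'm)" for I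
  have "measure gauss {x. (x + p I \<in> A) \<noteq> (x \<in> A)} \<le> 2 * (\<Sum>i\<in>I. \<bar>v $ i\<bar>)" if "finite I" for I
    using that
  proof (induction I rule: finite_induct)
    case empty
    then show ?case by (simp add: p_def)
  next
    case (insert k I)
    let ?A = "{x. x + p I \<in> A}"
    let ?L = "dilate k \<bar>v $ k\<bar> ?A - erode k \<bar>v $ k\<bar> ?A"
    let ?D = "{x. (x + p I \<in> A) \<noteq> (x \<in> A)}"
    have pk: "p (insert k I) = p I + (v $ k) *\<^sub>R axis k 1" using insert by (simp add: p_def)
    have L: "?L \<in> sets gauss"
      using dilate_compact_convex(1)[OF tr] erode_compact_convex(1)[OF tr] by auto
    have D: "?D \<in> sets gauss"
    proof -
      have e: "?D = (?A - A) \<union> (A - ?A)" by auto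
      show ?thesis unfolding e using tr(1)[of "p I"] by (auto intro!: sets.Un sets.Diff)
    qed
    have "{x. (x + p (insert k I) \<in> A) \<noteq> (x \<in> A)} \<subseteq> ?L \<union> ?D"
    proof
      fix x assume x: "x \<in> {x. (x + p (insert k I) \<in> A) \<noteq> (x \<in> A)}"
      show "x \<in> ?L \<union> ?D"
      proof (cases "x \<in> ?D")
        case False
        then have ne: "(x + (v $ k) *\<^sub>R axis k 1 \<in> ?A) \<noteq> (x \<in> ?A)" using x by (auto simp: pk add_ac)
        have "\<exists>s. \<bar>s\<bar> \<le> \<bar>v $ k\<bar> \<and> x + s *\<^sub>R axis k 1 \<in> ?A"
          using ne by (cases "x \<in> ?A") (auto intro: exI[of _ 0] exI[of _ "v $ k"])
        moreover have "\<exists>s. \<bar>s\<bar> \<le> \<bar>v $ k\<bar> \<and> x + s *\<^sub>R axis k 1 \<notin> ?A"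
          using ne by (cases "x \<in> ?A") (auto intro: exI[of _ 0] exI[of _ "v $ k"])
        ultimately have "x \<in> dilate k \<bar>v $ k\<bar> ?A" "x \<notin> erode k \<bar>v $ k\<bar> ?A"
          unfolding dilate_def erode_def by blast+
        then show ?thesis by blast
      qed simp
    qed
    then have "measure gauss {x. (x + p (insert k I) \<in> A) \<noteq> (x \<in> A)} \<le> measure gauss (?L \<union> ?D)"
      by (rule gauss.finite_measure_mono) (use L D in auto)
    also have "\<dots> \<le> measure gauss ?L + measure gauss ?D"
      using L D by (rule measure_Un_le)
    also have "\<dots> \<le> 2 * \<bar>v $ k\<bar> + 2 * (\<Sum>i\<in>I. \<bar>v $ i\<bar>)"
      using gauss_boundary_layer[OF tr, of "\<bar>v $ k\<bar>" k "p I"] insert.IH by simp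
    finally show ?case using insert by (simp add: algebra_simps)
  qed
  from this[of UNIV] show ?thesis
    by (simp add: p_def basis_expansion[of v, unfolded scalar_mult_eq_scaleR])
qed

section \<open>Stein Hessians of convex sets in mean square\<close>

lemma gauss_prob_UNIV[simp]: "measure (gauss :: (real ^ 'm::finite) measure) UNIV = 1"
  using gauss.prob_space by simp

lemma mult_cos_le_sin:
  fixes t :: real
  assumes "0 < t" "t \<le> pi/2"
  shows "t * cos t \<le> sin t"
proof -
  obtain z where z: "0 < z" "z < t" "sin t - sin 0 = (t - 0) * cos z"
    using MVT2[of 0 t sin cos] assms DERIV_sin by blast
  have "cos t \<le> cos z" using z assms by (intro cos_monotone_0_pi_le) auto
  then show ?thesis using z assms by simp
qed

text \<open>The singularity of \<open>cot\<close> at zero is that of \<open>1 / t\<close>.\<close>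

lemma cot_le_inverse:
  fixes t :: real
  assumes "0 < t" "t \<le> pi/2"
  shows "cos t / sin t \<le> 1 / t"
proof -
  have "0 < sin t" using assms pi_gt_zero by (intro sin_gt_zero) auto
  then show ?thesis using mult_cos_le_sin[OF assms] assms by (simp add: field_simps)
qed

lemma tan_le_double:
  fixes t :: real
  assumes "0 < t" "t \<le> 1"
  shows "tan t \<le> 2 * t" "0 < cos t"
proof -
  have "(sin (t/2))\<^sup>2 \<le> (t/2)\<^sup>2" using assms sin_x_le_x[of "t/2"] sin_ge_zero[of "t/2"] pi_ge_two by (intro power_mono) auto
  also have "\<dots> \<le> 1/4" using assms by (simp add: power2_eq_square mult_le_one)
  finally have half: "1/2 \<le> cos t" using cos_double_sin[of "t/2"] by simp
  then show "0 < cos t" by simp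
  have "2 * t * (1/2) \<le> 2 * t * cos t"
    using assms half by (intro mult_left_mono) auto
  then have "sin t \<le> 2 * t * cos t"
    using sin_x_le_x[OF less_imp_le[OF assms(1)]] by linarith
  then show "tan t \<le> 2 * t" using \<open>0 < cos t\<close> by (simp add: tan_def pos_divide_le_eq)
qed

lemma rot_eq_tan:
  assumes "0 < cos t"
  shows "rot t y z = cos t *\<^sub>R (y + tan t *\<^sub>R z)"
  using assms by (simp add: rot_def tan_def scaleR_add_right)

text \<open>For convex \<open>C\<close> this set of starting points is convex, and so is the intersection of two of them; this is how the square
  of a Stein Hessian is seen by the convex distance.\<close>

definition rot_section :: "(real ^ 'm) set \<Rightarrow> real \<times> (real ^ 'm) \<Rightarrow> (real ^ 'm) set" where
  "rot_section C q = {y. rot (fst q) y (snd q) \<in> C}"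

lemma rot_vimage_convex:
  assumes "convex C"
  shows "convex {y. rot t y z \<in> C}"
proof (rule convexI)
  fix x y u v assume *: "x \<in> {y. rot t y z \<in> C}" "y \<in> {y. rot t y z \<in> C}" "0 \<le> (u::real)" "0 \<le> v" "u + v = 1"
  have "u *\<^sub>R rot t x z + v *\<^sub>R rot t y z \<in> C" using convexD[OF assms] * by blast
  moreover have "u *\<^sub>R rot t x z + v *\<^sub>R rot t y z = cos t *\<^sub>R (u *\<^sub>R x + v *\<^sub>R y) + (u + v) *\<^sub>R sin t *\<^sub>R z"
    by (simp add: rot_def algebra_simps)
  ultimately show "u *\<^sub>R x + v *\<^sub>R y \<in> {y. rot t y z \<in> C}" using * by (simp add: rot_def)
qed

lemma rot_vimage_borel:
  fixes C :: "(real ^ 'm::finite) set"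
  assumes "C \<in> sets borel" shows "{y. rot t y z \<in> C} \<in> sets borel"
proof -
  have "(\<lambda>y. rot t y z) \<in> borel_measurable borel" by measurable
  from measurable_sets[OF this assms] show ?thesis by (simp add: vimage_def)
qed

lemma scaleR_vimage_compact_convex:
  fixes C :: "(real ^ 'm::finite) set"
  assumes C: "compact C" "convex C" and c: "c \<noteq> 0"
  shows "compact {x. c *\<^sub>R x \<in> C}" "convex {x. c *\<^sub>R x \<in> C}"
proof -
  have e: "{x. c *\<^sub>R x \<in> C} = (\<lambda>x. (1/c) *\<^sub>R x) ` C"
    using c by (auto simp: image_iff intro!: bexI[of _ "c *\<^sub>R _"])
  show "compact {x. c *\<^sub>R x \<in> C}" unfolding e using C by (intro compact_scaling)
  show "convex {x. c *\<^sub>R x \<in> C}" unfolding e using C by (intro convex_scaling)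
qed

context
  fixes a :: real and C :: "(real ^ 'm::finite) set" and i j :: 'm
  assumes a: "0 < a" "a < pi/2" and C: "compact C" "convex C"
begin

interpretation A: prob_space "angles a" by (rule prob_space_angles[OF a(2)])
interpretation Q: prob_space "mixer a :: (real \<times> (real ^ 'm)) measure" by (rule prob_space_mixer[OF a(2)])
interpretation AG: pair_prob_space "angles a" "gauss :: (real ^ 'm) measure" ..
interpretation QQ: pair_prob_space "mixer a :: (real \<times> (real ^ 'm)) measure" "mixer a :: (real \<times> (real ^ 'm)) measure" ..

lemma C_borel[measurable]: "C \<in> sets borel" using C by simp

abbreviation (input) "Wh \<equiv> stein_hessian a (indicator C) i j"
abbreviation (input) "Kh \<equiv> stein_kernel a i j"

lemma stein_kernel_indicator_integrable:
  "integrable (mixer a) (\<lambda>q. Kh q * indicator C (rot (fst q) y (snd q)))"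
  by (rule Bochner_Integration.integrable_bound[OF integrable_stein_kernel[OF a, of i j]])
     (auto split: split_indicator)

lemma stein_hessian_measurable[measurable]: "Wh \<in> borel_measurable borel"
proof -
  have "(\<lambda>y. LINT q|mixer a. Kh q * indicator C (rot (fst q) y (snd q))) \<in> borel_measurable borel"
    by measurable
  then show ?thesis by (simp add: stein_hessian_def[abs_def])
qed

lemma stein_hessian_bounded: "\<bar>Wh y\<bar> \<le> (LINT q|mixer a. \<bar>Kh q\<bar>)"
proof -
  have "\<bar>Wh y\<bar> \<le> (LINT q|mixer a. norm (Kh q * indicator C (rot (fst q) y (snd q))))"
    unfolding stein_hessian_def using integral_norm_bound[of "mixer a" "\<lambda>q. Kh q * indicator C (rot (fst q) y (snd q))"] by simp
  also have "\<dots> \<le> (LINT q|mixer a. \<bar>Kh q\<bar>)"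
    by (rule integral_mono) (use stein_kernel_indicator_integrable integrable_stein_kernel[OF a, of i j] in \<open>auto split: split_indicator\<close>)
  finally show ?thesis .
qed

lemma stein_hessian_square_integrable:
  assumes "prob_space \<nu>" "sets \<nu> = sets borel"
  shows "integrable \<nu> (\<lambda>y. (Wh y)\<^sup>2)"
proof -
  interpret prob_space \<nu> by fact
  note [measurable_cong] = assms(2)
  show ?thesis
  proof (rule integrable_const_bound)
    show "AE y in \<nu>. norm ((Wh y)\<^sup>2) \<le> (LINT q|mixer a. \<bar>Kh q\<bar>)\<^sup>2"
      using power_mono[OF stein_hessian_bounded abs_ge_zero, of _ 2] by simp
  qed measurable
qed

text \<open>The square of an integral is a double integral, and the product of two indicator functions is that of the intersection.\<close>

lemma stein_hessian_square_integral:
  assumes \<nu>: "prob_space \<nu>" "sets \<nu> = sets borel"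
  shows "(LINT y|\<nu>. (Wh y)\<^sup>2) = (LINT p|(mixer a \<Otimes>\<^sub>M mixer a). Kh (fst p) * Kh (snd p) * measure \<nu> (rot_section C (fst p) \<inter> rot_section C (snd p)))"
    and "integrable (mixer a \<Otimes>\<^sub>M mixer a) (\<lambda>p. Kh (fst p) * Kh (snd p) * measure \<nu> (rot_section C (fst p) \<inter> rot_section C (snd p)))"
proof -
  let ?Q = "mixer a :: (real \<times> (real ^ 'm)) measure"
  interpret N: prob_space \<nu> by fact
  note [measurable_cong] = \<nu>(2)
  interpret NQ: pair_prob_space \<nu> "?Q \<Otimes>\<^sub>M ?Q" ..
  have spN: "space \<nu> = UNIV" using sets_eq_imp_space_eq[OF \<nu>(2)] by simp
  define f where "f y q = Kh q * indicator C (rot (fst q) y (snd q))" for y q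
  have fi: "integrable ?Q (f y)" for y unfolding f_def by (rule stein_kernel_indicator_integrable)
  have KK: "integrable (?Q \<Otimes>\<^sub>M ?Q) (\<lambda>p. Kh (fst p) * Kh (snd p))"
    by (rule integrable_product_pair(1)[OF Q.prob_space_axioms Q.prob_space_axioms integrable_stein_kernel[OF a] integrable_stein_kernel[OF a]])
  have KKn: "integrable (\<nu> \<Otimes>\<^sub>M (?Q \<Otimes>\<^sub>M ?Q)) (\<lambda>p. Kh (fst (snd p)) * Kh (snd (snd p)))"
    by (rule pair_prob_snd(1)[OF \<nu>(1) QQ.prob_space_axioms KK])
  have I: "integrable (\<nu> \<Otimes>\<^sub>M (?Q \<Otimes>\<^sub>M ?Q)) (\<lambda>(y, p). f y (fst p) * f y (snd p))"
  proof (rule Bochner_Integration.integrable_bound[OF KKn])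
    show "(\<lambda>(y, p). f y (fst p) * f y (snd p)) \<in> borel_measurable (\<nu> \<Otimes>\<^sub>M (?Q \<Otimes>\<^sub>M ?Q))"
      unfolding f_def by measurable
  qed (auto simp: f_def split: split_indicator)
  have sq: "(Wh y)\<^sup>2 = (LINT p|(?Q \<Otimes>\<^sub>M ?Q). f y (fst p) * f y (snd p))" for y
    using integrable_product_pair(2)[OF Q.prob_space_axioms Q.prob_space_axioms fi fi, of y y]
    by (simp add: stein_hessian_def f_def power2_eq_square)
  have inner: "(LINT y|\<nu>. f y (fst p) * f y (snd p)) = Kh (fst p) * Kh (snd p) * measure \<nu> (rot_section C (fst p) \<inter> rot_section C (snd p))" for p
  proof -
    have A: "rot_section C q \<in> sets \<nu>" for q unfolding rot_section_def \<nu>(2) by (rule rot_vimage_borel) measurable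
    have "(LINT y|\<nu>. f y (fst p) * f y (snd p)) = (LINT y|\<nu>. (Kh (fst p) * Kh (snd p)) * indicator (rot_section C (fst p) \<inter> rot_section C (snd p)) y)"
      by (intro Bochner_Integration.integral_cong refl) (auto simp: f_def rot_section_def split: split_indicator)
    then show ?thesis using A spN by simp
  qed
  have "(LINT y|\<nu>. (Wh y)\<^sup>2) = (LINT p|(?Q \<Otimes>\<^sub>M ?Q). LINT y|\<nu>. f y (fst p) * f y (snd p))"
    unfolding sq by (rule NQ.Fubini_integral[OF I, symmetric])
  then show "(LINT y|\<nu>. (Wh y)\<^sup>2) = (LINT p|(?Q \<Otimes>\<^sub>M ?Q). Kh (fst p) * Kh (snd p) * measure \<nu> (rot_section C (fst p) \<inter> rot_section C (snd p)))"
    unfolding inner .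
  show "integrable (?Q \<Otimes>\<^sub>M ?Q) (\<lambda>p. Kh (fst p) * Kh (snd p) * measure \<nu> (rot_section C (fst p) \<inter> rot_section C (snd p)))"
    using NQ.integrable_snd[OF I] unfolding inner .
qed

text \<open>In the representation of \<open>stein_hessian_square_integral\<close> the law enters only through its values on convex sets.\<close>

lemma stein_hessian_compare:
  assumes \<mu>: "prob_space \<mu>" "sets \<mu> = sets borel"
    and \<kappa>: "\<And>S :: (real ^ 'm) set. convex S \<Longrightarrow> S \<in> sets borel \<Longrightarrow> \<bar>measure \<mu> S - measure gauss S\<bar> \<le> \<kappa>"
  shows "(LINT y|\<mu>. (Wh y)\<^sup>2) \<le> (LINT y|gauss. (Wh y)\<^sup>2) + \<kappa> * (LINT q|mixer a. \<bar>Kh q\<bar>)\<^sup>2"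
proof -
  let ?Q = "mixer a :: (real \<times> (real ^ 'm)) measure"
  note m = stein_hessian_square_integral[OF \<mu>]
  note g = stein_hessian_square_integral[OF prob_space_gauss sets_gauss]
  have AA: "convex (rot_section C q \<inter> rot_section C q')" "rot_section C q \<inter> rot_section C q' \<in> sets borel" for q q'
    unfolding rot_section_def by (auto intro!: convex_Int rot_vimage_convex C(2) sets.Int rot_vimage_borel)
  have KA: "integrable ?Q (\<lambda>q. \<bar>Kh q\<bar>)" using integrable_stein_kernel[OF a, of i j] by simp
  note KK = integrable_product_pair[OF Q.prob_space_axioms Q.prob_space_axioms KA KA]
  have "(LINT y|\<mu>. (Wh y)\<^sup>2) - (LINT y|gauss. (Wh y)\<^sup>2) =
    (LINT p|(?Q \<Otimes>\<^sub>M ?Q). Kh (fst p) * Kh (snd p) * measure \<mu> (rot_section C (fst p) \<inter> rot_section C (snd p)) - Kh (fst p) * Kh (snd p) * measure gauss (rot_section C (fst p) \<inter> rot_section C (snd p)))"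
    unfolding m(1) g(1) by (rule Bochner_Integration.integral_diff[symmetric, OF m(2) g(2)])
  also have "\<dots> \<le> (LINT p|(?Q \<Otimes>\<^sub>M ?Q). \<kappa> * (\<bar>Kh (fst p)\<bar> * \<bar>Kh (snd p)\<bar>))"
  proof (rule integral_mono)
    fix p
    have "Kh (fst p) * Kh (snd p) * (measure \<mu> (rot_section C (fst p) \<inter> rot_section C (snd p)) - measure gauss (rot_section C (fst p) \<inter> rot_section C (snd p))) \<le>
      \<bar>Kh (fst p) * Kh (snd p)\<bar> * \<bar>measure \<mu> (rot_section C (fst p) \<inter> rot_section C (snd p)) - measure gauss (rot_section C (fst p) \<inter> rot_section C (snd p))\<bar>"
      unfolding abs_mult[symmetric] by (rule abs_ge_self)
    also have "\<dots> \<le> \<bar>Kh (fst p) * Kh (snd p)\<bar> * \<kappa>" by (intro mult_left_mono \<kappa> AA) auto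
    finally show "Kh (fst p) * Kh (snd p) * measure \<mu> (rot_section C (fst p) \<inter> rot_section C (snd p)) - Kh (fst p) * Kh (snd p) * measure gauss (rot_section C (fst p) \<inter> rot_section C (snd p)) \<le> \<kappa> * (\<bar>Kh (fst p)\<bar> * \<bar>Kh (snd p)\<bar>)"
      by (simp add: right_diff_distrib abs_mult mult.commute)
  qed (use m(2) g(2) KK(1) in auto)
  also have "\<dots> = \<kappa> * (LINT q|?Q. \<bar>Kh q\<bar>)\<^sup>2"
    using KK(2) by (simp add: power2_eq_square)
  finally show ?thesis by simp
qed

text \<open>The angular part is \<open>\<integral> cot t \<le> \<integral> 1/t = ln (\<pi>/2) - ln a\<close>, and the Gaussian part is at most the root of the second
  moment of \<open>H2\<close>.\<close>

lemma stein_kernel_L1: "(LINT q|mixer a. \<bar>Kh q\<bar>)\<^sup>2 \<le> 2 * (ln (pi / (2 * a)))\<^sup>2"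
proof -
  let ?l = "pi/2 - a"
  have l: "0 < ?l" using a by simp
  have ci: "integrable (angles a) (\<lambda>t. \<bar>?l * (cos t / sin t)\<bar>)"
    by (intro integrable_abs integrable_mult_right integrable_cot_angles[OF a])
  have Hi: "integrable gauss (\<lambda>z::real ^ 'm. \<bar>H2 i j z\<bar>)" by (intro all_moments_integrable all_moments_abs H2_moments)
  have H: "(LINT z|gauss. \<bar>H2 i j (z :: real ^ 'm)\<bar>)\<^sup>2 \<le> 2"
  proof -
    have "(LINT z|gauss. \<bar>H2 i j (z :: real ^ 'm)\<bar> * 1)\<^sup>2 \<le> (LINT z|gauss. \<bar>H2 i j (z :: real ^ 'm)\<bar>\<^sup>2) * (LINT z|(gauss :: (real ^ 'm) measure). 1\<^sup>2)"
      by (rule Cauchy_Schwarz_integral(2)) (use all_moments_square_integrable[OF H2_moments[of i j]] in auto)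
    also have "\<dots> \<le> 2" using gauss_H2_second_moment[of i j] gauss.prob_space by simp
    finally show ?thesis by simp
  qed
  have "(LINT q|mixer a. \<bar>Kh q\<bar>) = (LINT t|angles a. \<bar>?l * (cos t / sin t)\<bar>) * (LINT z|gauss. \<bar>H2 i j (z :: real ^ 'm)\<bar>)"
    unfolding mixer_def
    using integrable_product_pair(2)[OF A.prob_space_axioms prob_space_gauss ci Hi] by (simp add: stein_kernel_def abs_mult)
  moreover have "(LINT t|angles a. \<bar>?l * (cos t / sin t)\<bar>) \<le> ln (pi / (2 * a))"
  proof -
    have m: "(\<lambda>t. 1 / t :: real) \<in> borel_measurable borel" by measurable
    have "integrable (angles a) (\<lambda>t. 1 / t)"
      by (rule angles_integrable_bounded[OF a(2) m, where B="1 / a"]) (use a in \<open>auto intro!: frac_le\<close>)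
    then have "(LINT t|angles a. \<bar>?l * (cos t / sin t)\<bar>) \<le> (LINT t|angles a. ?l *\<^sub>R (1 / t))"
    proof (intro integral_mono_AE ci)
      show "AE t in angles a. \<bar>?l * (cos t / sin t)\<bar> \<le> ?l *\<^sub>R (1 / t)"
        using AE_angles
      proof eventually_elim
        case (elim t)
        then have "0 \<le> cos t / sin t" "cos t / sin t \<le> 1 / t"
          using cot_angles_bound(1)[OF a(1), of t] cot_le_inverse[of t] a by auto
        then have "?l * (cos t / sin t) \<le> ?l * (1 / t)" "0 \<le> ?l * (cos t / sin t)"
          using l by (auto intro!: mult_left_mono simp del: times_divide_eq_right)
        then show ?case by (simp only: abs_of_nonneg real_scaleR_def)
      qed
    qed (rule integrable_scaleR_right)
    also have "\<dots> = (LINT t|lborel. indicator {a..pi/2} t *\<^sub>R (1 / t))" by (rule angles_integral[OF a(2) m])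
    also have "\<dots> = ln (pi/2) - ln a"
    proof (rule integral_FTC_atLeastAtMost)
      show "(ln has_vector_derivative 1 / t) (at t within {a..pi/2})" if "a \<le> t" for t
        using DERIV_ln_divide[of t] that a
        by (auto simp: has_real_derivative_iff_has_vector_derivative[symmetric] intro: DERIV_subset)
    qed (use a in \<open>auto intro!: continuous_intros\<close>)
    also have "\<dots> = ln (pi / (2 * a))" using a by (simp add: ln_div ln_mult)
    finally show ?thesis .
  qed
  ultimately have le: "(LINT q|mixer a. \<bar>Kh q\<bar>) \<le> ln (pi / (2 * a)) * (LINT z|gauss. \<bar>H2 i j (z :: real ^ 'm)\<bar>)"
    by (simp add: mult_right_mono)
  have "(LINT q|mixer a. \<bar>Kh q\<bar>)\<^sup>2 \<le> (ln (pi / (2 * a)) * (LINT z|gauss. \<bar>H2 i j (z :: real ^ 'm)\<bar>))\<^sup>2"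
    by (rule power_mono[OF le]) simp
  also have "\<dots> \<le> (ln (pi / (2 * a)))\<^sup>2 * 2" unfolding power_mult_distrib by (intro mult_left_mono H) simp
  finally show ?thesis by simp
qed

text \<open>Relative to \<open>cos t *\<^sub>R x\<close>, the rotation is a translation by \<open>tan t *\<^sub>R z\<close> of a rescaled convex set. For \<open>t > 1\<close> the bound is
  trivial.\<close>

lemma gauss_rotation_oscillation:
  fixes t :: real
  assumes t: "0 < t" "t \<le> pi/2"
  shows "(LINT z|gauss. LINT x|gauss. \<bar>indicator C (rot t x z) - indicator C (cos t *\<^sub>R x) :: real\<bar>) \<le> 4 * real CARD('m) * t"
proof -
  define d where "d z x = \<bar>indicator C (rot t x z) - indicator C (cos t *\<^sub>R x) :: real\<bar>" for z x
  have d1: "0 \<le> d z x" "d z x \<le> 1" for z x by (auto simp: d_def split: split_indicator)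
  have d_m: "(\<lambda>x. d z x) \<in> borel_measurable borel" for z unfolding d_def by measurable
  have d_m2: "(\<lambda>z. LINT x|gauss. d z x) \<in> borel_measurable borel" unfolding d_def by measurable
  have di: "integrable gauss (d z)" for z
    by (rule gauss.integrable_const_bound[where B=1]) (use d1 d_m in auto)
  have L1: "(LINT x|gauss. d z x) \<le> 1" for z
    using integral_mono[OF di[of z] gauss.integrable_const[of 1] d1(2)] gauss.prob_space by simp
  have L0: "0 \<le> (LINT x|gauss. d z x)" for z using d1(1) by simp
  have Li: "integrable gauss (\<lambda>z. LINT x|gauss. d z x)"
    by (rule gauss.integrable_const_bound[where B=1]) (use L0 L1 d_m2 in auto)
  have "(LINT z|gauss. LINT x|gauss. d z x) \<le> 4 * real CARD('m) * t"
  proof (cases "t \<le> 1")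
    case False
    have "(LINT z|gauss. LINT x|gauss. d z x) \<le> (LINT z|(gauss :: (real ^ 'm) measure). 1)"
      by (rule integral_mono[OF Li]) (use L1 in auto)
    also have "\<dots> \<le> 4 * 1 * 1" using gauss.prob_space by simp
    also have "\<dots> \<le> 4 * real CARD('m) * t"
      using False by (intro mult_mono) (auto simp: Suc_le_eq)
    finally show ?thesis .
  next
    case True
    note tt = tan_le_double[OF t(1) True]
    have tan0: "0 \<le> tan t" using t tt(2) sin_ge_zero[of t] pi_gt_zero by (simp add: tan_def)
    define A where "A = {x. cos t *\<^sub>R x \<in> C}"
    have A: "compact A" "convex A" unfolding A_def using scaleR_vimage_compact_convex[OF C] tt(2) by auto
    have b: "(LINT x|gauss. d z x) \<le> 2 * (\<Sum>i\<in>UNIV. \<bar>tan t * z $ i\<bar>)" for z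
    proof -
      have "d z x = indicator {x. (x + tan t *\<^sub>R z \<in> A) \<noteq> (x \<in> A)} x" for x
        unfolding d_def rot_eq_tan[OF tt(2)] A_def by (auto split: split_indicator)
      moreover have "{x. (x + tan t *\<^sub>R z \<in> A) \<noteq> (x \<in> A)} \<in> sets borel"
      proof -
        have [measurable]: "A \<in> sets borel" using A by simp
        have "{x \<in> space borel. (x + tan t *\<^sub>R z \<in> A) \<noteq> (x \<in> A)} \<in> sets borel" by measurable
        then show ?thesis by simp
      qed
      ultimately have "(LINT x|gauss. d z x) = measure gauss {x. (x + tan t *\<^sub>R z \<in> A) \<noteq> (x \<in> A)}"
        by simp
      also have "\<dots> \<le> 2 * (\<Sum>i\<in>UNIV. \<bar>(tan t *\<^sub>R z) $ i\<bar>)" by (rule gauss_translation_symmetric_difference[OF A])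
      finally show ?thesis by simp
    qed
    have zi: "integrable gauss (\<lambda>z::real ^ 'm. \<bar>z $ k\<bar>)" for k by (intro all_moments_integrable all_moments_abs gauss_all_moments)
    have "(LINT z|gauss. LINT x|gauss. d z x) \<le> (LINT z|gauss. 2 * (\<Sum>k\<in>UNIV. tan t * \<bar>(z :: real ^ 'm) $ k\<bar>))"
      by (rule integral_mono[OF Li]) (use b zi tan0 in \<open>auto simp: abs_mult\<close>)
    also have "\<dots> = 2 * (\<Sum>k\<in>UNIV. tan t * (LINT z|gauss. \<bar>(z :: real ^ 'm) $ k\<bar>))" using zi by simp
    also have "\<dots> \<le> 2 * (\<Sum>k\<in>(UNIV :: 'm set). (2 * t) * 1)"
      using gauss_abs_mean tt tan0 t by (intro mult_left_mono sum_mono mult_mono) auto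
    also have "\<dots> = 4 * real CARD('m) * t" by simp
    finally show ?thesis .
  qed
  then show ?thesis unfolding d_def .
qed

lemma integral_inverse_sqrt_angles:
  "(LINT t|angles a. (pi/2 - a) * (1 / sqrt t)) \<le> 2 * sqrt (pi/2)"
  "integrable (angles a) (\<lambda>t. 1 / sqrt t)"
proof -
  have m: "(\<lambda>t. 1 / sqrt t) \<in> borel_measurable borel" by measurable
  show "integrable (angles a) (\<lambda>t. 1 / sqrt t)"
    by (rule angles_integrable_bounded[OF a(2) m, where B="1 / sqrt a"]) (use a in \<open>auto intro!: frac_le\<close>)
  have "(LINT t|angles a. (pi/2 - a) *\<^sub>R (1 / sqrt t)) = (LINT t|lborel. indicator {a..pi/2} t *\<^sub>R (1 / sqrt t))"
    by (rule angles_integral[OF a(2) m])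
  also have "\<dots> = 2 * sqrt (pi/2) - 2 * sqrt a"
  proof (rule integral_FTC_atLeastAtMost)
    show "((\<lambda>t. 2 * sqrt t) has_vector_derivative 1 / sqrt t) (at t within {a..pi/2})" if "a \<le> t" for t
      unfolding has_real_derivative_iff_has_vector_derivative[symmetric]
      using that a by (auto intro!: derivative_eq_intros simp: field_simps)
  qed (use a in \<open>auto intro!: continuous_intros\<close>)
  finally show "(LINT t|angles a. (pi/2 - a) * (1 / sqrt t)) \<le> 2 * sqrt (pi/2)" using a by simp
qed

text \<open>As \<open>H2\<close> has mean zero, the constant \<open>indicator C (cos t *\<^sub>R x)\<close> may be subtracted from \<open>indicator C (rot t x z)\<close>; the
  difference \<open>d\<close> has mean of order \<open>t\<close>. Split the kernel with the weight \<open>t\<^sup>1\<^sup>/\<^sup>4\<close> and use the Cauchy-Schwarz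
  inequality: one factor is \<open>\<integral> t\<^sup>-\<^sup>1\<^sup>/\<^sup>2\<close>, the other \<open>\<integral> t\<^sup>1\<^sup>/\<^sup>2 cot\<^sup>2 t E\<bar>d\<bar>\<close>, which is again of the order of
  \<open>\<integral> t\<^sup>-\<^sup>1\<^sup>/\<^sup>2\<close>. Both stay bounded as \<open>a\<close> tends to zero.\<close>

lemma stein_hessian_gauss_L2: "(LINT x|gauss. (Wh x)\<^sup>2) \<le> 64 * real CARD('m)"
proof -
  let ?Q = "mixer a :: (real \<times> (real ^ 'm)) measure" and ?l = "pi/2 - a"
  interpret GQ: pair_prob_space "gauss :: (real ^ 'm) measure" ?Q ..
  have l: "0 < ?l" using a by simp
  define d where "d x q = (indicator C (rot (fst q) x (snd q)) - indicator C (cos (fst q) *\<^sub>R x) :: real)" for x and q :: "real \<times> (real ^ 'm)"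
  have d_m[measurable]: "(\<lambda>p. d (fst p) (snd p)) \<in> borel_measurable (borel \<Otimes>\<^sub>M (borel \<Otimes>\<^sub>M borel))"
    unfolding d_def by measurable
  have d_m1[measurable]: "d x \<in> borel_measurable (borel \<Otimes>\<^sub>M borel)" for x
    unfolding d_def[abs_def] by measurable
  have d1: "\<bar>d x q\<bar> \<le> 1" for x q by (auto simp: d_def split: split_indicator)
  define s where "s t = sqrt (sqrt t)" for t :: real
  have s_m[measurable]: "s \<in> borel_measurable borel" unfolding s_def[abs_def] by measurable
  have spos: "0 < s t" "(s t)\<^sup>2 = sqrt t" if "a \<le> t" for t using that a by (auto simp: s_def)
  define F where "F q = sqrt ?l * (1 / s (fst q)) * H2 i j (snd q)" for q
  define G where "G x q = sqrt ?l * (s (fst q) * (cos (fst q) / sin (fst q))) * d x q" for x q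
  have F_m[measurable]: "F \<in> borel_measurable (borel \<Otimes>\<^sub>M borel)" unfolding F_def[abs_def] by measurable
  have G_m[measurable]: "G x \<in> borel_measurable (borel \<Otimes>\<^sub>M borel)" for x unfolding G_def[abs_def] by measurable
  have AEQ: "AE q in ?Q. a \<le> fst q \<and> fst q \<le> pi/2"
  proof -
    have "AE q in angles a \<Otimes>\<^sub>M (gauss :: (real ^ 'm) measure). a \<le> fst q \<and> fst q \<le> pi/2"
    proof (rule AG.AE_pair_measure)
      show "{q \<in> space (angles a \<Otimes>\<^sub>M (gauss :: (real ^ 'm) measure)). a \<le> fst q \<and> fst q \<le> pi/2} \<in> sets (angles a \<Otimes>\<^sub>M gauss)"
        by measurable
      show "AE t in angles a. AE z in (gauss :: (real ^ 'm) measure). a \<le> fst (t, z) \<and> fst (t, z) \<le> pi/2"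
        using AE_angles by eventually_elim simp
    qed
    then show ?thesis unfolding mixer_def .
  qed
  \<comment> \<open>The factor \<open>F\<close> carries \<open>H2\<close> and the integrable singularity \<open>t\<^sup>-\<^sup>1\<^sup>/\<^sup>4\<close>.\<close>
  have F2e: "AE q in ?Q. (F q)\<^sup>2 = (?l * (1 / sqrt (fst q))) * (H2 i j (snd q))\<^sup>2"
    using AEQ
  proof eventually_elim
    case (elim q)
    then show ?case using spos[of "fst q"] l by (simp add: F_def power_mult_distrib power_divide)
  qed
  note HH = all_moments_square_integrable[OF H2_moments[of i j]]
  note FP = integrable_product_pair[OF A.prob_space_axioms prob_space_gauss integrable_mult_right[OF integral_inverse_sqrt_angles(2), of ?l] HH, folded mixer_def]
  have F2i: "integrable ?Q (\<lambda>q. (F q)\<^sup>2)"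
    by (rule integrable_cong_AE_imp[OF FP(1)]) (use F2e in auto)
  have F2: "(LINT q|?Q. (F q)\<^sup>2) \<le> 2 * sqrt (pi/2) * 2"
  proof -
    have "(LINT q|?Q. (F q)\<^sup>2) = (LINT q|?Q. (?l * (1 / sqrt (fst q))) * (H2 i j (snd q))\<^sup>2)"
      by (rule integral_cong_AE) (use F2e in auto)
    also have "\<dots> = (LINT t|angles a. ?l * (1 / sqrt t)) * (LINT z|gauss. (H2 i j (z :: real ^ 'm))\<^sup>2)" by (rule FP(2))
    also have "\<dots> \<le> 2 * sqrt (pi/2) * 2"
      by (intro mult_mono integral_inverse_sqrt_angles(1) gauss_H2_second_moment) auto
    finally show ?thesis .
  qed
  \<comment> \<open>The square of \<open>G\<close> is of order \<open>t\<^sup>-\<^sup>3\<^sup>/\<^sup>2\<close> times \<open>\<bar>d\<bar>\<close>, and \<open>d\<close> has mean of order \<open>t\<close>.\<close>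
  define B where "B t = ?l * (1 / (t * sqrt t))" for t
  have B_m[measurable]: "B \<in> borel_measurable borel" unfolding B_def[abs_def] by measurable
  have B0: "0 \<le> B t" if "a \<le> t" for t using that a l by (simp add: B_def)
  have Bi: "integrable (angles a) B"
  proof (rule angles_integrable_bounded[OF a(2) B_m, where B="?l * (1 / (a * sqrt a))"])
    fix t assume t: "a \<le> t"
    have "1 / (t * sqrt t) \<le> 1 / (a * sqrt a)" using t a by (intro frac_le mult_mono) auto
    then have "B t \<le> ?l * (1 / (a * sqrt a))" unfolding B_def using l by (intro mult_left_mono) auto
    then show "norm (B t) \<le> ?l * (1 / (a * sqrt a))" using B0[OF t] by simp
  qed
  note BQ = pair_prob_fst[OF A.prob_space_axioms prob_space_gauss Bi, folded mixer_def]
  have G2le: "AE q in ?Q. (G x q)\<^sup>2 \<le> B (fst q) * \<bar>d x q\<bar>" for x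
    using AEQ
  proof eventually_elim
    case (elim q)
    let ?t = "fst q"
    have t0: "0 < ?t" using elim a by simp
    have "(cos ?t / sin ?t)\<^sup>2 \<le> (1 / ?t)\<^sup>2"
      using elim cot_angles_bound(1)[OF a(1), of ?t] cot_le_inverse[OF t0] by (intro power_mono) auto
    then have "sqrt ?t * (cos ?t / sin ?t)\<^sup>2 \<le> sqrt ?t * (1 / ?t)\<^sup>2" using t0 by (intro mult_left_mono) auto
    also have "\<dots> = 1 / (?t * sqrt ?t)" using t0 by (simp add: field_simps power2_eq_square)
    finally have 1: "sqrt ?t * (cos ?t / sin ?t)\<^sup>2 \<le> 1 / (?t * sqrt ?t)" .
    have d2: "(d x q)\<^sup>2 = \<bar>d x q\<bar>" by (auto simp: d_def split: split_indicator)
    have "(G x q)\<^sup>2 = ?l * (sqrt ?t * (cos ?t / sin ?t)\<^sup>2) * \<bar>d x q\<bar>"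
      unfolding G_def power_mult_distrib d2 using spos[of ?t] elim l by simp
    also have "\<dots> \<le> ?l * (1 / (?t * sqrt ?t)) * \<bar>d x q\<bar>"
      using 1 l by (intro mult_right_mono mult_left_mono) auto
    finally show ?case by (simp add: B_def)
  qed
  have Bdi: "integrable ?Q (\<lambda>q. B (fst q) * \<bar>d x q\<bar>)" for x
    by (rule Bochner_Integration.integrable_bound[OF BQ(1)])
       (use d1 in \<open>auto simp: abs_mult intro!: mult_left_le\<close>)
  have G2i: "integrable ?Q (\<lambda>q. (G x q)\<^sup>2)" for x
    by (rule Bochner_Integration.integrable_bound[OF Bdi[of x]])
       (use G2le[of x] in \<open>auto elim!: eventually_mono intro: order_trans[OF _ abs_ge_self]\<close>)
  \<comment> \<open>Subtracting \<open>indicator C (cos t *\<^sub>R x)\<close> does not change the integral, since \<open>H2\<close> has mean zero.\<close>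
  have Weq: "Wh x = (LINT q|?Q. F q * G x q)" for x
  proof -
    define c where "c t = ?l * (cos t / sin t) * indicator C (cos t *\<^sub>R x)" for t
    have ci: "integrable (angles a) c"
      by (rule Bochner_Integration.integrable_bound[OF integrable_mult_right[OF integrable_cot_angles[OF a], of ?l]])
         (auto simp: c_def[abs_def] split: split_indicator)
    note cH = integrable_product_pair[OF A.prob_space_axioms prob_space_gauss ci all_moments_integrable[OF H2_moments[of i j]], folded mixer_def]
    have "(LINT q|?Q. F q * G x q) = (LINT q|?Q. Kh q * d x q)"
    proof (rule integral_cong_AE)
      show "AE q in ?Q. F q * G x q = Kh q * d x q"
        using AEQ
      proof eventually_elim
        case (elim q)
        have "sqrt ?l * sqrt ?l = ?l" using l by simp
        then show ?case using spos(1)[of "fst q"] elim by (simp add: F_def G_def stein_kernel_def)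
      qed
    qed auto
    also have "\<dots> = (LINT q|?Q. Kh q * indicator C (rot (fst q) x (snd q)) - c (fst q) * H2 i j (snd q))"
    proof (intro Bochner_Integration.integral_cong refl)
      fix q
      have "Kh q * indicator C (cos (fst q) *\<^sub>R x) = c (fst q) * H2 i j (snd q)"
        unfolding c_def stein_kernel_def by (simp only: mult_ac)
      then show "Kh q * d x q = Kh q * indicator C (rot (fst q) x (snd q)) - c (fst q) * H2 i j (snd q)"
        unfolding d_def right_diff_distrib by simp
    qed
    also have "\<dots> = Wh x - (LINT q|?Q. c (fst q) * H2 i j (snd q))"
      unfolding stein_hessian_def by (rule Bochner_Integration.integral_diff[OF stein_kernel_indicator_integrable cH(1)])
    also have "(LINT q|?Q. c (fst q) * H2 i j (snd q)) = 0" unfolding cH(2) gauss_H2_mean by simp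
    finally show ?thesis by simp
  qed
  have W2: "(Wh x)\<^sup>2 \<le> (4 * sqrt (pi/2)) * (LINT q|?Q. B (fst q) * \<bar>d x q\<bar>)" for x
  proof -
    have "(Wh x)\<^sup>2 \<le> (LINT q|?Q. (F q)\<^sup>2) * (LINT q|?Q. (G x q)\<^sup>2)"
      unfolding Weq by (rule Cauchy_Schwarz_integral(2)) (use F2i G2i in auto)
    also have "\<dots> \<le> (4 * sqrt (pi/2)) * (LINT q|?Q. B (fst q) * \<bar>d x q\<bar>)"
    proof (rule mult_mono)
      show "(LINT q|?Q. (G x q)\<^sup>2) \<le> (LINT q|?Q. B (fst q) * \<bar>d x q\<bar>)"
        by (rule integral_mono_AE[OF G2i Bdi G2le])
    qed (use F2 in auto)
    finally show ?thesis .
  qed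
  have BGi: "integrable (gauss \<Otimes>\<^sub>M ?Q) (\<lambda>p. B (fst (snd p)))"
    by (rule pair_prob_snd(1)[OF prob_space_gauss Q.prob_space_axioms BQ(1)])
  have I: "integrable (gauss \<Otimes>\<^sub>M ?Q) (\<lambda>(x, q). B (fst q) * \<bar>d x q\<bar>)"
  proof (rule Bochner_Integration.integrable_bound[OF BGi])
    show "AE p in gauss \<Otimes>\<^sub>M ?Q. norm (case p of (x, q) \<Rightarrow> B (fst q) * \<bar>d x q\<bar>) \<le> norm (B (fst (snd p)))"
      using d1 by (auto simp: case_prod_unfold abs_mult intro!: mult_left_le)
  qed (unfold d_def, measurable)
  have ix: "integrable gauss (\<lambda>x. LINT q|?Q. B (fst q) * \<bar>d x q\<bar>)"
    using GQ.integrable_fst'[OF I] by simp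
  have "(LINT x|gauss. (Wh x)\<^sup>2) \<le> (LINT x|gauss. (4 * sqrt (pi/2)) * (LINT q|?Q. B (fst q) * \<bar>d x q\<bar>))"
    by (rule integral_mono[OF stein_hessian_square_integrable[OF prob_space_gauss sets_gauss] integrable_mult_right[OF ix] W2])
  also have "\<dots> = (4 * sqrt (pi/2)) * (LINT x|gauss. LINT q|?Q. B (fst q) * \<bar>d x q\<bar>)" by simp
  also have "(LINT x|gauss. LINT q|?Q. B (fst q) * \<bar>d x q\<bar>) = (LINT q|?Q. LINT x|gauss. B (fst q) * \<bar>d x q\<bar>)"
    by (rule GQ.Fubini_integral[OF I, symmetric])
  also have "\<dots> = (LINT q|?Q. B (fst q) * (LINT x|gauss. \<bar>d x q\<bar>))" by simp
  also have "\<dots> = (LINT t|angles a. LINT z|gauss. B t * (LINT x|gauss. \<bar>d x (t, z)\<bar>))"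
  proof -
    have "integrable ?Q (\<lambda>q. LINT x|gauss. B (fst q) * \<bar>d x q\<bar>)" using GQ.integrable_snd[OF I] .
    then have "integrable (angles a \<Otimes>\<^sub>M gauss) (\<lambda>q. B (fst q) * (LINT x|gauss. \<bar>d x q\<bar>))" by (simp add: mixer_def)
    from AG.integral_fst'[OF this] show ?thesis by (simp add: mixer_def)
  qed
  also have "\<dots> = (LINT t|angles a. B t * (LINT z|gauss. LINT x|gauss. \<bar>d x (t, z)\<bar>))" by simp
  also have "\<dots> \<le> (LINT t|angles a. (4 * real CARD('m)) * (?l * (1 / sqrt t)))"
  proof (rule integral_mono_AE)
    define e where "e t = (LINT z|gauss. LINT x|gauss. \<bar>d x (t, z)\<bar>)" for t
    have e_m[measurable]: "e \<in> borel_measurable borel" unfolding e_def[abs_def] d_def by measurable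
    have e_le: "0 \<le> e t \<and> e t \<le> 4 * real CARD('m) * t" if "a \<le> t" "t \<le> pi/2" for t
      using gauss_rotation_oscillation[of t] that a by (simp add: e_def d_def)
    show ae: "AE t in angles a. B t * (LINT z|gauss. LINT x|gauss. \<bar>d x (t, z)\<bar>) \<le> (4 * real CARD('m)) * (?l * (1 / sqrt t))"
      unfolding e_def[symmetric] using AE_angles
    proof eventually_elim
      case (elim t)
      have "B t * e t \<le> B t * (4 * real CARD('m) * t)" using elim e_le B0 by (intro mult_left_mono) auto
      also have "\<dots> = (4 * real CARD('m)) * (?l * (1 / sqrt t))" using elim a by (simp add: B_def)
      finally show ?case .
    qed
    show i2: "integrable (angles a) (\<lambda>t. (4 * real CARD('m)) * (?l * (1 / sqrt t)))"
      by (intro integrable_mult_right integral_inverse_sqrt_angles(2))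
    show "integrable (angles a) (\<lambda>t. B t * (LINT z|gauss. LINT x|gauss. \<bar>d x (t, z)\<bar>))"
      unfolding e_def[symmetric]
    proof (rule Bochner_Integration.integrable_bound[OF i2])
      show "AE t in angles a. norm (B t * e t) \<le> norm ((4 * real CARD('m)) * (?l * (1 / sqrt t)))"
        using ae[folded e_def] AE_angles
      proof eventually_elim
        case (elim t)
        then have "0 \<le> B t * e t" using B0 e_le by auto
        then show ?case using order_trans[OF elim(1) abs_ge_self] by (simp only: real_norm_def abs_of_nonneg)
      qed
    qed measurable
  qed
  also have "\<dots> = (4 * real CARD('m)) * (LINT t|angles a. ?l * (1 / sqrt t))" by (rule integral_mult_right_zero)
  also have "\<dots> \<le> (4 * real CARD('m)) * (2 * sqrt (pi/2))" by (intro mult_left_mono integral_inverse_sqrt_angles(1)) simp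
  finally have "(LINT x|gauss. (Wh x)\<^sup>2) \<le> (4 * sqrt (pi/2)) * ((4 * real CARD('m)) * (2 * sqrt (pi/2)))"
    by (simp add: mult_left_mono)
  also have "\<dots> = 16 * real CARD('m) * pi" by (simp add: field_simps)
  also have "\<dots> \<le> 16 * real CARD('m) * 4" using pi_less_4 by (intro mult_left_mono) auto
  finally show ?thesis by simp
qed

end

section \<open>The convex distance to the standard Gaussian law\<close>

text \<open>The interpolation formula, with each pairing of \<open>V - I\<close> with a Stein Hessian estimated by Young's inequality. The weight
  \<open>l\<close> is chosen so that the two contributions that do not contain \<open>\<kappa>\<close> are equal.\<close>

lemma stein_pairing_bound:
  fixes M :: "'w measure" and Y :: "'w \<Rightarrow> real ^ 'm::finite" and V :: "'w \<Rightarrow> real ^ 'm ^ 'm" and C :: "(real ^ 'm) set"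
  assumes M: "prob_space M" and Ym[measurable]: "Y \<in> borel_measurable M"
    and Yi: "\<And>i. integrable M (\<lambda>w. Y w $ i)"
    and Vm[measurable]: "\<And>i j. (\<lambda>w. V w $ i $ j) \<in> borel_measurable M"
    and Bsq: "\<And>i j. integrable M (\<lambda>w. (V w $ i $ j - (if i = j then 1 else 0))\<^sup>2)"
    and stein: "stein_identity M Y V"
    and a: "0 < a" "a < pi/2" and C: "compact C" "convex C"
    and \<kappa>: "\<And>S :: (real ^ 'm) set. convex S \<Longrightarrow> S \<in> sets borel \<Longrightarrow> \<bar>measure (distr M borel Y) S - measure gauss S\<bar> \<le> \<kappa>"
    and g: "0 < g" "(\<Sum>i\<in>UNIV. \<Sum>j\<in>UNIV. LINT w|M. (V w $ i $ j - (if i = j then 1 else 0))\<^sup>2) \<le> g\<^sup>2"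
  defines "m \<equiv> real CARD('m)"
  shows "\<bar>(LINT w|M. LINT z|gauss. indicator C (rot a (Y w) z)) - measure gauss C\<bar> \<le>
    8 * (m * sqrt m) * g + sqrt m * (ln (pi / (2 * a)))\<^sup>2 * g * \<kappa> / 8"
proof -
  interpret M: prob_space M by (rule M)
  let ?B = "\<lambda>w i j. V w $ i $ j - (if i = j then 1 else 0)"
  let ?W = "\<lambda>i j. stein_hessian a (indicator C) i j" and ?L = "ln (pi / (2 * a))"
  let ?\<mu> = "distr M borel Y"
  have \<mu>: "prob_space ?\<mu>" "sets ?\<mu> = sets borel" by (auto intro: M.prob_space_distr)
  have m1: "1 \<le> m" unfolding m_def by (simp add: Suc_le_eq)
  have Bi: "integrable M (\<lambda>w. ?B w i j)" for i j
    by (rule M.square_integrable_imp_integrable[OF _ Bsq]) measurable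
  have Vi: "integrable M (\<lambda>w. V w $ i $ j)" for i j
    using Bochner_Integration.integrable_add[OF Bi[of i j] M.integrable_const[of "if i = j then 1 else 0"]] by simp
  have Cb[measurable]: "C \<in> sets borel" using C by simp
  note Wm[measurable] = stein_hessian_measurable[OF a C]
  have Wsq: "integrable M (\<lambda>w. (?W i j (Y w))\<^sup>2)" for i j
    using stein_hessian_square_integrable[OF a C \<mu>, of i j] by (simp add: integrable_distr_eq)
  have Wle: "(LINT w|M. (?W i j (Y w))\<^sup>2) \<le> 64 * m + 2 * ?L\<^sup>2 * \<kappa>" for i j
  proof -
    have k0: "0 \<le> \<kappa>" using \<kappa>[of "{}"] by simp
    have "(LINT w|M. (?W i j (Y w))\<^sup>2) = (LINT y|?\<mu>. (?W i j y)\<^sup>2)"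
      by (rule integral_distr[OF Ym borel_measurable_power[OF Wm], symmetric])
    also have "\<dots> \<le> (LINT y|gauss. (?W i j y)\<^sup>2) + \<kappa> * (LINT q|mixer a. \<bar>stein_kernel a i j q\<bar>)\<^sup>2"
      by (rule stein_hessian_compare[OF a C \<mu> \<kappa>])
    also have "\<dots> \<le> 64 * m + \<kappa> * (2 * ?L\<^sup>2)"
      unfolding m_def by (intro add_mono mult_left_mono stein_hessian_gauss_L2[OF a C] stein_kernel_L1[OF a C] k0)
    finally show ?thesis by (simp add: mult_ac)
  qed
  have BW: "integrable M (\<lambda>w. ?B w i j * ?W i j (Y w))" for i j
    by (rule Cauchy_Schwarz_integral(1)[OF _ _ Bsq Wsq]) auto
  \<comment> \<open>This makes \<open>l g\<^sup>2 / 2\<close> and \<open>m\<^sup>2 (64 m) / (2 l)\<close> both equal to \<open>4 m\<^sup>3\<^sup>/\<^sup>2 g\<close>.\<close>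
  define l where "l = 8 * (m * sqrt m) / g"
  have l: "0 < l" unfolding l_def using m1 g by simp
  have young: "\<bar>LINT w|M. ?B w i j * ?W i j (Y w)\<bar> \<le> l / 2 * (LINT w|M. (?B w i j)\<^sup>2) + 1 / (2 * l) * (LINT w|M. (?W i j (Y w))\<^sup>2)" for i j
  proof -
    have "\<bar>LINT w|M. ?B w i j * ?W i j (Y w)\<bar> \<le> (LINT w|M. \<bar>?B w i j * ?W i j (Y w)\<bar>)"
      by (rule integral_abs_bound)
    also have "\<dots> \<le> (LINT w|M. l / 2 * (?B w i j)\<^sup>2 + 1 / (2 * l) * (?W i j (Y w))\<^sup>2)"
    proof (rule integral_mono)
      show "integrable M (\<lambda>w. l / 2 * (?B w i j)\<^sup>2 + 1 / (2 * l) * (?W i j (Y w))\<^sup>2)"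
        by (intro Bochner_Integration.integrable_add integrable_mult_right Bsq Wsq)
      fix w
      have y: "\<bar>x * y\<bar> \<le> l / 2 * x\<^sup>2 + 1 / (2 * l) * y\<^sup>2" for x y :: real
      proof -
        have "0 \<le> (l * \<bar>x\<bar> - \<bar>y\<bar>)\<^sup>2" by simp
        then have "2 * l * (\<bar>x\<bar> * \<bar>y\<bar>) \<le> l\<^sup>2 * x\<^sup>2 + y\<^sup>2" by (simp add: power2_diff power_mult_distrib)
        then have "(2 * l * (\<bar>x\<bar> * \<bar>y\<bar>)) / (2 * l) \<le> (l\<^sup>2 * x\<^sup>2 + y\<^sup>2) / (2 * l)" using l by (intro divide_right_mono) auto
        then show ?thesis using l by (simp add: abs_mult add_divide_distrib power2_eq_square)
      qed
      show "\<bar>?B w i j * ?W i j (Y w)\<bar> \<le> l / 2 * (?B w i j)\<^sup>2 + 1 / (2 * l) * (?W i j (Y w))\<^sup>2" by (rule y)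
    qed (intro integrable_abs BW)
    also have "\<dots> = l / 2 * (LINT w|M. (?B w i j)\<^sup>2) + 1 / (2 * l) * (LINT w|M. (?W i j (Y w))\<^sup>2)"
      using Bsq Wsq by simp
    finally show ?thesis .
  qed
  have "\<bar>(LINT w|M. LINT z|gauss. indicator C (rot a (Y w) z)) - measure gauss C\<bar> =
    \<bar>\<Sum>i\<in>UNIV. \<Sum>j\<in>UNIV. LINT w|M. ?B w i j * ?W i j (Y w)\<bar>"
    using stein_interpolation[OF M Ym Yi Vi stein a, of "indicator C"] by (simp split: split_indicator)
  also have "\<dots> \<le> (\<Sum>i\<in>UNIV. \<Sum>j\<in>UNIV. \<bar>LINT w|M. ?B w i j * ?W i j (Y w)\<bar>)"
    by (rule order_trans[OF sum_abs]) (intro sum_mono sum_abs)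
  also have "\<dots> \<le> (\<Sum>i\<in>UNIV. \<Sum>j\<in>UNIV. l / 2 * (LINT w|M. (?B w i j)\<^sup>2) + 1 / (2 * l) * (64 * m + 2 * ?L\<^sup>2 * \<kappa>))"
    by (intro sum_mono order_trans[OF young] add_left_mono mult_left_mono Wle) (use l in auto)
  also have "\<dots> = l / 2 * (\<Sum>i\<in>UNIV. \<Sum>j\<in>UNIV. LINT w|M. (?B w i j)\<^sup>2) + m * (m * (1 / (2 * l) * (64 * m + 2 * ?L\<^sup>2 * \<kappa>)))"
    unfolding sum.distrib sum_distrib_left[symmetric] by (simp add: m_def algebra_simps)
  also have "\<dots> \<le> l / 2 * g\<^sup>2 + m * (m * (1 / (2 * l) * (64 * m + 2 * ?L\<^sup>2 * \<kappa>)))"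
    using g l by (intro add_right_mono mult_left_mono) auto
  also have "\<dots> = 8 * (m * sqrt m) * g + sqrt m * ?L\<^sup>2 * g * \<kappa> / 8"
  proof -
    define r where "r = sqrt m"
    have r: "m = r * r" "0 < r" using m1 by (auto simp: r_def)
    show ?thesis unfolding l_def r_def[symmetric] unfolding r(1)
      using r(2) g(1) by (simp add: field_simps power2_eq_square)
  qed
  finally show ?thesis .
qed

lemma translate_vimage:
  fixes A :: "(real ^ 'm::finite) set"
  assumes "convex A" "A \<in> sets borel"
  shows "convex {y. y + v \<in> A}" "{y. y + v \<in> A} \<in> sets borel"
proof -
  have e: "{y. y + v \<in> A} = (\<lambda>x. x - v) ` A" by (auto simp: image_iff intro!: bexI[of _ "_ + v"])
  show "convex {y. y + v \<in> A}" unfolding e using assms(1) by (simp add: convex_translation_subtract)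
  have "(\<lambda>y. y + v) \<in> borel_measurable borel" by measurable
  from measurable_sets[OF this assms(2)] show "{y. y + v \<in> A} \<in> sets borel" by (simp add: vimage_def)
qed

text \<open>Markov's inequality for the square of the norm, whose mean is the dimension.\<close>

lemma gauss_large_norm:
  "measure gauss {z :: real ^ 'm::finite. 8 * real CARD('m) \<le> (norm z)\<^sup>2} \<le> 1/8"
proof -
  have n2: "(norm z)\<^sup>2 = (\<Sum>i\<in>UNIV. (z $ i)\<^sup>2)" for z :: "real ^ 'm"
    by (simp add: norm_vec_def L2_set_def sum_nonneg)
  have i: "integrable gauss (\<lambda>z::real ^ 'm. (norm z)\<^sup>2)"
    unfolding n2 by (intro Bochner_Integration.integrable_sum all_moments_square_integrable gauss_all_moments)
  have e: "(LINT z|gauss. (norm (z :: real ^ 'm))\<^sup>2) = real CARD('m)"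
    unfolding n2 by (subst Bochner_Integration.integral_sum)
      (auto intro: all_moments_square_integrable gauss_all_moments simp: gauss_square_mean)
  have "measure gauss {z \<in> space gauss. 8 * real CARD('m) \<le> (norm (z :: real ^ 'm))\<^sup>2} \<le> (LINT z|gauss. (norm (z :: real ^ 'm))\<^sup>2) / (8 * real CARD('m))"
    by (rule integral_Markov_inequality_measure[OF i, where A="{}"]) auto
  then show ?thesis unfolding e by simp
qed

text \<open>A smoothing lemma in the style of Sazonov. Off the event \<open>bad\<close>, of probability at most \<open>1/8\<close>, the perturbation \<open>t *\<^sub>R z\<close> lies in
  the cube of size \<open>\<epsilon>\<close>. There the perturbed set for the sandwiching set \<open>B\<close> contains \<open>C\<close>, and its Gaussian measure
  exceeds that of \<open>C\<close> by at most \<open>4 \<epsilon> m\<close>; on \<open>bad\<close> the difference of the two measures is bounded by \<open>\<kappa>\<close>.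
  The lower bound is obtained in the same way from inside.\<close>

lemma convex_smoothing:
  fixes \<nu> :: "(real ^ 'm::finite) measure"
  assumes \<nu>: "prob_space \<nu>" "sets \<nu> = sets borel"
    and \<kappa>: "\<And>A. convex A \<Longrightarrow> A \<in> sets borel \<Longrightarrow> \<bar>measure \<nu> A - measure gauss A\<bar> \<le> \<kappa>"
    and t: "0 < t"
    and S: "\<And>B. compact B \<Longrightarrow> convex B \<Longrightarrow>
      \<bar>LINT z|gauss. measure \<nu> {y. y + t *\<^sub>R z \<in> B} - measure gauss {y. y + t *\<^sub>R z \<in> B}\<bar> \<le> S"
    and C: "compact C" "convex C"
  shows "\<bar>measure \<nu> C - measure gauss C\<bar> \<le> S + 4 * (t * sqrt (8 * real CARD('m))) * real CARD('m) + \<kappa> / 4"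
proof -
  interpret N: prob_space \<nu> by (rule \<nu>(1))
  note [measurable_cong] = \<nu>(2)
  have spN: "space \<nu> = UNIV" using sets_eq_imp_space_eq[OF \<nu>(2)] by simp
  define \<epsilon> where "\<epsilon> = t * sqrt (8 * real CARD('m))"
  have \<epsilon>: "0 \<le> \<epsilon>" using t by (simp add: \<epsilon>_def)
  define bad where "bad = {z :: real ^ 'm. 8 * real CARD('m) \<le> (norm z)\<^sup>2}"
  have bad_m[measurable]: "bad \<in> sets borel"
  proof -
    have "{z \<in> space borel. 8 * real CARD('m) \<le> (norm (z :: real ^ 'm))\<^sup>2} \<in> sets borel" by measurable
    then show ?thesis by (simp add: bad_def)
  qed
  define p where "p = measure gauss bad"
  have p: "0 \<le> p" "p \<le> 1/8" using gauss_large_norm by (auto simp: p_def bad_def)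
  have good: "t *\<^sub>R z \<in> cube \<epsilon> UNIV" if "z \<notin> bad" for z
  proof -
    have "norm z \<le> sqrt (8 * real CARD('m))" using that by (intro real_le_rsqrt) (auto simp: bad_def)
    then have "\<bar>z $ i\<bar> \<le> sqrt (8 * real CARD('m))" for i using component_le_norm_cart[of z i] by linarith
    then show ?thesis using t by (auto simp: cube_def \<epsilon>_def abs_mult intro!: mult_left_mono)
  qed
  define D where "D A = measure \<nu> A - measure gauss A" for A
  let ?T = "\<lambda>B z. {y. y + t *\<^sub>R z \<in> B}"
  have k0: "0 \<le> \<kappa>" using \<kappa>[of "{}"] by simp
  have D\<kappa>: "\<bar>D A\<bar> \<le> \<kappa>" if "convex A" "A \<in> sets borel" for A using \<kappa>[OF that] by (simp add: D_def)
  have meas: "(\<lambda>z. measure \<rho> (?T B z)) \<in> borel_measurable borel"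
    if B: "B \<in> sets borel" and \<rho>: "prob_space \<rho>" "sets \<rho> = sets borel" for B and \<rho> :: "(real ^ 'm) measure"
  proof -
    interpret R: prob_space \<rho> by (rule \<rho>(1))
    note [measurable_cong] = \<rho>(2)
    have sp: "space \<rho> = UNIV" using sets_eq_imp_space_eq[OF \<rho>(2)] by simp
    have [measurable]: "B \<in> sets borel" by (rule B)
    have "(\<lambda>z. LINT y|\<rho>. indicator B (y + t *\<^sub>R z) :: real) \<in> borel_measurable borel" by measurable
    moreover have "(LINT y|\<rho>. indicator B (y + t *\<^sub>R z) :: real) = measure \<rho> (?T B z)" for z
    proof -
      have s: "?T B z \<in> sets \<rho>" unfolding \<rho>(2)
      proof -
        have "(\<lambda>y. y + t *\<^sub>R z) \<in> borel_measurable borel" by measurable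
        from measurable_sets[OF this B] show "?T B z \<in> sets borel" by (simp add: vimage_def)
      qed
      have "(LINT y|\<rho>. indicator B (y + t *\<^sub>R z) :: real) = (LINT y|\<rho>. indicator (?T B z) y)"
        by (intro Bochner_Integration.integral_cong) (auto split: split_indicator)
      then show ?thesis using s sp by simp
    qed
    ultimately show ?thesis by simp
  qed
  have f_int: "integrable gauss (\<lambda>z. D (?T B z))" if "B \<in> sets borel" "convex B" for B
  proof (rule gauss.integrable_const_bound[where B=\<kappa>])
    show "AE z in gauss. norm (D (?T B z)) \<le> \<kappa>" using D\<kappa> translate_vimage[OF that(2,1)] by simp
    show "(\<lambda>z. D (?T B z)) \<in> borel_measurable gauss"
      unfolding D_def using meas[OF that(1) \<nu>] meas[OF that(1) prob_space_gauss sets_gauss] by simp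
  qed
  have key: "c * (1 - p) - \<kappa> * p \<le> (LINT z|gauss. f z)"
    if f: "integrable gauss f" and lo: "\<And>z. z \<notin> bad \<Longrightarrow> c \<le> f z" and all: "\<And>z. - \<kappa> \<le> f z" for f :: "real ^ 'm \<Rightarrow> real" and c
  proof -
    define k where "k = c + \<kappa>"
    have ib: "integrable gauss (indicator bad :: real ^ 'm \<Rightarrow> real)"
      by (rule gauss.integrable_const_bound[where B=1]) auto
    have i: "integrable gauss (\<lambda>z. c - k * indicator bad z)" using ib by simp
    have e: "(LINT z|gauss. c - k * indicator bad z) = c * (1 - p) - \<kappa> * p"
      using ib by (simp add: p_def k_def algebra_simps)
    have "(LINT z|gauss. c - k * indicator bad z) \<le> (LINT z|gauss. f z)"
      by (rule integral_mono[OF i f]) (use lo all in \<open>auto simp: k_def split: split_indicator\<close>)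
    then show ?thesis unfolding e .
  qed
  have fin: "x \<le> S + \<delta> + \<kappa> / 4" if "(x - \<delta>) * (1 - p) - \<kappa> * p \<le> S" "x \<le> \<kappa>" "0 \<le> \<delta>" for x \<delta>
  proof -
    have "x - \<delta> = (x - \<delta>) * (1 - p) - \<kappa> * p + (x - \<delta> + \<kappa>) * p" by (simp add: algebra_simps)
    also have "\<dots> \<le> S + (2 * \<kappa>) * p" using that p by (intro add_mono mult_right_mono) auto
    also have "\<dots> \<le> S + (2 * \<kappa>) * (1/8)" using p k0 by (intro add_left_mono mult_left_mono) auto
    finally show ?thesis by simp
  qed
  have mass0: "0 \<le> 4 * \<epsilon> * real CARD('m)" using \<epsilon> by simp
  have up: "D C \<le> S + 4 * \<epsilon> * real CARD('m) + \<kappa> / 4"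
  proof -
    obtain B U where B: "compact B" "convex B" and U: "compact U" "convex U"
      and in1: "\<And>x v. v \<in> cube \<epsilon> UNIV \<Longrightarrow> x \<in> C \<Longrightarrow> x + v \<in> B"
      and in2: "\<And>x v. v \<in> cube \<epsilon> UNIV \<Longrightarrow> x + v \<in> B \<Longrightarrow> x \<in> U"
      and mU: "measure gauss U \<le> measure gauss C + 4 * \<epsilon> * CARD('m)"
      by (rule convex_sandwich_outer[OF C \<epsilon>]) (rule that)
    note Bb = compact_borel[OF B(1)]
    note T = translate_vimage[OF B(2) Bb]
    have "(D C - 4 * \<epsilon> * real CARD('m)) * (1 - p) - \<kappa> * p \<le> (LINT z|gauss. D (?T B z))"
    proof (rule key[OF f_int[OF Bb B(2)]])
      fix z show "- \<kappa> \<le> D (?T B z)" using D\<kappa>[OF T, of "t *\<^sub>R z"] by simp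
      assume z: "z \<notin> bad"
      have "measure \<nu> C \<le> measure \<nu> (?T B z)"
        by (rule N.finite_measure_mono) (use in1[OF good[OF z]] T(2)[of "t *\<^sub>R z"] \<nu>(2) in auto)
      moreover have "measure gauss (?T B z) \<le> measure gauss U"
        by (rule gauss.finite_measure_mono) (use in2[OF good[OF z]] U in auto)
      ultimately show "D C - 4 * \<epsilon> * real CARD('m) \<le> D (?T B z)" using mU by (simp add: D_def)
    qed
    also have "\<dots> \<le> S" using S[OF B] unfolding D_def by linarith
    finally show ?thesis by (rule fin) (use D\<kappa>[OF C(2)] C mass0 in auto)
  qed
  have lo: "- D C \<le> S + 4 * \<epsilon> * real CARD('m) + \<kappa> / 4"
  proof -
    obtain B U where B: "compact B" "convex B" and U: "compact U" "convex U"
      and in1: "\<And>x v. v \<in> cube \<epsilon> UNIV \<Longrightarrow> x \<in> U \<Longrightarrow> x + v \<in> B"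
      and in2: "\<And>x v. v \<in> cube \<epsilon> UNIV \<Longrightarrow> x + v \<in> B \<Longrightarrow> x \<in> C"
      and mU: "measure gauss C \<le> measure gauss U + 4 * \<epsilon> * CARD('m)"
      by (rule convex_sandwich_inner[OF C \<epsilon>]) (rule that)
    note Bb = compact_borel[OF B(1)]
    note T = translate_vimage[OF B(2) Bb]
    have "(- D C - 4 * \<epsilon> * real CARD('m)) * (1 - p) - \<kappa> * p \<le> (LINT z|gauss. - D (?T B z))"
    proof (rule key)
      show "integrable gauss (\<lambda>z. - D (?T B z))" using f_int[OF Bb B(2)] by simp
      fix z show "- \<kappa> \<le> - D (?T B z)" using D\<kappa>[OF T, of "t *\<^sub>R z"] by simp
      assume z: "z \<notin> bad"
      have "measure \<nu> (?T B z) \<le> measure \<nu> C"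
        by (rule N.finite_measure_mono) (use in2[OF good[OF z]] C \<nu>(2) in auto)
      moreover have "measure gauss U \<le> measure gauss (?T B z)"
        by (rule gauss.finite_measure_mono) (use in1[OF good[OF z]] T(2)[of "t *\<^sub>R z"] in auto)
      ultimately show "- D C - 4 * \<epsilon> * real CARD('m) \<le> - D (?T B z)" using mU by (simp add: D_def)
    qed
    also have "\<dots> = - (LINT z|gauss. D (?T B z))" by simp
    also have "\<dots> \<le> S" using S[OF B] unfolding D_def by linarith
    finally show ?thesis by (rule fin) (use D\<kappa>[OF C(2)] C mass0 in auto)
  qed
  show ?thesis using up lo unfolding D_def \<epsilon>_def by linarith
qed

text \<open>By inner regularity, \<open>C\<close> is approximated in both measures by a compact subset, and the convex hull of a compact set is
  compact and stays inside \<open>C\<close>.\<close>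

lemma convex_compact_approximation:
  fixes \<mu> \<nu> :: "(real ^ 'm::finite) measure"
  assumes \<mu>: "prob_space \<mu>" "sets \<mu> = sets borel" and \<nu>: "prob_space \<nu>" "sets \<nu> = sets borel"
    and b: "\<And>K. compact K \<Longrightarrow> convex K \<Longrightarrow> \<bar>measure \<mu> K - measure \<nu> K\<bar> \<le> b"
    and C: "convex C" "C \<in> sets borel"
  shows "\<bar>measure \<mu> C - measure \<nu> C\<bar> \<le> b"
proof (rule field_le_epsilon)
  fix e :: real assume e: "0 < e"
  have approx: "\<exists>K\<subseteq>C. compact K \<and> measure \<rho> C - e < measure \<rho> K"
    if \<rho>: "prob_space \<rho>" "sets \<rho> = sets borel" for \<rho> :: "(real ^ 'm) measure"
  proof -
    interpret prob_space \<rho> by (rule \<rho>(1))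
    have reg: "emeasure \<rho> C = (SUP K\<in>{K. K \<subseteq> C \<and> compact K}. emeasure \<rho> K)"
      by (rule inner_regular) (use \<rho> C in \<open>auto simp: emeasure_space_1\<close>)
    show ?thesis
    proof (cases "measure \<rho> C < e")
      case True
      then show ?thesis by (intro exI[of _ "{}"]) simp
    next
      case False
      then have "ennreal (measure \<rho> C - e) < emeasure \<rho> C"
        unfolding emeasure_eq_measure using e by (intro ennreal_lessI) auto
      then obtain K where K: "K \<subseteq> C" "compact K" "ennreal (measure \<rho> C - e) < emeasure \<rho> K"
        unfolding reg by (auto simp: less_SUP_iff)
      have "measure \<rho> C - e < measure \<rho> K"
        using K(3) False by (simp add: emeasure_eq_measure ennreal_less_iff)
      with K show ?thesis by (intro exI[of _ K]) simp
    qed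
  qed
  obtain K1 where K1: "K1 \<subseteq> C" "compact K1" "measure \<mu> C - e < measure \<mu> K1" using approx[OF \<mu>] by blast
  obtain K2 where K2: "K2 \<subseteq> C" "compact K2" "measure \<nu> C - e < measure \<nu> K2" using approx[OF \<nu>] by blast
  define K where "K = convex hull (K1 \<union> K2)"
  have K: "compact K" "convex K" "K \<subseteq> C" "K1 \<subseteq> K" "K2 \<subseteq> K"
    unfolding K_def by (intro compact_convex_hull compact_Un K1(2) K2(2), simp, intro hull_minimal Un_least K1(1) K2(1) C(1), (meson hull_subset le_sup_iff order_trans)+)
  interpret U: prob_space \<mu> by (rule \<mu>(1))
  interpret N: prob_space \<nu> by (rule \<nu>(1))
  have KS: "K \<in> sets borel" using K(1) by (rule compact_borel)
  have m1: "K \<in> sets \<mu>" "C \<in> sets \<mu>" unfolding \<mu>(2) by (rule KS, rule C(2))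
  have m2: "K \<in> sets \<nu>" "C \<in> sets \<nu>" unfolding \<nu>(2) by (rule KS, rule C(2))
  have "measure \<mu> K1 \<le> measure \<mu> K" "measure \<mu> K \<le> measure \<mu> C"
    by (rule U.finite_measure_mono[OF K(4) m1(1)], rule U.finite_measure_mono[OF K(3) m1(2)])
  moreover have "measure \<nu> K2 \<le> measure \<nu> K" "measure \<nu> K \<le> measure \<nu> C"
    by (rule N.finite_measure_mono[OF K(5) m2(1)], rule N.finite_measure_mono[OF K(3) m2(2)])
  ultimately show "\<bar>measure \<mu> C - measure \<nu> C\<bar> \<le> b + e"
    using b[OF K(1,2)] K1(3) K2(3) by linarith
qed

lemma stein_identity_gauss: "stein_identity gauss (\<lambda>x. x) (\<lambda>_. mat 1 :: real ^ 'm::finite ^ 'm)"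
  unfolding stein_identity_def
proof (intro allI)
  fix \<xi> :: "real ^ 'm" and c :: real
  let ?e = "\<lambda>z. iexp (c * (\<xi> \<bullet> z))"
  have zi: "integrable gauss (\<lambda>z::real ^ 'm. complex_of_real (z $ i) * ?e z)" for i
    by (intro iexp_poly_integrable gauss_all_moments) measurable
  have one: "(CLINT z|gauss. (z :: real ^ 'm) $ i * ?e z) = \<i> * (c * \<xi> $ i) * (CLINT z|gauss. ?e z)" for i
  proof -
    have e: "?e (vec_lambda z) = iexp (\<Sum>j\<in>UNIV. (c * \<xi> $ j) * z j)" for z
      by (simp add: inner_vec_def sum_distrib_left mult_ac)
    have "(CLINT z|gauss. (z :: real ^ 'm) $ i * ?e z) = (CLINT z|gauss_pi UNIV. z i * iexp (\<Sum>j\<in>UNIV. (c * \<xi> $ j) * z j))"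
      unfolding e[symmetric] by (subst gauss_integral(1)) auto
    also have "\<dots> = \<i> * (c * \<xi> $ i) * (CLINT z|gauss_pi UNIV. iexp (\<Sum>j\<in>UNIV. (c * \<xi> $ j) * z j))"
      using gauss_pi_stein[of UNIV i "\<lambda>j. c * \<xi> $ j"] by simp
    also have "(CLINT z|gauss_pi UNIV. iexp (\<Sum>j\<in>UNIV. (c * \<xi> $ j) * z j)) = (CLINT z|gauss. ?e z)"
      unfolding e[symmetric] by (subst gauss_integral(1)) auto
    finally show ?thesis .
  qed
  have "(CLINT z|gauss. (\<xi> \<bullet> z) * ?e z) = (CLINT z|gauss. \<Sum>i\<in>UNIV. \<xi> $ i * (complex_of_real (z $ i) * ?e z))"
    by (intro Bochner_Integration.integral_cong refl) (simp add: inner_vec_def sum_distrib_right mult.assoc)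
  also have "\<dots> = (\<Sum>i\<in>UNIV. \<xi> $ i * (\<i> * (c * \<xi> $ i) * (CLINT z|gauss. ?e z)))"
    using zi by (simp only: Bochner_Integration.integral_sum integrable_mult_right integral_mult_right_zero one)
  also have "\<dots> = \<i> * c * (complex_of_real (\<xi> \<bullet> \<xi>) * (CLINT z|gauss. ?e z))"
    by (simp add: inner_vec_def sum_distrib_left sum_distrib_right mult_ac)
  also have "complex_of_real (\<xi> \<bullet> \<xi>) * (CLINT z|gauss. ?e z) = (CLINT z|gauss. (\<xi> \<bullet> (mat 1 *v \<xi>)) * ?e z)"
    by (simp only: matrix_vector_mul_lid integral_mult_right_zero)
  finally show "(CLINT z|gauss. (\<xi> \<bullet> z) * ?e z) = \<i> * c * (CLINT z|gauss. (\<xi> \<bullet> (mat 1 *v \<xi>)) * ?e z)" .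
qed

text \<open>The interpolation formula for \<open>Y = Z\<close>, where \<open>V = I\<close>.\<close>

lemma gauss_rotation_invariance:
  fixes C :: "(real ^ 'm::finite) set"
  assumes a: "0 < a" "a < pi/2" and C[measurable]: "C \<in> sets borel"
  shows "(LINT x|gauss. LINT z|gauss. indicator C (rot a x z)) = measure gauss C"
proof -
  have "(LINT w|gauss. LINT z|gauss. indicator C (rot a w z)) - (LINT z|gauss. indicator C z) =
    (\<Sum>i\<in>UNIV. \<Sum>j\<in>UNIV. LINT w|gauss. ((mat 1 :: real ^ 'm ^ 'm) $ i $ j - (if i = j then 1 else 0)) * stein_hessian a (indicator C) i j w)"
    by (rule stein_interpolation[OF prob_space_gauss _ _ _ stein_identity_gauss a])
       (use all_moments_integrable[OF gauss_all_moments] in \<open>auto split: split_indicator\<close>)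
  also have "\<dots> = 0" by (simp add: mat_def)
  finally show ?thesis by simp
qed

lemma smoothed_measure:
  fixes B :: "(real ^ 'm::finite) set"
  assumes N: "prob_space N" and Z[measurable]: "Z \<in> borel_measurable N" and B[measurable]: "B \<in> sets borel"
  shows "(LINT w|N. LINT z|gauss. indicator B (Z w + t *\<^sub>R z)) = (LINT z|gauss. measure (distr N borel Z) {y. y + t *\<^sub>R z \<in> B})"
    and "integrable gauss (\<lambda>z. measure (distr N borel Z) {y. y + t *\<^sub>R z \<in> B})"
proof -
  interpret N: prob_space N by (rule N)
  interpret NG: pair_prob_space N "gauss :: (real ^ 'm) measure" ..
  have I: "integrable (N \<Otimes>\<^sub>M gauss) (\<lambda>(w, z). indicator B (Z w + t *\<^sub>R z) :: real)"
    by (rule NG.P.integrable_const_bound[where B=1]) (auto split: split_indicator)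
  have s: "{y. y + v \<in> B} \<in> sets borel" for v
  proof -
    have "(\<lambda>y. y + v) \<in> borel_measurable borel" by measurable
    from measurable_sets[OF this B] show ?thesis by (simp add: vimage_def)
  qed
  have e: "(LINT w|N. indicator B (Z w + t *\<^sub>R z) :: real) = measure (distr N borel Z) {y. y + t *\<^sub>R z \<in> B}" for z
  proof -
    have "(LINT w|N. indicator B (Z w + t *\<^sub>R z) :: real) = (LINT y|distr N borel Z. indicator {y. y + t *\<^sub>R z \<in> B} y)"
      by (subst integral_distr) (use s in \<open>auto intro!: Bochner_Integration.integral_cong split: split_indicator\<close>)
    then show ?thesis using s by simp
  qed
  show "(LINT w|N. LINT z|gauss. indicator B (Z w + t *\<^sub>R z)) = (LINT z|gauss. measure (distr N borel Z) {y. y + t *\<^sub>R z \<in> B})"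
    using NG.Fubini_integral[OF I] unfolding e by simp
  show "integrable gauss (\<lambda>z. measure (distr N borel Z) {y. y + t *\<^sub>R z \<in> B})"
    using NG.integrable_snd[OF I] unfolding e .
qed

text \<open>With \<open>ln x \<le> 4 x\<^sup>1\<^sup>/\<^sup>4\<close> the left-hand side is at most \<open>16 (2 m g)\<^sup>1\<^sup>/\<^sup>2\<close>, and \<open>m g < 1 / 402\<close>.\<close>

lemma log_factor_bound:
  fixes m g :: real
  assumes m: "1 \<le> m" and g: "0 < g" "402 * (m * sqrt m) * g < 1"
  shows "sqrt m * (ln (pi / (2 * g)))\<^sup>2 * g \<le> 3" "g < 1"
proof -
  have sm: "1 \<le> sqrt m" using m by simp
  have "m * 1 * g \<le> m * sqrt m * g" using sm m g by (intro mult_right_mono mult_left_mono) auto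
  with g have mg: "m * g < 1 / 402" by simp
  have "1 * g \<le> m * g" using m g by (intro mult_right_mono) auto
  with mg show g1: "g < 1" by simp
  define x where "x = pi / (2 * g)"
  have x: "0 < x" "x \<le> 2 / g" using g pi_less_4 by (auto simp: x_def field_simps)
  have x1: "1 \<le> x" unfolding x_def using g g1 pi_ge_two by (simp add: field_simps)
  have "ln x = 4 * ln (sqrt (sqrt x))" using x by (simp add: ln_sqrt)
  also have "\<dots> \<le> 4 * sqrt (sqrt x)" using ln_bound[of "sqrt (sqrt x)"] x by simp
  finally have "(ln x)\<^sup>2 \<le> (4 * sqrt (sqrt x))\<^sup>2" using x1 by (intro power_mono) auto
  also have "\<dots> = 16 * sqrt x" using x by (simp add: power_mult_distrib)
  also have "\<dots> \<le> 16 * sqrt (2 / g)" using x by simp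
  finally have "sqrt m * (ln x)\<^sup>2 * g \<le> sqrt m * (16 * sqrt (2 / g)) * g"
    using m g by (intro mult_right_mono mult_left_mono) auto
  also have "\<dots> = 16 * sqrt (2 * (m * g))"
  proof -
    have "g = sqrt g * sqrt g" using g by simp
    then show ?thesis using g m by (simp add: real_sqrt_mult real_sqrt_divide field_simps)
  qed
  also have "\<dots> \<le> 16 * sqrt (1 / 201)" using mg by (intro mult_left_mono real_sqrt_le_mono) auto
  also have "\<dots> \<le> 16 * (3 / 16)" by (intro mult_left_mono real_le_lsqrt) (auto simp: power2_eq_square)
  finally show "sqrt m * (ln (pi / (2 * g)))\<^sup>2 * g \<le> 3" by (simp add: x_def)
qed

text \<open>If \<open>402 m\<^sup>3\<^sup>/\<^sup>2 g \<ge> 1\<close> there is nothing to prove. Otherwise take the angle \<open>a = g\<close>. With \<open>q = m\<^sup>3\<^sup>/\<^sup>2 g\<close>, the supremum \<open>\<kappa>\<close>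
  of the differences satisfies \<open>\<kappa> \<le> (8 q + 3 \<kappa> / 8) + 24 q + \<kappa> / 4\<close>: the first term comes from
  \<open>stein_pairing_bound\<close>, the other two from \<open>convex_smoothing\<close>. As \<open>\<kappa>\<close> is finite, it can be absorbed.\<close>

theorem convex_distance_std_gauss:
  fixes M :: "'w measure" and Y :: "'w \<Rightarrow> real ^ 'm::finite" and V :: "'w \<Rightarrow> real ^ 'm ^ 'm"
  assumes M: "prob_space M" and Ym[measurable]: "Y \<in> borel_measurable M"
    and Yi: "\<And>i. integrable M (\<lambda>w. Y w $ i)"
    and Vm[measurable]: "\<And>i j. (\<lambda>w. V w $ i $ j) \<in> borel_measurable M"
    and Bsq: "\<And>i j. integrable M (\<lambda>w. (V w $ i $ j - (if i = j then 1 else 0))\<^sup>2)"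
    and stein: "stein_identity M Y V"
    and g: "0 < g" "(\<Sum>i\<in>UNIV. \<Sum>j\<in>UNIV. LINT w|M. (V w $ i $ j - (if i = j then 1 else 0))\<^sup>2) \<le> g\<^sup>2"
    and C: "convex C" "C \<in> sets borel"
  shows "\<bar>measure (distr M borel Y) C - measure gauss C\<bar> \<le> 402 * (real CARD('m) * sqrt (real CARD('m))) * g"
proof -
  interpret M: prob_space M by (rule M)
  define m where "m = real CARD('m)"
  define q where "q = m * sqrt m * g"
  let ?\<mu> = "distr M borel Y"
  have \<mu>: "prob_space ?\<mu>" "sets ?\<mu> = sets borel" by (auto intro: M.prob_space_distr)
  interpret U: prob_space ?\<mu> by (rule \<mu>(1))
  have m1: "1 \<le> m" unfolding m_def by (simp add: Suc_le_eq)
  have triv: "\<bar>measure ?\<mu> A - measure gauss A\<bar> \<le> 1" for A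
    using U.prob_le_1[of A] gauss.prob_le_1[of A] measure_nonneg[of ?\<mu> A] measure_nonneg[of gauss A] by linarith
  show ?thesis
  proof (cases "402 * (m * sqrt m) * g < 1")
    case False
    then show ?thesis using triv[of C] unfolding m_def by linarith
  next
    case True
    note lf = log_factor_bound[OF m1 g(1) True]
    have a: "0 < g" "g < pi/2" using g lf pi_ge_two by auto
    have ct: "tan g \<le> 2 * g" "0 < cos g" using tan_le_double[of g] g lf by auto
    have t: "0 < tan g" using a by (intro tan_gt_zero) auto
    define F where "F = {A :: (real ^ 'm) set. convex A \<and> A \<in> sets borel}"
    define \<kappa> where "\<kappa> = (SUP A\<in>F. \<bar>measure ?\<mu> A - measure gauss A\<bar>)"
    have Fne: "F \<noteq> {}" unfolding F_def by (auto intro!: exI[of _ "{}"])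
    have bdd: "bdd_above ((\<lambda>A. \<bar>measure ?\<mu> A - measure gauss A\<bar>) ` F)"
      using triv by (intro bdd_aboveI2[where M=1]) auto
    have \<kappa>: "\<bar>measure ?\<mu> A - measure gauss A\<bar> \<le> \<kappa>" if "convex A" "A \<in> sets borel" for A :: "(real ^ 'm) set"
      unfolding \<kappa>_def by (rule cSUP_upper[OF _ bdd]) (use that in \<open>simp add: F_def\<close>)
    have k0: "0 \<le> \<kappa>" using \<kappa>[of "{}"] by simp
    define S where "S = 8 * (m * sqrt m) * g + sqrt m * (ln (pi / (2 * g)))\<^sup>2 * g * \<kappa> / 8"
    have S: "\<bar>LINT z|gauss. measure ?\<mu> {y. y + tan g *\<^sub>R z \<in> B} - measure gauss {y. y + tan g *\<^sub>R z \<in> B}\<bar> \<le> S"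
      if B: "compact B" "convex B" for B :: "(real ^ 'm) set"
    proof -
      have Bb[measurable]: "B \<in> sets borel" using B by simp
      \<comment> \<open>Rescaling by \<open>cos g\<close> turns the rotation by the angle \<open>g\<close> into the perturbation by \<open>tan g *\<^sub>R z\<close>.\<close>
      define C' where "C' = {x. (1 / cos g) *\<^sub>R x \<in> B}"
      have C': "compact C'" "convex C'" unfolding C'_def using scaleR_vimage_compact_convex[OF B] ct(2) by auto
      have ind: "indicator C' (rot g y z) = (indicator B (y + tan g *\<^sub>R z) :: real)" for y z
        unfolding C'_def rot_eq_tan[OF ct(2)] using ct(2) by (auto split: split_indicator)
      have gid: "distr gauss borel (\<lambda>x. x) = (gauss :: (real ^ 'm) measure)" by (rule distr_id2) simp
      have im: "(\<lambda>x. x) \<in> borel_measurable (gauss :: (real ^ 'm) measure)" by simp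
      have smg: "integrable gauss (\<lambda>z. measure gauss {y. y + tan g *\<^sub>R z \<in> B})"
        using smoothed_measure(2)[OF prob_space_gauss im Bb, of "tan g"] unfolding gid .
      have sm1: "(LINT z|gauss. measure gauss {y. y + tan g *\<^sub>R z \<in> B}) = (LINT x|gauss. LINT z|gauss. indicator B (x + tan g *\<^sub>R z))"
        using smoothed_measure(1)[OF prob_space_gauss im Bb, of "tan g"] unfolding gid by simp
      have "(LINT z|gauss. measure ?\<mu> {y. y + tan g *\<^sub>R z \<in> B} - measure gauss {y. y + tan g *\<^sub>R z \<in> B}) =
        (LINT w|M. LINT z|gauss. indicator C' (rot g (Y w) z)) - (LINT x|gauss. LINT z|gauss. indicator C' (rot g x z))"
        unfolding ind smoothed_measure(1)[OF M Ym Bb] sm1[symmetric]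
        by (rule Bochner_Integration.integral_diff[OF smoothed_measure(2)[OF M Ym Bb] smg])
      also have "\<dots> = (LINT w|M. LINT z|gauss. indicator C' (rot g (Y w) z)) - measure gauss C'"
        using gauss_rotation_invariance[OF a compact_borel[OF C'(1)]] by simp
      finally have e: "(LINT z|gauss. measure ?\<mu> {y. y + tan g *\<^sub>R z \<in> B} - measure gauss {y. y + tan g *\<^sub>R z \<in> B}) =
        (LINT w|M. LINT z|gauss. indicator C' (rot g (Y w) z)) - measure gauss C'" .
      show ?thesis
        unfolding e S_def m_def by (rule stein_pairing_bound[OF M Ym Yi Vm Bsq stein a C' \<kappa> g])
    qed
    have cc: "\<bar>measure ?\<mu> K - measure gauss K\<bar> \<le> S + 4 * (tan g * sqrt (8 * m)) * m + \<kappa> / 4"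
      if "compact K" "convex K" for K :: "(real ^ 'm) set"
      unfolding m_def by (rule convex_smoothing[OF \<mu> \<kappa> t S that])
    have all: "\<bar>measure ?\<mu> A - measure gauss A\<bar> \<le> S + 4 * (tan g * sqrt (8 * m)) * m + \<kappa> / 4" if "A \<in> F" for A
      by (rule convex_compact_approximation[OF \<mu> prob_space_gauss sets_gauss cc]) (use that in \<open>auto simp: F_def\<close>)
    have "\<kappa> \<le> S + 4 * (tan g * sqrt (8 * m)) * m + \<kappa> / 4"
      unfolding \<kappa>_def by (rule cSUP_least[OF Fne]) (use all in \<open>simp add: \<kappa>_def\<close>)
    also have "4 * (tan g * sqrt (8 * m)) * m \<le> 24 * q"
    proof -
      have "sqrt (8 * m) \<le> 3 * sqrt m" using m1 by (simp add: real_sqrt_mult real_le_lsqrt mult_right_mono)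
      then have "4 * (tan g * sqrt (8 * m)) * m \<le> 4 * (2 * g * (3 * sqrt m)) * m"
        using ct t m1 g by (intro mult_right_mono mult_left_mono mult_mono) auto
      then show ?thesis by (simp add: q_def mult_ac)
    qed
    also have "S \<le> 8 * q + 3 * \<kappa> / 8"
    proof -
      have "sqrt m * (ln (pi / (2 * g)))\<^sup>2 * g * \<kappa> \<le> 3 * \<kappa>" using lf(1) k0 by (rule mult_right_mono)
      then show ?thesis by (simp add: S_def q_def)
    qed
    finally have "\<kappa> \<le> 402 * q" using k0 by simp
    then show ?thesis using \<kappa>[OF C] unfolding q_def m_def by (simp add: mult.assoc)
  qed
qed

section \<open>Reduction to the identity covariance\<close>

text \<open>The rows of \<open>A\<close> are orthonormal for the scalar product given by \<open>S\<close>. They are found one after the other: a vector that is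
  orthogonal to the images under \<open>S\<close> of the previous ones exists because these span a proper subspace.\<close>

lemma whitening_matrix:
  fixes S :: "real ^ 'm::finite ^ 'm"
  assumes sym: "transpose S = S" and pos: "\<And>x. x \<noteq> 0 \<Longrightarrow> 0 < x \<bullet> (S *v x)"
  obtains A :: "real ^ 'm ^ 'm" where "A ** S ** transpose A = mat 1"
proof -
  have sm: "x \<bullet> (S *v y) = y \<bullet> (S *v x)" for x y
    by (metis sym dot_lmul_matrix inner_commute transpose_matrix_vector)
  have "\<exists>a :: 'm \<Rightarrow> real ^ 'm. \<forall>i\<in>I. \<forall>j\<in>I. a i \<bullet> (S *v a j) = (if i = j then 1 else 0)" if "finite I" for I :: "'m set"
    using that
  proof (induction I)
    case empty
    then show ?case by simp
  next
    case (insert i I)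
    then obtain a :: "'m \<Rightarrow> real ^ 'm" where a: "\<And>i j. i \<in> I \<Longrightarrow> j \<in> I \<Longrightarrow> a i \<bullet> (S *v a j) = (if i = j then 1 else 0)"
      by auto
    have "dim ((\<lambda>j. S *v a j) ` I) \<le> card I"
      using insert(1) by (intro order_trans[OF dim_le_card'[OF finite_imageI] card_image_le])
    also have "card I < CARD('m)"
      using insert(1,2) by (intro psubset_card_mono) auto
    finally have "dim ((\<lambda>j. S *v a j) ` I) < DIM(real ^ 'm)" by simp
    from orthogonal_to_subspace_exists[OF this]
    obtain x where x: "x \<noteq> 0" and ox: "\<And>y. y \<in> span ((\<lambda>j. S *v a j) ` I) \<Longrightarrow> orthogonal x y" by blast
    have o: "x \<bullet> (S *v a j) = 0" "a j \<bullet> (S *v x) = 0" if "j \<in> I" for j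
      using ox[of "S *v a j"] that sm[of x "a j"] by (auto simp: orthogonal_def intro: span_base)
    define c where "c = sqrt (x \<bullet> (S *v x))"
    have c: "c \<noteq> 0" "c * c = x \<bullet> (S *v x)" using pos[OF x] by (auto simp: c_def)
    have "\<forall>k\<in>insert i I. \<forall>j\<in>insert i I. (a(i := x /\<^sub>R c)) k \<bullet> (S *v (a(i := x /\<^sub>R c)) j) = (if k = j then 1 else 0)"
      using insert(2) o a c by (auto simp: matrix_vector_mult_scaleR field_simps)
    then show ?case by (intro exI[of _ "a(i := x /\<^sub>R c)"])
  qed
  from this[of UNIV] obtain a :: "'m \<Rightarrow> real ^ 'm" where a: "\<And>i j. a i \<bullet> (S *v a j) = (if i = j then 1 else 0)"
    by auto
  have "((\<chi> i. a i) ** S ** transpose (\<chi> i. a i)) $ i $ j = a i \<bullet> (S *v a j)" for i j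
    unfolding matrix_mul_assoc[symmetric]
    by (simp add: matrix_matrix_mult_def matrix_vector_mult_def transpose_def inner_vec_def)
  then have "(\<chi> i. a i) ** S ** transpose (\<chi> i. a i) = mat 1" by (simp add: vec_eq_iff a mat_def)
  then show thesis by (rule that)
qed

lemma inner_matrix_vector_left: "(A *v x) \<bullet> y = x \<bullet> (transpose A *v y)" for A :: "real ^ 'n ^ 'm"
  by (metis dot_lmul_matrix inner_commute transpose_matrix_vector)

text \<open>From \<open>S\<^sup>-\<^sup>1 = A\<^sup>T A\<close> one gets \<open>\<parallel>A x\<parallel>\<^sup>2 = \<langle>x, S\<^sup>-\<^sup>1 x\<rangle>\<close>.\<close>

lemma whitening_facts:
  fixes A S :: "real ^ 'm::finite ^ 'm"
  assumes A: "A ** S ** transpose A = mat 1" and S: "invertible S"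
  shows "S ** transpose A ** A = mat 1" "A ** (S ** transpose A) = mat 1"
    and "(norm (A *v x))\<^sup>2 \<le> op_norm (matrix_inv S) * (norm x)\<^sup>2"
proof -
  show 2: "A ** (S ** transpose A) = mat 1" using A by (simp add: matrix_mul_assoc)
  then show 1: "S ** transpose A ** A = mat 1" using matrix_left_right_inverse by blast
  have "matrix_inv S = matrix_inv S ** (S ** (transpose A ** A))" using 1 by (simp add: matrix_mul_assoc)
  also have "\<dots> = transpose A ** A"
    using someI_ex[OF S[unfolded invertible_def]] unfolding matrix_inv_def by (simp add: matrix_mul_assoc)
  finally have inv: "matrix_inv S = transpose A ** A" .
  have "(norm (A *v x))\<^sup>2 = x \<bullet> (matrix_inv S *v x)"
    unfolding inv power2_norm_eq_inner inner_matrix_vector_left by (simp add: matrix_vector_mul_assoc del: transpose_matrix_vector)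
  also have "\<dots> \<le> norm x * norm (matrix_inv S *v x)" by (rule norm_cauchy_schwarz)
  also have "\<dots> \<le> norm x * (op_norm (matrix_inv S) * norm x)"
    unfolding op_norm_def by (intro mult_left_mono onorm matrix_vector_mul_bounded_linear) auto
  finally show "(norm (A *v x))\<^sup>2 \<le> op_norm (matrix_inv S) * (norm x)\<^sup>2" by (simp add: power2_eq_square mult_ac)
qed

lemma hs_norm_sq: "(hs_norm A)\<^sup>2 = (\<Sum>i\<in>UNIV. \<Sum>j\<in>UNIV. (A $ i $ j)\<^sup>2)" for A :: "real ^ 'm::finite ^ 'm"
  unfolding hs_norm_def by (intro real_sqrt_pow2 sum_nonneg) auto

lemma hs_norm_transpose: "hs_norm (transpose A) = hs_norm A" for A :: "real ^ 'm::finite ^ 'm"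
  unfolding hs_norm_def by (subst sum.swap) (simp add: transpose_def)

text \<open>The squared Hilbert-Schmidt norm is the sum of the squared lengths of the columns.\<close>

lemma hs_norm_mult_le:
  fixes A B :: "real ^ 'm::finite ^ 'm"
  assumes "\<And>x. (norm (A *v x))\<^sup>2 \<le> c * (norm x)\<^sup>2"
  shows "(hs_norm (A ** B))\<^sup>2 \<le> c * (hs_norm B)\<^sup>2"
proof -
  have col: "(hs_norm C)\<^sup>2 = (\<Sum>j\<in>UNIV. (norm (column j C))\<^sup>2)" for C :: "real ^ 'm ^ 'm"
    unfolding hs_norm_sq by (subst sum.swap) (simp add: power2_norm_eq_inner inner_vec_def column_def, simp add: power2_eq_square)
  have "column j (A ** B) = A *v column j B" for j
    by (simp add: column_def matrix_matrix_mult_def matrix_vector_mult_def vec_eq_iff)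
  then show ?thesis unfolding col sum_distrib_left using assms by (simp add: sum_mono)
qed

lemma hs_norm_congruence_le:
  fixes A B :: "real ^ 'm::finite ^ 'm"
  assumes A: "\<And>x. (norm (A *v x))\<^sup>2 \<le> c * (norm x)\<^sup>2" and c: "0 \<le> c"
  shows "(hs_norm (A ** B ** transpose A))\<^sup>2 \<le> (c * hs_norm B)\<^sup>2"
proof -
  have "hs_norm (A ** B ** transpose A) = hs_norm (A ** transpose (A ** B))"
    by (subst hs_norm_transpose[symmetric]) (simp add: matrix_transpose_mul)
  then have "(hs_norm (A ** B ** transpose A))\<^sup>2 \<le> c * (hs_norm (A ** B))\<^sup>2"
    using hs_norm_mult_le[OF A, of "transpose (A ** B)"] by (simp add: hs_norm_transpose)
  also have "\<dots> \<le> c * (c * (hs_norm B)\<^sup>2)" using hs_norm_mult_le[OF A] c by (rule mult_left_mono)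
  finally show ?thesis by (simp add: power2_eq_square mult_ac)
qed

text \<open>Replace \<open>\<xi>\<close> by \<open>A\<^sup>T \<xi>\<close>.\<close>

lemma stein_identity_linear:
  fixes A :: "real ^ 'm::finite ^ 'm"
  assumes "stein_identity M Y V"
  shows "stein_identity M (\<lambda>w. A *v Y w) (\<lambda>w. A ** V w ** transpose A)"
proof -
  have 1: "\<xi> \<bullet> (A *v y) = (transpose A *v \<xi>) \<bullet> y" for \<xi> y
    by (simp only: inner_matrix_vector_left transpose_transpose)
  have 2: "\<xi> \<bullet> ((A ** B ** transpose A) *v \<xi>) = (transpose A *v \<xi>) \<bullet> (B *v (transpose A *v \<xi>))" for \<xi> B
    by (simp only: 1[symmetric] matrix_vector_mul_assoc matrix_mul_assoc)
  show ?thesis using assms unfolding stein_identity_def 1 2 by blast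
qed

text \<open>The law of \<open>Y\<close> is compared with the image of the standard Gaussian law under the inverse \<open>S A\<^sup>T\<close> of \<open>A\<close>; that this image is
  the centered Gaussian law with covariance \<open>S\<close> will follow from the estimate itself, applied with \<open>V = S\<close>.\<close>

lemma convex_distance_whitened:
  fixes M :: "'w measure" and Y :: "'w \<Rightarrow> real ^ 'm::finite" and V :: "'w \<Rightarrow> real ^ 'm ^ 'm" and A S :: "real ^ 'm ^ 'm"
  assumes A: "A ** S ** transpose A = mat 1" and S: "invertible S"
    and M: "prob_space M" and Ym[measurable]: "Y \<in> borel_measurable M"
    and Yi: "\<And>i. integrable M (\<lambda>w. Y w $ i)"
    and Vm[measurable]: "\<And>i j. (\<lambda>w. V w $ i $ j) \<in> borel_measurable M"
    and hs: "integrable M (\<lambda>w. (hs_norm (V w - S))\<^sup>2)"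
    and stein: "stein_identity M Y V"
    and g: "0 < g" "op_norm (matrix_inv S) * sqrt (LINT w|M. (hs_norm (V w - S))\<^sup>2) \<le> g"
    and C: "convex C" "C \<in> sets borel"
  shows "\<bar>measure (distr M borel Y) C - measure gauss ((*v) (S ** transpose A) -` C)\<bar> \<le> 402 * (real CARD('m) * sqrt (real CARD('m))) * g"
proof -
  interpret M: prob_space M by (rule M)
  let ?R = "S ** transpose A" and ?W = "\<lambda>w. A ** V w ** transpose A"
  define C' where "C' = (*v) ?R -` C"
  note A' = whitening_facts[OF A S]
  have meas[measurable]: "(*v) B \<in> borel_measurable borel" for B :: "real ^ 'm ^ 'm"
    by (intro borel_measurable_continuous_onI linear_continuous_on matrix_vector_mul_bounded_linear)
  have C': "convex C'" "C' \<in> sets borel"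
    unfolding C'_def using C(1) measurable_sets[OF meas C(2), of ?R] by (auto intro: convex_linear_vimage)
  have "Y w \<in> C \<longleftrightarrow> A *v Y w \<in> C'" for w
    using A'(1) by (simp add: C'_def matrix_vector_mul_assoc del: transpose_matrix_vector)
  then have law: "measure (distr M borel (\<lambda>w. A *v Y w)) C' = measure (distr M borel Y) C"
    using C C' by (simp add: measure_distr vimage_def)
  have diff: "?W w $ i $ j - (if i = j then 1 else 0) = (A ** (V w - S) ** transpose A) $ i $ j" for w i j
  proof -
    have "A ** (V w - S) ** transpose A = ?W w - mat 1"
    proof -
      have "A ** (V w - S) = A ** V w - A ** S" "(A ** V w - A ** S) ** transpose A = ?W w - A ** S ** transpose A"
        by (simp_all add: matrix_matrix_mult_def vec_eq_iff algebra_simps sum_subtractf)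
      then show ?thesis using A by simp
    qed
    then show ?thesis by (simp add: mat_def)
  qed
  have c0: "0 \<le> op_norm (matrix_inv S)" unfolding op_norm_def by (rule onorm_pos_le[OF matrix_vector_mul_bounded_linear])
  have Wm[measurable]: "(\<lambda>w. ?W w $ i $ j) \<in> borel_measurable M" for i j
    unfolding matrix_matrix_mult_def by simp
  have bd: "(\<Sum>i\<in>UNIV. \<Sum>j\<in>UNIV. (?W w $ i $ j - (if i = j then 1 else 0))\<^sup>2) \<le> (op_norm (matrix_inv S))\<^sup>2 * (hs_norm (V w - S))\<^sup>2" for w
    using hs_norm_congruence_le[OF A'(3) c0, of "V w - S"] unfolding hs_norm_sq diff power_mult_distrib .
  have int: "integrable M (\<lambda>w. (?W w $ i $ j - (if i = j then 1 else 0))\<^sup>2)" for i j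
  proof (rule Bochner_Integration.integrable_bound[OF integrable_mult_right[OF hs, of "(op_norm (matrix_inv S))\<^sup>2"]])
    have "(?W w $ i $ j - (if i = j then 1 else 0))\<^sup>2 \<le> (\<Sum>i\<in>UNIV. \<Sum>j\<in>UNIV. (?W w $ i $ j - (if i = j then 1 else 0))\<^sup>2)" for w
      by (rule order_trans[OF member_le_sum[of j] member_le_sum[of i]]) (auto intro: sum_nonneg)
    then have "(?W w $ i $ j - (if i = j then 1 else 0))\<^sup>2 \<le> (op_norm (matrix_inv S))\<^sup>2 * (hs_norm (V w - S))\<^sup>2" for w
      using bd[of w] by (rule order_trans)
    then show "AE w in M. norm ((?W w $ i $ j - (if i = j then 1 else 0))\<^sup>2) \<le> norm ((op_norm (matrix_inv S))\<^sup>2 * (hs_norm (V w - S))\<^sup>2)"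
      by (intro AE_I2) (simp only: real_norm_def, rule order_trans[OF _ abs_ge_self], simp only: abs_of_nonneg zero_le_power2)
  qed measurable
  have "(\<Sum>i\<in>UNIV. \<Sum>j\<in>UNIV. LINT w|M. (?W w $ i $ j - (if i = j then 1 else 0))\<^sup>2) =
      (LINT w|M. (\<Sum>i\<in>UNIV. \<Sum>j\<in>UNIV. (?W w $ i $ j - (if i = j then 1 else 0))\<^sup>2))"
    using int by (simp only: Bochner_Integration.integral_sum Bochner_Integration.integrable_sum)
  also have "\<dots> \<le> (LINT w|M. (op_norm (matrix_inv S))\<^sup>2 * (hs_norm (V w - S))\<^sup>2)"
    using bd int hs by (intro integral_mono Bochner_Integration.integrable_sum) auto
  also have "\<dots> = (op_norm (matrix_inv S) * sqrt (LINT w|M. (hs_norm (V w - S))\<^sup>2))\<^sup>2"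
    by (simp add: power_mult_distrib Bochner_Integration.integral_nonneg)
  also have "\<dots> \<le> g\<^sup>2" using g c0 by (intro power_mono) (auto intro!: mult_nonneg_nonneg Bochner_Integration.integral_nonneg)
  finally have le: "(\<Sum>i\<in>UNIV. \<Sum>j\<in>UNIV. LINT w|M. (?W w $ i $ j - (if i = j then 1 else 0))\<^sup>2) \<le> g\<^sup>2" .
  have AY: "(\<lambda>w. A *v Y w) \<in> borel_measurable M" using measurable_compose[OF Ym meas] .
  have AYi: "integrable M (\<lambda>w. (A *v Y w) $ i)" for i
    unfolding matrix_vector_mult_def using Yi by simp
  show ?thesis
    using convex_distance_std_gauss[OF M AY AYi Wm int stein_identity_linear[OF stein] g(1) le C', unfolded law] unfolding C'_def .
qed

section \<open>Divergence vectors and Gaussian vectors\<close>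

text \<open>A linear combination of the identities \<open>divergence_malliavin_iexp\<close> for the fields \<open>u i\<close>.\<close>

lemma (in isonormal_process) stein_identity_malliavin:
  fixes F :: "'m::finite \<Rightarrow> 'w \<Rightarrow> real" and u DF :: "'m \<Rightarrow> 'w \<Rightarrow> 'h"
  assumes mal: "\<And>i. malliavin_derivative M X (F i) (DF i)" and div: "\<And>i. divergence M X (u i) (F i)"
  shows "stein_identity M (\<lambda>w. \<chi> i. F i w) (\<lambda>w. \<chi> i j. inner (DF i w) (u j w))"
  unfolding stein_identity_def
proof (intro allI)
  fix \<xi> :: "real ^ 'm" and c :: real
  let ?Y = "\<lambda>w. (\<chi> i. F i w) :: real ^ 'm" and ?V = "\<lambda>w. (\<chi> i j. inner (DF i w) (u j w)) :: real ^ 'm ^ 'm"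
  let ?e = "\<lambda>w. iexp (c * (\<xi> \<bullet> ?Y w))"
  have L: "DF i \<in> L2 M" "u i \<in> L2 M" "F i \<in> L2 M" for i
    using mal[of i] div[of i] by (auto simp: malliavin_derivative_def divergence_def L2_tendsto_def)
  have Fm[measurable]: "F i \<in> borel_measurable M" for i using L(3)[of i] by (simp add: L2_def)
  have xF: "\<xi> \<bullet> ?Y w = (\<Sum>j\<in>UNIV. \<xi> $ j * F j w)" for w by (simp add: inner_vec_def)
  have em: "?e \<in> borel_measurable M" unfolding xF by measurable
  have ei: "integrable M (\<lambda>w. complex_of_real (f w) * ?e w)" if "integrable M f" for f
  proof (rule Bochner_Integration.integrable_bound[OF that])
    show "(\<lambda>w. complex_of_real (f w) * ?e w) \<in> borel_measurable M"
      using borel_measurable_integrable[OF that] em by measurable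
  qed (simp add: norm_mult)
  have E: "?e w = iexp (\<Sum>j\<in>UNIV. (c * \<xi> $ j) * F j w)" for w
    unfolding xF by (simp add: sum_distrib_left mult_ac)
  have IF: "integrable M (\<lambda>w. complex_of_real (F i w) * ?e w)" for i by (rule ei[OF L2_integrable[OF L(3)]])
  have ID: "integrable M (\<lambda>w. complex_of_real (inner (u i w) (\<Sum>j\<in>UNIV. (c * \<xi> $ j) *\<^sub>R DF j w)) * ?e w)" for i
    by (rule ei) (simp add: inner_sum_right L2_inner_integrable(1)[OF L(2,1)])
  have "(CLINT w|M. (\<xi> \<bullet> ?Y w) * ?e w) = (CLINT w|M. (\<Sum>i\<in>UNIV. \<xi> $ i * (F i w * ?e w)))"
    by (intro Bochner_Integration.integral_cong) (simp_all add: xF sum_distrib_left sum_distrib_right mult_ac)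
  also have "\<dots> = (\<Sum>i\<in>UNIV. \<xi> $ i * (CLINT w|M. F i w * ?e w))"
    using IF by (simp only: Bochner_Integration.integral_sum integrable_mult_right integral_mult_right_zero)
  also have "\<dots> = (\<Sum>i\<in>UNIV. \<xi> $ i * (\<i> * (CLINT w|M. inner (u i w) (\<Sum>j\<in>UNIV. (c * \<xi> $ j) *\<^sub>R DF j w) * ?e w)))"
    unfolding E by (subst divergence_malliavin_iexp[OF div mal]) simp
  also have "\<dots> = (CLINT w|M. (\<Sum>i\<in>UNIV. \<xi> $ i * (\<i> * (inner (u i w) (\<Sum>j\<in>UNIV. (c * \<xi> $ j) *\<^sub>R DF j w) * ?e w))))"
    using ID by (simp only: Bochner_Integration.integral_sum integrable_mult_right integral_mult_right_zero)
  also have "\<dots> = (CLINT w|M. (\<i> * c) * ((\<xi> \<bullet> (?V w *v \<xi>)) * ?e w))"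
  proof (rule Bochner_Integration.integral_cong[OF refl])
    fix w
    have "(\<Sum>i\<in>UNIV. \<xi> $ i * inner (u i w) (\<Sum>j\<in>UNIV. (c * \<xi> $ j) *\<^sub>R DF j w)) =
        (\<Sum>i\<in>UNIV. \<Sum>j\<in>UNIV. c * (\<xi> $ i * \<xi> $ j * inner (DF j w) (u i w)))"
      by (simp add: inner_sum_right sum_distrib_left mult_ac inner_commute)
    also have "\<dots> = (\<Sum>j\<in>UNIV. \<Sum>i\<in>UNIV. c * (\<xi> $ i * \<xi> $ j * inner (DF j w) (u i w)))" by (rule sum.swap)
    also have "\<dots> = c * (\<xi> \<bullet> (?V w *v \<xi>))"
      by (simp add: inner_vec_def matrix_vector_mult_def sum_distrib_left mult_ac)
    finally have s: "(\<Sum>i\<in>UNIV. \<xi> $ i * inner (u i w) (\<Sum>j\<in>UNIV. (c * \<xi> $ j) *\<^sub>R DF j w)) = c * (\<xi> \<bullet> (?V w *v \<xi>))" .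
    have "(\<Sum>i\<in>UNIV. \<xi> $ i * (\<i> * (inner (u i w) (\<Sum>j\<in>UNIV. (c * \<xi> $ j) *\<^sub>R DF j w) * ?e w))) =
      \<i> * complex_of_real (\<Sum>i\<in>UNIV. \<xi> $ i * inner (u i w) (\<Sum>j\<in>UNIV. (c * \<xi> $ j) *\<^sub>R DF j w)) * ?e w"
      by (simp add: sum_distrib_left sum_distrib_right mult_ac)
    then show "(\<Sum>i\<in>UNIV. \<xi> $ i * (\<i> * (inner (u i w) (\<Sum>j\<in>UNIV. (c * \<xi> $ j) *\<^sub>R DF j w) * ?e w))) =
       (\<i> * c) * ((\<xi> \<bullet> (?V w *v \<xi>)) * ?e w)" unfolding s by simp
  qed
  also have "\<dots> = \<i> * c * (CLINT w|M. (\<xi> \<bullet> (?V w *v \<xi>)) * ?e w)" by (simp only: integral_mult_right_zero)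
  finally show "(CLINT w|M. (\<xi> \<bullet> ?Y w) * ?e w) = \<i> * c * (CLINT w|M. (\<xi> \<bullet> (?V w *v \<xi>)) * ?e w)" .
qed

text \<open>The variable \<open>\<langle>\<xi>, N\<rangle>\<close> is a centered Gaussian variable with variance \<open>\<langle>\<xi>, S \<xi>\<rangle>\<close>, so the Stein identity is the
  one-dimensional one.\<close>

lemma (in prob_space) gaussian_vector_facts:
  fixes N :: "'a \<Rightarrow> real ^ 'm::finite"
  assumes N: "gaussian_vector M N S"
  shows "N \<in> borel_measurable M" "integrable M (\<lambda>v. N v $ i)"
    and "transpose S = S" and "0 \<le> x \<bullet> (S *v x)"
    and "stein_identity M N (\<lambda>_. S)"
proof -
  have cov: "(LINT v|M. N v $ i * N v $ j) = S $ i $ j" for i j using N by (simp add: gaussian_vector_def)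
  have mean: "(LINT v|M. N v $ i) = 0" for i using N by (simp add: gaussian_vector_def centered_gaussian_family_def)
  have g: "gaussian_rv M (\<lambda>v. x \<bullet> N v)" for x
  proof -
    have "\<forall>J c. finite J \<longrightarrow> gaussian_rv M (\<lambda>v. \<Sum>i\<in>J. c i * N v $ i)"
      using N by (simp add: gaussian_vector_def centered_gaussian_family_def)
    from this[rule_format, of UNIV "\<lambda>i. x $ i"] show ?thesis by (simp add: inner_vec_def)
  qed
  have gi: "gaussian_rv M (\<lambda>v. N v $ i)" for i using g[of "axis i 1"] by (simp add: inner_axis')
  have Nm[measurable]: "(\<lambda>v. N v $ i) \<in> borel_measurable M" for i using gi[of i] by (simp add: gaussian_rv_def)
  show Nb: "N \<in> borel_measurable M"
  proof -
    have "(\<lambda>v. N v \<bullet> b) \<in> borel_measurable M" for b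
      using g[of b] by (simp add: gaussian_rv_def inner_commute)
    then show ?thesis by (subst borel_measurable_euclidean_space) auto
  qed
  have am: "all_moments M (\<lambda>v. N v $ i)" for i
    by (rule centered_gaussian_distr[OF gi mean]) (rule scaled_gauss_all_moments[OF Nm])
  have am2: "integrable M (\<lambda>v. N v $ i)" "integrable M (\<lambda>v. N v $ i * N v $ j)" for i j
  proof -
    show "integrable M (\<lambda>v. N v $ i)" by (rule all_moments_integrable[OF am])
    have "(\<lambda>v. N v $ i) \<in> L2 M" for i
      using all_moments_integrable[OF all_moments_power[OF am, where k=2]] by (simp add: L2_def)
    from L2_inner_integrable(1)[OF this this] show "integrable M (\<lambda>v. N v $ i * N v $ j)" by simp
  qed
  show "integrable M (\<lambda>v. N v $ i)" by (rule am2)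
  show "transpose S = S" by (simp add: vec_eq_iff transpose_def cov[symmetric] mult.commute)
  have var: "(LINT v|M. (x \<bullet> N v)\<^sup>2) = x \<bullet> (S *v x)" for x
  proof -
    have "(LINT v|M. (x \<bullet> N v)\<^sup>2) = (LINT v|M. (\<Sum>i\<in>UNIV. \<Sum>j\<in>UNIV. (x $ i * x $ j) * (N v $ i * N v $ j)))"
      by (intro Bochner_Integration.integral_cong) (simp_all add: inner_vec_def power2_eq_square sum_product mult_ac)
    also have "\<dots> = (\<Sum>i\<in>UNIV. \<Sum>j\<in>UNIV. (x $ i * x $ j) * S $ i $ j)"
      using am2(2) by (simp add: cov)
    also have "\<dots> = x \<bullet> (S *v x)" by (simp add: inner_vec_def matrix_vector_mult_def sum_distrib_left mult_ac)
    finally show ?thesis .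
  qed
  show "0 \<le> x \<bullet> (S *v x)" unfolding var[symmetric] by (rule Bochner_Integration.integral_nonneg) simp
  show "stein_identity M N (\<lambda>_. S)"
    unfolding stein_identity_def
  proof (intro allI)
    fix \<xi> :: "real ^ 'm" and c :: real
    have m0: "(LINT v|M. \<xi> \<bullet> N v) = 0" using am2(1) by (simp add: inner_vec_def mean)
    have gm: "(\<lambda>v. \<xi> \<bullet> N v) \<in> borel_measurable M" using g[of \<xi>] by (simp add: gaussian_rv_def)
    obtain \<sigma> where s: "0 \<le> \<sigma>" "distr M borel (\<lambda>v. \<xi> \<bullet> N v) = distr std_gauss borel (\<lambda>x. \<sigma> * x)"
      by (rule centered_gaussian_distr[OF g m0])
    have "\<sigma>\<^sup>2 = \<xi> \<bullet> (S *v \<xi>)" using scaled_gauss_second_moment[OF gm s(2)] unfolding var by simp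
    then show "(CLINT v|M. (\<xi> \<bullet> N v) * iexp (c * (\<xi> \<bullet> N v))) = \<i> * c * (CLINT v|M. (\<xi> \<bullet> (S *v \<xi>)) * iexp (c * (\<xi> \<bullet> N v)))"
      using scaled_gauss_stein[OF gm s(2), of c] by (simp only: integral_mult_right_zero of_real_mult mult.assoc)
  qed
qed

text \<open>If \<open>\<langle>x, S x\<rangle> = 0\<close>, then moving from \<open>x\<close> a little in the direction \<open>- S x\<close> would make the nonnegative quadratic form
  negative, as \<open>S x \<noteq> 0\<close>.\<close>

lemma gaussian_covariance_pos:
  fixes S :: "real ^ 'm::finite ^ 'm"
  assumes sym: "transpose S = S" and nonneg: "\<And>x. 0 \<le> x \<bullet> (S *v x)" and inv: "invertible S" and x: "x \<noteq> 0"
  shows "0 < x \<bullet> (S *v x)"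
proof (rule ccontr)
  assume "\<not> ?thesis"
  with nonneg[of x] have x0: "x \<bullet> (S *v x) = 0" by simp
  have sm: "a \<bullet> (S *v b) = b \<bullet> (S *v a)" for a b
    by (metis sym inner_commute inner_matrix_vector_left)
  let ?y = "S *v x"
  have "?y \<noteq> 0" using x inv by (metis inj_matrix_vector_mult injD matrix_vector_mult_0_right)
  then have yy: "0 < ?y \<bullet> ?y" by simp
  define b where "b = ?y \<bullet> (S *v ?y)"
  have exp: "(x + t *\<^sub>R ?y) \<bullet> (S *v (x + t *\<^sub>R ?y)) = 2 * t * (?y \<bullet> ?y) + t\<^sup>2 * b" for t
    using x0 sm[of x ?y] by (simp add: b_def matrix_vector_right_distrib matrix_vector_mult_scaleR inner_add_left inner_add_right power2_eq_square algebra_simps)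
  \<comment> \<open>Small enough to make the linear term \<open>2 t \<langle>y, y\<rangle>\<close> dominate \<open>t\<^sup>2 b\<close>.\<close>
  define t where "t = - (?y \<bullet> ?y) / (1 + b)"
  have b0: "0 \<le> b" unfolding b_def by (rule nonneg)
  have "0 \<le> 2 * t * (?y \<bullet> ?y) + t\<^sup>2 * b" using nonneg[of "x + t *\<^sub>R ?y"] unfolding exp .
  also have "\<dots> = t * (2 * (?y \<bullet> ?y) + t * b)" by (simp add: power2_eq_square algebra_simps)
  also have "2 * (?y \<bullet> ?y) + t * b = (?y \<bullet> ?y) * (2 - b / (1 + b))" by (simp add: t_def algebra_simps)
  finally have "0 \<le> t * ((?y \<bullet> ?y) * (2 - b / (1 + b)))" .
  moreover have "t < 0" unfolding t_def using yy b0 by (intro divide_neg_pos) auto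
  moreover have "0 < (?y \<bullet> ?y) * (2 - b / (1 + b))"
  proof (rule mult_pos_pos[OF yy])
    have "b / (1 + b) \<le> 1" using b0 by simp
    then show "0 < 2 - b / (1 + b)" by simp
  qed
  ultimately show False by (simp add: zero_le_mult_iff)
qed

lemma (in prob_space) integral_indicator_vector:
  assumes [measurable]: "Y \<in> borel_measurable M" "C \<in> sets borel"
  shows "(LINT w|M. indicator C (Y w) :: real) = measure (distr M borel Y) C"
proof -
  interpret D: prob_space "distr M borel Y" by (rule prob_space_distr) simp
  have "(LINT w|M. indicator C (Y w) :: real) = (LINT y|distr M borel Y. indicator C y)"
    by (rule integral_distr[symmetric]) measurable
  then show ?thesis by simp
qed

theorem theorem1p2:
  fixes M :: "'w measure"
    and X :: "'h::{real_inner, complete_space, second_countable_topology} \<Rightarrow> 'w \<Rightarrow> real"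
    and F :: "'m::finite \<Rightarrow> 'w \<Rightarrow> real"
    and u DF :: "'m \<Rightarrow> 'w \<Rightarrow> 'h"
    and M' :: "'v measure"
    and N :: "'v \<Rightarrow> real ^ 'm"
    and \<Sigma> :: "real ^ 'm ^ 'm"
    and MF :: "'w \<Rightarrow> real ^ 'm ^ 'm"
  assumes "isonormal_process M X"
    and "\<And>i. (LINT w|M. F i w) = 0"
    and "\<And>i. F i \<in> D12 M X"
    and "\<And>i. malliavin_derivative M X (F i) (DF i)"
    and "\<And>i. divergence M X (u i) (F i)"
    and "prob_space M'"
    and "gaussian_vector M' N \<Sigma>"
    and "invertible \<Sigma>"
    and "\<And>w. MF w = (\<chi> i j. inner (DF i w) (u j w))"
  shows "ennreal (convex_distance M (\<lambda>w. \<chi> i. F i w) M' N)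
    \<le> ennreal (402 * (op_norm (matrix_inv \<Sigma>) powr (3/2) + 1) * real CARD('m) powr (41/24))
       * ennreal_sqrt (\<integral>\<^sup>+ w. ennreal ((hs_norm (MF w - \<Sigma>))\<^sup>2) \<partial>M)"
proof -
  interpret isonormal_process M X by (rule assms(1))
  interpret M': prob_space M' by (rule assms(6))
  let ?Y = "\<lambda>w. (\<chi> i. F i w) :: real ^ 'm"
  let ?m = "real CARD('m)" and ?op = "op_norm (matrix_inv \<Sigma>)"
  let ?I = "\<integral>\<^sup>+ w. ennreal ((hs_norm (MF w - \<Sigma>))\<^sup>2) \<partial>M"
  define c where "c = 402 * (?op powr (3/2) + 1) * ?m powr (41/24)"
  have op0: "0 \<le> ?op" unfolding op_norm_def by (rule onorm_pos_le[OF matrix_vector_mul_bounded_linear])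
  have m1: "1 \<le> ?m" by (simp add: Suc_leI)
  have c0: "0 < c" unfolding c_def using m1 by (intro mult_pos_pos) (auto intro: add_nonneg_pos)
  have L: "DF i \<in> L2 M" "u i \<in> L2 M" "F i \<in> L2 M" for i
    using assms(4)[of i] assms(5)[of i] by (auto simp: malliavin_derivative_def divergence_def L2_tendsto_def)
  have [measurable]: "DF i \<in> borel_measurable M" "u i \<in> borel_measurable M" "F i \<in> borel_measurable M" for i
    using L[of i] by (auto simp: L2_def)
  have MFm[measurable]: "(\<lambda>w. MF w $ i $ j) \<in> borel_measurable M" for i j unfolding assms(9) by simp
  have hsm[measurable]: "(\<lambda>w. (hs_norm (MF w - \<Sigma>))\<^sup>2) \<in> borel_measurable M" unfolding hs_norm_sq by simp
  have Ym: "?Y \<in> borel_measurable M"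
    by (subst borel_measurable_euclidean_space) (auto simp: Basis_vec_def inner_axis)
  have Yi: "integrable M (\<lambda>w. ?Y w $ i)" for i using L2_integrable[OF L(3)] by simp
  have steinF: "stein_identity M ?Y MF"
    using stein_identity_malliavin[OF assms(4,5)] unfolding assms(9)[abs_def] .
  note N = M'.gaussian_vector_facts[OF assms(7)]
  obtain A :: "real ^ 'm ^ 'm" where A: "A ** \<Sigma> ** transpose A = mat 1"
    by (rule whitening_matrix[OF N(3) gaussian_covariance_pos[OF N(3,4) assms(8)]])
  show ?thesis
  proof (cases "?I = \<infinity>")
    case True
    have "ennreal c * \<infinity> = \<infinity>" using c0 by (simp add: ennreal_mult_top)
    with True show ?thesis unfolding ennreal_sqrt_def c_def[symmetric] by simp
  next
    case False
    have hsi: "integrable M (\<lambda>w. (hs_norm (MF w - \<Sigma>))\<^sup>2)"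
      using False by (intro integrableI_nonneg) (auto simp: top.not_eq_extremum)
    define \<gamma> where "\<gamma> = sqrt (LINT w|M. (hs_norm (MF w - \<Sigma>))\<^sup>2)"
    have \<gamma>0: "0 \<le> \<gamma>" unfolding \<gamma>_def by (simp add: Bochner_Integration.integral_nonneg)
    have I: "ennreal_sqrt ?I = ennreal \<gamma>"
      using nn_integral_eq_integral[OF hsi] by (simp add: ennreal_sqrt_def \<gamma>_def Bochner_Integration.integral_nonneg)
    define K where "K = 402 * (?m * sqrt ?m)"
    have K0: "0 < K" unfolding K_def using m1 by simp
    have dist: "\<bar>measure (distr M borel ?Y) C - measure (distr M' borel N) C\<bar> \<le> K * (?op * \<gamma>)"
      if C: "convex C" "C \<in> sets borel" for C
    proof (rule field_le_epsilon)
      fix e :: real assume e: "0 < e"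
      \<comment> \<open>Both laws are compared with the same image of the standard Gaussian law. The bound for \<open>F\<close> may be zero, but the estimate needs a positive one; hence the slack \<open>d\<close>.\<close>
      define d where "d = e / (2 * K)"
      have d: "0 < d" using e K0 by (simp add: d_def)
      let ?G = "measure gauss ((*v) (\<Sigma> ** transpose A) -` C)"
      have "\<bar>measure (distr M borel ?Y) C - ?G\<bar> \<le> K * (?op * \<gamma> + d)"
        unfolding K_def
        by (rule convex_distance_whitened[OF A assms(8) prob_space_axioms Ym Yi MFm hsi steinF _ _ C])
          (use op0 \<gamma>0 d in \<open>auto simp: \<gamma>_def[symmetric] add_nonneg_pos\<close>)
      moreover have "\<bar>measure (distr M' borel N) C - ?G\<bar> \<le> K * d"
        unfolding K_def
        by (rule convex_distance_whitened[OF A assms(8) M'.prob_space_axioms N(1,2) _ _ N(5) d _ C])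
          (use d in \<open>auto simp: hs_norm_def\<close>)
      moreover have "2 * (K * d) = e" using K0 by (simp add: d_def)
      ultimately show "\<bar>measure (distr M borel ?Y) C - measure (distr M' borel N) C\<bar> \<le> K * (?op * \<gamma>) + e"
        by (simp add: distrib_left)
    qed
    have "convex_distance M ?Y M' N \<le> K * (?op * \<gamma>)"
      unfolding convex_distance_def
    proof (rule cSUP_least)
      show "(convex_indicators :: (real ^ 'm \<Rightarrow> real) set) \<noteq> {}"
        unfolding convex_indicators_def by (auto intro: exI[of _ "{}"])
      fix h :: "real ^ 'm \<Rightarrow> real" assume "h \<in> convex_indicators"
      then obtain C where C: "h = indicator C" "convex C" "C \<in> sets borel" unfolding convex_indicators_def by blast
      show "\<bar>(LINT w|M. h (?Y w)) - (LINT v|M'. h (N v))\<bar> \<le> K * (?op * \<gamma>)"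
        unfolding C(1) integral_indicator_vector[OF Ym C(3)] M'.integral_indicator_vector[OF N(1) C(3)]
        by (rule dist[OF C(2,3)])
    qed
    also have "\<dots> \<le> c * \<gamma>"
    proof -
      have "?m * sqrt ?m = ?m powr (3/2)"
        using m1 powr_add[of ?m 1 "1/2"] by (simp add: powr_half_sqrt)
      also have "\<dots> \<le> ?m powr (41/24)" using m1 by (intro powr_mono) auto
      finally have 1: "?m * sqrt ?m \<le> ?m powr (41/24)" .
      have 2: "?op \<le> ?op powr (3/2) + 1"
      proof (cases "?op \<le> 1")
        case True
        then show ?thesis by (simp add: add_increasing)
      next
        case False
        then show ?thesis using powr_mono[of 1 "3/2" ?op] by simp
      qed
      have "K * ?op \<le> c"
        using mult_left_mono[OF mult_mono[OF 1 2], of 402] op0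
        unfolding K_def c_def by (simp add: algebra_simps)
      then show ?thesis using \<gamma>0 by (simp add: mult.assoc[symmetric] mult_right_mono)
    qed
    finally show ?thesis
      unfolding I c_def[symmetric] using c0 \<gamma>0 by (simp add: ennreal_mult[symmetric] ennreal_leI)
  qed
qed

end
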